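(* Let $X$ be a smooth manifold, $D\subset X$ a normal crossing divisor, $D'\subset X$ a normal crossing divisor containing $D$, and assume that the stratification $\mathcal{S}=\mathcal{S}(X,D')$ is simply connected. (1) The real-oriented blow-up $\widetilde X=\mathrm{Bl}^{\mathbf R}(X,D)$ is the Whitney-stratified space obtained from gluing $$\widehat X=\bigsqcup_{S\in\mathcal{S}}\widehat S\times Q(S)$$ via the maps $$\partial\widehat S\times Q(S)=\bigsqcup_{T}T\times E(T,S)\times Q(S)\ \longrightarrow\ \bigsqcup_{T}T\times Q(T)\subset\widehat X,\qquad (p,e,q)\mapsto(p,\mu_{T,S}(e,q)),$$ where, for each $S\in\mathcal{S}$, the disjoint unions run over all strata $T\in\mathcal{S}$ with $T\neq S$ and $T\subset\overline S$. (2) Suppose in addition that $\pi\colon X\to I$ is a smooth semi-stable degeneration and $D=X_0$. Then the positive special fibre $\widetilde X_0^+$ is the Whitney-stratified space obtained from gluing $$\widehat X_0^+=\bigsqcup_{\substack{S\in\mathcal{S}\\ S\subset X_0}}\widehat S\times Q^+(S)$$ via the same maps restricted to positive orthants. In particular, in this case $\mu_{T,S}(e,q)\in Q^+(T)$ for all $e\in E(T,S)$, $q\in Q^+(S)$.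
   Context: $I=(-1,1)$, $\mathbf{R}_{\ge0}=[0,\infty)$, $\mathbf{R}_{\le0}=(-\infty,0]$. *Normal crossing divisors and stratifications.* A normal crossing divisor in a smooth $n$-manifold $X$ is a closed subset $D$ such that for each $p\in D$ there is a chart $U\to V\subset\mathbf{R}^n$ centred at $p$ identifying $D\cap U$ with $\{x_1\cdots x_k=0\}\cap V$ for some $1\le k\le n$ (normal crossing chart of type $(k,n)$); $k$ is the codimension of $p$ in $(X,D)$, and points outside $D$ have codimension $0$. $\mathcal{S}(X,D)$ is the Whitney stratification of $X$ whose strata are the connected components of the loci of points of codimension exactly $k$, $k=0,\dots,n$. A stratification is *simply connected* if all its strata are simply connected. *Blow-up.* $\alpha\colon\widetilde X=\mathrm{Bl}^{\mathbf R}(X,D)\to X$ is the Hausdorff space over $X$, unique up to unique homeomorphism over $X$, such that $\alpha$ is a homeomorphism over $X\setminus D$ and over each normal crossing chart of type $(k,n)$ for $D$ it is the restriction of the model $(\mathbf{R}_{\le0}\sqcup\mathbf{R}_{\ge0})^k\times\mathbf{R}^{n-k}\to\mathbf{R}^n$ given by the obvious map on the first $k$ factors and the identity on the others. *Smooth semi-stable degeneration.* This is a proper smooth function $\pi\colon X\to I$, submersive over $I\setminus\{0\}$, such that each $p\in X_0=\pi^{-1}(0)$ has a chart centred at $p$ in which $\pi=x_1\cdots x_k$ for some $1\le k\le n$. With $\beta\colon\widetilde I=(-1,0]\sqcup[0,1)\to I$ and $D=X_0$, $\widetilde\pi\colon\widetilde X\to\widetilde I$ is the unique continuous map with $\beta\circ\widetilde\pi=\pi\circ\alpha$;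 $0^+$ is the copy of $0$ in $[0,1)$ and $\widetilde X_0^+=\widetilde\pi^{-1}(0^+)$. *Orthants.* For $p\in X$, the set of orthants near $p$ is $Q(p)=\varprojlim_{U\ni p\text{ open}}\pi_0(U\setminus D)$ (it has $2^k$ elements, $k$ the codimension of $p$ in $(X,D)$); it is canonically identified with $\alpha^{-1}(p)$. In the semi-stable case the set of positive orthants is $Q^+(p)=\varprojlim_{U\ni p\text{ open}}\pi_0(U\cap\pi^{-1}((0,1)))\subset Q(p)$; for $p\in X_0$ it is identified with $\alpha^{-1}(p)\cap\widetilde\pi^{-1}(0^+)$. *Ends.* For $S\in\mathcal{S}$ and $p\in\overline S$, the set of ends of $S$ in $p$ is $E(p,S)=\varprojlim_{U\ni p\text{ open}}\pi_0(U\cap S)$. If $p,p'$ lie in the same stratum $T$, a path in $T$ from $p$ to $p'$ induces identifications $Q(p)\cong Q(p')$, $Q^+(p)\cong Q^+(p')$, $E(p,S)\cong E(p',S)$, which do not depend on the path since $T$ is simply connected; one writes $Q(T),Q^+(T),E(T,S)$. Thus $\alpha^{-1}(S)=S\times Q(S)$, and in the semi-stable case, for $S\subset X_0$, $\alpha^{-1}(S)\cap\widetilde X_0^+=S\times Q^+(S)$; the connected components of these sets, i.e. the $S\times\{q\}$, are the strata of $\widetilde X$ and $\widetilde X_0^+$ respectively. *Orthant map* $\mu_{T,S}\colon E(T,S)\times Q(S)\to Q(T)$: choose $p\in T$ and a small normal crossing chart $U$ for $D'$ centred at $p$ in which $D$ is a union of coordinate hyperplanes. An end $e\in E(T,S)$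 corresponds to a component of $U\cap S$, i.e. to a face of the subdivision given by the coordinate hyperplanes, and $Q(S)$ is identified with the set of orthants (components of $U\setminus D$) adjacent to this face; $\mu_{T,S}(e,\cdot)$ is the inclusion of this set into the set $Q(T)$ of all orthants, i.e. of all components of $U\setminus D$. *Endpoint modification.* $\beta_S\colon\widehat S\to\overline S\subset X$ is the map whose fibre over $p\in\overline S$ is $E(p,S)$, where $\widehat S$ has the topology for which a basis of neighbourhoods of $e\in E(p,S)$ is given, for $U$ ranging over open neighbourhoods of $p$, by the sets of all $e'\in E(p',S)$ with $p'\in U$ whose image in $\pi_0(U\cap S)$ agrees with that of $e$. So $\beta_S$ is continuous, and a sequence in $S$ converges to $e\in E(p,S)$ iff it converges to $p$ and for every open $U\ni p$ it eventually lies in the component of $U\cap S$ specified by $e$. $\widehat S$ is a manifold with corners with interior $S$ and boundary $\partial\widehat S=\widehat S\setminus S=\bigsqcup_T T\times E(T,S)$, the union running over the strata $T\ne S$ with $T\subset\overline S$. *Gluing* means taking the quotient space by the equivalence relation generated by identifying each point of the source with its image under the given maps. *)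

theory Defs
  imports "HOL-Analysis.Analysis"
begin

section \<open>Smooth manifolds\<close>

text \<open>
  \<open>Euclidean_space n\<close> is the space of all \<open>x :: nat \<Rightarrow> real\<close> with \<open>x i = 0\<close> for \<open>i \<ge> n\<close>;
  the coordinates \<open>x\<^sub>1, \<dots>, x\<^sub>n\<close> are numbered \<open>0, \<dots>, n - 1\<close>, and \<open>n = 0\<close> is allowed.
\<close>

definition partial_deriv :: "nat \<Rightarrow> ((nat \<Rightarrow> real) \<Rightarrow> real) \<Rightarrow> (nat \<Rightarrow> real) \<Rightarrow> real" where
  "partial_deriv i f x = deriv (\<lambda>t. f (x(i := t))) (x i)"

primrec iter_partial :: "nat list \<Rightarrow> ((nat \<Rightarrow> real) \<Rightarrow> real) \<Rightarrow> (nat \<Rightarrow> real) \<Rightarrow> real" where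
  "iter_partial [] f = f"
| "iter_partial (i # is) f = partial_deriv i (iter_partial is f)"

text \<open>On an open \<open>V\<close>: the iterated partial derivatives of all orders exist and are continuous.\<close>

definition smooth_real_on :: "nat \<Rightarrow> (nat \<Rightarrow> real) set \<Rightarrow> ((nat \<Rightarrow> real) \<Rightarrow> real) \<Rightarrow> bool" where
  "smooth_real_on n V f \<longleftrightarrow>
     (\<forall>is. set is \<subseteq> {..<n} \<longrightarrow>
        continuous_map (subtopology (Euclidean_space n) V) euclideanreal (iter_partial is f) \<and>
        (\<forall>x\<in>V. \<forall>i<n. (\<lambda>t. iter_partial is f (x(i := t))) differentiable (at (x i))))"

definition smooth_on :: "nat \<Rightarrow> (nat \<Rightarrow> real) set \<Rightarrow> ((nat \<Rightarrow> real) \<Rightarrow> nat \<Rightarrow> real) \<Rightarrow> bool" where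
  "smooth_on n V f \<longleftrightarrow> (\<forall>i<n. smooth_real_on n V (\<lambda>x. f x i))"

type_synonym 'a chart = "'a set \<times> ('a \<Rightarrow> nat \<Rightarrow> real)"

definition topological_chart :: "nat \<Rightarrow> 'a topology \<Rightarrow> 'a chart \<Rightarrow> bool" where
  "topological_chart n X = (\<lambda>(U, \<phi>).
     openin X U \<and> openin (Euclidean_space n) (\<phi> ` U) \<and>
     homeomorphic_map (subtopology X U) (subtopology (Euclidean_space n) (\<phi> ` U)) \<phi>)"

definition compatible_charts :: "nat \<Rightarrow> 'a chart \<Rightarrow> 'a chart \<Rightarrow> bool" where
  "compatible_charts n = (\<lambda>(U, \<phi>) (V, \<psi>).
     smooth_on n (\<phi> ` (U \<inter> V)) (\<psi> \<circ> inv_into U \<phi>) \<and>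
     smooth_on n (\<psi> ` (U \<inter> V)) (\<phi> \<circ> inv_into V \<psi>))"

definition smooth_manifold :: "nat \<Rightarrow> 'a topology \<Rightarrow> 'a chart set \<Rightarrow> bool" where
  "smooth_manifold n X A \<longleftrightarrow>
     Hausdorff_space X \<and> second_countable X \<and>
     (\<forall>c\<in>A. topological_chart n X c) \<and> (\<Union>(U, \<phi>)\<in>A. U) = topspace X \<and>
     (\<forall>c\<in>A. \<forall>d\<in>A. compatible_charts n c d)"

text \<open>The maximal atlas: these are the charts of the smooth manifold \<open>(X, A)\<close>.\<close>

definition smooth_charts :: "nat \<Rightarrow> 'a topology \<Rightarrow> 'a chart set \<Rightarrow> 'a chart set" where
  "smooth_charts n X A = {c. topological_chart n X c \<and> (\<forall>d\<in>A. compatible_charts n c d)}"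

definition smooth_function :: "nat \<Rightarrow> 'a chart set \<Rightarrow> ('a \<Rightarrow> real) \<Rightarrow> bool" where
  "smooth_function n A f \<longleftrightarrow> (\<forall>(U, \<phi>)\<in>A. smooth_real_on n (\<phi> ` U) (f \<circ> inv_into U \<phi>))"

definition submersive_at :: "nat \<Rightarrow> 'a chart set \<Rightarrow> ('a \<Rightarrow> real) \<Rightarrow> 'a \<Rightarrow> bool" where
  "submersive_at n A f p \<longleftrightarrow>
     (\<exists>(U, \<phi>)\<in>A. p \<in> U \<and> (\<exists>i<n. partial_deriv i (f \<circ> inv_into U \<phi>) (\<phi> p) \<noteq> 0))"

definition smooth_submanifold :: "nat \<Rightarrow> 'a topology \<Rightarrow> 'a chart set \<Rightarrow> nat \<Rightarrow> 'a set \<Rightarrow> bool" where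
  "smooth_submanifold n X A m M \<longleftrightarrow>
     m \<le> n \<and> M \<subseteq> topspace X \<and>
     (\<forall>x\<in>M. \<exists>(U, \<phi>)\<in>smooth_charts n X A. \<exists>J\<subseteq>{..<n}. card J = n - m \<and> x \<in> U \<and>
        M \<inter> U = {y \<in> U. \<forall>i\<in>J. \<phi> y i = 0})"

section \<open>Normal crossing divisors and their stratifications\<close>

definition nc_chart ::
  "nat \<Rightarrow> 'a topology \<Rightarrow> 'a chart set \<Rightarrow> 'a set \<Rightarrow> nat \<Rightarrow> 'a \<Rightarrow> 'a set \<Rightarrow> ('a \<Rightarrow> nat \<Rightarrow> real) \<Rightarrow> bool" where
  "nc_chart n X A D k p U \<phi> \<longleftrightarrow>
     (U, \<phi>) \<in> smooth_charts n X A \<and> p \<in> U \<and> \<phi> p = (\<lambda>_. 0) \<and> 1 \<le> k \<and> k \<le> n \<and>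
     D \<inter> U = {x \<in> U. (\<Prod>i<k. \<phi> x i) = 0}"

definition nc_divisor :: "nat \<Rightarrow> 'a topology \<Rightarrow> 'a chart set \<Rightarrow> 'a set \<Rightarrow> bool" where
  "nc_divisor n X A D \<longleftrightarrow> closedin X D \<and> (\<forall>p\<in>D. \<exists>k U \<phi>. nc_chart n X A D k p U \<phi>)"

definition codim_locus :: "nat \<Rightarrow> 'a topology \<Rightarrow> 'a chart set \<Rightarrow> 'a set \<Rightarrow> nat \<Rightarrow> 'a set" where
  "codim_locus n X A D k =
     {p \<in> topspace X. if p \<in> D then \<exists>U \<phi>. nc_chart n X A D k p U \<phi> else k = 0}"

definition strata :: "nat \<Rightarrow> 'a topology \<Rightarrow> 'a chart set \<Rightarrow> 'a set \<Rightarrow> 'a set set" where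
  "strata n X A D = (\<Union>k\<le>n. connected_components_of (subtopology X (codim_locus n X A D k)))"

text \<open>The notion \<^const>\<open>simply_connected\<close> of the library, for abstract topologies.\<close>

definition simply_connected_space :: "'a topology \<Rightarrow> bool" where
  "simply_connected_space X \<longleftrightarrow>
     (\<forall>g h. pathin X g \<and> g 1 = g 0 \<and> pathin X h \<and> h 1 = h 0 \<longrightarrow>
        homotopic_with (\<lambda>r. r 1 = r 0) (top_of_set {0..1}) X g h)"

lemma simply_connected_space_top_of_set:
  "simply_connected_space (top_of_set S) \<longleftrightarrow> simply_connected S"
  unfolding simply_connected_space_def simply_connected_def homotopic_loops_def
  by (simp add: pathin_def path_def path_image_def pathstart_def pathfinish_def
      image_subset_iff_funcset conj_ac)

section \<open>Whitney stratified spaces\<close>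

text \<open>Velocities at \<open>x\<close> of curves in \<open>M\<close>; the tangent space if \<open>M\<close> is a submanifold.\<close>

definition tangent_space :: "nat \<Rightarrow> (nat \<Rightarrow> real) set \<Rightarrow> (nat \<Rightarrow> real) \<Rightarrow> (nat \<Rightarrow> real) set" where
  "tangent_space n M x =
     {v \<in> topspace (Euclidean_space n).
        \<exists>\<gamma> :: real \<Rightarrow> nat \<Rightarrow> real. \<gamma> 0 = x \<and> (\<forall>\<^sub>F t in at 0. \<gamma> t \<in> M) \<and>
          (\<forall>i<n. ((\<lambda>t. \<gamma> t i) has_real_derivative v i) (at 0))}"

text \<open>
  Kuratowski convergence of sets. For linear subspaces of a fixed dimension this is convergence
  in the Grassmannian.
\<close>

definition set_limit :: "nat \<Rightarrow> (nat \<Rightarrow> (nat \<Rightarrow> real) set) \<Rightarrow> (nat \<Rightarrow> real) set \<Rightarrow> bool" where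
  "set_limit n P \<tau> \<longleftrightarrow>
     (\<forall>v\<in>\<tau>. \<exists>w. (\<forall>j. w j \<in> P j) \<and> limitin (Euclidean_space n) w v sequentially) \<and>
     (\<forall>r w v. strict_mono (r :: nat \<Rightarrow> nat) \<and> (\<forall>j. w j \<in> P (r j)) \<and>
        limitin (Euclidean_space n) w v sequentially \<longrightarrow> v \<in> \<tau>)"

definition whitney_b :: "nat \<Rightarrow> (nat \<Rightarrow> real) set \<Rightarrow> (nat \<Rightarrow> real) set \<Rightarrow> bool" where
  "whitney_b n M N \<longleftrightarrow>
     (\<forall>z\<in>N. \<forall>x y v \<tau>.
        (\<forall>j. x j \<in> M \<and> y j \<in> N \<and> x j \<noteq> y j) \<and>
        limitin (Euclidean_space n) x z sequentially \<and>
        limitin (Euclidean_space n) y z sequentially \<and>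
        limitin (Euclidean_space n)
          (\<lambda>j i. (x j i - y j i) / sqrt (\<Sum>l<n. (x j l - y j l)\<^sup>2)) v sequentially \<and>
        set_limit n (\<lambda>j. tangent_space n M (x j)) \<tau>
        \<longrightarrow> v \<in> \<tau>)"

text \<open>
  The spaces \<open>Y\<close> to be stratified (the blow-up and its positive special fibre) are not subspaces
  of a manifold, but \<open>f : Y \<rightarrow> X\<close> embeds them locally in the manifold \<open>X\<close>. Being smooth and
  Whitney's condition (b) are local on \<open>Y\<close> and independent of the chart of \<open>X\<close>.
\<close>

definition whitney_stratified ::
  "nat \<Rightarrow> 'a topology \<Rightarrow> 'a chart set \<Rightarrow> 'b topology \<Rightarrow> ('b \<Rightarrow> 'a) \<Rightarrow> 'b set set \<Rightarrow> bool" where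
  "whitney_stratified n X A Y f \<Y> \<longleftrightarrow>
     continuous_map Y X f \<and>
     \<Union>\<Y> = topspace Y \<and> {} \<notin> \<Y> \<and> pairwise disjnt \<Y> \<and>
     (\<forall>S\<in>\<Y>. \<forall>T\<in>\<Y>. T \<inter> Y closure_of S \<noteq> {} \<longrightarrow> T \<subseteq> Y closure_of S) \<and>
     (\<forall>y\<in>topspace Y. \<exists>W. \<exists>(U, \<phi>)\<in>smooth_charts n X A.
        openin Y W \<and> y \<in> W \<and> f ` W \<subseteq> U \<and> embedding_map (subtopology Y W) X f \<and>
        finite {S\<in>\<Y>. S \<inter> W \<noteq> {}} \<and>
        (\<forall>S\<in>\<Y>. \<exists>m. smooth_submanifold n X A m (f ` (S \<inter> W))) \<and>
        (\<forall>S\<in>\<Y>. \<forall>T\<in>\<Y>. S \<noteq> T \<longrightarrow> whitney_b n (\<phi> ` f ` (S \<inter> W)) (\<phi> ` f ` (T \<inter> W))))"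

section \<open>Real-oriented blow-up\<close>

text \<open>\<open>cut_line\<close> is \<open>(-\<infinity>, 0] \<squnion> [0, \<infinity>)\<close>; the copies are tagged \<open>False\<close> and \<open>True\<close>.\<close>

definition cut_line :: "(bool \<times> real) topology" where
  "cut_line = sum_topology (\<lambda>b. top_of_set (if b then {0..} else {..0})) UNIV"

definition cut_model :: "nat \<Rightarrow> nat \<Rightarrow> ((nat \<Rightarrow> bool \<times> real) \<times> (nat \<Rightarrow> real)) topology" where
  "cut_model n k = prod_topology (product_topology (\<lambda>_. cut_line) {..<k}) (Euclidean_space (n - k))"

definition cut_map :: "nat \<Rightarrow> (nat \<Rightarrow> bool \<times> real) \<times> (nat \<Rightarrow> real) \<Rightarrow> nat \<Rightarrow> real" where
  "cut_map k = (\<lambda>(y, z) i. if i < k then snd (y i) else z (i - k))"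

text \<open>\<open>\<alpha> : Xt \<rightarrow> X\<close> has the properties that characterise the blow-up up to unique homeomorphism.\<close>

definition real_blowup ::
  "nat \<Rightarrow> 'a topology \<Rightarrow> 'a chart set \<Rightarrow> 'a set \<Rightarrow> 'b topology \<Rightarrow> ('b \<Rightarrow> 'a) \<Rightarrow> bool" where
  "real_blowup n X A D Xt \<alpha> \<longleftrightarrow>
     Hausdorff_space Xt \<and> continuous_map Xt X \<alpha> \<and>
     homeomorphic_map (subtopology Xt {x \<in> topspace Xt. \<alpha> x \<notin> D})
       (subtopology X (topspace X - D)) \<alpha> \<and>
     (\<forall>k p U \<phi>. p \<in> D \<and> nc_chart n X A D k p U \<phi> \<longrightarrow>
        (\<exists>g. homeomorphic_map
               (subtopology Xt {x \<in> topspace Xt. \<alpha> x \<in> U})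
               (subtopology (cut_model n k) {y \<in> topspace (cut_model n k). cut_map k y \<in> \<phi> ` U}) g \<and>
             (\<forall>x\<in>topspace Xt. \<alpha> x \<in> U \<longrightarrow> cut_map k (g x) = \<phi> (\<alpha> x))))"

section \<open>Orthants and ends\<close>

definition nbhds_of :: "'a topology \<Rightarrow> 'a \<Rightarrow> 'a set set" where
  "nbhds_of X p = {U. openin X U \<and> p \<in> U}"

text \<open>
  \<open>lim_pi0 X B p\<close> is the inverse limit of \<open>\<pi>\<^sub>0(U \<inter> B)\<close> over the open \<open>U \<ni> p\<close>. An element is a
  compatible family \<open>c\<close>, and \<open>c U\<close> is its image in \<open>\<pi>\<^sub>0(U \<inter> B)\<close>; the transition maps send a
  component to the component containing it.
\<close>

definition lim_pi0 :: "'a topology \<Rightarrow> 'a set \<Rightarrow> 'a \<Rightarrow> ('a set \<Rightarrow> 'a set) set" where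
  "lim_pi0 X B p =
     {c \<in> (\<Pi>\<^sub>E U\<in>nbhds_of X p. path_components_of (subtopology X (U \<inter> B))).
        \<forall>U\<in>nbhds_of X p. \<forall>V\<in>nbhds_of X p. U \<subseteq> V \<longrightarrow> c U \<subseteq> c V}"

text \<open>
  \<open>transport X B \<gamma> a b\<close>: the identification induced by the path \<open>\<gamma>\<close> sends \<open>a\<close> to \<open>b\<close>, that is,
  \<open>a\<close> and \<open>b\<close> are the end points of a locally constant family along \<open>\<gamma>\<close>.
\<close>

definition transport ::
  "'a topology \<Rightarrow> 'a set \<Rightarrow> (real \<Rightarrow> 'a) \<Rightarrow> ('a set \<Rightarrow> 'a set) \<Rightarrow> ('a set \<Rightarrow> 'a set) \<Rightarrow> bool" where
  "transport X B \<gamma> a b \<longleftrightarrow>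
     (\<exists>c. c 0 = a \<and> c 1 = b \<and>
        (\<forall>t\<in>{0..1}. c t \<in> lim_pi0 X B (\<gamma> t)) \<and>
        (\<forall>t\<in>{0..1}. \<forall>U\<in>nbhds_of X (\<gamma> t). \<forall>\<^sub>F s in at t within {0..1}. \<gamma> s \<in> U \<and> c s U = c t U))"

text \<open>
  The common value on a stratum \<open>T\<close> of the sets \<open>lim_pi0 X B p\<close>, \<open>p \<in> T\<close>: an element \<open>\<sigma>\<close> is
  represented by all its incarnations \<open>\<sigma> p\<close>, which correspond under transport along paths in \<open>T\<close>.
\<close>

definition lim_pi0_stratum :: "'a topology \<Rightarrow> 'a set \<Rightarrow> 'a set \<Rightarrow> ('a \<Rightarrow> 'a set \<Rightarrow> 'a set) set" where
  "lim_pi0_stratum X B T =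
     {\<sigma> \<in> (\<Pi>\<^sub>E p\<in>T. lim_pi0 X B p).
        \<forall>\<gamma>. pathin (subtopology X T) \<gamma> \<longrightarrow> transport X B \<gamma> (\<sigma> (\<gamma> 0)) (\<sigma> (\<gamma> 1))}"

abbreviation orthants :: "'a topology \<Rightarrow> 'a set \<Rightarrow> 'a set \<Rightarrow> ('a \<Rightarrow> 'a set \<Rightarrow> 'a set) set" where
  "orthants X D T \<equiv> lim_pi0_stratum X (topspace X - D) T"

abbreviation pos_orthants :: "'a topology \<Rightarrow> ('a \<Rightarrow> real) \<Rightarrow> 'a set \<Rightarrow> ('a \<Rightarrow> 'a set \<Rightarrow> 'a set) set" where
  "pos_orthants X \<pi> T \<equiv> lim_pi0_stratum X {p \<in> topspace X. \<pi> p \<in> {0<..<1}} T"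

abbreviation (input) ends_at :: "'a topology \<Rightarrow> 'a \<Rightarrow> 'a set \<Rightarrow> ('a set \<Rightarrow> 'a set) set" where
  "ends_at X p S \<equiv> lim_pi0 X S p"

abbreviation (input) ends :: "'a topology \<Rightarrow> 'a set \<Rightarrow> 'a set \<Rightarrow> ('a \<Rightarrow> 'a set \<Rightarrow> 'a set) set" where
  "ends X T S \<equiv> lim_pi0_stratum X S T"

text \<open>The canonical identification of the set of orthants near \<open>p\<close> with \<open>\<alpha>\<^sup>-\<^sup>1(p)\<close>.\<close>

definition orthant_point ::
  "'a topology \<Rightarrow> 'b topology \<Rightarrow> ('b \<Rightarrow> 'a) \<Rightarrow> 'a \<Rightarrow> ('a set \<Rightarrow> 'a set) \<Rightarrow> 'b \<Rightarrow> bool" where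
  "orthant_point X Xt \<alpha> p c x \<longleftrightarrow>
     x \<in> topspace Xt \<and> \<alpha> x = p \<and>
     (\<forall>U\<in>nbhds_of X p. x \<in> Xt closure_of {y \<in> topspace Xt. \<alpha> y \<in> c U})"

text \<open>
  A small chart for \<open>D'\<close> centred at \<open>p\<close> (its image is a cube), in which \<open>D\<close> is a union of
  coordinate hyperplanes.
\<close>

definition small_nc_chart ::
  "nat \<Rightarrow> 'a topology \<Rightarrow> 'a chart set \<Rightarrow> 'a set \<Rightarrow> 'a set \<Rightarrow> 'a \<Rightarrow> 'a set \<Rightarrow> ('a \<Rightarrow> nat \<Rightarrow> real) \<Rightarrow> bool" where
  "small_nc_chart n X A D D' p U \<phi> \<longleftrightarrow>
     (\<exists>k. nc_chart n X A D' k p U \<phi> \<and>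
        (\<exists>\<epsilon>>0. \<phi> ` U = {x \<in> topspace (Euclidean_space n). \<forall>i<n. \<bar>x i\<bar> < \<epsilon>}) \<and>
        (\<exists>J\<subseteq>{..<k}. D \<inter> U = {x \<in> U. \<exists>i\<in>J. \<phi> x i = 0}))"

text \<open>
  \<open>e p U\<close> is the face of the cube \<open>U\<close> given by the end \<open>e\<close>. For \<open>p'\<close> on this face, \<open>q p' U\<close> is
  the orthant of \<open>U\<close> which is adjacent to the face and corresponds to \<open>q\<close>.
\<close>

definition orthant_map ::
  "nat \<Rightarrow> 'a topology \<Rightarrow> 'a chart set \<Rightarrow> 'a set \<Rightarrow> 'a set \<Rightarrow> 'a set \<Rightarrow>
     ('a \<Rightarrow> 'a set \<Rightarrow> 'a set) \<Rightarrow> ('a \<Rightarrow> 'a set \<Rightarrow> 'a set) \<Rightarrow> ('a \<Rightarrow> 'a set \<Rightarrow> 'a set)" where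
  "orthant_map n X A D D' T e q =
     (THE \<tau>. \<tau> \<in> orthants X D T \<and>
        (\<forall>p\<in>T. \<forall>U \<phi>. small_nc_chart n X A D D' p U \<phi> \<longrightarrow> (\<forall>p'\<in>e p U. \<tau> p U = q p' U)))"

section \<open>Endpoint modification and gluing\<close>

text \<open>
  The points over \<open>p\<close> are the pairs \<open>(p, e)\<close> with \<open>e\<close> an end of \<open>S\<close> in \<open>p\<close>. The generating sets
  containing \<open>(p, e)\<close>, those with \<open>p \<in> U\<close> and \<open>C = e U\<close>, are a basis of neighbourhoods of it.
\<close>

definition endpoint_modification :: "'a topology \<Rightarrow> 'a set \<Rightarrow> ('a \<times> ('a set \<Rightarrow> 'a set)) topology" where
  "endpoint_modification X S =
     topology_generated_by
       {{(p, e). p \<in> U \<and> e \<in> ends_at X p S \<and> e U = C} | U C.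
          openin X U \<and> C \<in> path_components_of (subtopology X (U \<inter> S))}"

text \<open>The inclusion of \<open>S\<close> in its endpoint modification: \<open>p \<in> S\<close> has only one end of \<open>S\<close>.\<close>

definition interior_point :: "'a topology \<Rightarrow> 'a set \<Rightarrow> 'a \<Rightarrow> 'a \<times> ('a set \<Rightarrow> 'a set)" where
  "interior_point X S p =
     (p, \<lambda>U\<in>nbhds_of X p. path_component_of_set (subtopology X (U \<inter> S)) p)"

type_synonym 'a piece_point = "'a set \<times> (('a \<times> ('a set \<Rightarrow> 'a set)) \<times> ('a \<Rightarrow> 'a set \<Rightarrow> 'a set))"

text \<open>
  In the following, \<open>\<S>\<close> is a set of strata and \<open>Q S\<close> is the set of (positive) orthants of \<open>S\<close>.
\<close>

definition pieces ::
  "'a topology \<Rightarrow> 'a set set \<Rightarrow> ('a set \<Rightarrow> ('a \<Rightarrow> 'a set \<Rightarrow> 'a set) set) \<Rightarrow> 'a piece_point topology" where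
  "pieces X \<S> Q =
     sum_topology (\<lambda>S. prod_topology (endpoint_modification X S) (discrete_topology (Q S))) \<S>"

definition gluing_map ::
  "nat \<Rightarrow> 'a topology \<Rightarrow> 'a chart set \<Rightarrow> 'a set \<Rightarrow> 'a set \<Rightarrow> 'a set set \<Rightarrow>
     ('a set \<Rightarrow> ('a \<Rightarrow> 'a set \<Rightarrow> 'a set) set) \<Rightarrow> 'a piece_point \<Rightarrow> 'a piece_point \<Rightarrow> bool" where
  "gluing_map n X A D D' \<S> Q x y \<longleftrightarrow>
     (\<exists>S\<in>\<S>. \<exists>T\<in>\<S>. \<exists>p\<in>T. \<exists>e\<in>ends X T S. \<exists>q\<in>Q S.
        T \<noteq> S \<and> T \<subseteq> X closure_of S \<and>
        x = (S, (p, e p), q) \<and>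
        y = (T, interior_point X T p, orthant_map n X A D D' T e q))"

definition glue_class :: "'z topology \<Rightarrow> ('z \<Rightarrow> 'z \<Rightarrow> bool) \<Rightarrow> 'z \<Rightarrow> 'z set" where
  "glue_class Z r z = {z' \<in> topspace Z. equivclp r z z'}"

definition glue :: "'z topology \<Rightarrow> ('z \<Rightarrow> 'z \<Rightarrow> bool) \<Rightarrow> 'z set topology" where
  "glue Z r = topology (\<lambda>W. W \<subseteq> glue_class Z r ` topspace Z \<and>
                             openin Z {z \<in> topspace Z. glue_class Z r z \<in> W})"

lemma openin_glue:
  "openin (glue Z r) W \<longleftrightarrow>
     W \<subseteq> glue_class Z r ` topspace Z \<and> openin Z {z \<in> topspace Z. glue_class Z r z \<in> W}"
proof -
  have 1: "{z \<in> topspace Z. glue_class Z r z \<in> S \<inter> T} =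
      {z \<in> topspace Z. glue_class Z r z \<in> S} \<inter> {z \<in> topspace Z. glue_class Z r z \<in> T}" for S T
    by auto
  have 2: "{z \<in> topspace Z. glue_class Z r z \<in> \<Union>\<K>} =
      (\<Union>K\<in>\<K>. {z \<in> topspace Z. glue_class Z r z \<in> K})" for \<K>
    by auto
  have "istopology (\<lambda>W. W \<subseteq> glue_class Z r ` topspace Z \<and>
                         openin Z {z \<in> topspace Z. glue_class Z r z \<in> W})"
    unfolding istopology_def 1 2 by blast
  then show ?thesis
    by (simp add: glue_def)
qed

lemma quotient_map_glue: "quotient_map Z (glue Z r) (glue_class Z r)"
proof -
  have "openin (glue Z r) (glue_class Z r ` topspace Z)"
    by (simp add: openin_glue) (metis (mono_tags, lifting) Collect_cong image_eqI openin_topspace Collect_mem_eq)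
  then have "topspace (glue Z r) = glue_class Z r ` topspace Z"
    by (metis openin_glue openin_subset openin_topspace subset_antisym)
  then show ?thesis
    by (auto simp: quotient_map_def openin_glue)
qed

text \<open>The image of \<open>S \<times> {q}\<close> in the glued space.\<close>

definition glued_stratum ::
  "'a topology \<Rightarrow> 'a piece_point topology \<Rightarrow> ('a piece_point \<Rightarrow> 'a piece_point \<Rightarrow> bool) \<Rightarrow>
     'a set \<Rightarrow> ('a \<Rightarrow> 'a set \<Rightarrow> 'a set) \<Rightarrow> 'a piece_point set set" where
  "glued_stratum X Z r S q = (\<lambda>p. glue_class Z r (S, interior_point X S p, q)) ` S"

text \<open>
  \<open>Y\<close> is a subset of the blow-up \<open>Xt\<close>, stratified by the connected components of the \<open>\<alpha>\<^sup>-\<^sup>1(S) \<inter> Y\<close>.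
  It is the Whitney stratified space obtained from gluing: the two are identified by a homeomorphism
  \<open>h\<close> over \<open>X\<close> which maps strata to strata, and which on the stratum \<open>S \<times> {q}\<close> is the canonical map
  sending \<open>(p, q)\<close> to the point of \<open>\<alpha>\<^sup>-\<^sup>1(p)\<close> given by \<open>q\<close>.
\<close>

definition obtained_from_gluing ::
  "nat \<Rightarrow> 'a topology \<Rightarrow> 'a chart set \<Rightarrow> 'a set \<Rightarrow> 'a set \<Rightarrow> 'b topology \<Rightarrow> ('b \<Rightarrow> 'a) \<Rightarrow> 'b set \<Rightarrow>
     'a set set \<Rightarrow> ('a set \<Rightarrow> ('a \<Rightarrow> 'a set \<Rightarrow> 'a set) set) \<Rightarrow> bool" where
  "obtained_from_gluing n X A D D' Xt \<alpha> Y \<S> Q \<longleftrightarrow>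
     (let Z = pieces X \<S> Q;
          r = gluing_map n X A D D' \<S> Q;
          \<Y> = (\<Union>S\<in>\<S>. connected_components_of (subtopology Xt {x \<in> topspace Xt \<inter> Y. \<alpha> x \<in> S}))
      in whitney_stratified n X A (subtopology Xt Y) \<alpha> \<Y> \<and>
         (\<exists>h. homeomorphic_map (glue Z r) (subtopology Xt Y) h \<and>
              (\<forall>S p e q. (S, (p, e), q) \<in> topspace Z \<longrightarrow> \<alpha> (h (glue_class Z r (S, (p, e), q))) = p) \<and>
              (\<forall>S\<in>\<S>. \<forall>q\<in>Q S. \<forall>p\<in>S.
                 orthant_point X Xt \<alpha> p (q p) (h (glue_class Z r (S, interior_point X S p, q)))) \<and>
              {h ` glued_stratum X Z r S q | S q. S \<in> \<S> \<and> q \<in> Q S} = \<Y>))"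

section \<open>Smooth semi-stable degenerations\<close>

definition semistable_degeneration ::
  "nat \<Rightarrow> 'a topology \<Rightarrow> 'a chart set \<Rightarrow> ('a \<Rightarrow> real) \<Rightarrow> bool" where
  "semistable_degeneration n X A \<pi> \<longleftrightarrow>
     \<pi> ` topspace X \<subseteq> {-1<..<1} \<and> smooth_function n A \<pi> \<and>
     proper_map X (top_of_set {-1<..<1}) \<pi> \<and>
     (\<forall>p\<in>topspace X. \<pi> p \<noteq> 0 \<longrightarrow> submersive_at n A \<pi> p) \<and>
     (\<forall>p\<in>topspace X. \<pi> p = 0 \<longrightarrow>
        (\<exists>(U, \<phi>)\<in>smooth_charts n X A. p \<in> U \<and> \<phi> p = (\<lambda>_. 0) \<and>
           (\<exists>k. 1 \<le> k \<and> k \<le> n \<and> (\<forall>x\<in>U. \<pi> x = (\<Prod>i<k. \<phi> x i)))))"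

definition special_fibre :: "'a topology \<Rightarrow> ('a \<Rightarrow> real) \<Rightarrow> 'a set" where
  "special_fibre X \<pi> = {p \<in> topspace X. \<pi> p = 0}"

text \<open>\<open>(-1, 0] \<squnion> [0, 1)\<close>, with the same tags as in \<open>cut_line\<close>; so \<open>(True, 0)\<close> is \<open>0\<^sup>+\<close>.\<close>

definition cut_interval :: "(bool \<times> real) topology" where
  "cut_interval = sum_topology (\<lambda>b. top_of_set (if b then {0..<1} else {-1<..0})) UNIV"

definition lifted_degeneration ::
  "'b topology \<Rightarrow> ('b \<Rightarrow> 'a) \<Rightarrow> ('a \<Rightarrow> real) \<Rightarrow> ('b \<Rightarrow> bool \<times> real) \<Rightarrow> bool" where
  "lifted_degeneration Xt \<alpha> \<pi> \<pi>t \<longleftrightarrow>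
     continuous_map Xt cut_interval \<pi>t \<and> (\<forall>x\<in>topspace Xt. snd (\<pi>t x) = \<pi> (\<alpha> x))"

definition positive_special_fibre :: "'b topology \<Rightarrow> ('b \<Rightarrow> bool \<times> real) \<Rightarrow> 'b set" where
  "positive_special_fibre Xt \<pi>t = {x \<in> topspace Xt. \<pi>t x = (True, 0)}"

end

theory Submission
  imports Defs
begin

text \<open>Each branch of \<open>D\<close> is a smooth hypersurface contained in \<open>D'\<close>, hence a coordinate hyperplane in every
  normal crossing chart of \<open>D'\<close>. Contracting a small coordinate cube towards a point shows that ends and orthants
  near that point do not depend on the cube, so that they form coverings of the strata; over a simply connected
  stratum these have a global section through every point.

  A point of the blow-up is the same as a point \<open>p\<close> of \<open>X\<close> with an orthant near \<open>p\<close>. Sending \<open>(p, e, q)\<close> to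
  the orthant near \<open>p\<close> that is adjacent to the end \<open>e\<close> of \<open>S\<close> and corresponds to \<open>q\<close> is a quotient map onto the
  blow-up, because there are only finitely many faces and orthants in a cube. Every point is equivalent to the
  interior point \<open>(p, \<mu>(e, q))\<close> of the stratum through \<open>p\<close>, and interior points have different images, so the
  fibres are exactly the classes of the gluing relation. For a degeneration, the function has constant sign on
  each orthant, and \<open>\<mu>\<close> preserves this sign.\<close>

section \<open>Functions with continuous partial derivatives\<close>

text \<open>A normal crossing chart is tied to one divisor and one centre, so charts of
  \<open>D\<close> and of \<open>D'\<close> at the same point are a priori unrelated, and the
  maximal atlas compares charts only through members of \<open>A\<close>. Comparing branches is
  where differentiability of transition maps does its work, and it is done with first derivatives.
  Afterwards a germ of components at \<open>p\<close> is evaluated on a cube centred at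
  \<open>p\<close>, where it becomes a set of sign vectors. The gluing relation is phrased with
  sections over whole strata, whereas a point of either space carries only germs. The construction
  \<open>push\<close> mediates: it takes the germ of an end and a section of orthants, works on
  arbitrary neighbourhoods instead of charts, and agrees with \<open>orthant_map\<close> wherever
  the gluing uses it. The topologies are compared through one test: a set is open iff with each of
  its points it contains, for some neighbourhood \<open>V\<close>, all points over \<open>V\<close>
  with the same component at \<open>V\<close>. The endpoint modification satisfies it with ends, the
  blow-up with orthants, and \<open>push\<close> at \<open>V\<close> depends on the end only through
  its component at \<open>V\<close>.\<close>

lemma continuous_map_Euclidean_coord:
  "continuous_map (Euclidean_space n) euclideanreal (\<lambda>x. x i)"
  unfolding Euclidean_space_def
  by (intro continuous_map_from_subtopology) (metis UNIV_I continuous_map_product_coordinates)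

lemma continuous_map_into_Euclidean:
  assumes "\<And>i. i < n \<Longrightarrow> continuous_map Y euclideanreal (\<lambda>x. f x i)"
    and "\<And>x i. x \<in> topspace Y \<Longrightarrow> i \<ge> n \<Longrightarrow> f x i = 0"
  shows "continuous_map Y (Euclidean_space n) f"
proof -
  have "continuous_map Y (Euclidean_space n) (\<lambda>x i. if i < n then f x i else 0)"
    using assms(1) by (simp add: continuous_map_componentwise_Euclidean_space)
  then show ?thesis
    by (rule continuous_map_eq) (use assms(2) in \<open>auto simp: fun_eq_iff\<close>)
qed

lemma openin_Euclidean_box:
  "openin (Euclidean_space n) {x \<in> topspace (Euclidean_space n). \<forall>i<n. \<bar>x i - a i\<bar> < (d::real)}"
proof -
  have "openin (Euclidean_space n) {x \<in> topspace (Euclidean_space n). \<forall>i<m. \<bar>x i - a i\<bar> < d}" for m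
  proof (induction m)
    case 0
    then show ?case by simp
  next
    case (Suc m)
    have "openin (Euclidean_space n) {x \<in> topspace (Euclidean_space n). x m \<in> {t. \<bar>t - a m\<bar> < d}}"
      by (rule openin_continuous_map_preimage[OF continuous_map_Euclidean_coord])
        (auto intro!: open_Collect_less continuous_intros)
    from openin_Int[OF Suc this] show ?case
      by (rule back_subst[where P = "openin _"]) (auto simp: less_Suc_eq)
  qed
  then show ?thesis .
qed

lemma Euclidean_box_nbhd:
  assumes "openin (Euclidean_space n) W" "a \<in> W"
  obtains d where "d > 0"
    "\<And>x. x \<in> topspace (Euclidean_space n) \<Longrightarrow> (\<And>i. i < n \<Longrightarrow> \<bar>x i - a i\<bar> < d) \<Longrightarrow> x \<in> W"
proof -
  obtain V where V: "openin (powertop_real UNIV) V" "W = V \<inter> {x. \<forall>i\<ge>n. x i = 0}"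
    using assms(1) by (auto simp: Euclidean_space_def openin_subtopology)
  then have "\<exists>U. finite {i \<in> UNIV. U i \<noteq> topspace euclideanreal} \<and>
      (\<forall>i\<in>UNIV. openin euclideanreal (U i)) \<and> a \<in> Pi\<^sub>E UNIV U \<and> Pi\<^sub>E UNIV U \<subseteq> V"
    using assms(2) by (auto simp: openin_product_topology_alt)
  then obtain U where U: "\<And>i. open (U i)" "a \<in> Pi\<^sub>E UNIV U" "Pi\<^sub>E UNIV U \<subseteq> V"
    by auto
  have "\<exists>d>0. \<forall>t. \<bar>t - a i\<bar> < d \<longrightarrow> t \<in> U i" for i
  proof -
    have "a i \<in> U i" using U(2) by auto
    then show ?thesis
      using U(1)[of i] by (auto simp: open_dist dist_real_def)
  qed
  then obtain D where D: "\<And>i. D i > 0" "\<And>i t. \<bar>t - a i\<bar> < D i \<Longrightarrow> t \<in> U i"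
    by metis
  \<comment> \<open>\<open>Euclidean_space n\<close> sits in an infinite product, but beyond
    \<open>n\<close> both \<open>x\<close> and \<open>a\<close> vanish, so the radii with
    \<open>i < n\<close> decide. The 1 keeps the minimum defined for \<open>n = 0\<close>.\<close>
  define d where "d = Min (insert 1 (D ` {..<n}))"
  have a0: "a i = 0" if "i \<ge> n" for i
    using assms(2) V(2) that by auto
  show ?thesis
  proof
    show "d > 0"
      using D(1) by (auto simp: d_def)
    fix x assume x: "x \<in> topspace (Euclidean_space n)" "\<And>i. i < n \<Longrightarrow> \<bar>x i - a i\<bar> < d"
    have "x i \<in> U i" for i
    proof (cases "i < n")
      case True
      then have "d \<le> D i" by (auto simp: d_def)
      then show ?thesis using x(2)[OF True] D(2)[of "x i" i] by linarith
    next
      case False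
      then have "x i = a i" using x(1) a0 by (auto simp: topspace_Euclidean_space)
      then show ?thesis using D by auto
    qed
    then have "x \<in> V" using U(3) by auto
    then show "x \<in> W" using V(2) x(1) by (auto simp: topspace_Euclidean_space)
  qed
qed

lemma Euclidean_box_nbhd_ex:
  assumes "openin (Euclidean_space n) W" "a \<in> W"
  shows "\<exists>d>0. \<forall>x\<in>topspace (Euclidean_space n). (\<forall>i<n. \<bar>x i - a i\<bar> < d) \<longrightarrow> x \<in> W"
  by (rule Euclidean_box_nbhd[OF assms]) blast

lemma continuous_Euclidean_eps:
  assumes "continuous_map (subtopology (Euclidean_space n) W) euclideanreal f"
    and "openin (Euclidean_space n) W" "a \<in> W" "e > 0"
  obtains d where "d > 0"
    "\<And>x. x \<in> topspace (Euclidean_space n) \<Longrightarrow> (\<And>i. i < n \<Longrightarrow> \<bar>x i - a i\<bar> < d) \<Longrightarrow>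
        x \<in> W \<and> \<bar>f x - f a\<bar> < e"
proof -
  have sub: "W \<subseteq> topspace (Euclidean_space n)"
    using assms(2) openin_subset by blast
  have "openin (subtopology (Euclidean_space n) W)
     {x \<in> topspace (subtopology (Euclidean_space n) W). f x \<in> {t. \<bar>t - f a\<bar> < e}}"
    by (rule openin_continuous_map_preimage[OF assms(1)])
      (auto intro!: open_Collect_less continuous_intros)
  then have "openin (Euclidean_space n) {x \<in> W. \<bar>f x - f a\<bar> < e}"
    using assms(2) sub by (simp add: openin_open_subtopology Int_absorb1 Int_absorb2)
  moreover have "a \<in> {x \<in> W. \<bar>f x - f a\<bar> < e}"
    using assms by auto
  ultimately show ?thesis
    by (rule Euclidean_box_nbhd) (use that in auto)
qed

lemma continuous_Euclidean_eps_ex: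
  assumes "continuous_map (subtopology (Euclidean_space n) W) euclideanreal f"
    and "openin (Euclidean_space n) W" "a \<in> W" "e > 0"
  shows "\<exists>d>0. \<forall>x\<in>topspace (Euclidean_space n). (\<forall>i<n. \<bar>x i - a i\<bar> < d) \<longrightarrow>
     x \<in> W \<and> \<bar>f x - f a\<bar> < e"
proof -
  obtain d where "d > 0"
    "\<And>x. x \<in> topspace (Euclidean_space n) \<Longrightarrow> (\<And>i. i < n \<Longrightarrow> \<bar>x i - a i\<bar> < d) \<Longrightarrow>
        x \<in> W \<and> \<bar>f x - f a\<bar> < e"
    using continuous_Euclidean_eps[OF assms] by metis
  then show ?thesis by (intro exI[of _ d]) simp
qed

text \<open>The partial derivatives are carried as data \<open>f'\<close>, so that a composite can
  come with its chain-rule formula.\<close>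

definition C1_on :: "nat \<Rightarrow> (nat \<Rightarrow> real) set \<Rightarrow> ((nat \<Rightarrow> real) \<Rightarrow> real) \<Rightarrow> (nat \<Rightarrow> (nat \<Rightarrow> real) \<Rightarrow> real) \<Rightarrow> bool" where
  "C1_on n W f f' \<longleftrightarrow>
     continuous_map (subtopology (Euclidean_space n) W) euclideanreal f \<and>
     (\<forall>i<n. continuous_map (subtopology (Euclidean_space n) W) euclideanreal (f' i) \<and>
        (\<forall>x\<in>W. ((\<lambda>t. f (x(i := t))) has_real_derivative f' i x) (at (x i))))"

lemma smooth_real_on_imp_C1_on:
  assumes "smooth_real_on n W f"
  shows "C1_on n W f (\<lambda>i. partial_deriv i f)"
proof -
  have "continuous_map (subtopology (Euclidean_space n) W) euclideanreal (iter_partial [] f)"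
    using assms unfolding smooth_real_on_def by (metis empty_set empty_subsetI)
  moreover have "continuous_map (subtopology (Euclidean_space n) W) euclideanreal (iter_partial [i] f)"
    if "i < n" for i
    using assms that unfolding smooth_real_on_def by (metis empty_set lessThan_iff list.simps(15) singletonD subsetI)
  moreover have "(\<lambda>t. iter_partial [] f (x(i := t))) differentiable (at (x i))" if "i < n" "x \<in> W" for x i
    using assms that unfolding smooth_real_on_def by (metis empty_set empty_subsetI)
  ultimately show ?thesis
    by (simp add: C1_on_def partial_deriv_def DERIV_deriv_iff_real_differentiable)
qed

text \<open>Telescoping along the coordinates replaces total differentiability by Caratheodory's form.\<close>

lemma C1_on_caratheodory:
  assumes "C1_on n W f f'" "openin (Euclidean_space n) W" "a \<in> W"
  obtains A where "\<And>e. e > 0 \<Longrightarrow> \<exists>d>0. \<forall>x\<in>topspace (Euclidean_space n). (\<forall>i<n. \<bar>x i - a i\<bar> < d) \<longrightarrow>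
     x \<in> W \<and> f x = f a + (\<Sum>l<n. A x l * (x l - a l)) \<and> (\<forall>l<n. \<bar>A x l - f' l a\<bar> < e)"
proof -
  have top: "W \<subseteq> topspace (Euclidean_space n)"
    using assms(2) openin_subset by blast
  obtain d0 where d0: "d0 > 0"
    "\<And>x. x \<in> topspace (Euclidean_space n) \<Longrightarrow> (\<And>i. i < n \<Longrightarrow> \<bar>x i - a i\<bar> < d0) \<Longrightarrow> x \<in> W"
    using Euclidean_box_nbhd[OF assms(2,3)] by metis
  \<comment> \<open>A path from \<open>a\<close> to \<open>x\<close> along the axes:
    \<open>h x 0 = a\<close>, \<open>h x n = x\<close>, and the leg from \<open>h x l\<close> to
    \<open>h x (Suc l)\<close> moves only coordinate \<open>l\<close>, so that the mean value
    theorem in one variable applies to it.\<close>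
  define h where "h = (\<lambda>(x::nat\<Rightarrow>real) l i. if i < l then x i else a i)"
  have a0: "a i = 0" if "i \<ge> n" for i
    using assms(3) top that by (auto simp: topspace_Euclidean_space)
  have step: "\<exists>\<xi>. \<bar>\<xi> - a l\<bar> \<le> \<bar>x l - a l\<bar> \<and>
      f (h x (Suc l)) - f (h x l) = f' l ((h x l)(l := \<xi>)) * (x l - a l)"
    if x: "x \<in> topspace (Euclidean_space n)" "\<And>i. i < n \<Longrightarrow> \<bar>x i - a i\<bar> < d0" and l: "l < n" for x l
  proof -
    define g where "g = (\<lambda>t. f ((h x l)(l := t)))"
    have g1: "g (x l) = f (h x (Suc l))" "g (a l) = f (h x l)"
      unfolding g_def h_def by (rule arg_cong[where f=f], auto simp: fun_eq_iff)+
    have inW: "(h x l)(l := t) \<in> W" if "\<bar>t - a l\<bar> \<le> \<bar>x l - a l\<bar>" for t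
    proof (rule d0(2))
      show "(h x l)(l := t) \<in> topspace (Euclidean_space n)"
        using x(1) a0 l by (auto simp: topspace_Euclidean_space h_def)
      show "\<bar>((h x l)(l := t)) i - a i\<bar> < d0" if "i < n" for i
        using x(2)[OF that] d0(1) \<open>\<bar>t - a l\<bar> \<le> \<bar>x l - a l\<bar>\<close> x(2)[OF l] by (auto simp: h_def)
    qed
    have der: "(g has_real_derivative f' l ((h x l)(l := t))) (at t)" if "\<bar>t - a l\<bar> \<le> \<bar>x l - a l\<bar>" for t
    proof -
      have "((\<lambda>s. f (((h x l)(l := t))(l := s))) has_real_derivative f' l ((h x l)(l := t))) (at (((h x l)(l := t)) l))"
        using assms(1) inW[OF that] l unfolding C1_on_def by blast
      then show ?thesis by (simp add: g_def)
    qed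
    consider "a l < x l" | "x l < a l" | "x l = a l" by linarith
    then show ?thesis
    proof cases
      case 1
      obtain z where "z > a l" "z < x l" "g (x l) - g (a l) = (x l - a l) * f' l ((h x l)(l := z))"
        using MVT2[OF 1, of g "\<lambda>t. f' l ((h x l)(l := t))"] der by auto
      then show ?thesis by (intro exI[of _ z]) (auto simp: g1 algebra_simps)
    next
      case 2
      obtain z where "z > x l" "z < a l" "g (a l) - g (x l) = (a l - x l) * f' l ((h x l)(l := z))"
        using MVT2[OF 2, of g "\<lambda>t. f' l ((h x l)(l := t))"] der by auto
      then show ?thesis by (intro exI[of _ z]) (auto simp: g1 algebra_simps)
    next
      case 3
      then show ?thesis using g1 by auto
    qed
  qed
  \<comment> \<open>The mean value points are fixed before any \<open>e\<close> is given, so that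
    one \<open>A\<close> serves all \<open>e\<close>.\<close>
  define Z where "Z = (\<lambda>x l. SOME \<xi>. \<bar>\<xi> - a l\<bar> \<le> \<bar>x l - a l\<bar> \<and>
      f (h x (Suc l)) - f (h x l) = f' l ((h x l)(l := \<xi>)) * (x l - a l))"
  have Z: "\<bar>Z x l - a l\<bar> \<le> \<bar>x l - a l\<bar> \<and>
      f (h x (Suc l)) - f (h x l) = f' l ((h x l)(l := Z x l)) * (x l - a l)"
    if "x \<in> topspace (Euclidean_space n)" "\<And>i. i < n \<Longrightarrow> \<bar>x i - a i\<bar> < d0" "l < n" for x l
    unfolding Z_def by (rule someI_ex) (use step that in blast)
  \<comment> \<open>Since \<open>Z x l\<close> is no farther from \<open>a l\<close> than
    \<open>x l\<close> is, the intermediate point lies in every box around \<open>a\<close> that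
    contains \<open>x\<close>; continuity of \<open>f' l\<close> at \<open>a\<close> then controls
    \<open>A\<close>.\<close>
  define A where "A = (\<lambda>x l. f' l ((h x l)(l := Z x l)))"
  have "\<exists>d>0. \<forall>x\<in>topspace (Euclidean_space n). (\<forall>i<n. \<bar>x i - a i\<bar> < d) \<longrightarrow>
     x \<in> W \<and> f x = f a + (\<Sum>l<n. A x l * (x l - a l)) \<and> (\<forall>l<n. \<bar>A x l - f' l a\<bar> < e)" if "e > 0" for e
  proof -
    have "\<exists>d>0. \<forall>x\<in>topspace (Euclidean_space n). (\<forall>i<n. \<bar>x i - a i\<bar> < d) \<longrightarrow> \<bar>f' l x - f' l a\<bar> < e"
      if "l < n" for l
    proof -
      have "continuous_map (subtopology (Euclidean_space n) W) euclideanreal (f' l)"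
        using assms(1) that by (auto simp: C1_on_def)
      from continuous_Euclidean_eps[OF this assms(2,3) \<open>e > 0\<close>] show ?thesis by metis
    qed
    then obtain D where D: "\<And>l. l < n \<Longrightarrow> D l > 0" "\<And>l x. l < n \<Longrightarrow> x \<in> topspace (Euclidean_space n) \<Longrightarrow>
       (\<forall>i<n. \<bar>x i - a i\<bar> < D l) \<Longrightarrow> \<bar>f' l x - f' l a\<bar> < e"
      by metis
    define d where "d = Min (insert d0 (D ` {..<n}))"
    have d: "d > 0" "d \<le> d0" "\<And>l. l < n \<Longrightarrow> d \<le> D l"
      using D d0 by (auto simp: d_def)
    have "x \<in> W \<and> f x = f a + (\<Sum>l<n. A x l * (x l - a l)) \<and> (\<forall>l<n. \<bar>A x l - f' l a\<bar> < e)"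
      if x: "x \<in> topspace (Euclidean_space n)" "\<forall>i<n. \<bar>x i - a i\<bar> < d" for x
    proof (intro conjI allI impI)
      have xd0: "\<And>i. i < n \<Longrightarrow> \<bar>x i - a i\<bar> < d0"
        using x(2) d(2) by fastforce
      show "x \<in> W"
        using d0(2) x(1) xd0 by blast
      have "(\<Sum>l<n. A x l * (x l - a l)) = (\<Sum>l<n. f (h x (Suc l)) - f (h x l))"
        by (rule sum.cong) (use Z[OF x(1) xd0] in \<open>auto simp: A_def\<close>)
      also have "\<dots> = f (h x n) - f (h x 0)"
        by (rule sum_lessThan_telescope)
      also have "h x n = x"
        using x(1) a0 by (auto simp: h_def fun_eq_iff topspace_Euclidean_space)
      also have "h x 0 = a"
        by (auto simp: h_def)
      finally show "f x = f a + (\<Sum>l<n. A x l * (x l - a l))"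
        by simp
      fix l assume l: "l < n"
      show "\<bar>A x l - f' l a\<bar> < e"
        unfolding A_def
      proof (rule D(2)[OF l])
        show "(h x l)(l := Z x l) \<in> topspace (Euclidean_space n)"
          using x(1) a0 l by (auto simp: topspace_Euclidean_space h_def)
        show "\<forall>i<n. \<bar>((h x l)(l := Z x l)) i - a i\<bar> < D l"
        proof (intro allI impI)
          fix i assume "i < n"
          then have "\<bar>x i - a i\<bar> < D l" "\<bar>x l - a l\<bar> < D l"
            using x(2) d(3)[OF l] l by fastforce+
          then show "\<bar>((h x l)(l := Z x l)) i - a i\<bar> < D l"
            using Z[OF x(1) xd0 l] by (auto simp: h_def)
        qed
      qed
    qed
    then show ?thesis
      using d(1) by blast
  qed
  then show ?thesis
    by (rule that)
qed

text \<open>The factorisation makes the difference quotient of \<open>f\<close> along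
  \<open>\<gamma>\<close> a sum of products of \<open>A (\<gamma> t) l\<close> with the difference
  quotients of the coordinates, and all factors converge. The assumption \<open>top\<close> is there
  because the derivatives control \<open>\<gamma>\<close> only in the first \<open>n\<close>
  coordinates.\<close>

lemma C1_on_chain:
  assumes "C1_on n W f f'" "openin (Euclidean_space n) W" "a \<in> W" "\<gamma> t0 = a"
    and der: "\<And>l. l < n \<Longrightarrow> ((\<lambda>t. \<gamma> t l) has_real_derivative v l) (at t0)"
    and top: "\<forall>\<^sub>F t in at t0. \<gamma> t \<in> topspace (Euclidean_space n)"
  shows "((\<lambda>t. f (\<gamma> t)) has_real_derivative (\<Sum>l<n. f' l a * v l)) (at t0)"
proof -
  obtain A where A: "\<And>e. e > 0 \<Longrightarrow> \<exists>d>0. \<forall>x\<in>topspace (Euclidean_space n). (\<forall>i<n. \<bar>x i - a i\<bar> < d) \<longrightarrow>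
     x \<in> W \<and> f x = f a + (\<Sum>l<n. A x l * (x l - a l)) \<and> (\<forall>l<n. \<bar>A x l - f' l a\<bar> < e)"
    using C1_on_caratheodory[OF assms(1-3)] by blast
  have near: "\<forall>\<^sub>F t in at t0. \<forall>i<n. \<bar>\<gamma> t i - a i\<bar> < d" if "d > 0" for d
  proof -
    have "\<forall>\<^sub>F t in at t0. \<bar>\<gamma> t i - a i\<bar> < d" if "i < n" for i
    proof -
      have "((\<lambda>t. \<gamma> t i) \<longlongrightarrow> a i) (at t0)"
        using DERIV_isCont[OF der[OF that]] assms(4) by (auto simp: isCont_def)
      then show ?thesis
        using \<open>d > 0\<close> by (auto simp: tendsto_iff dist_real_def)
    qed
    then have "\<forall>\<^sub>F t in at t0. \<forall>i\<in>{..<n}. \<bar>\<gamma> t i - a i\<bar> < d"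
      by (intro eventually_ball_finite) auto
    then show ?thesis by (simp add: lessThan_iff Ball_def)
  qed
  have ev: "\<forall>\<^sub>F t in at t0. f (\<gamma> t) = f a + (\<Sum>l<n. A (\<gamma> t) l * (\<gamma> t l - a l)) \<and>
      (\<forall>l<n. \<bar>A (\<gamma> t) l - f' l a\<bar> < e)" if "e > 0" for e
  proof -
    obtain d where "d > 0" and d: "\<forall>x\<in>topspace (Euclidean_space n). (\<forall>i<n. \<bar>x i - a i\<bar> < d) \<longrightarrow>
     x \<in> W \<and> f x = f a + (\<Sum>l<n. A x l * (x l - a l)) \<and> (\<forall>l<n. \<bar>A x l - f' l a\<bar> < e)"
      using A[OF \<open>e > 0\<close>] by blast
    show ?thesis
      using eventually_conj[OF top near[OF \<open>d > 0\<close>]]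
    proof eventually_elim
      case (elim t)
      with d[rule_format, of "\<gamma> t"] show ?case by simp
    qed
  qed
  have At: "((\<lambda>t. A (\<gamma> t) l) \<longlongrightarrow> f' l a) (at t0)" if "l < n" for l
    unfolding tendsto_iff dist_real_def
  proof (intro allI impI)
    fix e :: real assume "e > 0"
    show "\<forall>\<^sub>F t in at t0. \<bar>A (\<gamma> t) l - f' l a\<bar> < e"
      using ev[OF \<open>e > 0\<close>] by eventually_elim (simp add: that)
  qed
  have "((\<lambda>t. \<Sum>l<n. A (\<gamma> t) l * ((\<gamma> t l - \<gamma> t0 l) / (t - t0))) \<longlongrightarrow> (\<Sum>l<n. f' l a * v l)) (at t0)"
  proof (intro tendsto_sum tendsto_mult)
    fix l assume "l \<in> {..<n}"
    then have "l < n" by simp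
    then show "((\<lambda>t. A (\<gamma> t) l) \<longlongrightarrow> f' l a) (at t0)"
      "((\<lambda>t. (\<gamma> t l - \<gamma> t0 l) / (t - t0)) \<longlongrightarrow> v l) (at t0)"
      using At der[of l] by (simp_all only: has_field_derivative_iff)
  qed
  moreover have "\<forall>\<^sub>F t in at t0. (\<Sum>l<n. A (\<gamma> t) l * ((\<gamma> t l - \<gamma> t0 l) / (t - t0))) = (f (\<gamma> t) - f (\<gamma> t0)) / (t - t0)"
    using ev[of 1, simplified]
    by eventually_elim (simp add: assms(4) sum_divide_distrib)
  ultimately show ?thesis
    unfolding has_field_derivative_iff by (rule Lim_transform_eventually)
qed

lemma C1_on_compose:
  assumes f: "C1_on n W f f'" and W: "openin (Euclidean_space n) W" and W': "openin (Euclidean_space n) W'"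
    and g: "\<And>l. l < n \<Longrightarrow> C1_on n W' (\<lambda>x. g x l) (g' l)" and gW: "\<And>x. x \<in> W' \<Longrightarrow> g x \<in> W"
  shows "C1_on n W' (\<lambda>x. f (g x)) (\<lambda>i x. \<Sum>l<n. f' l (g x) * g' l i x)"
proof -
  let ?E = "Euclidean_space n"
  have sub: "W \<subseteq> topspace ?E" "W' \<subseteq> topspace ?E"
    using W W' openin_subset by blast+
  have "continuous_map (subtopology ?E W') ?E g"
    by (rule continuous_map_into_Euclidean)
      (use g gW sub in \<open>auto simp: C1_on_def topspace_Euclidean_space subset_iff\<close>)
  then have gc: "continuous_map (subtopology ?E W') (subtopology ?E W) g"
    using gW by (auto simp: continuous_map_in_subtopology)
  show ?thesis
    unfolding C1_on_def
  proof (intro conjI allI impI ballI)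
    show "continuous_map (subtopology ?E W') euclideanreal (\<lambda>x. f (g x))"
      using continuous_map_compose[OF gc, of euclideanreal f] f by (auto simp: C1_on_def o_def)
    fix i assume i: "i < n"
    show "continuous_map (subtopology ?E W') euclideanreal (\<lambda>x. \<Sum>l<n. f' l (g x) * g' l i x)"
    proof (intro continuous_map_sum continuous_map_real_mult)
      fix l assume "l \<in> {..<n}"
      then show "continuous_map (subtopology ?E W') euclideanreal (\<lambda>x. f' l (g x))"
        using continuous_map_compose[OF gc, of euclideanreal "f' l"] f by (auto simp: C1_on_def o_def)
      show "continuous_map (subtopology ?E W') euclideanreal (g' l i)"
        using g i \<open>l \<in> {..<n}\<close> by (auto simp: C1_on_def)
    qed auto
    fix x assume x: "x \<in> W'"
    show "((\<lambda>t. f (g (x(i := t)))) has_real_derivative (\<Sum>l<n. f' l (g x) * g' l i x)) (at (x i))"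
    proof (rule C1_on_chain[OF f W gW[OF x]])
      show "g (x(i := x i)) = g x" by simp
      show "((\<lambda>t. g (x(i := t)) l) has_real_derivative g' l i x) (at (x i))" if "l < n" for l
        using g[OF that] x i by (auto simp: C1_on_def)
      obtain d where d: "d > 0"
        "\<And>y. y \<in> topspace ?E \<Longrightarrow> (\<And>j. j < n \<Longrightarrow> \<bar>y j - x j\<bar> < d) \<Longrightarrow> y \<in> W'"
        using Euclidean_box_nbhd[OF W' x] by metis
      have "\<forall>\<^sub>F t in at (x i). \<bar>t - x i\<bar> < d"
        using d(1) by (auto simp: eventually_at dist_real_def)
      then show "\<forall>\<^sub>F t in at (x i). g (x(i := t)) \<in> topspace ?E"
      proof eventually_elim
        case (elim t)
        then have "x(i := t) \<in> W'"
          using x sub i d by (intro d(2)) (auto simp: topspace_Euclidean_space)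
        then show ?case using gW sub by blast
      qed
    qed
  qed
qed

lemma C1_on_uminus:
  "C1_on n W f f' \<Longrightarrow> C1_on n W (\<lambda>x. - f x) (\<lambda>i x. - f' i x)"
  unfolding C1_on_def by (simp add: continuous_map_minus DERIV_minus)

section \<open>Smooth hypersurfaces in a normal crossing\<close>

text \<open>A smooth hypersurface contained in a normal crossing is one of its coordinate hyperplanes:
  it is a graph over \<open>x\<^sub>i = 0\<close>, and a generic point of the graph lies on \<open>x\<^sub>i = 0\<close> only.\<close>

lemma hypersurface_in_crossing_aux:
  assumes W: "openin (Euclidean_space n) W" "(\<lambda>_. 0) \<in> W" and f: "C1_on n W f f'"
    and f0: "f (\<lambda>_. 0) = 0" and i: "i < n" "f' i (\<lambda>_. 0) > 0"
    and zero: "\<And>x. x \<in> W \<Longrightarrow> f x = 0 \<Longrightarrow> \<exists>l<k. x l = 0" and k: "k \<le> n"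
  shows "i < k \<and> (\<exists>d>0. \<forall>x\<in>topspace (Euclidean_space n). (\<forall>l<n. \<bar>x l\<bar> < d) \<longrightarrow>
      x \<in> W \<and> (f x = 0 \<longleftrightarrow> x i = 0))"
proof -
  let ?E = "topspace (Euclidean_space n)"
  have cf: "continuous_map (subtopology (Euclidean_space n) W) euclideanreal f"
    and cf': "continuous_map (subtopology (Euclidean_space n) W) euclideanreal (f' i)"
    using f i(1) unfolding C1_on_def by blast+
  \<comment> \<open>On this box \<open>f' i\<close> stays positive, so \<open>f\<close> is strictly
    increasing in coordinate \<open>i\<close>.\<close>
  obtain d where "d > 0" and d': "\<And>x. x \<in> ?E \<Longrightarrow> (\<And>l. l < n \<Longrightarrow> \<bar>x l - 0\<bar> < d) \<Longrightarrow>
      x \<in> W \<and> \<bar>f' i x - f' i (\<lambda>_. 0)\<bar> < f' i (\<lambda>_. 0)"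
    using continuous_Euclidean_eps[OF cf' W i(2)] by metis
  note d = \<open>d > 0\<close>
  have dW: "x \<in> W" and dpos: "f' i x > 0" if x: "x \<in> ?E" and xd: "\<And>l. l < n \<Longrightarrow> \<bar>x l\<bar> < d" for x
  proof -
    have "x \<in> W \<and> \<bar>f' i x - f' i (\<lambda>_. 0)\<bar> < f' i (\<lambda>_. 0)"
      by (rule d'[OF x]) (simp add: xd)
    then show "x \<in> W" "f' i x > 0" by linarith+
  qed
  have upd: "x(i := t) \<in> ?E" if "x \<in> ?E" for x t
    using that i by (auto simp: topspace_Euclidean_space)
  have mono: "f (x(i := s)) < f (x(i := t))"
    if "x \<in> ?E" "\<And>l. l < n \<Longrightarrow> l \<noteq> i \<Longrightarrow> \<bar>x l\<bar> < d" "s < t" "\<bar>s\<bar> < d" "\<bar>t\<bar> < d" for x s t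
  proof (rule DERIV_pos_imp_increasing[OF that(3)])
    fix u assume u: "s \<le> u" "u \<le> t"
    have "x(i := u) \<in> W"
      by (rule dW[OF upd[OF that(1)]]) (use that(3-5) u in \<open>auto simp: that(2)\<close>)
    then have "((\<lambda>v. f ((x(i := u))(i := v))) has_real_derivative f' i (x(i := u))) (at ((x(i := u)) i))"
      using f i(1) unfolding C1_on_def by blast
    moreover have "f' i (x(i := u)) > 0"
      by (rule dpos[OF upd[OF that(1)]]) (use that(3-5) u in \<open>auto simp: that(2)\<close>)
    ultimately show "\<exists>y. ((\<lambda>a. f (x(i := a))) has_real_derivative y) (at u) \<and> y > 0"
      by auto
  qed
  \<comment> \<open>On the axis \<open>i\<close> the function has opposite signs at heights
    \<open>r\<close> and \<open>- r\<close>. Both signs survive small changes of the other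
    coordinates; \<open>D\<close> bounds these changes.\<close>
  define r where "r = d / 2"
  have r: "r > 0" "r < d" using d by (auto simp: r_def)
  let ?p = "(\<lambda>_. 0)(i := r) :: nat \<Rightarrow> real" and ?m = "(\<lambda>_. 0)(i := - r) :: nat \<Rightarrow> real"
  have z: "(\<lambda>_. 0) \<in> ?E" by (auto simp: topspace_Euclidean_space)
  have fp: "f ?p > 0"
    using mono[OF z, of 0 r] r f0 d(1) by (auto simp: fun_upd_idem)
  have fm: "f ?m < 0"
    using mono[OF z, of "-r" 0] r f0 d(1) by (auto simp: fun_upd_idem)
  have pW: "?p \<in> W" "?m \<in> W"
    by (rule dW[OF upd[OF z]]; use r in simp)+
  obtain d1 where d1: "d1 > 0" "\<forall>x\<in>?E. (\<forall>l<n. \<bar>x l - ?p l\<bar> < d1) \<longrightarrow> x \<in> W \<and> \<bar>f x - f ?p\<bar> < f ?p"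
    using continuous_Euclidean_eps_ex[OF cf W(1) pW(1) fp] by (elim exE conjE)
  have fm': "- f ?m > 0" using fm by simp
  obtain d2 where d2: "d2 > 0" "\<forall>x\<in>?E. (\<forall>l<n. \<bar>x l - ?m l\<bar> < d2) \<longrightarrow> x \<in> W \<and> \<bar>f x - f ?m\<bar> < - f ?m"
    using continuous_Euclidean_eps_ex[OF cf W(1) pW(2) fm'] by (elim exE conjE)
  define D where "D = Min {d, d1, d2}"
  have D: "D > 0" "D \<le> d" "D \<le> d1" "D \<le> d2"
    using d d1 d2 by (auto simp: D_def)
  \<comment> \<open>Intermediate value theorem on the line over \<open>y\<close> in direction
    \<open>i\<close>.\<close>
  have root: "\<exists>t. \<bar>t\<bar> < d \<and> f (y(i := t)) = 0"
    if y: "y \<in> ?E" "\<And>l. l < n \<Longrightarrow> l \<noteq> i \<Longrightarrow> \<bar>y l\<bar> < D" for y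
  proof -
    have yd: "\<bar>y l\<bar> < d1" "\<bar>y l\<bar> < d2" "\<bar>y l\<bar> < d" if "l < n" "l \<noteq> i" for l
      using y(2)[OF that] D by linarith+
    have "y(i := r) \<in> W \<and> \<bar>f (y(i := r)) - f ?p\<bar> < f ?p"
      by (rule d1(2)[rule_format, OF upd[OF y(1)]]) (simp add: yd d1(1))
    then have 1: "f (y(i := r)) > 0" by linarith
    have "y(i := - r) \<in> W \<and> \<bar>f (y(i := - r)) - f ?m\<bar> < - f ?m"
      by (rule d2(2)[rule_format, OF upd[OF y(1)]]) (simp add: yd d2(1))
    then have 2: "f (y(i := - r)) < 0" by linarith
    have "isCont (\<lambda>t. f (y(i := t))) u" if "- r \<le> u" "u \<le> r" for u
    proof -
      have "y(i := u) \<in> W"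
        by (rule dW[OF upd[OF y(1)]]) (use r that in \<open>auto simp: yd\<close>)
      then have "((\<lambda>v. f ((y(i := u))(i := v))) has_real_derivative f' i (y(i := u))) (at ((y(i := u)) i))"
        using f i(1) unfolding C1_on_def by blast
      then have "((\<lambda>v. f (y(i := v))) has_real_derivative f' i (y(i := u))) (at u)"
        by simp
      then show ?thesis by (rule DERIV_isCont)
    qed
    then have "\<exists>t\<ge>-r. t \<le> r \<and> f (y(i := t)) = 0"
      by (intro IVT) (use 1 2 r in auto)
    then obtain t where "- r \<le> t" "t \<le> r" "f (y(i := t)) = 0"
      by blast
    then show ?thesis using r by (intro exI[of _ t]) auto
  qed
  \<comment> \<open>If no other coordinate of \<open>y\<close> vanishes, the zero on the line over
    \<open>y\<close> can lie on the hyperplane of coordinate \<open>i\<close> only. So it has height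
    0, and \<open>i\<close> is one of the first \<open>k\<close> coordinates.\<close>
  have generic: "i < k \<and> f (y(i := 0)) = 0"
    if y: "y \<in> ?E" "\<And>l. l < n \<Longrightarrow> l \<noteq> i \<Longrightarrow> \<bar>y l\<bar> < D" "\<And>l. l < n \<Longrightarrow> l \<noteq> i \<Longrightarrow> y l \<noteq> 0" for y
  proof -
    obtain t where t: "\<bar>t\<bar> < d" "f (y(i := t)) = 0"
      using root[OF y(1,2)] by auto
    have yd: "\<bar>y l\<bar> < d" if "l < n" "l \<noteq> i" for l
      using y(2)[OF that] D by linarith
    have "y(i := t) \<in> W"
      by (rule dW[OF upd[OF y(1)]]) (simp add: yd t)
    then obtain l where "l < k" "(y(i := t)) l = 0"
      using zero t by blast
    moreover have "l = i"
      using calculation y(3)[of l] k by (cases "l = i") auto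
    ultimately show ?thesis
      using t by auto
  qed
  have ik: "i < k"
    by (rule generic[of "\<lambda>l. if l < n then D / 2 else 0", THEN conjunct1])
      (use D in \<open>auto simp: topspace_Euclidean_space\<close>)
  have flat: "f y = 0" if y: "y \<in> ?E" "y i = 0" "\<And>l. l < n \<Longrightarrow> \<bar>y l\<bar> < D" for y
  proof (rule ccontr)
    assume "f y \<noteq> 0"
    then have pos: "\<bar>f y\<bar> > 0" by simp
    have yd: "\<bar>y l\<bar> < d" if "l < n" for l
      using y(3)[OF that] D by linarith
    have "y \<in> W" by (rule dW[OF y(1) yd])
    obtain \<eta> where \<eta>: "\<eta> > 0" "\<forall>x\<in>?E. (\<forall>l<n. \<bar>x l - y l\<bar> < \<eta>) \<longrightarrow> x \<in> W \<and> \<bar>f x - f y\<bar> < \<bar>f y\<bar>"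
      using continuous_Euclidean_eps_ex[OF cf W(1) \<open>y \<in> W\<close> pos] by (elim exE conjE)
    \<comment> \<open>A generic point near \<open>y\<close>: its vanishing coordinates other than
      \<open>i\<close> are moved off zero by less than \<open>\<eta>\<close> and \<open>D\<close>.
      There \<open>f\<close> vanishes, against the choice of \<open>\<eta>\<close>.\<close>
    define y' where "y' = (\<lambda>l. if l < n \<and> l \<noteq> i \<and> y l = 0 then min \<eta> D / 2 else y l)"
    have "f (y'(i := 0)) = 0"
    proof (rule generic[THEN conjunct2])
      show "y' \<in> ?E"
        using y(1) by (auto simp: y'_def topspace_Euclidean_space)
      show "\<bar>y' l\<bar> < D" "y' l \<noteq> 0" if "l < n" "l \<noteq> i" for l
        using y(3)[OF that(1)] that \<eta>(1) D(1) by (auto simp: y'_def min_def)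
    qed
    moreover have "y'(i := 0) = y'"
      using y by (auto simp: y'_def fun_eq_iff)
    moreover have "y' \<in> W \<and> \<bar>f y' - f y\<bar> < \<bar>f y\<bar>"
    proof (rule \<eta>(2)[rule_format])
      show "y' \<in> ?E"
        using y(1) by (auto simp: y'_def topspace_Euclidean_space)
      show "\<bar>y' l - y l\<bar> < \<eta>" if "l < n" for l
        using \<eta>(1) D(1) by (auto simp: y'_def min_def)
    qed
    ultimately show False by auto
  qed
  have "x \<in> W \<and> (f x = 0 \<longleftrightarrow> x i = 0)" if x: "x \<in> ?E" "\<forall>l<n. \<bar>x l\<bar> < D" for x
  proof -
    have xd: "\<bar>x l\<bar> < d" if "l < n" for l
      using x(2) that D(2) by fastforce
    have f0: "f (x(i := 0)) = 0"
      by (rule flat[OF upd[OF x(1)]]) (use x(2) D(1) in \<open>simp_all\<close>)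
    \<comment> \<open>By strict monotonicity a line in direction \<open>i\<close> has no second zero
      besides the one at height 0.\<close>
    have "x i = 0" if "f x = 0"
    proof (rule ccontr)
      assume "x i \<noteq> 0"
      then consider "x i < 0" | "0 < x i" by linarith
      then show False
      proof cases
        case 1
        have "f (x(i := x i)) < f (x(i := 0))"
          by (rule mono[OF x(1)]) (use xd[OF i(1)] d(1) 1 in \<open>simp_all add: xd\<close>)
        then show False using f0 that by simp
      next
        case 2
        have "f (x(i := 0)) < f (x(i := x i))"
          by (rule mono[OF x(1)]) (use xd[OF i(1)] d(1) 2 in \<open>simp_all add: xd\<close>)
        then show False using f0 that by simp
      qed
    qed
    moreover have "x i = 0 \<Longrightarrow> f x = 0"
      using f0 by (simp add: fun_upd_idem)
    ultimately show ?thesis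
      using dW[OF x(1) xd] by blast
  qed
  then show ?thesis
    using ik D(1) by blast
qed

lemma hypersurface_in_crossing:
  assumes W: "openin (Euclidean_space n) W" "(\<lambda>_. 0) \<in> W" and f: "C1_on n W f f'"
    and f0: "f (\<lambda>_. 0) = 0" and i: "i < n" "f' i (\<lambda>_. 0) \<noteq> 0"
    and zero: "\<And>x. x \<in> W \<Longrightarrow> f x = 0 \<Longrightarrow> \<exists>l<k. x l = 0" and k: "k \<le> n"
  shows "i < k \<and> (\<exists>d>0. \<forall>x\<in>topspace (Euclidean_space n). (\<forall>l<n. \<bar>x l\<bar> < d) \<longrightarrow>
      x \<in> W \<and> (f x = 0 \<longleftrightarrow> x i = 0))"
proof (cases "f' i (\<lambda>_. 0) > 0")
  case True
  then show ?thesis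
    using hypersurface_in_crossing_aux assms by blast
next
  case False
  then show ?thesis
    using hypersurface_in_crossing_aux[OF W C1_on_uminus[OF f], of i k] assms by auto
qed

section \<open>Changes of charts\<close>

lemma eventually_upd_in_open:
  assumes "openin (Euclidean_space n) W" "x \<in> W" "i < n"
  shows "\<forall>\<^sub>F t in nhds (x i). x(i := t) \<in> W"
proof -
  obtain d where d: "d > 0"
    "\<And>y. y \<in> topspace (Euclidean_space n) \<Longrightarrow> (\<And>j. j < n \<Longrightarrow> \<bar>y j - x j\<bar> < d) \<Longrightarrow> y \<in> W"
    using Euclidean_box_nbhd[OF assms(1,2)] by metis
  have x: "x \<in> topspace (Euclidean_space n)"
    using assms openin_subset by blast
  have "x(i := t) \<in> W" if "dist t (x i) < d" for t
    by (rule d(2)) (use x assms(3) d(1) that in \<open>auto simp: topspace_Euclidean_space dist_real_def\<close>)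
  then show ?thesis
    unfolding eventually_nhds_metric using d(1) by blast
qed

text \<open>A partial derivative sees only the germ along a coordinate line, and near
  \<open>x\<close> this line stays in the open set \<open>W\<close>.\<close>

lemma iter_partial_cong:
  assumes "openin (Euclidean_space n) W" "\<And>x. x \<in> W \<Longrightarrow> f x = g x" "set is \<subseteq> {..<n}" "x \<in> W"
  shows "iter_partial is f x = iter_partial is g x"
  using assms(3,4)
proof (induction "is" arbitrary: x)
  case Nil
  then show ?case using assms(2) by simp
next
  case (Cons i "is")
  have "\<forall>\<^sub>F t in nhds (x i). x(i := t) \<in> W"
    using eventually_upd_in_open[OF assms(1)] Cons by simp
  then have "\<forall>\<^sub>F t in nhds (x i). iter_partial is f (x(i := t)) = iter_partial is g (x(i := t))"
    by eventually_elim (use Cons in auto)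
  then show ?case
    by (simp add: partial_deriv_def) (rule deriv_cong_ev, auto)
qed

lemma smooth_real_on_cong:
  assumes "smooth_real_on n W f" "openin (Euclidean_space n) W'" "W' \<subseteq> W" "\<And>x. x \<in> W' \<Longrightarrow> f x = g x"
  shows "smooth_real_on n W' g"
  unfolding smooth_real_on_def
proof (intro allI impI conjI ballI)
  fix "is" assume s: "set is \<subseteq> {..<n}"
  have eq: "iter_partial is f x = iter_partial is g x" if "x \<in> W'" for x
    by (rule iter_partial_cong[OF assms(2,4) s that])
  have "continuous_map (subtopology (Euclidean_space n) W') euclideanreal (iter_partial is f)"
    using assms(1,3) s by (auto simp: smooth_real_on_def intro: continuous_map_from_subtopology_mono)
  then show "continuous_map (subtopology (Euclidean_space n) W') euclideanreal (iter_partial is g)"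
    by (rule continuous_map_eq) (use eq in auto)
  fix x i assume x: "x \<in> W'" and i: "i < n"
  have "(\<lambda>t. iter_partial is f (x(i := t))) differentiable (at (x i))"
    using assms(1,3) s x i by (auto simp: smooth_real_on_def)
  then obtain D where D: "((\<lambda>t. iter_partial is f (x(i := t))) has_real_derivative D) (at (x i))"
    by (auto simp: real_differentiable_def)
  have "\<forall>\<^sub>F t in nhds (x i). x(i := t) \<in> W'"
    using eventually_upd_in_open[OF assms(2)] x i by simp
  then have "\<forall>\<^sub>F t in nhds (x i). iter_partial is f (x(i := t)) = iter_partial is g (x(i := t))"
    by eventually_elim (rule eq)
  then have "((\<lambda>t. iter_partial is g (x(i := t))) has_real_derivative D) (at (x i))"
    using D DERIV_cong_ev[OF refl _ refl, THEN iffD1] by fastforce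
  then show "(\<lambda>t. iter_partial is g (x(i := t))) differentiable (at (x i))"
    by (auto simp: real_differentiable_def)
qed

lemma C1_on_cong:
  assumes "C1_on n W f f'" "openin (Euclidean_space n) W" "\<And>x. x \<in> W \<Longrightarrow> f x = g x"
  shows "C1_on n W g f'"
  unfolding C1_on_def
proof (intro allI impI conjI ballI)
  have "continuous_map (subtopology (Euclidean_space n) W) euclideanreal f"
    using assms(1) unfolding C1_on_def by blast
  then show "continuous_map (subtopology (Euclidean_space n) W) euclideanreal g"
    by (rule continuous_map_eq) (use assms(3) in auto)
  fix i assume i: "i < n"
  then show "continuous_map (subtopology (Euclidean_space n) W) euclideanreal (f' i)"
    using assms(1) unfolding C1_on_def by blast
  fix x assume x: "x \<in> W"
  have "\<forall>\<^sub>F t in nhds (x i). x(i := t) \<in> W"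
    using eventually_upd_in_open[OF assms(2) x i] .
  then have "\<forall>\<^sub>F t in nhds (x i). f (x(i := t)) = g (x(i := t))"
    by eventually_elim (rule assms(3))
  moreover have "((\<lambda>t. f (x(i := t))) has_real_derivative f' i x) (at (x i))"
    using assms(1) i x unfolding C1_on_def by blast
  ultimately show "((\<lambda>t. g (x(i := t))) has_real_derivative f' i x) (at (x i))"
    by (rule DERIV_cong_ev[OF refl _ refl, THEN iffD1])
qed

section \<open>Permutations and translations of the coordinates\<close>

lemma partial_deriv_diff_const: "partial_deriv i (\<lambda>x. f x - c) = partial_deriv i f"
proof
  fix x
  have "((\<lambda>t. f (x(i := t)) - c) has_field_derivative D) (at (x i)) \<longleftrightarrow>
        ((\<lambda>t. f (x(i := t))) has_field_derivative D) (at (x i))" for D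
    using DERIV_diff[OF _ DERIV_const, of "\<lambda>t. f (x(i := t))" D "x i" UNIV c]
      DERIV_diff[OF _ DERIV_const, of "\<lambda>t. f (x(i := t)) - c" D "x i" UNIV "-c"] by auto
  then show "partial_deriv i (\<lambda>x. f x - c) x = partial_deriv i f x"
    by (simp add: partial_deriv_def deriv_def)
qed

lemma iter_partial_diff_const:
  "iter_partial is (\<lambda>x. f x - c) = (if is = [] then (\<lambda>x. f x - c) else iter_partial is f)"
proof (induction "is")
  case (Cons i "is")
  then show ?case
    by (cases "is = []") (simp_all add: partial_deriv_diff_const)
qed simp

lemma smooth_real_on_diff_const:
  assumes "smooth_real_on n W f"
  shows "smooth_real_on n W (\<lambda>x. f x - c)"
  unfolding smooth_real_on_def
proof (intro allI impI)
  fix "is" assume s: "set is \<subseteq> {..<n}"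
  have *: "continuous_map (subtopology (Euclidean_space n) W) euclideanreal (iter_partial is f)"
    "\<And>x i. x \<in> W \<Longrightarrow> i < n \<Longrightarrow> (\<lambda>t. iter_partial is f (x(i := t))) differentiable (at (x i))"
    using assms s unfolding smooth_real_on_def by blast+
  show "continuous_map (subtopology (Euclidean_space n) W) euclideanreal (iter_partial is (\<lambda>x. f x - c)) \<and>
        (\<forall>x\<in>W. \<forall>i<n. (\<lambda>t. iter_partial is (\<lambda>x. f x - c) (x(i := t))) differentiable (at (x i)))"
  proof (cases "is = []")
    case True
    then show ?thesis
      using * by (auto intro!: continuous_map_diff differentiable_diff)
  next
    case False
    then show ?thesis using * by (simp add: iter_partial_diff_const)
  qed
qed

lemma deriv_shift: "deriv (\<lambda>t. g (t + c)) x = deriv g (x + c)" for g :: "real \<Rightarrow> real"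
  by (simp add: deriv_def DERIV_shift)

text \<open>The substitution is inverse to the change of coordinates
  \<open>\<lambda>x i. x (\<sigma> i) - b i\<close>. Moving coordinate \<open>i\<close> of
  \<open>y\<close> moves coordinate \<open>\<sigma> i\<close> of the argument at unit speed, so
  derivatives of every order only have their indices relabelled.\<close>

lemma iter_partial_affine:
  assumes "\<sigma> permutes {..<n}"
  shows "iter_partial is (\<lambda>y. f (\<lambda>j. y (inv \<sigma> j) + b (inv \<sigma> j))) =
      (\<lambda>y. iter_partial (map \<sigma> is) f (\<lambda>j. y (inv \<sigma> j) + b (inv \<sigma> j)))"
proof (induction "is")
  case (Cons i "is")
  have bij: "bij \<sigma>" using assms by (simp add: permutes_bij)
  have upd: "(\<lambda>j. (y(i := t)) (inv \<sigma> j) + b (inv \<sigma> j)) =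
      (\<lambda>j. y (inv \<sigma> j) + b (inv \<sigma> j))(\<sigma> i := t + b i)" for y :: "nat \<Rightarrow> real" and t
    proof
    fix j
    show "(y(i := t)) (inv \<sigma> j) + b (inv \<sigma> j) =
        ((\<lambda>j. y (inv \<sigma> j) + b (inv \<sigma> j))(\<sigma> i := t + b i)) j"
      using permutes_inverses(2)[OF assms, of i] permutes_inv_eq[OF assms, of j i]
      by (cases "j = \<sigma> i") auto
  qed
  show ?case
  proof
    fix y
    let ?y = "\<lambda>j. y (inv \<sigma> j) + b (inv \<sigma> j)"
    have "deriv (\<lambda>t. iter_partial (map \<sigma> is) f (?y(\<sigma> i := t + b i))) (y i) =
        deriv (\<lambda>t. iter_partial (map \<sigma> is) f (?y(\<sigma> i := t))) (y i + b i)"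
      by (rule deriv_shift)
    then show "iter_partial (i # is) (\<lambda>y. f (\<lambda>j. y (inv \<sigma> j) + b (inv \<sigma> j))) y =
        iter_partial (map \<sigma> (i # is)) f ?y"
      using permutes_inverses(2)[OF assms]
      by (simp add: partial_deriv_def Cons upd del: fun_upd_apply)
  qed
qed simp

lemma continuous_map_affine:
  assumes "\<sigma> permutes {..<n}" "\<And>i. i \<ge> n \<Longrightarrow> b i = 0"
  shows "continuous_map (Euclidean_space n) (Euclidean_space n) (\<lambda>x i. x (\<sigma> i) + b i)"
proof (rule continuous_map_into_Euclidean)
  show "continuous_map (Euclidean_space n) euclideanreal (\<lambda>x. x (\<sigma> i) + b i)" for i
    by (intro continuous_map_add continuous_map_Euclidean_coord) simp
  show "x (\<sigma> i) + b i = 0" if "x \<in> topspace (Euclidean_space n)" "i \<ge> n" for x i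
    using that assms by (auto simp: topspace_Euclidean_space permutes_not_in)
qed

lemma homeomorphic_map_affine:
  assumes "\<sigma> permutes {..<n}" "\<And>i. i \<ge> n \<Longrightarrow> b i = (0::real)"
  shows "homeomorphic_map (Euclidean_space n) (Euclidean_space n) (\<lambda>x i. x (\<sigma> i) - b i)"
    (is "homeomorphic_map ?E ?E ?f")
proof -
  let ?g = "\<lambda>y j. y (inv \<sigma> j) + b (inv \<sigma> j)"
  have inv: "inv \<sigma> permutes {..<n}" using assms(1) by (rule permutes_inv)
  have "homeomorphic_maps ?E ?E ?f ?g"
    unfolding homeomorphic_maps_def
  proof (intro conjI)
    show "continuous_map ?E ?E ?f"
      using continuous_map_affine[OF assms(1), of "\<lambda>i. - b i"] assms(2) by simp
    show "continuous_map ?E ?E ?g"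
      by (rule continuous_map_affine[OF inv]) (use assms inv in \<open>auto simp: permutes_not_in\<close>)
  qed (use permutes_inverses[OF assms(1)] in auto)
  then show ?thesis by (auto simp: homeomorphic_map_maps)
qed

lemma smooth_real_on_affine:
  assumes "smooth_real_on n W f" and \<sigma>: "\<sigma> permutes {..<n}" and b: "\<And>i. i \<ge> n \<Longrightarrow> b i = (0::real)"
    and W: "W \<subseteq> topspace (Euclidean_space n)"
  shows "smooth_real_on n ((\<lambda>x i. x (\<sigma> i) - b i) ` W) (\<lambda>y. f (\<lambda>j. y (inv \<sigma> j) + b (inv \<sigma> j)))"
proof -
  let ?E = "Euclidean_space n" and ?T = "\<lambda>x i. x (\<sigma> i) - b i" and ?g = "\<lambda>y j. y (inv \<sigma> j) + b (inv \<sigma> j)"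
  have inv: "inv \<sigma> permutes {..<n}" using \<sigma> by (rule permutes_inv)
  have gT: "?g (?T x) = x" for x
    using permutes_inverses[OF \<sigma>] by auto
  have cg: "continuous_map ?E ?E ?g"
    by (rule continuous_map_affine[OF inv]) (use b inv in \<open>auto simp: permutes_not_in\<close>)
  have cg': "continuous_map (subtopology ?E (?T ` W)) (subtopology ?E W) ?g"
    using cg gT by (auto simp: continuous_map_in_subtopology continuous_map_from_subtopology)
  have bij: "bij \<sigma>" using \<sigma> by (simp add: permutes_bij)
  show ?thesis
    unfolding smooth_real_on_def
  proof (intro allI impI conjI ballI)
    fix "is" assume s: "set is \<subseteq> {..<n}"
    have s': "set (map \<sigma> is) \<subseteq> {..<n}"
      using s \<sigma> permutes_in_image[OF \<sigma>] by fastforce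
    have 1: "continuous_map (subtopology ?E W) euclideanreal (iter_partial (map \<sigma> is) f)"
      and 2: "\<And>x i. x \<in> W \<Longrightarrow> i < n \<Longrightarrow> (\<lambda>t. iter_partial (map \<sigma> is) f (x(i := t))) differentiable (at (x i))"
      using assms(1) s' unfolding smooth_real_on_def by blast+
    show "continuous_map (subtopology ?E (?T ` W)) euclideanreal (iter_partial is (\<lambda>y. f (?g y)))"
      using continuous_map_compose[OF cg' 1] by (simp add: iter_partial_affine[OF \<sigma>] o_def)
    fix y i assume "y \<in> ?T ` W" and i: "i < n"
    then obtain x where x: "x \<in> W" "y = ?T x" by blast
    have upd: "?g (y(i := t)) = x(\<sigma> i := t + b i)" for t
      proof
      fix j
      show "?g (y(i := t)) j = (x(\<sigma> i := t + b i)) j"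
        using permutes_inverses(2)[OF \<sigma>, of i] permutes_inverses(1)[OF \<sigma>, of j] permutes_inv_eq[OF \<sigma>, of j i]
        by (cases "j = \<sigma> i") (auto simp: x(2))
    qed
    have "\<sigma> i < n" using i permutes_in_image[OF \<sigma>, of i] by simp
    then obtain D where "((\<lambda>s. iter_partial (map \<sigma> is) f (x(\<sigma> i := s))) has_real_derivative D) (at (y i + b i))"
      using 2[OF x(1)] x(2) by (auto simp: real_differentiable_def)
    then have "((\<lambda>t. iter_partial (map \<sigma> is) f (x(\<sigma> i := t + b i))) has_real_derivative D) (at (y i))"
      by (simp add: DERIV_shift)
    then show "(\<lambda>t. iter_partial is (\<lambda>y. f (?g y)) (y(i := t))) differentiable (at (y i))"
      by (auto simp: real_differentiable_def iter_partial_affine[OF \<sigma>] upd simp del: fun_upd_apply)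
  qed
qed

context
  fixes n :: nat and X :: "'a topology" and A :: "'a chart set"
  assumes M: "smooth_manifold n X A"
begin

lemma smooth_charts_D:
  assumes "(U, \<phi>) \<in> smooth_charts n X A"
  shows "openin X U" "openin (Euclidean_space n) (\<phi> ` U)"
    "homeomorphic_map (subtopology X U) (subtopology (Euclidean_space n) (\<phi> ` U)) \<phi>"
    "U \<subseteq> topspace X" "inj_on \<phi> U"
proof -
  show *: "openin X U" "openin (Euclidean_space n) (\<phi> ` U)"
    "homeomorphic_map (subtopology X U) (subtopology (Euclidean_space n) (\<phi> ` U)) \<phi>"
    using assms by (auto simp: smooth_charts_def topological_chart_def)
  show U: "U \<subseteq> topspace X" using *(1) openin_subset by blast
  show "inj_on \<phi> U"
    using homeomorphic_imp_injective_map[OF *(3)] U by (simp add: Int_absorb1 Int_absorb2)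
qed

lemma atlas_subset_smooth_charts: "A \<subseteq> smooth_charts n X A"
  using M by (auto simp: smooth_manifold_def smooth_charts_def)

lemma chart_image_open:
  assumes "(U, \<phi>) \<in> smooth_charts n X A" "openin X U'" "U' \<subseteq> U"
  shows "openin (Euclidean_space n) (\<phi> ` U')"
proof -
  note c = smooth_charts_D[OF assms(1)]
  have "openin (subtopology X U) U'"
    using assms c(1) by (simp add: openin_open_subtopology)
  then have "openin (subtopology (Euclidean_space n) (\<phi> ` U)) (\<phi> ` U')"
    using homeomorphic_imp_open_map[OF c(3)] by (auto simp: open_map_def)
  then show ?thesis
    using c(2) openin_trans_full by blast
qed

lemma chart_preimage_open:
  assumes "(U, \<phi>) \<in> smooth_charts n X A" "openin (Euclidean_space n) W"
  shows "openin X {x \<in> U. \<phi> x \<in> W}"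
proof -
  note c = smooth_charts_D[OF assms(1)]
  have "continuous_map (subtopology X U) (Euclidean_space n) \<phi>"
    using homeomorphic_imp_continuous_map[OF c(3)] by (simp add: continuous_map_in_subtopology)
  from openin_continuous_map_preimage[OF this assms(2)]
  have "openin (subtopology X U) {x \<in> U. \<phi> x \<in> W}"
    using c(4) by (simp add: Int_absorb1 Int_absorb2)
  then show ?thesis using c(1) openin_trans_full by blast
qed

text \<open>A normal crossing chart must be centred at the origin and list its crossing coordinates
  first. The maximal atlas is closed under the operations that achieve this: restriction,
  translation and permutation of coordinates.\<close>

lemma smooth_chart_affine:
  assumes c: "(U, \<phi>) \<in> smooth_charts n X A" and U': "openin X U'" "U' \<subseteq> U"
    and \<sigma>: "\<sigma> permutes {..<n}" and b: "\<And>i. i \<ge> n \<Longrightarrow> b i = 0"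
  shows "(U', \<lambda>x i. \<phi> x (\<sigma> i) - b i) \<in> smooth_charts n X A"
proof -
  let ?E = "Euclidean_space n" and ?T = "\<lambda>x i. x (\<sigma> i) - b i :: real"
  let ?\<phi>' = "\<lambda>x i. \<phi> x (\<sigma> i) - b i"
  note cD = smooth_charts_D[OF c]
  have img: "?\<phi>' ` S = ?T ` (\<phi> ` S)" for S by auto
  have T: "homeomorphic_map ?E ?E ?T"
    by (rule homeomorphic_map_affine[OF \<sigma> b])
  have open_img: "openin ?E (\<phi> ` S)" "openin ?E (?\<phi>' ` S)" if "openin X S" "S \<subseteq> U'" for S
  proof -
    show "openin ?E (\<phi> ` S)"
      using chart_image_open[OF c that(1)] that(2) U'(2) by blast
    then show "openin ?E (?\<phi>' ` S)"
      unfolding img using homeomorphic_imp_open_map[OF T] by (auto simp: open_map_def)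
  qed
  have top: "\<phi> ` U \<subseteq> topspace ?E"
    using cD(2) openin_subset by blast
  have 1: "homeomorphic_map (subtopology X U') (subtopology ?E (\<phi> ` U')) \<phi>"
  proof -
    have "homeomorphic_map (subtopology (subtopology X U) U') (subtopology (subtopology ?E (\<phi> ` U)) (\<phi> ` U')) \<phi>"
      by (rule homeomorphic_map_subtopologies[OF cD(3)])
        (use U' cD(4) top in auto)
    moreover have "U \<inter> U' = U'" "\<phi> ` U \<inter> \<phi> ` U' = \<phi> ` U'" using U'(2) by auto
    ultimately show ?thesis by (simp add: subtopology_subtopology)
  qed
  have 2: "homeomorphic_map (subtopology ?E (\<phi> ` U')) (subtopology ?E (?\<phi>' ` U')) ?T"
  proof (rule homeomorphic_map_subtopologies[OF T])
    have "?\<phi>' ` U' \<subseteq> topspace ?E"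
      using open_img(2)[OF U'(1)] openin_subset by blast
    then have "topspace ?E \<inter> ?\<phi>' ` U' = ?\<phi>' ` U'" by (rule Int_absorb1)
    moreover have "topspace ?E \<inter> \<phi> ` U' = \<phi> ` U'"
      by (rule Int_absorb1) (use top U'(2) in blast)
    ultimately show "?T ` (topspace ?E \<inter> \<phi> ` U') = topspace ?E \<inter> ?\<phi>' ` U'"
      by (simp only: img)
  qed
  have "homeomorphic_map (subtopology X U') (subtopology ?E (?\<phi>' ` U')) ?\<phi>'"
    using homeomorphic_map_compose[OF 1 2] by (simp add: o_def)
  then have chart: "topological_chart n X (U', ?\<phi>')"
    using U' open_img(2)[OF U'(1)] by (simp add: topological_chart_def)
  have inj': "inj_on ?\<phi>' U'"
  proof (rule inj_onI)
    fix x y assume xy: "x \<in> U'" "y \<in> U'" "?\<phi>' x = ?\<phi>' y"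
    then have "\<phi> x (\<sigma> j) = \<phi> y (\<sigma> j)" for j
      by (auto simp: fun_eq_iff)
    then have "\<phi> x = \<phi> y"
      using permutes_inverses[OF \<sigma>] by (metis ext)
    then show "x = y" using cD(5) xy U'(2) by (auto dest: inj_onD)
  qed
  have "compatible_charts n (U', ?\<phi>') d" if "d \<in> A" for d
  proof -
    obtain V \<theta> where d: "d = (V, \<theta>)" by (cases d)
    have dc: "(V, \<theta>) \<in> smooth_charts n X A"
      using that atlas_subset_smooth_charts d by auto
    note dD = smooth_charts_D[OF dc]
    have comp: "compatible_charts n (U, \<phi>) (V, \<theta>)"
      using c that d by (auto simp: smooth_charts_def)
    have UV: "openin X (U' \<inter> V)" using U' dD(1) by blast
    have "smooth_on n (?\<phi>' ` (U' \<inter> V)) (\<theta> \<circ> inv_into U' ?\<phi>')"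
      unfolding smooth_on_def
    proof (intro allI impI)
      fix i assume i: "i < n"
      let ?f = "\<lambda>x. (\<theta> \<circ> inv_into U \<phi>) x i"
      have "smooth_real_on n (\<phi> ` (U \<inter> V)) ?f"
        using comp i by (auto simp: compatible_charts_def smooth_on_def)
      then have "smooth_real_on n (\<phi> ` (U' \<inter> V)) ?f"
        by (rule smooth_real_on_cong) (use open_img(1)[OF UV] U'(2) in auto)
      then have "smooth_real_on n (?T ` (\<phi> ` (U' \<inter> V))) (\<lambda>y. ?f (\<lambda>j. y (inv \<sigma> j) + b (inv \<sigma> j)))"
        by (rule smooth_real_on_affine[OF _ \<sigma> b]) (use top U'(2) in auto)
      then show "smooth_real_on n (?\<phi>' ` (U' \<inter> V)) (\<lambda>x. (\<theta> \<circ> inv_into U' ?\<phi>') x i)"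
      proof (rule smooth_real_on_cong)
        show "openin ?E (?\<phi>' ` (U' \<inter> V))" by (rule open_img(2)[OF UV]) auto
        show "?\<phi>' ` (U' \<inter> V) \<subseteq> ?T ` (\<phi> ` (U' \<inter> V))" by (simp add: img)
        fix y assume "y \<in> ?\<phi>' ` (U' \<inter> V)"
        then obtain x where x: "x \<in> U' \<inter> V" "y = ?\<phi>' x" by blast
        have "inv_into U' ?\<phi>' y = x"
          unfolding x(2) by (rule inv_into_f_f[OF inj']) (use x in auto)
        moreover have "(\<lambda>j. y (inv \<sigma> j) + b (inv \<sigma> j)) = \<phi> x"
          using permutes_inverses[OF \<sigma>] by (auto simp: x(2))
        moreover have "inv_into U \<phi> (\<phi> x) = x"
          by (rule inv_into_f_f[OF cD(5)]) (use x U' in auto)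
        ultimately show "?f (\<lambda>j. y (inv \<sigma> j) + b (inv \<sigma> j)) = (\<theta> \<circ> inv_into U' ?\<phi>') y i"
          by (simp add: o_def)
      qed
    qed
    moreover have "smooth_on n (\<theta> ` (U' \<inter> V)) (?\<phi>' \<circ> inv_into V \<theta>)"
      unfolding smooth_on_def
    proof (intro allI impI)
      fix i assume i: "i < n"
      have "\<sigma> i < n" using i permutes_in_image[OF \<sigma>, of i] by simp
      then have "smooth_real_on n (\<theta> ` (U \<inter> V)) (\<lambda>x. (\<phi> \<circ> inv_into V \<theta>) x (\<sigma> i))"
        using comp by (auto simp: compatible_charts_def smooth_on_def)
      then have "smooth_real_on n (\<theta> ` (U' \<inter> V)) (\<lambda>x. (\<phi> \<circ> inv_into V \<theta>) x (\<sigma> i))"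
        by (rule smooth_real_on_cong) (use chart_image_open[OF dc UV] U'(2) in auto)
      from smooth_real_on_diff_const[OF this, of "b i"]
      show "smooth_real_on n (\<theta> ` (U' \<inter> V)) (\<lambda>x. (?\<phi>' \<circ> inv_into V \<theta>) x i)"
        by (simp add: o_def)
    qed
    ultimately show ?thesis
      by (simp add: d compatible_charts_def)
  qed
  then show ?thesis
    using chart by (simp add: smooth_charts_def)
qed

text \<open>Compatibility is recorded only with the charts of \<open>A\<close>, so the transition
  from \<open>\<phi>\<close> to \<open>\<psi>\<close> is factored through a chart
  \<open>\<theta>\<close> of \<open>A\<close> at \<open>p\<close>; one application of the chain rule
  then gives continuous first derivatives.\<close>

lemma chart_transition_C1:
  assumes c: "(U, \<phi>) \<in> smooth_charts n X A" and d: "(V, \<psi>) \<in> smooth_charts n X A"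
    and p: "p \<in> U" "p \<in> V"
  obtains N F where "openin X N" "p \<in> N" "N \<subseteq> U \<inter> V" "openin (Euclidean_space n) (\<phi> ` N)"
    "\<And>l. l < n \<Longrightarrow> C1_on n (\<phi> ` N) (\<lambda>x. \<psi> (inv_into U \<phi> x) l) (F l)"
proof -
  let ?E = "Euclidean_space n"
  note cD = smooth_charts_D[OF c] and dD = smooth_charts_D[OF d]
  have "p \<in> topspace X" using p cD(4) by blast
  then obtain Z \<theta> where Z: "(Z, \<theta>) \<in> A" "p \<in> Z"
    using M unfolding smooth_manifold_def by blast
  have z: "(Z, \<theta>) \<in> smooth_charts n X A" using Z atlas_subset_smooth_charts by auto
  note zD = smooth_charts_D[OF z]
  define N where "N = U \<inter> V \<inter> Z"
  have N: "openin X N" "p \<in> N" "N \<subseteq> U" "N \<subseteq> V" "N \<subseteq> Z"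
    using cD dD zD p Z by (auto simp: N_def)
  have op: "openin ?E (\<phi> ` N)" "openin ?E (\<theta> ` N)"
    using chart_image_open[OF c] chart_image_open[OF z] N by auto
  define g where "g = \<theta> \<circ> inv_into U \<phi>"
  define f where "f = \<psi> \<circ> inv_into Z \<theta>"
  have inv: "inv_into U \<phi> (\<phi> x) = x" "inv_into Z \<theta> (\<theta> x) = x" if "x \<in> N" for x
    using inv_into_f_f[OF cD(5)] inv_into_f_f[OF zD(5)] that N by auto
  have "smooth_on n (\<phi> ` (U \<inter> Z)) g" "smooth_on n (\<theta> ` (V \<inter> Z)) f"
    using c d Z by (auto simp: smooth_charts_def compatible_charts_def g_def f_def)
  note smU = this
  have sm: "smooth_real_on n (\<phi> ` N) (\<lambda>x. g x l)" "smooth_real_on n (\<theta> ` N) (\<lambda>x. f x l)" if "l < n" for l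
  proof -
    have "smooth_real_on n (\<phi> ` (U \<inter> Z)) (\<lambda>x. g x l)" "smooth_real_on n (\<theta> ` (V \<inter> Z)) (\<lambda>x. f x l)"
      using that smU by (auto simp: smooth_on_def)
    then show "smooth_real_on n (\<phi> ` N) (\<lambda>x. g x l)" "smooth_real_on n (\<theta> ` N) (\<lambda>x. f x l)"
      using N by (blast intro: smooth_real_on_cong op)+
  qed
  have gN: "g x \<in> \<theta> ` N" if "x \<in> \<phi> ` N" for x
    using that inv by (auto simp: g_def)
  have "\<exists>F. C1_on n (\<phi> ` N) (\<lambda>x. \<psi> (inv_into U \<phi> x) l) F" if l: "l < n" for l
  proof -
    have C: "C1_on n (\<phi> ` N) (\<lambda>x. f (g x) l) (\<lambda>i x. \<Sum>j<n. partial_deriv j (\<lambda>x. f x l) (g x) * partial_deriv i (\<lambda>x. g x j) x)"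
      by (rule C1_on_compose[OF smooth_real_on_imp_C1_on[OF sm(2)[OF l]] op(2,1) smooth_real_on_imp_C1_on[OF sm(1)] gN])
    have eq: "f (g x) l = \<psi> (inv_into U \<phi> x) l" if "x \<in> \<phi> ` N" for x
      using that inv by (auto simp: f_def g_def)
    show ?thesis
      using C1_on_cong[OF C op(1) eq] by blast
  qed
  then obtain F where "\<And>l. l < n \<Longrightarrow> C1_on n (\<phi> ` N) (\<lambda>x. \<psi> (inv_into U \<phi> x) l) (F l)"
    by metis
  then show ?thesis
    using that N op by blast
qed

text \<open>In the chart \<open>\<phi>\<close> the branch is the zero set of a function to which
  \<open>hypersurface_in_crossing\<close> applies once some partial derivative at the origin is
  nonzero; this comes from the transition map having a differentiable inverse.\<close>

lemma smooth_branch_is_hyperplane: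
  assumes c: "(U, \<phi>) \<in> smooth_charts n X A" and d: "(V, \<psi>) \<in> smooth_charts n X A"
    and p: "p \<in> U" "p \<in> V" "\<phi> p = (\<lambda>_. 0)" "\<psi> p m = 0" and mk: "m < n" "k \<le> n"
    and sub: "\<And>x. x \<in> U \<inter> V \<Longrightarrow> \<psi> x m = 0 \<Longrightarrow> \<exists>l<k. \<phi> x l = 0"
  obtains i N where "i < k" "openin X N" "p \<in> N" "N \<subseteq> U \<inter> V" "\<And>x. x \<in> N \<Longrightarrow> \<psi> x m = 0 \<longleftrightarrow> \<phi> x i = 0"
proof -
  let ?E = "Euclidean_space n"
  note cD = smooth_charts_D[OF c] and dD = smooth_charts_D[OF d]
  obtain N F where N: "openin X N" "p \<in> N" "N \<subseteq> U \<inter> V" "openin ?E (\<phi> ` N)"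
    "\<And>l. l < n \<Longrightarrow> C1_on n (\<phi> ` N) (\<lambda>x. \<psi> (inv_into U \<phi> x) l) (F l)"
    using chart_transition_C1[OF c d p(1,2)] by blast
  obtain N' G where N': "openin X N'" "p \<in> N'" "N' \<subseteq> V \<inter> U" "openin ?E (\<psi> ` N')"
    "\<And>l. l < n \<Longrightarrow> C1_on n (\<psi> ` N') (\<lambda>x. \<phi> (inv_into V \<psi> x) l) (G l)"
    using chart_transition_C1[OF d c p(2,1)] by blast
  let ?f = "\<lambda>x. \<psi> (inv_into U \<phi> x) m"
  have inv: "inv_into U \<phi> (\<phi> x) = x" if "x \<in> U" for x
    using inv_into_f_f[OF cD(5) that] .
  have inv': "inv_into V \<psi> (\<psi> x) = x" if "x \<in> V" for x
    using inv_into_f_f[OF dD(5) that] .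
  note C = N(5)[OF mk(1)]
  have "\<exists>i<n. F m i (\<phi> p) \<noteq> 0"
  proof -
    \<comment> \<open>The line of the coordinate \<open>m\<close> of \<open>\<psi>\<close> through
      \<open>p\<close>, seen in \<open>\<phi>\<close>. Along it that coordinate is the parameter
      itself, so the chain rule writes 1 as the sum of
      \<open>F m l (\<phi> p) * G l m (\<psi> p)\<close>, and some \<open>F m l (\<phi> p)\<close>
      is nonzero.\<close>
    define \<gamma> where "\<gamma> = (\<lambda>t. \<phi> (inv_into V \<psi> ((\<psi> p)(m := t))))"
    have ev: "\<forall>\<^sub>F t in nhds (\<psi> p m). (\<psi> p)(m := t) \<in> \<psi> ` N'"
      by (rule eventually_upd_in_open[OF N'(4) _ mk(1)]) (use N' in auto)
    then have ev': "\<forall>\<^sub>F t in at (\<psi> p m). (\<psi> p)(m := t) \<in> \<psi> ` N'"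
      by (auto simp: eventually_at_filter elim: eventually_mono)
    have "((\<lambda>t. ?f (\<gamma> t)) has_real_derivative (\<Sum>l<n. F m l (\<phi> p) * G l m (\<psi> p))) (at (\<psi> p m))"
    proof (rule C1_on_chain[OF C N(4)])
      show "\<phi> p \<in> \<phi> ` N" using N by blast
      show "\<gamma> (\<psi> p m) = \<phi> p"
        by (simp add: \<gamma>_def fun_upd_idem inv'[OF p(2)])
      show "((\<lambda>t. \<gamma> t l) has_real_derivative G l m (\<psi> p)) (at (\<psi> p m))" if "l < n" for l
        using N'(2) N'(5)[OF that] mk(1) by (auto simp: C1_on_def \<gamma>_def)
      have "\<phi> ` U \<subseteq> topspace ?E" using cD(2) openin_subset by blast
      have "\<gamma> t \<in> topspace ?E" if mem: "(\<psi> p)(m := t) \<in> \<psi> ` N'" for t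
      proof -
        obtain x where x: "x \<in> N'" "(\<psi> p)(m := t) = \<psi> x" using mem by blast
        then have "\<gamma> t = \<phi> x" using N'(3) inv'[of x] by (auto simp: \<gamma>_def)
        then show ?thesis using x(1) N'(3) \<open>\<phi> ` U \<subseteq> topspace ?E\<close> by blast
      qed
      with ev' show "\<forall>\<^sub>F t in at (\<psi> p m). \<gamma> t \<in> topspace ?E"
        by (rule eventually_mono)
    qed
    moreover have "\<forall>\<^sub>F t in nhds (\<psi> p m). ?f (\<gamma> t) = t"
      using ev
    proof eventually_elim
      case (elim t)
      then obtain x where x: "x \<in> N'" "(\<psi> p)(m := t) = \<psi> x" by blast
      moreover have "x \<in> U" "x \<in> V" using x(1) N'(3) by blast+
      ultimately have "?f (\<gamma> t) = \<psi> x m"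
        using inv inv' \<open>x \<in> U\<close> \<open>x \<in> V\<close> by (simp add: \<gamma>_def)
      then show ?case using x(2) by (metis fun_upd_same)
    qed
    ultimately have "((\<lambda>t. t) has_real_derivative (\<Sum>l<n. F m l (\<phi> p) * G l m (\<psi> p))) (at (\<psi> p m))"
      using DERIV_cong_ev[where f = "\<lambda>t. ?f (\<gamma> t)" and g = "\<lambda>t. t", OF refl _ refl] by blast
    then have "(\<Sum>l<n. F m l (\<phi> p) * G l m (\<psi> p)) = 1"
      using DERIV_ident DERIV_unique by blast
    then show ?thesis
      by (metis (no_types, lifting) lessThan_iff mult_zero_left sum.neutral zero_neq_one)
  qed
  then obtain i where i: "i < n" "F m i (\<phi> p) \<noteq> 0" by blast
  have "i < k \<and> (\<exists>d>0. \<forall>x\<in>topspace ?E. (\<forall>l<n. \<bar>x l\<bar> < d) \<longrightarrow> x \<in> \<phi> ` N \<and> (?f x = 0 \<longleftrightarrow> x i = 0))"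
  proof (rule hypersurface_in_crossing[OF N(4) _ C _ i(1) _ _ mk(2)])
    show "(\<lambda>_. 0) \<in> \<phi> ` N" using N(2) p(3) by (metis imageI)
    show "?f (\<lambda>_. 0) = 0" using inv[OF p(1)] p by simp
    show "F m i (\<lambda>_. 0) \<noteq> 0" using i(2) p(3) by simp
    show "\<exists>l<k. x l = 0" if "x \<in> \<phi> ` N" "?f x = 0" for x
    proof -
      obtain z where "z \<in> N" "x = \<phi> z" using \<open>x \<in> \<phi> ` N\<close> by blast
      moreover have "z \<in> U" "z \<in> V" using \<open>z \<in> N\<close> N(3) by blast+
      ultimately show ?thesis using sub[of z] inv[of z] that(2) by simp
    qed
  qed
  then obtain e where ik: "i < k" and e: "e > 0"
    "\<And>x. x \<in> topspace ?E \<Longrightarrow> \<forall>l<n. \<bar>x l\<bar> < e \<Longrightarrow> x \<in> \<phi> ` N \<and> (?f x = 0 \<longleftrightarrow> x i = 0)"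
    by blast
  define B where "B = {x \<in> U. \<phi> x \<in> {y \<in> topspace ?E. \<forall>l<n. \<bar>y l - (\<lambda>_. 0) l\<bar> < e}}"
  have "openin X B"
    unfolding B_def by (rule chart_preimage_open[OF c openin_Euclidean_box])
  moreover have "p \<in> B"
    using p e(1) by (auto simp: B_def topspace_Euclidean_space)
  moreover have Bx: "x \<in> N \<and> (\<psi> x m = 0 \<longleftrightarrow> \<phi> x i = 0)" if "x \<in> B" for x
  proof -
    have x: "x \<in> U" "\<phi> x \<in> \<phi> ` N" "?f (\<phi> x) = 0 \<longleftrightarrow> \<phi> x i = 0"
      using e(2)[of "\<phi> x"] that by (auto simp: B_def)
    obtain z where z: "z \<in> N" "\<phi> x = \<phi> z" using x(2) by blast
    then have "x = z" using inj_onD[OF cD(5) z(2) x(1)] N(3) by blast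
    then show ?thesis using x(3) z(1) inv[OF x(1)] by simp
  qed
  ultimately show ?thesis
    using that[of i B] ik N(3) by blast
qed

end

section \<open>Cubical normal crossing charts for a pair of divisors\<close>

definition cube :: "nat \<Rightarrow> real \<Rightarrow> (nat \<Rightarrow> real) set" where
  "cube n \<epsilon> = {x \<in> topspace (Euclidean_space n). \<forall>i<n. \<bar>x i\<bar> < \<epsilon>}"

lemma openin_cube: "openin (Euclidean_space n) (cube n \<epsilon>)"
  using openin_Euclidean_box[of n "\<lambda>_. 0" \<epsilon>] by (simp add: cube_def)

lemma sgn_convex:
  fixes a b t :: real
  assumes "sgn a = sgn b" "0 \<le> t" "t \<le> 1"
  shows "sgn ((1 - t) * a + t * b) = sgn a"
proof -
  consider "a > 0" "b > 0" | "a = 0" "b = 0" | "a < 0" "b < 0"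
    using assms(1) by (metis linorder_less_linear sgn_greater sgn_less sgn_zero_iff)
  then show ?thesis
  proof cases
    case 1
    have "(1 - t) * a + t * b > 0"
    proof (cases "t = 0")
      case False
      then show ?thesis using 1 assms by (intro add_nonneg_pos mult_nonneg_nonneg mult_pos_pos) auto
    qed (use 1 in simp)
    then show ?thesis using 1 by simp
  next
    case 3
    have "(1 - t) * a + t * b < 0"
    proof (cases "t = 0")
      case False
      then show ?thesis using 3 assms by (intro add_nonpos_neg mult_nonneg_nonpos mult_pos_neg) auto
    qed (use 3 in simp)
    then show ?thesis using 3 by simp
  qed simp
qed

lemma abs_convex_less:
  fixes a b t :: real
  assumes "\<bar>a\<bar> < d" "\<bar>b\<bar> < d" "0 \<le> t" "t \<le> 1"
  shows "\<bar>(1 - t) * a + t * b\<bar> < d"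
proof -
  have "(1 - t) * \<bar>a\<bar> + t * \<bar>b\<bar> < d"
    using assms convex_bound_lt[of "\<bar>a\<bar>" d "\<bar>b\<bar>" "1 - t" t] by simp
  moreover have "\<bar>(1 - t) * a + t * b\<bar> \<le> (1 - t) * \<bar>a\<bar> + t * \<bar>b\<bar>"
    using assms abs_triangle_ineq[of "(1 - t) * a" "t * b"] by (simp add: abs_mult)
  ultimately show ?thesis by linarith
qed

locale nc_pair =
  fixes n :: nat and X :: "'a topology" and A :: "'a chart set" and D D' :: "'a set"
  assumes M: "smooth_manifold n X A" and ncD: "nc_divisor n X A D" and ncD': "nc_divisor n X A D'"
    and DD': "D \<subseteq> D'"
begin

lemma chart_restrict:
  "(U, \<phi>) \<in> smooth_charts n X A \<Longrightarrow> openin X U' \<Longrightarrow> U' \<subseteq> U \<Longrightarrow> (U', \<phi>) \<in> smooth_charts n X A"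
  using smooth_chart_affine[OF M, of U \<phi> U' id "\<lambda>_. 0"] by (simp add: permutes_id)

lemma chart_box_basis:
  assumes c: "(U, \<phi>) \<in> smooth_charts n X A" and V: "openin X V" "a \<in> V" "a \<in> U"
  shows "\<exists>d>0. {x \<in> U. \<forall>i<n. \<bar>\<phi> x i - \<phi> a i\<bar> < d} \<subseteq> V"
proof -
  note cD = smooth_charts_D[OF M c]
  have "openin (Euclidean_space n) (\<phi> ` (U \<inter> V))"
    by (rule chart_image_open[OF M c]) (use cD V in auto)
  then obtain d where d: "d > 0" "\<forall>x\<in>topspace (Euclidean_space n). (\<forall>i<n. \<bar>x i - \<phi> a i\<bar> < d) \<longrightarrow> x \<in> \<phi> ` (U \<inter> V)"
    using Euclidean_box_nbhd_ex[of n "\<phi> ` (U \<inter> V)" "\<phi> a"] V by blast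
  have "x \<in> V" if "x \<in> U" "\<forall>i<n. \<bar>\<phi> x i - \<phi> a i\<bar> < d" for x
  proof -
    have "\<phi> x \<in> topspace (Euclidean_space n)"
      using cD(2) openin_subset that(1) by blast
    then have "\<phi> x \<in> \<phi> ` (U \<inter> V)" using d(2) that(2) by blast
    then show ?thesis using cD(5) that(1) by (auto dest: inj_onD)
  qed
  then show ?thesis using d(1) by blast
qed

lemma chart_box_open:
  assumes c: "(U, \<phi>) \<in> smooth_charts n X A"
  shows "openin X {x \<in> U. \<forall>i<n. \<bar>\<phi> x i - a i\<bar> < d}"
proof -
  note cD = smooth_charts_D[OF M c]
  have "openin X {x \<in> U. \<phi> x \<in> {y \<in> topspace (Euclidean_space n). \<forall>i<n. \<bar>y i - a i\<bar> < d}}"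
    by (rule chart_preimage_open[OF M c openin_Euclidean_box])
  moreover have "\<phi> x \<in> topspace (Euclidean_space n)" if "x \<in> U" for x
    using cD(2) openin_subset that by blast
  then have "{x \<in> U. \<phi> x \<in> {y \<in> topspace (Euclidean_space n). \<forall>i<n. \<bar>y i - a i\<bar> < d}} =
      {x \<in> U. \<forall>i<n. \<bar>\<phi> x i - a i\<bar> < d}" by blast
  ultimately show ?thesis by simp
qed

lemma cube_chart_exists:
  assumes c: "(U0, \<phi>) \<in> smooth_charts n X A" and p: "p \<in> U0" "\<phi> p = (\<lambda>_. 0)" and V: "openin X V" "p \<in> V"
  shows "\<exists>U \<epsilon>. (U, \<phi>) \<in> smooth_charts n X A \<and> p \<in> U \<and> U \<subseteq> V \<and> U \<subseteq> U0 \<and> \<epsilon> > 0 \<and> \<phi> ` U = cube n \<epsilon>"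
proof -
  note cD = smooth_charts_D[OF M c]
  have "openin (Euclidean_space n) (\<phi> ` (U0 \<inter> V))"
    by (rule chart_image_open[OF M c]) (use cD V in auto)
  then obtain d where d: "d > 0" "\<forall>x\<in>topspace (Euclidean_space n). (\<forall>i<n. \<bar>x i - \<phi> p i\<bar> < d) \<longrightarrow> x \<in> \<phi> ` (U0 \<inter> V)"
    using Euclidean_box_nbhd_ex[of n "\<phi> ` (U0 \<inter> V)" "\<phi> p"] V p by blast
  define U where "U = {x \<in> U0. \<phi> x \<in> cube n d}"
  have sub: "cube n d \<subseteq> \<phi> ` (U0 \<inter> V)"
    using d(2) p(2) by (auto simp: cube_def)
  have "openin X U"
    unfolding U_def by (rule chart_preimage_open[OF M c openin_cube])
  then have "(U, \<phi>) \<in> smooth_charts n X A"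
    by (rule chart_restrict[OF c]) (auto simp: U_def)
  moreover have "p \<in> U"
    using p d(1) by (auto simp: U_def cube_def topspace_Euclidean_space)
  moreover have "U \<subseteq> V"
    using sub cD(5) by (auto simp: U_def dest: inj_onD)
  moreover have "\<phi> ` U = cube n d"
    using sub by (auto simp: U_def)
  moreover have "U \<subseteq> U0" by (auto simp: U_def)
  ultimately show ?thesis using d(1) by blast
qed

text \<open>\<open>J\<close> lists the coordinate hyperplanes of \<open>D'\<close> that make up \<open>D\<close>.\<close>

definition nc_cube :: "'a \<Rightarrow> nat \<Rightarrow> 'a set \<Rightarrow> ('a \<Rightarrow> nat \<Rightarrow> real) \<Rightarrow> real \<Rightarrow> nat set \<Rightarrow> bool" where
  "nc_cube p k U \<phi> \<epsilon> J \<longleftrightarrow> (U, \<phi>) \<in> smooth_charts n X A \<and> p \<in> U \<and> \<phi> p = (\<lambda>_. 0) \<and> \<epsilon> > 0 \<and>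
     \<phi> ` U = cube n \<epsilon> \<and> k \<le> n \<and> D' \<inter> U = {x \<in> U. \<exists>i<k. \<phi> x i = 0} \<and>
     J \<subseteq> {..<k} \<and> D \<inter> U = {x \<in> U. \<exists>i\<in>J. \<phi> x i = 0}"

section \<open>Comparison of normal crossing charts\<close>

lemma nc_chart_D:
  "nc_chart n X A E k p U \<phi> \<Longrightarrow> (U, \<phi>) \<in> smooth_charts n X A \<and> p \<in> U \<and> \<phi> p = (\<lambda>_. 0) \<and> 1 \<le> k \<and> k \<le> n \<and>
     (\<forall>x\<in>U. x \<in> E \<longleftrightarrow> (\<exists>i<k. \<phi> x i = 0))"
  by (auto simp: nc_chart_def)

text \<open>Each coordinate hyperplane of a chart of \<open>E\<close> is a smooth branch inside
  \<open>D'\<close>. With \<open>E = D\<close> this exhibits \<open>D\<close> as a union of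
  coordinate hyperplanes of \<open>D'\<close>; with \<open>E = D'\<close> it shows that the type of
  a chart is intrinsic.\<close>

lemma nc_charts_compare:
  assumes c: "nc_chart n X A D' k p U \<phi>" and d: "nc_chart n X A E j p V \<psi>" and E: "E \<subseteq> D'"
  obtains i N where "openin X N" "p \<in> N" "N \<subseteq> U \<inter> V" "\<And>m. m < j \<Longrightarrow> i m < k"
    "\<And>x m. x \<in> N \<Longrightarrow> m < j \<Longrightarrow> \<psi> x m = 0 \<longleftrightarrow> \<phi> x (i m) = 0"
proof -
  note c' = nc_chart_D[OF c] and d' = nc_chart_D[OF d]
  have "\<exists>i N. i < k \<and> openin X N \<and> p \<in> N \<and> N \<subseteq> U \<inter> V \<and> (\<forall>x\<in>N. \<psi> x m = 0 \<longleftrightarrow> \<phi> x i = 0)"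
    if m: "m < j" for m
  proof -
    have sub: "\<exists>l<k. \<phi> x l = 0" if "x \<in> U \<inter> V" "\<psi> x m = 0" for x
      using that m c' d' E by blast
    obtain i N where "i < k" "openin X N" "p \<in> N" "N \<subseteq> U \<inter> V" "\<And>x. x \<in> N \<Longrightarrow> \<psi> x m = 0 \<longleftrightarrow> \<phi> x i = 0"
      by (rule smooth_branch_is_hyperplane[OF M, of U \<phi> V \<psi> p m k])
        (use c' d' m sub in auto)
    then show ?thesis by blast
  qed
  then obtain i N where iN: "\<And>m. m < j \<Longrightarrow> i m < k \<and> openin X (N m) \<and> p \<in> N m \<and> N m \<subseteq> U \<inter> V \<and>
      (\<forall>x\<in>N m. \<psi> x m = 0 \<longleftrightarrow> \<phi> x (i m) = 0)"
    by metis
  have "openin X (U \<inter> V \<inter> (\<Inter>m\<in>{..<j}. N m))"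
    using c' d' iN smooth_charts_D(1)[OF M]
    by (cases "j = 0") (auto intro!: openin_Int openin_INT2)
  moreover have "p \<in> U \<inter> V \<inter> (\<Inter>m\<in>{..<j}. N m)"
    using iN c' d' by blast
  ultimately show ?thesis
    by (rule that[of "U \<inter> V \<inter> (\<Inter>m\<in>{..<j}. N m)" i]) (use iN in auto)
qed

text \<open>On \<open>D\<close> the set \<open>J\<close> is the image of the index map of the
  comparison. At points of \<open>D'\<close> off \<open>D\<close> the chart is shrunk away from the
  closed set \<open>D\<close>, so that \<open>J\<close> is empty. Off \<open>D'\<close> any
  recentred chart serves, with \<open>k = 0\<close>; thus later arguments treat all points of
  \<open>X\<close> alike.\<close>

lemma nc_cube_exists:
  assumes p: "p \<in> topspace X" and V: "openin X V" "p \<in> V"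
  shows "\<exists>k U \<phi> \<epsilon> J. nc_cube p k U \<phi> \<epsilon> J \<and> U \<subseteq> V \<and> (p \<in> D' \<longrightarrow> 1 \<le> k)"
proof (cases "p \<in> D'")
  case True
  then obtain k U0 \<phi> where c: "nc_chart n X A D' k p U0 \<phi>"
    using ncD' by (auto simp: nc_divisor_def)
  note c' = nc_chart_D[OF c]
  have "\<exists>N J. openin X N \<and> p \<in> N \<and> N \<subseteq> U0 \<and> J \<subseteq> {..<k} \<and> (\<forall>x\<in>N. x \<in> D \<longleftrightarrow> (\<exists>i\<in>J. \<phi> x i = 0))"
  proof (cases "p \<in> D")
    case True
    then obtain j V0 \<psi> where d: "nc_chart n X A D j p V0 \<psi>"
      using ncD by (auto simp: nc_divisor_def)
    obtain i N where N: "openin X N" "p \<in> N" "N \<subseteq> U0 \<inter> V0" "\<And>m. m < j \<Longrightarrow> i m < k"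
      "\<And>x m. x \<in> N \<Longrightarrow> m < j \<Longrightarrow> \<psi> x m = 0 \<longleftrightarrow> \<phi> x (i m) = 0"
      by (rule nc_charts_compare[OF c d DD']) (rule that)
    have "\<forall>x\<in>N. x \<in> D \<longleftrightarrow> (\<exists>i\<in>i ` {..<j}. \<phi> x i = 0)"
      using N nc_chart_D[OF d] by (auto simp: subset_iff)
    then show ?thesis
      using N by (intro exI[of _ N] exI[of _ "i ` {..<j}"]) auto
  next
    case False
    have "openin X (U0 - D)"
      using c' smooth_charts_D(1)[OF M] ncD by (auto simp: nc_divisor_def intro!: openin_diff)
    then show ?thesis
      using False c' by (intro exI[of _ "U0 - D"] exI[of _ "{}"]) auto
  qed
  then obtain N J where N: "openin X N" "p \<in> N" "N \<subseteq> U0" "J \<subseteq> {..<k}" "\<forall>x\<in>N. x \<in> D \<longleftrightarrow> (\<exists>i\<in>J. \<phi> x i = 0)"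
    by blast
  obtain U \<epsilon> where U: "(U, \<phi>) \<in> smooth_charts n X A" "p \<in> U" "U \<subseteq> N \<inter> V" "U \<subseteq> U0" "\<epsilon> > 0" "\<phi> ` U = cube n \<epsilon>"
    using cube_chart_exists[of U0 \<phi> p "N \<inter> V"] c' N V by blast
  have "D' \<inter> U = {x \<in> U. \<exists>i<k. \<phi> x i = 0}" "D \<inter> U = {x \<in> U. \<exists>i\<in>J. \<phi> x i = 0}"
    using U(3,4) c' N by auto
  then have "nc_cube p k U \<phi> \<epsilon> J"
    using U c' N(4) by (auto simp: nc_cube_def)
  then show ?thesis using U(3) c' by blast
next
  case False
  obtain U0 \<phi>0 where "(U0, \<phi>0) \<in> A" "p \<in> U0"
    using M p unfolding smooth_manifold_def by blast
  then have c: "(U0, \<phi>0) \<in> smooth_charts n X A" using atlas_subset_smooth_charts[OF M] by blast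
  have "\<phi>0 p \<in> topspace (Euclidean_space n)"
    using smooth_charts_D(2)[OF M c] openin_subset \<open>p \<in> U0\<close> by blast
  then have b: "\<phi>0 p i = 0" if "i \<ge> n" for i
    using that by (auto simp: topspace_Euclidean_space)
  have c': "(U0, \<lambda>x i. \<phi>0 x i - \<phi>0 p i) \<in> smooth_charts n X A"
    using smooth_chart_affine[OF M c smooth_charts_D(1)[OF M c] order_refl permutes_id b] by simp
  have "openin X (V - D')"
    using V ncD' by (auto simp: nc_divisor_def intro!: openin_diff)
  then obtain U \<epsilon> where U: "(U, \<lambda>x i. \<phi>0 x i - \<phi>0 p i) \<in> smooth_charts n X A" "p \<in> U" "U \<subseteq> V - D'"
      "\<epsilon> > 0" "(\<lambda>x i. \<phi>0 x i - \<phi>0 p i) ` U = cube n \<epsilon>"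
    using cube_chart_exists[OF c', of p "V - D'"] \<open>p \<in> U0\<close> False V by auto
  then have "nc_cube p 0 U (\<lambda>x i. \<phi>0 x i - \<phi>0 p i) \<epsilon> {}"
    using DD' by (auto simp: nc_cube_def)
  then show ?thesis using U(3) False by blast
qed

lemma nc_cube_D:
  assumes "nc_cube p k U \<phi> \<epsilon> J"
  shows "(U, \<phi>) \<in> smooth_charts n X A" "p \<in> U" "\<phi> p = (\<lambda>_. 0)" "\<epsilon> > 0" "\<phi> ` U = cube n \<epsilon>" "k \<le> n"
    "\<And>x. x \<in> U \<Longrightarrow> x \<in> D' \<longleftrightarrow> (\<exists>i<k. \<phi> x i = 0)" "J \<subseteq> {..<k}"
    "\<And>x. x \<in> U \<Longrightarrow> x \<in> D \<longleftrightarrow> (\<exists>i\<in>J. \<phi> x i = 0)"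
    "openin X U" "U \<subseteq> topspace X" "inj_on \<phi> U" "p \<in> topspace X"
    "\<And>x. x \<in> U \<Longrightarrow> \<phi> x \<in> topspace (Euclidean_space n)" "\<And>x i. x \<in> U \<Longrightarrow> i < n \<Longrightarrow> \<bar>\<phi> x i\<bar> < \<epsilon>"
proof -
  show *: "(U, \<phi>) \<in> smooth_charts n X A" "p \<in> U" "\<phi> p = (\<lambda>_. 0)" "\<epsilon> > 0" "\<phi> ` U = cube n \<epsilon>" "k \<le> n"
    "J \<subseteq> {..<k}"
    using assms by (auto simp: nc_cube_def)
  have "D' \<inter> U = {x \<in> U. \<exists>i<k. \<phi> x i = 0}" "D \<inter> U = {x \<in> U. \<exists>i\<in>J. \<phi> x i = 0}"
    using assms by (auto simp: nc_cube_def)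
  then show "\<And>x. x \<in> U \<Longrightarrow> x \<in> D' \<longleftrightarrow> (\<exists>i<k. \<phi> x i = 0)" "\<And>x. x \<in> U \<Longrightarrow> x \<in> D \<longleftrightarrow> (\<exists>i\<in>J. \<phi> x i = 0)"
    by auto
  show "openin X U" "U \<subseteq> topspace X" "inj_on \<phi> U"
    using smooth_charts_D[OF M *(1)] by auto
  then show "p \<in> topspace X" using *(2) by blast
  have "\<phi> x \<in> cube n \<epsilon>" if "x \<in> U" for x
    using *(5) that by blast
  then show "\<And>x. x \<in> U \<Longrightarrow> \<phi> x \<in> topspace (Euclidean_space n)" "\<And>x i. x \<in> U \<Longrightarrow> i < n \<Longrightarrow> \<bar>\<phi> x i\<bar> < \<epsilon>"
    by (auto simp: cube_def)
qed

text \<open>The index map from the hyperplanes of \<open>\<psi>\<close> to those of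
  \<open>\<phi>\<close> is onto, because a generic point of any hyperplane of \<open>\<phi>\<close>
  lies on no other one.\<close>

lemma nc_chart_type_le:
  assumes c: "nc_chart n X A D' a p U \<phi>" and d: "nc_chart n X A D' b p V \<psi>"
  shows "a \<le> b"
proof -
  note c' = nc_chart_D[OF c] and d' = nc_chart_D[OF d]
  obtain i N where N: "openin X N" "p \<in> N" "N \<subseteq> U \<inter> V" "\<And>m. m < b \<Longrightarrow> i m < a"
    "\<And>x m. x \<in> N \<Longrightarrow> m < b \<Longrightarrow> \<psi> x m = 0 \<longleftrightarrow> \<phi> x (i m) = 0"
    by (rule nc_charts_compare[OF c d order_refl]) (rule that)
  obtain B \<epsilon> where B: "p \<in> B" "B \<subseteq> N" "\<epsilon> > 0" "\<phi> ` B = cube n \<epsilon>"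
    using cube_chart_exists[of U \<phi> p N] c' N by blast
  have "l \<in> i ` {..<b}" if l: "l < a" for l
  proof -
    \<comment> \<open>A point of the hyperplane of coordinate \<open>l\<close> off all other
      coordinate hyperplanes.\<close>
    define y where "y = (\<lambda>j. if j < n \<and> j \<noteq> l then \<epsilon> / 2 else 0)"
    have "y \<in> cube n \<epsilon>"
      using B(3) by (auto simp: cube_def y_def topspace_Euclidean_space)
    then obtain x where x: "x \<in> B" "\<phi> x = y" using B(4) by (metis imageE)
    then have "\<phi> x l = 0" by (simp add: y_def)
    then have "x \<in> D'" using c' l x B N by blast
    then obtain m where m: "m < b" "\<psi> x m = 0" using d' x B N by blast
    then have "\<phi> x (i m) = 0" using N(5) x B by blast
    moreover have "i m < n" using N(4)[OF m(1)] c' by linarith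
    ultimately have "i m = l" using x(2) B(3) by (auto simp: y_def split: if_splits)
    then show ?thesis using m by blast
  qed
  then have "{..<a} \<subseteq> i ` {..<b}" by auto
  then show ?thesis
    by (metis card_lessThan finite_lessThan surj_card_le)
qed

lemma codim_unique:
  assumes "x \<in> codim_locus n X A D' a" "x \<in> codim_locus n X A D' b"
  shows "a = b"
proof (cases "x \<in> D'")
  case True
  then obtain U \<phi> V \<psi> where "nc_chart n X A D' a x U \<phi>" "nc_chart n X A D' b x V \<psi>"
    using assms unfolding codim_locus_def by auto
  then show ?thesis using nc_chart_type_le by (meson order_antisym)
next
  case False
  then show ?thesis using assms unfolding codim_locus_def by auto
qed

text \<open>Near \<open>x\<close> only the crossing coordinates that vanish at \<open>x\<close>
  matter. Moved to the front and recentred, they form a normal crossing chart at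
  \<open>x\<close>.\<close>

lemma nc_cube_codim:
  assumes q: "nc_cube p k U \<phi> \<epsilon> J" and x: "x \<in> U"
  shows "x \<in> codim_locus n X A D' (card {i. i < k \<and> \<phi> x i = 0})"
proof -
  note q' = nc_cube_D[OF q]
  let ?Z = "{i. i < k \<and> \<phi> x i = 0}"
  have xt: "x \<in> topspace X" using q' x by blast
  show ?thesis
  proof (cases "?Z = {}")
    case True
    then have "x \<notin> D'" using q'(7)[OF x] by blast
    then show ?thesis using xt True by (simp add: codim_locus_def)
  next
    case False
    have "?Z \<subseteq> {..<n}" using q'(6) by auto
    have fin: "finite ?Z" by auto
    let ?c = "card ?Z"
    have cn: "?c \<le> n" using card_mono[of "{..<n}" ?Z] \<open>?Z \<subseteq> {..<n}\<close> by simp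
    obtain h1 where h1: "bij_betw h1 {..<?c} ?Z"
      using finite_same_card_bij[OF finite_lessThan fin, of ?c] by auto
    have "card ({..<n} - {..<?c}) = card ({..<n} - ?Z)"
      using \<open>?Z \<subseteq> {..<n}\<close> cn fin by (simp add: card_Diff_subset)
    then obtain h2 where h2: "bij_betw h2 ({..<n} - {..<?c}) ({..<n} - ?Z)"
      using finite_same_card_bij[of "{..<n} - {..<?c}" "{..<n} - ?Z"] by auto
    \<comment> \<open>The coordinates vanishing at \<open>x\<close> come first, since the product in
      \<open>nc_chart\<close> runs over an initial segment.\<close>
    define \<sigma> where "\<sigma> = (\<lambda>i. if i < n then (if i < ?c then h1 i else h2 i) else i)"
    have "bij_betw (\<lambda>i. if i \<in> {..<?c} then h1 i else h2 i) ({..<?c} \<union> ({..<n} - {..<?c})) (?Z \<union> ({..<n} - ?Z))"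
      by (rule bij_betw_disjoint_Un[OF h1 h2]) auto
    moreover have "{..<?c} \<union> ({..<n} - {..<?c}) = {..<n}" "?Z \<union> ({..<n} - ?Z) = {..<n}"
      using cn \<open>?Z \<subseteq> {..<n}\<close> by auto
    ultimately have "bij_betw (\<lambda>i. if i \<in> {..<?c} then h1 i else h2 i) {..<n} {..<n}"
      by simp
    then have "bij_betw \<sigma> {..<n} {..<n}"
      by (rule bij_betw_cong[THEN iffD1, rotated]) (auto simp: \<sigma>_def)
    then have \<sigma>: "\<sigma> permutes {..<n}"
      by (rule bij_imp_permutes) (auto simp: \<sigma>_def)
    have \<sigma>Z: "\<sigma> ` {..<?c} = ?Z"
    proof -
      have "\<sigma> ` {..<?c} = h1 ` {..<?c}" by (rule image_cong) (use cn in \<open>auto simp: \<sigma>_def\<close>)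
      then show ?thesis using h1 by (simp add: bij_betw_def)
    qed
    define b where "b = (\<lambda>i. \<phi> x (\<sigma> i))"
    have b: "b i = 0" if "i \<ge> n" for i
      using q'(14)[OF x] that by (auto simp: b_def \<sigma>_def topspace_Euclidean_space)
    \<comment> \<open>Within this radius the crossing coordinates that are nonzero at
      \<open>x\<close> stay nonzero. The 1 covers the case that there are none.\<close>
    obtain d where d: "d > 0" "\<And>i. i < k \<Longrightarrow> i \<notin> ?Z \<Longrightarrow> d \<le> \<bar>\<phi> x i\<bar>"
    proof
      let ?S = "insert 1 ((\<lambda>i. \<bar>\<phi> x i\<bar>) ` {i. i < k \<and> \<phi> x i \<noteq> 0})"
      show "Min ?S > 0" by (subst Min_gr_iff) auto
      show "Min ?S \<le> \<bar>\<phi> x i\<bar>" if "i < k" "i \<notin> ?Z" for i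
        by (rule Min_le) (use that in auto)
    qed
    define U' where "U' = {y \<in> U. \<forall>i<n. \<bar>\<phi> y i - \<phi> x i\<bar> < d}"
    have U'o: "openin X U'" unfolding U'_def by (rule chart_box_open[OF q'(1)])
    have ch: "(U', \<lambda>y i. \<phi> y (\<sigma> i) - b i) \<in> smooth_charts n X A"
      by (rule smooth_chart_affine[OF M q'(1) U'o _ \<sigma> b]) (auto simp: U'_def)
    have nz: "\<phi> y i \<noteq> 0" if "y \<in> U'" "i < k" "i \<notin> ?Z" for y i
    proof
      assume "\<phi> y i = 0"
      moreover have "\<bar>\<phi> y i - \<phi> x i\<bar> < d" using that(1,2) q'(6) by (simp add: U'_def)
      ultimately have "\<bar>\<phi> x i\<bar> < d" by simp
      then show False using d(2)[OF that(2,3)] by linarith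
    qed
    have "D' \<inter> U' = {y \<in> U'. (\<Prod>i<?c. \<phi> y (\<sigma> i) - b i) = 0}"
    proof -
      have "y \<in> D' \<longleftrightarrow> (\<Prod>i<?c. \<phi> y (\<sigma> i) - b i) = 0" if y: "y \<in> U'" for y
      proof -
        have "y \<in> D' \<longleftrightarrow> (\<exists>i<k. \<phi> y i = 0)" using q'(7) y by (auto simp: U'_def)
        also have "\<dots> \<longleftrightarrow> (\<exists>i\<in>?Z. \<phi> y i = 0)" using nz[OF y] by blast
        also have "\<dots> \<longleftrightarrow> (\<exists>i\<in>\<sigma> ` {..<?c}. \<phi> y i = 0)" by (simp only: \<sigma>Z)
        also have "\<dots> \<longleftrightarrow> (\<exists>i<?c. \<phi> y (\<sigma> i) = 0)" by blast
        also have "\<dots> \<longleftrightarrow> (\<exists>i<?c. \<phi> y (\<sigma> i) - b i = 0)"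
        proof -
          have "b i = 0" if "i < ?c" for i
          proof -
            have "\<sigma> i \<in> ?Z" using that by (subst \<sigma>Z[symmetric]) simp
            then show ?thesis by (simp add: b_def)
          qed
          then show ?thesis by (metis diff_zero)
        qed
        finally show ?thesis by auto
      qed
      then show ?thesis by blast
    qed
    moreover have "x \<in> U'" using x d(1) by (auto simp: U'_def)
    moreover have "1 \<le> ?c" using False fin by (simp add: Suc_leI card_gt_0_iff)
    ultimately have "nc_chart n X A D' ?c x U' (\<lambda>y i. \<phi> y (\<sigma> i) - b i)"
      using ch cn by (simp add: nc_chart_def b_def)
    moreover have "x \<in> D'" using False q'(7)[OF x] by blast
    ultimately show ?thesis using xt by (auto simp: codim_locus_def)
  qed
qed

lemma codim_iff:
  assumes q: "nc_cube p k U \<phi> \<epsilon> J" and x: "x \<in> U"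
  shows "x \<in> codim_locus n X A D' j \<longleftrightarrow> card {i. i < k \<and> \<phi> x i = 0} = j"
  using nc_cube_codim[OF assms] codim_unique by blast

section \<open>Segments and faces in a cube\<close>

abbreviation pt :: "'a set \<Rightarrow> ('a \<Rightarrow> nat \<Rightarrow> real) \<Rightarrow> (nat \<Rightarrow> real) \<Rightarrow> 'a" where
  "pt U \<phi> \<equiv> inv_into U \<phi>"

lemma pt_cube:
  assumes q: "nc_cube p k U \<phi> \<epsilon> J" and a: "a \<in> cube n \<epsilon>"
  shows "pt U \<phi> a \<in> U" "\<phi> (pt U \<phi> a) = a"
  using nc_cube_D(5)[OF q] a by (metis inv_into_into, metis f_inv_into_f)

lemma pt_phi:
  assumes q: "nc_cube p k U \<phi> \<epsilon> J" and x: "x \<in> U"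
  shows "pt U \<phi> (\<phi> x) = x"
  using nc_cube_D(12)[OF q] x by simp

lemma segment_in_cube:
  assumes q: "nc_cube p k U \<phi> \<epsilon> J" and "x \<in> U" "y \<in> U" "0 \<le> t" "t \<le> 1"
  shows "(\<lambda>i. (1 - t) * \<phi> x i + t * \<phi> y i) \<in> cube n \<epsilon>"
proof -
  note q' = nc_cube_D[OF q]
  show ?thesis
    using q'(14)[OF assms(2)] q'(14)[OF assms(3)] q'(15)[OF assms(2)] q'(15)[OF assms(3)] assms(4,5)
    by (auto simp: cube_def topspace_Euclidean_space intro!: abs_convex_less)
qed

lemma continuous_map_pt:
  assumes q: "nc_cube p k U \<phi> \<epsilon> J"
  shows "continuous_map (subtopology (Euclidean_space n) (cube n \<epsilon>)) (subtopology X U) (pt U \<phi>)"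
proof -
  note q' = nc_cube_D[OF q]
  have "homeomorphic_map (subtopology X U) (subtopology (Euclidean_space n) (\<phi> ` U)) \<phi>"
    by (rule smooth_charts_D(3)[OF M q'(1)])
  then obtain g where g: "homeomorphic_maps (subtopology X U) (subtopology (Euclidean_space n) (cube n \<epsilon>)) \<phi> g"
    using q'(5) by (auto simp: homeomorphic_map_maps)
  then have "continuous_map (subtopology (Euclidean_space n) (cube n \<epsilon>)) (subtopology X U) g"
    by (simp add: homeomorphic_maps_def)
  then show ?thesis
  proof (rule continuous_map_eq)
    fix a assume "a \<in> topspace (subtopology (Euclidean_space n) (cube n \<epsilon>))"
    then have a: "a \<in> cube n \<epsilon>" by auto
    then obtain x where x: "x \<in> U" "a = \<phi> x" using q'(5) by (metis imageE)
    then have "g a = x" using g q'(11) by (auto simp: homeomorphic_maps_def)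
    then show "g a = pt U \<phi> a" using pt_phi[OF q x(1)] x(2) by simp
  qed
qed

lemma segment_path:
  assumes q: "nc_cube p k U \<phi> \<epsilon> J" and xy: "x \<in> U" "y \<in> U"
    and R: "\<And>t. 0 \<le> t \<Longrightarrow> t \<le> 1 \<Longrightarrow> pt U \<phi> (\<lambda>i. (1 - t) * \<phi> x i + t * \<phi> y i) \<in> R"
  shows "path_component_of (subtopology X R) x y"
proof -
  note q' = nc_cube_D[OF q]
  let ?s = "\<lambda>t i. (1 - t) * \<phi> x i + t * \<phi> y i"
  have "continuous_map (top_of_set {0..1}) (Euclidean_space n) ?s"
    by (rule continuous_map_into_Euclidean)
      (use q'(14)[OF xy(1)] q'(14)[OF xy(2)] in \<open>auto simp: topspace_Euclidean_space intro!: continuous_intros\<close>)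
  then have "continuous_map (top_of_set {0..1}) (subtopology (Euclidean_space n) (cube n \<epsilon>)) ?s"
    using segment_in_cube[OF q xy] by (auto simp: continuous_map_in_subtopology)
  from continuous_map_compose[OF this continuous_map_pt[OF q]]
  have "continuous_map (top_of_set {0..1}) X (\<lambda>t. pt U \<phi> (?s t))"
    by (simp add: o_def continuous_map_in_subtopology)
  then have "pathin (subtopology X R) (\<lambda>t. pt U \<phi> (?s t))"
    using R by (auto simp: pathin_def continuous_map_in_subtopology)
  moreover have "pt U \<phi> (?s 0) = x" "pt U \<phi> (?s 1) = y"
    using pt_phi[OF q] xy by auto
  ultimately show ?thesis
    unfolding path_component_of_def by (intro exI[of _ "\<lambda>t. pt U \<phi> (?s t)"]) auto
qed

text \<open>The classes in a cube are the faces of its subdivision by the hyperplanes of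
  \<open>D'\<close>.\<close>

definition same_signs :: "nat \<Rightarrow> ('a \<Rightarrow> nat \<Rightarrow> real) \<Rightarrow> 'a \<Rightarrow> 'a \<Rightarrow> bool" where
  "same_signs k \<phi> x y \<longleftrightarrow> (\<forall>i<k. sgn (\<phi> x i) = sgn (\<phi> y i))"

text \<open>Says that \<open>B\<close> meets \<open>U\<close> in a union of faces.\<close>

definition saturated :: "nat \<Rightarrow> 'a set \<Rightarrow> ('a \<Rightarrow> nat \<Rightarrow> real) \<Rightarrow> 'a set \<Rightarrow> bool" where
  "saturated k U \<phi> B \<longleftrightarrow> (\<forall>x\<in>U. \<forall>y\<in>U. same_signs k \<phi> x y \<longrightarrow> x \<in> B \<longrightarrow> y \<in> B)"

lemma same_signs_zero_iff: "same_signs k \<phi> x y \<Longrightarrow> i < k \<Longrightarrow> \<phi> x i = 0 \<longleftrightarrow> \<phi> y i = 0"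
  unfolding same_signs_def by (metis sgn_0_0)

lemma same_signs_segment:
  assumes q: "nc_cube p k U \<phi> \<epsilon> J" and "x \<in> U" "y \<in> U" "0 \<le> t" "t \<le> 1" "same_signs k \<phi> x y"
  shows "pt U \<phi> (\<lambda>i. (1 - t) * \<phi> x i + t * \<phi> y i) \<in> U"
    "same_signs k \<phi> x (pt U \<phi> (\<lambda>i. (1 - t) * \<phi> x i + t * \<phi> y i))"
proof -
  note s = pt_cube[OF q segment_in_cube[OF q assms(2-5)]]
  show "pt U \<phi> (\<lambda>i. (1 - t) * \<phi> x i + t * \<phi> y i) \<in> U" by (rule s(1))
  show "same_signs k \<phi> x (pt U \<phi> (\<lambda>i. (1 - t) * \<phi> x i + t * \<phi> y i))"
    using assms(4-6) sgn_convex unfolding same_signs_def s(2) by metis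
qed

lemma saturated_segment:
  assumes q: "nc_cube p k U \<phi> \<epsilon> J" and B: "saturated k U \<phi> B" and xy: "x \<in> U" "y \<in> U" "same_signs k \<phi> x y" "x \<in> B"
  shows "path_component_of (subtopology X (U \<inter> B)) x y"
proof (rule segment_path[OF q xy(1,2)])
  fix t :: real assume t: "0 \<le> t" "t \<le> 1"
  show "pt U \<phi> (\<lambda>i. (1 - t) * \<phi> x i + t * \<phi> y i) \<in> U \<inter> B"
    using same_signs_segment[OF q xy(1,2) t xy(3)] B xy unfolding saturated_def by blast
qed

lemma codim_saturated:
  assumes q: "nc_cube p k U \<phi> \<epsilon> J"
  shows "saturated k U \<phi> (codim_locus n X A D' j)"
  unfolding saturated_def
proof (intro ballI impI)
  fix x y assume xy: "x \<in> U" "y \<in> U" "same_signs k \<phi> x y" "x \<in> codim_locus n X A D' j"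
  have "{i. i < k \<and> \<phi> x i = 0} = {i. i < k \<and> \<phi> y i = 0}"
    using same_signs_zero_iff[OF xy(3)] by blast
  then show "y \<in> codim_locus n X A D' j"
    using xy(4) unfolding codim_iff[OF q xy(1)] codim_iff[OF q xy(2)] by simp
qed

section \<open>Strata in a cube\<close>

lemma strataE:
  assumes "S \<in> strata n X A D'"
  obtains j where "j \<le> n" "S \<in> connected_components_of (subtopology X (codim_locus n X A D' j))"
  using assms by (auto simp: strata_def)

lemma strata_codim:
  assumes "S \<in> strata n X A D'"
  obtains j where "j \<le> n" "S \<subseteq> codim_locus n X A D' j"
  using assms by (elim strataE) (use connected_components_of_subset in fastforce)

lemma strata_facts:
  assumes "S \<in> strata n X A D'"
  shows "S \<subseteq> topspace X" "S \<noteq> {}" "connectedin X S"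
proof -
  obtain j where j: "S \<in> connected_components_of (subtopology X (codim_locus n X A D' j))"
    using assms by (elim strataE)
  show "S \<subseteq> topspace X" using connected_components_of_subset[OF j] by auto
  show "S \<noteq> {}" using j nonempty_connected_components_of by blast
  show "connectedin X S" using connectedin_connected_components_of[OF j] by (simp add: connectedin_subtopology)
qed

text \<open>A face is path connected and has constant codimension, so it lies in a single component
  of a codimension locus.\<close>

lemma strata_saturated:
  assumes q: "nc_cube p k U \<phi> \<epsilon> J" and S: "S \<in> strata n X A D'"
  shows "saturated k U \<phi> S"
  unfolding saturated_def
proof (intro ballI impI)
  fix x y assume xy: "x \<in> U" "y \<in> U" "same_signs k \<phi> x y" "x \<in> S"
  obtain j where j: "S \<in> connected_components_of (subtopology X (codim_locus n X A D' j))"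
    using S by (elim strataE)
  let ?C = "codim_locus n X A D' j"
  have "x \<in> ?C" using connected_components_of_subset[OF j] xy(4) by auto
  then have "path_component_of (subtopology X (U \<inter> ?C)) x y"
    by (rule saturated_segment[OF q codim_saturated[OF q] xy(1-3)])
  then have "path_component_of (subtopology X ?C) x y"
    by (rule path_component_of_mono[OF _ Int_lower2])
  then have "connected_component_of (subtopology X ?C) x y"
    by (rule path_imp_connected_component_of)
  moreover obtain a where "S = connected_component_of_set (subtopology X ?C) a"
    using j by (auto simp: connected_components_of_def)
  ultimately show "y \<in> S"
    using xy(4) connected_component_of_trans by (metis mem_Collect_eq)
qed

lemma compl_saturated:
  assumes q: "nc_cube p k U \<phi> \<epsilon> J"
  shows "saturated k U \<phi> (topspace X - D)"
  unfolding saturated_def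
proof (intro ballI impI)
  fix x y assume xy: "x \<in> U" "y \<in> U" "same_signs k \<phi> x y" "x \<in> topspace X - D"
  note q' = nc_cube_D[OF q]
  have "x \<in> D \<longleftrightarrow> y \<in> D"
    using q'(9)[OF xy(1)] q'(9)[OF xy(2)] q'(8) same_signs_zero_iff[OF xy(3)] by (metis lessThan_iff subsetD)
  then show "y \<in> topspace X - D" using xy q'(11) by blast
qed

text \<open>The codimension counts the vanishing crossing coordinates, so it equals \<open>k\<close>
  only where all of them vanish; and this slice is a single face, hence lies in the stratum of its
  centre.\<close>

lemma stratum_cube:
  assumes q: "nc_cube p k U \<phi> \<epsilon> J" and T: "T \<in> strata n X A D'" "p \<in> T"
  shows "T \<inter> U = {x \<in> U. \<forall>i<k. \<phi> x i = 0}"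
proof -
  note q' = nc_cube_D[OF q]
  obtain j where j: "T \<subseteq> codim_locus n X A D' j" using T(1) by (elim strata_codim)
  then have "p \<in> codim_locus n X A D' j" using T by blast
  then have jk: "j = k" using codim_iff[OF q q'(2)] q'(3) by simp
  have "\<forall>i<k. \<phi> x i = 0" if "x \<in> T" "x \<in> U" for x
  proof -
    have "card {i. i < k \<and> \<phi> x i = 0} = k"
      using codim_iff[OF q that(2)] that(1) j jk by blast
    then have "{i. i < k \<and> \<phi> x i = 0} = {..<k}"
      by (intro card_subset_eq) auto
    then show ?thesis by blast
  qed
  moreover have "x \<in> T" if "x \<in> U" "\<forall>i<k. \<phi> x i = 0" for x
  proof -
    have "same_signs k \<phi> p x" using that(2) by (simp add: same_signs_def q'(3))
    then show ?thesis
      using strata_saturated[OF q T(1)] that(1) T(2) q'(2) unfolding saturated_def by blast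
  qed
  ultimately show ?thesis by blast
qed

lemma strata_cover:
  assumes p: "p \<in> topspace X"
  shows "\<exists>S\<in>strata n X A D'. p \<in> S"
proof -
  obtain k U \<phi> \<epsilon> J where q: "nc_cube p k U \<phi> \<epsilon> J"
    using nc_cube_exists[OF p openin_topspace p] by blast
  note q' = nc_cube_D[OF q]
  have "p \<in> codim_locus n X A D' k"
    using codim_iff[OF q q'(2), of k] q'(3) by simp
  then have "p \<in> topspace (subtopology X (codim_locus n X A D' k))" using p by simp
  then obtain S where "S \<in> connected_components_of (subtopology X (codim_locus n X A D' k))" "p \<in> S"
    by (metis Union_connected_components_of UnionE)
  then show ?thesis using q'(6) by (auto simp: strata_def)
qed

lemma strata_disjoint:
  assumes S: "S \<in> strata n X A D'" "T \<in> strata n X A D'" and p: "p \<in> S" "p \<in> T"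
  shows "S = T"
proof -
  obtain i j where i: "S \<in> connected_components_of (subtopology X (codim_locus n X A D' i))"
    and j: "T \<in> connected_components_of (subtopology X (codim_locus n X A D' j))"
    using S by (elim strataE)
  have "p \<in> codim_locus n X A D' i" "p \<in> codim_locus n X A D' j"
    using connected_components_of_subset[OF i] connected_components_of_subset[OF j] p by auto
  then have "i = j" by (rule codim_unique)
  then show ?thesis
    using i j p connected_components_of_overlap[of S "subtopology X (codim_locus n X A D' j)" T] by blast
qed

text \<open>The bound \<open>1 \<le> k\<close> separates the two notions: at a point off
  \<open>D'\<close> there are cubes with \<open>k = 0\<close> but no normal crossing charts.\<close>

lemma nc_cube_small:
  assumes q: "nc_cube p k U \<phi> \<epsilon> J" "1 \<le> k"
  shows "small_nc_chart n X A D D' p U \<phi>"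
proof -
  have "D' \<inter> U = {x \<in> U. (\<Prod>i<k. \<phi> x i) = 0}"
    using q by (auto simp: nc_cube_def)
  then show ?thesis
    using q unfolding small_nc_chart_def nc_chart_def nc_cube_def cube_def by blast
qed

end

section \<open>Orthants and ends as coverings of strata\<close>

lemma path_comps_eq:
  "C \<in> path_components_of Y \<Longrightarrow> C' \<in> path_components_of Y \<Longrightarrow> x \<in> C \<Longrightarrow> x \<in> C' \<Longrightarrow> C = C'"
  using path_components_of_overlap[of C Y C'] by blast

lemma nbhds_of_iff: "U \<in> nbhds_of X p \<longleftrightarrow> openin X U \<and> p \<in> U"
  by (simp add: nbhds_of_def)

lemma lim_pi0_PiE:
  "c \<in> lim_pi0 X B p \<Longrightarrow> c \<in> (\<Pi>\<^sub>E U\<in>nbhds_of X p. path_components_of (subtopology X (U \<inter> B)))"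
  unfolding lim_pi0_def by (drule CollectD) (erule conjunct1)

lemma lim_pi0_stratum_PiE:
  "\<sigma> \<in> lim_pi0_stratum X B T \<Longrightarrow> \<sigma> \<in> (\<Pi>\<^sub>E p\<in>T. lim_pi0 X B p)"
  unfolding lim_pi0_stratum_def by (drule CollectD) (erule conjunct1)

lemma lim_pi0_comp:
  "c \<in> lim_pi0 X B p \<Longrightarrow> U \<in> nbhds_of X p \<Longrightarrow> c U \<in> path_components_of (subtopology X (U \<inter> B))"
  by (drule lim_pi0_PiE) (erule PiE_mem)

lemma lim_pi0_mono:
  "c \<in> lim_pi0 X B p \<Longrightarrow> U \<in> nbhds_of X p \<Longrightarrow> V \<in> nbhds_of X p \<Longrightarrow> U \<subseteq> V \<Longrightarrow> c U \<subseteq> c V"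
  unfolding lim_pi0_def by blast

lemma lim_pi0_nonempty:
  "c \<in> lim_pi0 X B p \<Longrightarrow> U \<in> nbhds_of X p \<Longrightarrow> c U \<noteq> {}"
  using lim_pi0_comp nonempty_path_components_of by metis

lemma lim_pi0_subset:
  "c \<in> lim_pi0 X B p \<Longrightarrow> U \<in> nbhds_of X p \<Longrightarrow> c U \<subseteq> U \<inter> B \<and> c U \<subseteq> topspace X"
  using path_components_of_subset[OF lim_pi0_comp, of c X B p U] by simp

lemma lim_pi0_ext:
  assumes "c \<in> lim_pi0 X B p" "c' \<in> lim_pi0 X B p" "\<And>U. U \<in> nbhds_of X p \<Longrightarrow> c U = c' U"
  shows "c = c'"
proof (rule PiE_ext)
  show "c \<in> (\<Pi>\<^sub>E U\<in>nbhds_of X p. path_components_of (subtopology X (U \<inter> B)))"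
    "c' \<in> (\<Pi>\<^sub>E U\<in>nbhds_of X p. path_components_of (subtopology X (U \<inter> B)))"
    by (rule lim_pi0_PiE[OF assms(1)], rule lim_pi0_PiE[OF assms(2)])
qed (rule assms(3))

lemma lim_pi0_agree:
  assumes "c \<in> lim_pi0 X B p" "c' \<in> lim_pi0 X B p'" "U \<in> nbhds_of X p" "U \<in> nbhds_of X p'" "x \<in> c U" "x \<in> c' U"
  shows "c U = c' U"
  using path_comps_eq[OF lim_pi0_comp[OF assms(1,3)] lim_pi0_comp[OF assms(2,4)] assms(5,6)] .

lemma lim_pi0_agree_mono:
  assumes "c \<in> lim_pi0 X B p" "c' \<in> lim_pi0 X B p'" "U \<in> nbhds_of X p" "U \<in> nbhds_of X p'"
    "V \<in> nbhds_of X p" "V \<in> nbhds_of X p'" "U \<subseteq> V" "c U = c' U"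
  shows "c V = c' V"
proof -
  obtain x where "x \<in> c U" using lim_pi0_nonempty[OF assms(1,3)] by blast
  moreover have "c U \<subseteq> c V" by (rule lim_pi0_mono[OF assms(1,3,5,7)])
  moreover have "c' U \<subseteq> c' V" by (rule lim_pi0_mono[OF assms(2,4,6,7)])
  ultimately show ?thesis
    using lim_pi0_agree[OF assms(1,2,5,6), of x] assms(8) by blast
qed

text \<open>The value on \<open>N\<close> is forced: \<open>c N\<close> is contained in
  \<open>c U \<inter> N\<close>, which is path connected, so the two coincide; and the value on
  \<open>N\<close> determines those on all larger neighbourhoods.\<close>

lemma lim_pi0_eval_inj:
  assumes U: "U \<in> nbhds_of X p"
    and N: "\<And>V. V \<in> nbhds_of X p \<Longrightarrow> \<exists>N\<in>nbhds_of X p. N \<subseteq> V \<and> N \<subseteq> U \<and>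
        (\<forall>C\<in>path_components_of (subtopology X (U \<inter> B)). path_connectedin X (C \<inter> N))"
  shows "inj_on (\<lambda>c. c U) (lim_pi0 X B p)"
proof (rule inj_onI)
  fix c c' assume c: "c \<in> lim_pi0 X B p" and c': "c' \<in> lim_pi0 X B p" and eq: "c U = c' U"
  show "c = c'"
  proof (rule lim_pi0_ext[OF c c'])
    fix V assume V: "V \<in> nbhds_of X p"
    obtain N where N: "N \<in> nbhds_of X p" "N \<subseteq> V" "N \<subseteq> U"
      and pc: "\<forall>C\<in>path_components_of (subtopology X (U \<inter> B)). path_connectedin X (C \<inter> N)"
      using N[OF V] by blast
    have eqN: "d N = d U \<inter> N" if d: "d \<in> lim_pi0 X B p" for d
    proof
      show sub: "d N \<subseteq> d U \<inter> N"
        using lim_pi0_mono[OF d N(1) U N(3)] lim_pi0_subset[OF d N(1)] by blast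
      have "path_connectedin X (d U \<inter> N)" using pc lim_pi0_comp[OF d U] by blast
      then have "path_connectedin (subtopology X (N \<inter> B)) (d U \<inter> N)"
        using lim_pi0_subset[OF d U] by (auto simp: path_connectedin_subtopology)
      moreover have "\<not> disjnt (d N) (d U \<inter> N)"
        using sub lim_pi0_nonempty[OF d N(1)] unfolding disjnt_def by blast
      ultimately show "d U \<inter> N \<subseteq> d N"
        using path_components_of_maximal lim_pi0_comp[OF d N(1)] by metis
    qed
    have "c N = c' N" using eqN[OF c] eqN[OF c'] eq by simp
    then show "c V = c' V"
      by (rule lim_pi0_agree_mono[OF c c' N(1,1) V V N(2)])
  qed
qed

text \<open>The germ sends \<open>V\<close> to the component that contains the part of
  \<open>C\<close> near \<open>p\<close>. This is well defined because the sets
  \<open>C \<inter> N\<close> are connected and any two of them meet.\<close>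

lemma lim_pi0_eval_surj:
  assumes U: "U \<in> nbhds_of X p"
    and N: "\<And>V. V \<in> nbhds_of X p \<Longrightarrow> \<exists>N\<in>nbhds_of X p. N \<subseteq> V \<and> N \<subseteq> U \<and> path_connectedin X (C \<inter> N)"
    and ne: "\<And>N. N \<in> nbhds_of X p \<Longrightarrow> C \<inter> N \<noteq> {}"
    and C: "C \<in> path_components_of (subtopology X (U \<inter> B))"
  shows "\<exists>c\<in>lim_pi0 X B p. c U = C"
proof -
  have CB: "C \<subseteq> U \<inter> B" "C \<subseteq> topspace X" using path_components_of_subset[OF C] by auto
  have "\<exists>K. K \<in> path_components_of (subtopology X (V \<inter> B)) \<and> (\<exists>N\<in>nbhds_of X p. N \<subseteq> V \<and> C \<inter> N \<subseteq> K)"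
    if V: "V \<in> nbhds_of X p" for V
  proof -
    obtain N where N: "N \<in> nbhds_of X p" "N \<subseteq> V" "N \<subseteq> U" "path_connectedin X (C \<inter> N)"
      using N[OF V] by blast
    have "path_connectedin (subtopology X (V \<inter> B)) (C \<inter> N)"
      using N CB by (auto simp: path_connectedin_subtopology)
    moreover have "topspace (subtopology X (V \<inter> B)) \<noteq> {}"
      using ne[OF N(1)] N(2) CB by auto
    ultimately obtain K where "K \<in> path_components_of (subtopology X (V \<inter> B))" "C \<inter> N \<subseteq> K"
      by (rule exists_path_component_of_superset) auto
    then show ?thesis using N by blast
  qed
  then obtain K where K: "\<And>V. V \<in> nbhds_of X p \<Longrightarrow> K V \<in> path_components_of (subtopology X (V \<inter> B))"
    "\<And>V. V \<in> nbhds_of X p \<Longrightarrow> \<exists>N\<in>nbhds_of X p. N \<subseteq> V \<and> C \<inter> N \<subseteq> K V"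
    by metis
  define c where "c = restrict K (nbhds_of X p)"
  have common: "C \<inter> K V \<inter> K W \<noteq> {}" if V: "V \<in> nbhds_of X p" and W: "W \<in> nbhds_of X p" for V W
  proof -
    obtain N1 N2 where N: "N1 \<in> nbhds_of X p" "C \<inter> N1 \<subseteq> K V" "N2 \<in> nbhds_of X p" "C \<inter> N2 \<subseteq> K W"
      using K(2)[OF V] K(2)[OF W] by blast
    then have "N1 \<inter> N2 \<in> nbhds_of X p" by (auto simp: nbhds_of_iff)
    then show ?thesis using ne[of "N1 \<inter> N2"] N by blast
  qed
  have "c \<in> lim_pi0 X B p"
    unfolding lim_pi0_def
  proof (intro CollectI conjI ballI impI)
    show "c \<in> (\<Pi>\<^sub>E U\<in>nbhds_of X p. path_components_of (subtopology X (U \<inter> B)))"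
      unfolding c_def using K(1) by auto
    fix V W assume V: "V \<in> nbhds_of X p" and W: "W \<in> nbhds_of X p" and sub: "V \<subseteq> W"
    have "path_connectedin X (K V)" "K V \<subseteq> V \<inter> B"
      using path_connectedin_path_components_of[OF K(1)[OF V]] path_components_of_subset[OF K(1)[OF V]]
      by (auto simp: path_connectedin_subtopology)
    then have "path_connectedin (subtopology X (W \<inter> B)) (K V)"
      using sub by (auto simp: path_connectedin_subtopology)
    moreover have "\<not> disjnt (K W) (K V)"
      using common[OF V W] unfolding disjnt_def by blast
    ultimately have "K V \<subseteq> K W"
      using path_components_of_maximal K(1)[OF W] by metis
    then show "c V \<subseteq> c W" using V W by (simp add: c_def)
  qed
  moreover have "c U = C"
    using path_comps_eq[OF K(1)[OF U] C] common[OF U U] U by (auto simp: c_def)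
  ultimately show ?thesis by blast
qed

text \<open>Locally constant sections over \<open>K\<close> of the family \<open>lim_pi0 X B\<close> pulled back along \<open>H\<close>.\<close>

definition lcs :: "'a topology \<Rightarrow> 'a set \<Rightarrow> 'x::topological_space set \<Rightarrow> ('x \<Rightarrow> 'a) \<Rightarrow> ('x \<Rightarrow> 'a set \<Rightarrow> 'a set) \<Rightarrow> bool" where
  "lcs X B K H c \<longleftrightarrow> (\<forall>y\<in>K. c y \<in> lim_pi0 X B (H y)) \<and>
     (\<forall>y\<in>K. \<forall>U\<in>nbhds_of X (H y). \<exists>S. open S \<and> y \<in> S \<and> (\<forall>y'\<in>S \<inter> K. H y' \<in> U \<and> c y' U = c y U))"

text \<open>Phrased with open sets over an arbitrary domain, locally constant families can be pulled
  back and glued, over squares as well as intervals.\<close>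

lemma transport_iff: "transport X B \<gamma> a b \<longleftrightarrow> (\<exists>c. c 0 = a \<and> c 1 = b \<and> lcs X B {0..1} \<gamma> c)"
proof -
  have *: "(\<forall>\<^sub>F s in at t within {0..1}. \<gamma> s \<in> U \<and> c s U = c t U) \<longleftrightarrow>
      (\<exists>S. open S \<and> t \<in> S \<and> (\<forall>y'\<in>S \<inter> {0..1}. \<gamma> y' \<in> U \<and> c y' U = c t U))"
    if "U \<in> nbhds_of X (\<gamma> t)" for t :: real and U c
    unfolding eventually_at_topological using that by (metis IntE IntI nbhds_of_iff)
  show ?thesis
    unfolding transport_def lcs_def by (intro ex_cong1 conj_cong ball_cong refl *)
qed

lemma lcs_lim: "lcs X B K H c \<Longrightarrow> y \<in> K \<Longrightarrow> c y \<in> lim_pi0 X B (H y)"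
  unfolding lcs_def by blast

lemma lcs_local:
  "lcs X B K H c \<Longrightarrow> y \<in> K \<Longrightarrow> U \<in> nbhds_of X (H y) \<Longrightarrow>
     \<exists>S. open S \<and> y \<in> S \<and> (\<forall>y'\<in>S \<inter> K. H y' \<in> U \<and> c y' U = c y U)"
  unfolding lcs_def by blast

lemma lcs_cong:
  assumes "lcs X B K H c" "\<And>y. y \<in> K \<Longrightarrow> H y = H' y" "\<And>y. y \<in> K \<Longrightarrow> c y = c' y"
  shows "lcs X B K H' c'"
  unfolding lcs_def
proof (intro conjI ballI)
  fix y assume y: "y \<in> K"
  show "c' y \<in> lim_pi0 X B (H' y)" using lcs_lim[OF assms(1) y] assms(2,3)[OF y] by simp
  fix U assume "U \<in> nbhds_of X (H' y)"
  then have "U \<in> nbhds_of X (H y)" using assms(2)[OF y] by simp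
  from lcs_local[OF assms(1) y this] obtain S where S: "open S" "y \<in> S" "\<forall>y'\<in>S \<inter> K. H y' \<in> U \<and> c y' U = c y U"
    by blast
  have "\<forall>y'\<in>S \<inter> K. H' y' \<in> U \<and> c' y' U = c' y U"
    using S(3) assms(2,3) y by (metis IntE)
  then show "\<exists>S. open S \<and> y \<in> S \<and> (\<forall>y'\<in>S \<inter> K. H' y' \<in> U \<and> c' y' U = c' y U)"
    using S(1,2) by blast
qed

lemma lcs_compose:
  assumes c: "lcs X B K H c" and f: "continuous_on K' f" "f ` K' \<subseteq> K"
  shows "lcs X B K' (\<lambda>y. H (f y)) (\<lambda>y. c (f y))"
  unfolding lcs_def
proof (intro conjI ballI)
  fix y assume y: "y \<in> K'"
  then have fy: "f y \<in> K" using f(2) by blast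
  show "c (f y) \<in> lim_pi0 X B (H (f y))" by (rule lcs_lim[OF c fy])
  fix U assume U: "U \<in> nbhds_of X (H (f y))"
  obtain S where S: "open S" "f y \<in> S" "\<forall>y'\<in>S \<inter> K. H y' \<in> U \<and> c y' U = c (f y) U"
    using lcs_local[OF c fy U] by blast
  obtain S' where S': "open S'" "y \<in> S'" "\<forall>z\<in>K'. z \<in> S' \<longrightarrow> f z \<in> S"
    using f(1)[unfolded continuous_on_topological] y S(1,2) by blast
  have "\<forall>y'\<in>S' \<inter> K'. H (f y') \<in> U \<and> c (f y') U = c (f y) U"
    using S'(3) S(3) f(2) by blast
  then show "\<exists>S. open S \<and> y \<in> S \<and> (\<forall>y'\<in>S \<inter> K'. H (f y') \<in> U \<and> c (f y') U = c (f y) U)"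
    using S'(1,2) by blast
qed

text \<open>The family of sets \<open>lim_pi0 X B p\<close>, \<open>p \<in> T\<close>, is a covering of \<open>T\<close>.\<close>

definition locally_trivial :: "'a topology \<Rightarrow> 'a set \<Rightarrow> 'a set \<Rightarrow> bool" where
  "locally_trivial X B T \<longleftrightarrow> T \<subseteq> topspace X \<and> (\<forall>p\<in>T. \<forall>V\<in>nbhds_of X p. \<exists>U\<in>nbhds_of X p. U \<subseteq> V \<and>
      (\<forall>p'\<in>U \<inter> T. bij_betw (\<lambda>c. c U) (lim_pi0 X B p') (path_components_of (subtopology X (U \<inter> B)))))"

lemma locally_trivialE:
  assumes "locally_trivial X B T" "p \<in> T" "V \<in> nbhds_of X p"
  obtains U where "U \<in> nbhds_of X p" "U \<subseteq> V"
    "\<forall>p'\<in>U \<inter> T. bij_betw (\<lambda>c. c U) (lim_pi0 X B p') (path_components_of (subtopology X (U \<inter> B)))"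
  using assms unfolding locally_trivial_def by blast

text \<open>Near each point both sections have constant values on a trivialising \<open>U\<close>,
  and evaluation on \<open>U\<close> is injective over \<open>T \<inter> U\<close>; so agreement is
  a locally constant condition.\<close>

lemma lcs_unique:
  assumes tr: "locally_trivial X B T" and HT: "\<And>y. y \<in> K \<Longrightarrow> H y \<in> T" and K: "connected K"
    and c: "lcs X B K H c" and c': "lcs X B K H c'" and y: "y0 \<in> K" "c y0 = c' y0" "y \<in> K"
  shows "c y = c' y"
proof -
  have "(c y0 = c' y0) = (c y = c' y)"
  proof (rule connected_local_const[OF K y(1,3)], intro ballI)
    fix a assume a: "a \<in> K"
    have top: "topspace X \<in> nbhds_of X (H a)"
      using HT[OF a] tr by (auto simp: nbhds_of_iff locally_trivial_def)
    obtain U where U1: "U \<in> nbhds_of X (H a)"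
      and U2: "\<forall>p'\<in>U \<inter> T. bij_betw (\<lambda>c. c U) (lim_pi0 X B p') (path_components_of (subtopology X (U \<inter> B)))"
      by (rule locally_trivialE[OF tr HT[OF a] top]) blast
    note U = U1 U2[THEN bspec, OF IntI]
    obtain S where S: "open S" "a \<in> S" "\<forall>y'\<in>S \<inter> K. H y' \<in> U \<and> c y' U = c a U"
      using lcs_local[OF c a U(1)] by blast
    obtain S' where S': "open S'" "a \<in> S'" "\<forall>y'\<in>S' \<inter> K. H y' \<in> U \<and> c' y' U = c' a U"
      using lcs_local[OF c' a U(1)] by blast
    have inj: "c z U = c' z U \<longleftrightarrow> c z = c' z" if "z \<in> S \<inter> K" for z
    proof -
      have "z \<in> K" "H z \<in> U" using that S(3) by blast+
      then have "inj_on (\<lambda>c. c U) (lim_pi0 X B (H z))"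
        using U(2)[OF _ HT] by (simp add: bij_betw_def)
      then show ?thesis
        using lcs_lim[OF c \<open>z \<in> K\<close>] lcs_lim[OF c' \<open>z \<in> K\<close>] by (metis inj_onD)
    qed
    have "(c a = c' a) = (c z = c' z)" if "z \<in> S \<inter> S'" "z \<in> K" for z
      using inj[of z] inj[of a] that S S' a by (metis IntE IntI)
    then show "\<forall>\<^sub>F b in at a within K. (c a = c' a) = (c b = c' b)"
      unfolding eventually_at_topological using S S' by (intro exI[of _ "S \<inter> S'"]) auto
  qed
  then show ?thesis using y(2) by simp
qed

section \<open>Sections over intervals and squares\<close>

definition has_sections :: "'a topology \<Rightarrow> 'a set \<Rightarrow> 'x::topological_space set \<Rightarrow> ('x \<Rightarrow> 'a) \<Rightarrow> bool" where
  "has_sections X B K H \<longleftrightarrow> (\<forall>y\<in>K. \<forall>a\<in>lim_pi0 X B (H y). \<exists>c. lcs X B K H c \<and> c y = a)"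

text \<open>At every point of \<open>K\<close> the section is the germ whose value on the
  trivialising \<open>U\<close> is \<open>a U\<close>.\<close>

lemma has_sections_local:
  assumes tr: "locally_trivial X B T" and H: "continuous_map (top_of_set K) (subtopology X T) H"
    and U: "\<And>p'. p' \<in> U \<Longrightarrow> p' \<in> T \<Longrightarrow> bij_betw (\<lambda>c. c U) (lim_pi0 X B p') (path_components_of (subtopology X (U \<inter> B)))"
      "openin X U" and HU: "H ` K \<subseteq> U"
  shows "has_sections X B K H"
  unfolding has_sections_def
proof (intro ballI)
  fix y a assume y: "y \<in> K" and a: "a \<in> lim_pi0 X B (H y)"
  have HT: "H z \<in> T" "H z \<in> U" if "z \<in> K" for z
    using continuous_map_image_subset_topspace[OF H] HU that by auto
  have nb: "U \<in> nbhds_of X (H z)" if "z \<in> K" for z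
    using HT that U(2) by (simp add: nbhds_of_iff)
  have C: "a U \<in> path_components_of (subtopology X (U \<inter> B))" by (rule lim_pi0_comp[OF a nb[OF y]])
  have "\<exists>c. c \<in> lim_pi0 X B (H z) \<and> c U = a U" if "z \<in> K" for z
  proof -
    have "a U \<in> (\<lambda>c. c U) ` lim_pi0 X B (H z)"
      using U(1)[OF HT(2)[OF that] HT(1)[OF that]] C by (simp add: bij_betw_def)
    then show ?thesis by blast
  qed
  then obtain c where c: "\<And>z. z \<in> K \<Longrightarrow> c z \<in> lim_pi0 X B (H z) \<and> c z U = a U" by metis
  have inj: "d = c z" if "z \<in> K" "d \<in> lim_pi0 X B (H z)" "d U = a U" for d z
    using U(1)[OF HT(2)[OF that(1)] HT(1)[OF that(1)]] c[OF that(1)] that(2,3) by (metis bij_betw_def inj_onD)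
  have "lcs X B K H c"
    unfolding lcs_def
  proof (intro conjI ballI)
    fix z assume z: "z \<in> K"
    show "c z \<in> lim_pi0 X B (H z)" using c[OF z] by blast
    fix V assume V: "V \<in> nbhds_of X (H z)"
    then have UV: "U \<inter> V \<in> nbhds_of X (H z)" using nb[OF z] by (auto simp: nbhds_of_iff)
    \<comment> \<open>Constancy is required on every \<open>V\<close>, not only on \<open>U\<close>.
      The germ at a nearby point with the same value on the trivialising \<open>W\<close> has value
      \<open>a U\<close> on \<open>U\<close>, so it is the chosen one; being equal on
      \<open>W\<close>, the values agree on \<open>V\<close> too.\<close>
    obtain W where W1: "W \<in> nbhds_of X (H z)" "W \<subseteq> U \<inter> V"
      and W2: "\<forall>p'\<in>W \<inter> T. bij_betw (\<lambda>c. c W) (lim_pi0 X B p') (path_components_of (subtopology X (W \<inter> B)))"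
      by (rule locally_trivialE[OF tr HT(1)[OF z] UV]) blast
    note W = W1 W2[THEN bspec, OF IntI]
    have "openin X W" using W(1) by (simp add: nbhds_of_iff)
    then have "openin (top_of_set K) {y \<in> K. H y \<in> W}"
      using openin_continuous_map_preimage[of "top_of_set K" X H W] H by (simp add: continuous_map_in_subtopology)
    then obtain S where S: "open S" "{y \<in> K. H y \<in> W} = K \<inter> S" by (auto simp: openin_open)
    have zS: "z \<in> S" using S(2) z W(1) by (auto simp: nbhds_of_iff)
    have "H z' \<in> V \<and> c z' V = c z V" if z': "z' \<in> S \<inter> K" for z'
    proof -
      have z'K: "z' \<in> K" and HW: "H z' \<in> W" using z' S(2) by blast+
      have W': "W \<in> nbhds_of X (H z')" using W(1) HW by (simp add: nbhds_of_iff)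
      have "c z W \<in> path_components_of (subtopology X (W \<inter> B))"
        by (rule lim_pi0_comp[OF conjunct1[OF c[OF z]] W(1)])
      then have "c z W \<in> (\<lambda>c. c W) ` lim_pi0 X B (H z')"
        using W(3)[OF HW HT(1)[OF z'K]] by (simp add: bij_betw_def)
      then obtain d where d: "d \<in> lim_pi0 X B (H z')" "d W = c z W" by auto
      have cz: "c z \<in> lim_pi0 X B (H z)" using c[OF z] by blast
      have "d U = c z U"
        by (rule lim_pi0_agree_mono[OF d(1) cz W' W(1) nb[OF z'K] nb[OF z] _ d(2)]) (use W(2) in blast)
      then have "d = c z'" using inj[OF z'K d(1)] c[OF z] by simp
      moreover have V': "V \<in> nbhds_of X (H z')" using V HW W(2) by (auto simp: nbhds_of_iff)
      moreover have "d V = c z V"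
        by (rule lim_pi0_agree_mono[OF d(1) cz W' W(1) V' V _ d(2)]) (use W(2) in blast)
      ultimately show ?thesis by (simp add: nbhds_of_iff)
    qed
    then show "\<exists>S. open S \<and> z \<in> S \<and> (\<forall>y'\<in>S \<inter> K. H y' \<in> V \<and> c y' V = c z V)"
      using S(1) zS by blast
  qed
  moreover have "c y = a" using inj[OF y a] by simp
  ultimately show "\<exists>c. lcs X B K H c \<and> c y = a" by blast
qed

lemma lcs_glue:
  assumes cl: "closed K1" "closed K2" and c1: "lcs X B K1 H c1" and c2: "lcs X B K2 H c2"
    and agree: "\<And>y. y \<in> K1 \<inter> K2 \<Longrightarrow> c1 y = c2 y"
  shows "lcs X B (K1 \<union> K2) H (\<lambda>y. if y \<in> K1 then c1 y else c2 y)"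
  unfolding lcs_def
proof (intro conjI ballI)
  let ?c = "\<lambda>y. if y \<in> K1 then c1 y else c2 y"
  have e1: "?c y = c1 y" if "y \<in> K1" for y using that by simp
  have e2: "?c y = c2 y" if "y \<in> K2" for y using that agree by simp
  fix y assume y: "y \<in> K1 \<union> K2"
  show "?c y \<in> lim_pi0 X B (H y)"
    using y lcs_lim[OF c1] lcs_lim[OF c2] by auto
  fix U assume U: "U \<in> nbhds_of X (H y)"
  have loc: "\<exists>S. open S \<and> y \<in> S \<and> (\<forall>y'\<in>S \<inter> K. H y' \<in> U \<and> ?c y' U = ?c y U)"
    if K: "closed K" "lcs X B K H d" "\<And>z. z \<in> K \<Longrightarrow> ?c z = d z" for K d
  proof (cases "y \<in> K")
    case True
    then obtain S where S: "open S" "y \<in> S" "\<forall>y'\<in>S \<inter> K. H y' \<in> U \<and> d y' U = d y U"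
      using lcs_local[OF K(2) True U] by blast
    have "H y' \<in> U \<and> ?c y' U = ?c y U" if y': "y' \<in> S \<inter> K" for y'
    proof -
      have e: "?c y' = d y'" by (rule K(3)) (use y' in blast)
      have e': "?c y = d y" by (rule K(3)[OF True])
      show ?thesis unfolding e e' by (rule bspec[OF S(3) y'])
    qed
    then show ?thesis using S(1,2) by blast
  next
    case False
    then show ?thesis using K(1) by (intro exI[of _ "- K"]) auto
  qed
  obtain S1 where S1: "open S1" "y \<in> S1" "\<forall>y'\<in>S1 \<inter> K1. H y' \<in> U \<and> ?c y' U = ?c y U"
    using loc[OF cl(1) c1 e1] by blast
  obtain S2 where S2: "open S2" "y \<in> S2" "\<forall>y'\<in>S2 \<inter> K2. H y' \<in> U \<and> ?c y' U = ?c y U"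
    using loc[OF cl(2) c2 e2] by blast
  show "\<exists>S. open S \<and> y \<in> S \<and> (\<forall>y'\<in>S \<inter> (K1 \<union> K2). H y' \<in> U \<and> ?c y' U = ?c y U)"
    using S1 S2 by (intro exI[of _ "S1 \<inter> S2"]) blast
qed

text \<open>Over the connected overlap two sections that agree at one point agree throughout, so
  they glue.\<close>

lemma has_sections_Un:
  assumes tr: "locally_trivial X B T" and HT: "\<And>y. y \<in> K1 \<union> K2 \<Longrightarrow> H y \<in> T"
    and K: "closed K1" "closed K2" "connected (K1 \<inter> K2)" "K1 \<inter> K2 \<noteq> {}"
    and s: "has_sections X B K1 H" "has_sections X B K2 H"
  shows "has_sections X B (K1 \<union> K2) H"
proof -
  have half: "\<exists>c. lcs X B (L1 \<union> L2) H c \<and> c y = a"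
    if L: "closed L1" "closed L2" "connected (L1 \<inter> L2)" "L1 \<inter> L2 \<noteq> {}" and HL: "\<And>y. y \<in> L1 \<union> L2 \<Longrightarrow> H y \<in> T"
      and s: "has_sections X B L1 H" "has_sections X B L2 H"
      and y: "y \<in> L1" "a \<in> lim_pi0 X B (H y)" for L1 L2 y a
  proof -
    obtain c1 where c1: "lcs X B L1 H c1" "c1 y = a"
      using s(1) y unfolding has_sections_def by blast
    obtain z where z: "z \<in> L1" "z \<in> L2" using L(4) by blast
    obtain c2 where c2: "lcs X B L2 H c2" "c2 z = c1 z"
      using s(2) z lcs_lim[OF c1(1) z(1)] unfolding has_sections_def by blast
    have c1': "lcs X B (L1 \<inter> L2) H c1"
      using lcs_compose[OF c1(1), of "L1 \<inter> L2" id] by (simp add: continuous_on_id)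
    have c2': "lcs X B (L1 \<inter> L2) H c2"
      using lcs_compose[OF c2(1), of "L1 \<inter> L2" id] by (simp add: continuous_on_id)
    have "c1 w = c2 w" if "w \<in> L1 \<inter> L2" for w
      by (rule lcs_unique[OF tr _ L(3) c1' c2' _ _ that, of z]) (use HL z c2(2) in auto)
    from lcs_glue[OF L(1,2) c1(1) c2(1) this]
    show ?thesis using y(1) c1(2) by (intro exI[of _ "\<lambda>y. if y \<in> L1 then c1 y else c2 y"]) simp
  qed
  show ?thesis
    unfolding has_sections_def
  proof (intro ballI)
    fix y a assume y: "y \<in> K1 \<union> K2" and a: "a \<in> lim_pi0 X B (H y)"
    show "\<exists>c. lcs X B (K1 \<union> K2) H c \<and> c y = a"
    proof (cases "y \<in> K1")
      case True
      show ?thesis by (rule half[OF K HT s True a])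
    next
      case False
      then have y2: "y \<in> K2" using y by blast
      have "connected (K2 \<inter> K1)" "K2 \<inter> K1 \<noteq> {}" using K(3,4) by (simp_all add: Int_commute)
      from half[OF K(2,1) this _ s(2,1) y2 a] HT show ?thesis
        by (simp add: Un_commute)
    qed
  qed
qed

lemma has_sections_square:
  fixes H :: "real \<times> real \<Rightarrow> 'a"
  assumes tr: "locally_trivial X B T" and H: "continuous_map (top_of_set ({0..1} \<times> {0..1})) (subtopology X T) H"
  shows "has_sections X B ({0..1} \<times> {0..1}) H"
proof -
  let ?Q = "{0..1} \<times> {0..1} :: (real \<times> real) set"
  have HT: "H y \<in> T" if "y \<in> ?Q" for y
    using continuous_map_image_subset_topspace[OF H] that by auto
  have HX: "continuous_map (top_of_set ?Q) X H" using H by (simp add: continuous_map_in_subtopology)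
  \<comment> \<open>Open sets with sections over all of their subsets in the square; a Lebesgue
    number of this cover bounds the mesh of a grid.\<close>
  define good where "good = {G. open G \<and> (\<forall>K. K \<subseteq> G \<inter> ?Q \<longrightarrow> has_sections X B K H)}"
  have "\<exists>G\<in>good. y \<in> G" if y: "y \<in> ?Q" for y
  proof -
    have top: "topspace X \<in> nbhds_of X (H y)"
      using HT[OF y] tr by (auto simp: nbhds_of_iff locally_trivial_def)
    obtain U where U1: "U \<in> nbhds_of X (H y)"
      and U2: "\<forall>p'\<in>U \<inter> T. bij_betw (\<lambda>c. c U) (lim_pi0 X B p') (path_components_of (subtopology X (U \<inter> B)))"
      by (rule locally_trivialE[OF tr HT[OF y] top]) blast
    note U = U1 U2[THEN bspec, OF IntI]
    have oU: "openin X U" using U(1) by (simp add: nbhds_of_iff)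
    have "openin (top_of_set ?Q) {z \<in> ?Q. H z \<in> U}"
      using openin_continuous_map_preimage[OF HX oU] by simp
    then obtain G where G: "open G" "{z \<in> ?Q. H z \<in> U} = ?Q \<inter> G" by (auto simp: openin_open)
    have "has_sections X B K H" if K: "K \<subseteq> G \<inter> ?Q" for K
    proof (rule has_sections_local[OF tr _ U(2) oU])
      show "continuous_map (top_of_set K) (subtopology X T) H"
        using H K by (metis continuous_map_from_subtopology_mono le_inf_iff)
      show "H ` K \<subseteq> U" using K G(2) by blast
    qed
    then have "G \<in> good" using G(1) by (simp add: good_def)
    moreover have "y \<in> G" using G(2) y U(1) by (auto simp: nbhds_of_iff)
    ultimately show ?thesis by blast
  qed
  then have cover: "?Q \<subseteq> \<Union>good" by blast
  have cpt: "compact ?Q" by (intro compact_Times) auto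
  have "\<exists>e>0. \<forall>x\<in>?Q. \<exists>G\<in>good. ball x e \<subseteq> G"
  proof (rule Heine_Borel_lemma[OF cpt cover])
    show "open G" if "G \<in> good" for G using that by (simp add: good_def)
    fix \<epsilon> :: real assume "0 < \<epsilon>" and h: "\<And>x. x \<in> ?Q \<Longrightarrow> \<exists>G\<in>good. ball x \<epsilon> \<subseteq> G"
    show "\<exists>e>0. \<forall>x\<in>?Q. \<exists>G\<in>good. ball x e \<subseteq> G"
      by (intro exI[of _ \<epsilon>] conjI ballI h \<open>0 < \<epsilon>\<close>)
  qed
  then obtain e where e: "e > 0" "\<forall>x\<in>?Q. \<exists>G\<in>good. ball x e \<subseteq> G"
    by blast
  have cell: "has_sections X B K H" if K: "K \<subseteq> ball x e \<inter> ?Q" and x: "x \<in> ?Q" for K x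
  proof -
    obtain G where "G \<in> good" "ball x e \<subseteq> G" using bspec[OF e(2) x] by blast
    then show ?thesis using K unfolding good_def by blast
  qed
  \<comment> \<open>Two points of a cell of side \<open>1 / N\<close> have distance at most
    \<open>2 / N\<close>.\<close>
  obtain N :: nat where N: "N > 0" "2 / real N < e"
  proof -
    obtain N :: nat where "real N > 2 / e" using reals_Archimedean2 by blast
    then have "2 < e * real N" using e(1) by (simp add: field_simps)
    moreover have "N > 0" using \<open>real N > 2 / e\<close> e(1) by (cases N) (auto simp: field_simps)
    ultimately show ?thesis using that[of N] by (simp add: field_simps)
  qed
  let ?d = "1 / real N"
  have dpos: "?d > 0" using N by simp
  have small: "{a..b} \<times> {u..v} \<subseteq> ball (a, u) e" if "b \<le> a + ?d" "v \<le> u + ?d" for a b u v :: real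
  proof
    fix z assume z: "z \<in> {a..b} \<times> {u..v}"
    have "dist (a, u) z \<le> dist a (fst z) + dist u (snd z)"
      by (metis dist_Pair_Pair prod.collapse sqrt_sum_squares_le_sum zero_le_dist)
    also have "\<dots> \<le> ?d + ?d" using z that by (auto simp: dist_real_def)
    also have "\<dots> < e" using N(2) by (simp add: field_simps)
    finally show "z \<in> ball (a, u) e" by simp
  qed
  \<comment> \<open>Cells are glued along vertical edges into rows, and below rows along horizontal
    edges; each overlap is a segment and therefore connected.\<close>
  have row: "has_sections X B ({0..real i * ?d} \<times> {u..v}) H"
    if "i \<le> N" "0 \<le> u" "u \<le> v" "v \<le> 1" "v \<le> u + ?d" for i u v
    using that(1)
  proof (induction i)
    case 0
    have "{0..0} \<times> {u..v} \<subseteq> ball (0, u) e \<inter> ?Q"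
      using small[of 0 0 v u] dpos that by auto
    then have "has_sections X B ({0..0} \<times> {u..v}) H" by (rule cell) (use that in auto)
    then show ?case by simp
  next
    case (Suc i)
    have le: "real i * ?d \<le> real (Suc i) * ?d" "real (Suc i) * ?d \<le> 1"
      using Suc.prems N(1) by (auto simp: field_simps)
    have nn: "0 \<le> real i * ?d" by simp
    have "{real i * ?d..real (Suc i) * ?d} \<times> {u..v} \<subseteq> ball (real i * ?d, u) e \<inter> ?Q"
    proof -
      have "{real i * ?d..real (Suc i) * ?d} \<times> {u..v} \<subseteq> ball (real i * ?d, u) e"
        by (rule small) (use \<open>v \<le> u + ?d\<close> in \<open>auto simp: add_divide_distrib\<close>)
      moreover have "{real i * ?d..real (Suc i) * ?d} \<subseteq> {0..1}" using le nn by auto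
      moreover have "{u..v} \<subseteq> {0..1}" using that by auto
      ultimately show ?thesis by blast
    qed
    then have s2: "has_sections X B ({real i * ?d..real (Suc i) * ?d} \<times> {u..v}) H"
      by (rule cell) (use that le nn in auto)
    have un: "{0..real i * ?d} \<times> {u..v} \<union> {real i * ?d..real (Suc i) * ?d} \<times> {u..v} = {0..real (Suc i) * ?d} \<times> {u..v}"
      by (simp only: Sigma_Un_distrib1[symmetric] ivl_disj_un_two_touch(4)[OF nn le(1)])
    have int: "({0..real i * ?d} \<times> {u..v}) \<inter> ({real i * ?d..real (Suc i) * ?d} \<times> {u..v}) = {real i * ?d} \<times> {u..v}"
      using le nn by auto
    have "has_sections X B ({0..real i * ?d} \<times> {u..v} \<union> {real i * ?d..real (Suc i) * ?d} \<times> {u..v}) H"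
    proof (rule has_sections_Un[OF tr])
      show "H y \<in> T" if "y \<in> {0..real i * ?d} \<times> {u..v} \<union> {real i * ?d..real (Suc i) * ?d} \<times> {u..v}" for y
      proof (rule HT)
        have "{0..real (Suc i) * ?d} \<subseteq> {0..1}" "{u..v} \<subseteq> {0..1}" using le \<open>0 \<le> u\<close> \<open>v \<le> 1\<close> by auto
        then show "y \<in> ?Q" using that unfolding un by blast
      qed
      show "connected (({0..real i * ?d} \<times> {u..v}) \<inter> ({real i * ?d..real (Suc i) * ?d} \<times> {u..v}))"
        unfolding int by (intro connected_Times connected_sing connected_Icc)
      show "({0..real i * ?d} \<times> {u..v}) \<inter> ({real i * ?d..real (Suc i) * ?d} \<times> {u..v}) \<noteq> {}"
        unfolding int using \<open>u \<le> v\<close> by auto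
      show "has_sections X B ({0..real i * ?d} \<times> {u..v}) H" using Suc by simp
    qed (use s2 in \<open>auto intro!: closed_Times\<close>)
    then show ?case unfolding un .
  qed
  have full: "real N * ?d = 1" using N(1) by simp
  have "has_sections X B ({0..1} \<times> {0..real j * ?d}) H" if "j \<le> N" for j
    using that
  proof (induction j)
    case 0
    show ?case using row[of N 0 0] dpos full by simp
  next
    case (Suc j)
    have le: "real j * ?d \<le> real (Suc j) * ?d" "real (Suc j) * ?d \<le> 1"
      using Suc.prems N(1) by (auto simp: field_simps)
    have nn: "0 \<le> real j * ?d" by simp
    have s2: "has_sections X B ({0..1} \<times> {real j * ?d..real (Suc j) * ?d}) H"
    proof -
      have "real (Suc j) * ?d \<le> real j * ?d + ?d" by (simp add: add_divide_distrib)
      from row[OF order_refl nn le this] show ?thesis unfolding full .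
    qed
    have un: "{0..1} \<times> {0..real j * ?d} \<union> {0..1} \<times> {real j * ?d..real (Suc j) * ?d} = {0..1::real} \<times> {0..real (Suc j) * ?d}"
      by (simp only: Sigma_Un_distrib2[symmetric] ivl_disj_un_two_touch(4)[OF nn le(1)])
    have int: "({0..1} \<times> {0..real j * ?d}) \<inter> ({0..1} \<times> {real j * ?d..real (Suc j) * ?d}) = {0..1::real} \<times> {real j * ?d}"
      using le nn by auto
    have "has_sections X B ({0..1} \<times> {0..real j * ?d} \<union> {0..1} \<times> {real j * ?d..real (Suc j) * ?d}) H"
    proof (rule has_sections_Un[OF tr])
      show "H y \<in> T" if "y \<in> {0..1} \<times> {0..real j * ?d} \<union> {0..1} \<times> {real j * ?d..real (Suc j) * ?d}" for y
      proof (rule HT)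
        have "{0..real (Suc j) * ?d} \<subseteq> {0..1}" using le by auto
        then show "y \<in> ?Q" using that unfolding un by blast
      qed
      show "connected (({0..1} \<times> {0..real j * ?d}) \<inter> ({0..1::real} \<times> {real j * ?d..real (Suc j) * ?d}))"
        unfolding int by (intro connected_Times connected_sing connected_Icc)
      show "({0..1} \<times> {0..real j * ?d}) \<inter> ({0..1::real} \<times> {real j * ?d..real (Suc j) * ?d}) \<noteq> {}"
        unfolding int by auto
      show "has_sections X B ({0..1} \<times> {0..real j * ?d}) H" using Suc by simp
    qed (use s2 in \<open>auto intro!: closed_Times\<close>)
    then show ?case unfolding un .
  qed
  from this[of N] show ?thesis using full by simp
qed

section \<open>Monodromy and global sections\<close>

lemma path_section_exists:
  assumes tr: "locally_trivial X B T" and g: "pathin (subtopology X T) \<gamma>" and a: "a \<in> lim_pi0 X B (\<gamma> 0)"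
  shows "\<exists>c. lcs X B {0..1} \<gamma> c \<and> c 0 = a"
proof -
  \<comment> \<open>The path as a map on the square that ignores the first coordinate.\<close>
  let ?H = "\<lambda>z::real \<times> real. \<gamma> (snd z)"
  have "continuous_map (top_of_set ({0..1} \<times> {0..1})) (top_of_set {0..1}) (snd :: real \<times> real \<Rightarrow> real)"
    by (auto intro!: continuous_intros)
  from continuous_map_compose[OF this] g
  have "continuous_map (top_of_set ({0..1} \<times> {0..1})) (subtopology X T) ?H"
    by (simp add: pathin_def o_def)
  from has_sections_square[OF tr this]
  obtain c where c: "lcs X B ({0..1} \<times> {0..1}) ?H c" "c (0, 0) = a"
    using a unfolding has_sections_def by force
  have "lcs X B {0..1} (\<lambda>t. ?H (0, t)) (\<lambda>t. c (0, t))"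
    by (rule lcs_compose[OF c(1)]) (auto intro!: continuous_intros)
  then show ?thesis using c(2) by auto
qed

lemma pathin_join:
  assumes g: "pathin Y g" and h: "pathin Y h" and gh: "g 1 = h 0"
  shows "pathin Y (\<lambda>t. if t \<le> 1 / 2 then g (2 * t) else h (2 * t - 1))"
  unfolding pathin_def
proof (rule continuous_map_cases_le[where p = "\<lambda>t. t" and q = "\<lambda>_. 1/2"])
  show "continuous_map (top_of_set {0..1}) euclideanreal (\<lambda>t. t)" by simp
  show "continuous_map (top_of_set {0..1}) euclideanreal (\<lambda>_. 1/2)" by simp
  have 1: "continuous_map (top_of_set {0..1::real}) Y g" "continuous_map (top_of_set {0..1}) Y h"
    using g h by (simp_all add: pathin_def)
  have "continuous_map (subtopology (top_of_set {0..1}) {x \<in> topspace (top_of_set {0..1}). x \<le> 1 / 2})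
     (top_of_set {0..1::real}) (\<lambda>t. 2 * t)"
    by (auto simp: continuous_map_in_subtopology subtopology_subtopology intro!: continuous_intros)
  from continuous_map_compose[OF this 1(1)]
  show "continuous_map (subtopology (top_of_set {0..1}) {x \<in> topspace (top_of_set {0..1}). x \<le> 1 / 2}) Y (\<lambda>t. g (2 * t))"
    by (simp add: o_def)
  have "continuous_map (subtopology (top_of_set {0..1}) {x \<in> topspace (top_of_set {0..1}). 1 / 2 \<le> x})
     (top_of_set {0..1::real}) (\<lambda>t. 2 * t - 1)"
    by (auto simp: continuous_map_in_subtopology subtopology_subtopology intro!: continuous_intros)
  from continuous_map_compose[OF this 1(2)]
  show "continuous_map (subtopology (top_of_set {0..1}) {x \<in> topspace (top_of_set {0..1}). 1 / 2 \<le> x}) Y (\<lambda>t. h (2 * t - 1))"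
    by (simp add: o_def)
  show "g (2 * t) = h (2 * t - 1)" if "t = 1 / 2" for t
    using gh by (simp add: that)
qed

lemma pathin_rev:
  assumes h: "pathin Y h"
  shows "pathin Y (\<lambda>t. h (1 - t))"
proof -
  have "continuous_map (top_of_set {0..1}) (top_of_set {0..1::real}) (\<lambda>t. 1 - t)"
    by (auto intro!: continuous_intros)
  from continuous_map_compose[OF this] h show ?thesis
    by (simp add: pathin_def o_def)
qed

lemma pathin_T: "pathin (subtopology X T) \<gamma> \<Longrightarrow> t \<in> {0..1} \<Longrightarrow> \<gamma> t \<in> T"
  unfolding pathin_def by (drule continuous_map_image_subset_topspace) auto

text \<open>Take a section over the square of a free homotopy from \<open>g\<close> to a constant
  loop. It is constant over the constant edge. The other two edges carry the same path, since all
  intermediate curves are loops; so uniqueness carries the equality of the end values along them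
  back to the edge of \<open>g\<close>.\<close>

lemma trivial_monodromy:
  assumes tr: "locally_trivial X B T" and sc: "simply_connected_space (subtopology X T)"
    and g: "pathin (subtopology X T) g" "g 1 = g 0" and c: "lcs X B {0..1} g c"
  shows "c 1 = c 0"
proof -
  have g0: "g 0 \<in> T" "g 0 \<in> topspace X" using pathin_T[OF g(1), of 0] tr by (auto simp: locally_trivial_def)
  have "pathin (subtopology X T) (\<lambda>_. g 0)" using g0 by (simp add: pathin_def)
  with sc g have "homotopic_with (\<lambda>r. r 1 = r 0) (top_of_set {0..1}) (subtopology X T) g (\<lambda>_. g 0)"
    by (simp add: simply_connected_space_def)
  then obtain H where H: "continuous_map (prod_topology (top_of_set {0..1::real}) (top_of_set {0..1::real})) (subtopology X T) H"
    "\<And>x. H (0, x) = g x" "\<And>x. H (1, x) = g 0" "\<And>t. t \<in> {0..1} \<Longrightarrow> H (t, 1) = H (t, 0)"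
    by (auto simp: homotopic_with_def)
  have H1: "continuous_map (top_of_set ({0..1} \<times> {0..1})) (subtopology X T) H"
    using H(1) by (simp add: prod_topology_subtopology_eu)
  have HT: "H y \<in> T" if "y \<in> {0..1} \<times> {0..1}" for y
    using continuous_map_image_subset_topspace[OF H1] that by auto
  have c0: "c 0 \<in> lim_pi0 X B (H (0, 0))" using lcs_lim[OF c, of 0] H(2) by simp
  obtain C where C: "lcs X B ({0..1} \<times> {0..1}) H C" "C (0, 0) = c 0"
    using has_sections_square[OF tr H1] c0 unfolding has_sections_def by force
  have conn: "connected {0..1::real}" by simp
  have l0: "lcs X B {0..1} (\<lambda>t. H (0, t)) (\<lambda>t. C (0, t))"
    by (rule lcs_compose[OF C(1)]) (auto intro!: continuous_intros)
  then have l0': "lcs X B {0..1} g (\<lambda>t. C (0, t))" using H(2) by simp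
  have "c 1 = C (0, 1)"
    by (rule lcs_unique[OF tr _ conn c l0', of 0]) (use pathin_T[OF g(1)] C(2) in auto)
  also have "\<dots> = C (0, 0)"
  proof -
    have r: "lcs X B {0..1} (\<lambda>t. g 0) (\<lambda>t. C (1, t))"
    proof -
      have "lcs X B {0..1} (\<lambda>t. H (1, t)) (\<lambda>t. C (1, t))"
        by (rule lcs_compose[OF C(1)]) (auto intro!: continuous_intros)
      then show ?thesis using H(3) by simp
    qed
    have r0: "C (1, 0) \<in> lim_pi0 X B (g 0)" using lcs_lim[OF r, of 0] by simp
    have "lcs X B {0..1::real} (\<lambda>t. g 0) (\<lambda>t. C (1, 0))"
      unfolding lcs_def using r0 by (auto simp: nbhds_of_iff intro: exI[of _ UNIV])
    from lcs_unique[OF tr _ conn this r, of 0 1] g0 have e: "C (1, 0) = C (1, 1)" by simp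
    have s0: "lcs X B {0..1} (\<lambda>t. H (t, 0)) (\<lambda>t. C (t, 0))"
      by (rule lcs_compose[OF C(1)]) (auto intro!: continuous_intros)
    have s1: "lcs X B {0..1} (\<lambda>t. H (t, 1)) (\<lambda>t. C (t, 1))"
      by (rule lcs_compose[OF C(1)]) (auto intro!: continuous_intros)
    have s1': "lcs X B {0..1} (\<lambda>t. H (t, 0)) (\<lambda>t. C (t, 1))"
      by (rule lcs_cong[OF s1]) (use H(4) in auto)
    have "C (0, 0) = C (0, 1)"
      by (rule lcs_unique[OF tr _ conn s0 s1', of 1]) (use HT e in auto)
    then show ?thesis by simp
  qed
  finally show ?thesis using C(2) by simp
qed

lemma lim_pi0_stratum_at: "\<sigma> \<in> lim_pi0_stratum X B T \<Longrightarrow> p \<in> T \<Longrightarrow> \<sigma> p \<in> lim_pi0 X B p"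
  by (drule lim_pi0_stratum_PiE) (erule PiE_mem)

lemma lim_pi0_stratum_transport:
  "\<sigma> \<in> lim_pi0_stratum X B T \<Longrightarrow> pathin (subtopology X T) \<gamma> \<Longrightarrow> transport X B \<gamma> (\<sigma> (\<gamma> 0)) (\<sigma> (\<gamma> 1))"
  unfolding lim_pi0_stratum_def by blast

text \<open>The germ \<open>a\<close> is transported from \<open>p0\<close> along paths; trivial
  monodromy makes the result independent of the path.\<close>

lemma lim_pi0_stratum_exists:
  assumes tr: "locally_trivial X B T" and sc: "simply_connected_space (subtopology X T)"
    and pc: "path_connectedin X T" and p: "p0 \<in> T" and a: "a \<in> lim_pi0 X B p0"
  shows "\<exists>\<sigma>\<in>lim_pi0_stratum X B T. \<sigma> p0 = a"
proof -
  have path: "\<exists>\<gamma>. pathin (subtopology X T) \<gamma> \<and> \<gamma> 0 = q \<and> \<gamma> 1 = q'" if "q \<in> T" "q' \<in> T" for q q'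
  proof -
    have "path_connected_space (subtopology X T)" "T \<subseteq> topspace X"
      using pc by (auto simp: path_connectedin_def)
    then show ?thesis using that by (simp add: path_connected_space_def Int_absorb1)
  qed
  have wd: "c 1 = c' 1"
    if g: "pathin (subtopology X T) \<gamma>" "pathin (subtopology X T) \<gamma>'" "\<gamma> 0 = \<gamma>' 0" "\<gamma> 1 = \<gamma>' 1"
      and c: "lcs X B {0..1} \<gamma> c" "lcs X B {0..1} \<gamma>' c'" "c 0 = c' 0" for \<gamma> \<gamma>' c c'
  proof -
    \<comment> \<open>The loop \<open>\<gamma>\<close> followed by the reverse of
      \<open>\<gamma>'\<close>. A section \<open>C\<close> over it restricts to
      \<open>\<gamma>\<close> by \<open>t / 2\<close> and to \<open>\<gamma>'\<close> by
      \<open>1 - t / 2\<close>. Both start at the same germ by trivial monodromy, and both end at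
      \<open>C (1 / 2)\<close>.\<close>
    let ?g = "\<lambda>t. if t \<le> 1 / 2 then \<gamma> (2 * t) else \<gamma>' (1 - (2 * t - 1))"
    have pg: "pathin (subtopology X T) ?g"
      by (rule pathin_join[OF g(1) pathin_rev[OF g(2)]]) (use g in simp)
    obtain C where C: "lcs X B {0..1} ?g C" "C 0 = c 0"
      using path_section_exists[OF tr pg] lcs_lim[OF c(1), of 0] by auto
    have "C 1 = C 0"
      by (rule trivial_monodromy[OF tr sc pg _ C(1)]) (use g in simp)
    have "lcs X B {0..1} (\<lambda>t. ?g (t / 2)) (\<lambda>t. C (t / 2))"
      by (rule lcs_compose[OF C(1)]) (auto intro!: continuous_intros)
    then have 1: "lcs X B {0..1} \<gamma> (\<lambda>t. C (t / 2))"
      by (rule lcs_cong) auto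
    have "c 1 = C (1 / 2)"
      by (rule lcs_unique[OF tr _ _ c(1) 1, of 0]) (use pathin_T[OF g(1)] C(2) in auto)
    have "lcs X B {0..1} (\<lambda>t. ?g (1 - t / 2)) (\<lambda>t. C (1 - t / 2))"
      by (rule lcs_compose[OF C(1)]) (auto intro!: continuous_intros)
    then have 2: "lcs X B {0..1} \<gamma>' (\<lambda>t. C (1 - t / 2))"
      by (rule lcs_cong) (use g(4) in \<open>auto simp: not_le field_simps\<close>)
    have "c' 1 = C (1 - 1 / 2)"
      by (rule lcs_unique[OF tr _ _ c(2) 2, of 0]) (use pathin_T[OF g(2)] C(2) c(3) \<open>C 1 = C 0\<close> in auto)
    then show ?thesis using \<open>c 1 = C (1 / 2)\<close> by simp
  qed
  have "\<exists>b. \<exists>\<gamma> c. pathin (subtopology X T) \<gamma> \<and> \<gamma> 0 = p0 \<and> \<gamma> 1 = q \<and> lcs X B {0..1} \<gamma> c \<and> c 0 = a \<and> c 1 = b"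
    if q: "q \<in> T" for q
  proof -
    obtain \<gamma> where g: "pathin (subtopology X T) \<gamma>" "\<gamma> 0 = p0" "\<gamma> 1 = q" using path[OF p q] by blast
    obtain c where "lcs X B {0..1} \<gamma> c" "c 0 = a" using path_section_exists[OF tr g(1)] a g(2) by auto
    then show ?thesis using g by blast
  qed
  then obtain \<sigma>0 where s0: "\<And>q. q \<in> T \<Longrightarrow> \<exists>\<gamma> c. pathin (subtopology X T) \<gamma> \<and> \<gamma> 0 = p0 \<and> \<gamma> 1 = q \<and>
      lcs X B {0..1} \<gamma> c \<and> c 0 = a \<and> c 1 = \<sigma>0 q"
    by metis
  define \<sigma> where "\<sigma> = restrict \<sigma>0 T"
  have s: "c 1 = \<sigma> (\<gamma> 1)" if g: "pathin (subtopology X T) \<gamma>" "\<gamma> 0 = p0" and c: "lcs X B {0..1} \<gamma> c" "c 0 = a" for \<gamma> c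
  proof -
    have q: "\<gamma> 1 \<in> T" using pathin_T[OF g(1), of 1] by simp
    obtain \<gamma>' c' where "pathin (subtopology X T) \<gamma>'" "\<gamma>' 0 = p0" "\<gamma>' 1 = \<gamma> 1"
      "lcs X B {0..1} \<gamma>' c'" "c' 0 = a" "c' 1 = \<sigma>0 (\<gamma> 1)" using s0[OF q] by blast
    then show ?thesis using wd[OF g(1), of \<gamma>' c c'] g c q by (simp add: \<sigma>_def)
  qed
  have "\<sigma> \<in> lim_pi0_stratum X B T"
    unfolding lim_pi0_stratum_def
  proof (intro CollectI conjI allI impI)
    have "\<sigma>0 q \<in> lim_pi0 X B q" if q: "q \<in> T" for q
    proof -
      obtain \<gamma> c where "pathin (subtopology X T) \<gamma>" "\<gamma> 0 = p0" "\<gamma> 1 = q" "lcs X B {0..1} \<gamma> c"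
        "c 0 = a" "c 1 = \<sigma>0 q" using s0[OF q] by blast
      then show ?thesis using lcs_lim[of X B "{0..1}" \<gamma> c 1] by simp
    qed
    then show "\<sigma> \<in> (\<Pi>\<^sub>E p\<in>T. lim_pi0 X B p)" unfolding \<sigma>_def by auto
    fix \<delta> assume d: "pathin (subtopology X T) \<delta>"
    have dT: "\<delta> 0 \<in> T" using pathin_T[OF d, of 0] by simp
    obtain \<gamma> where g: "pathin (subtopology X T) \<gamma>" "\<gamma> 0 = p0" "\<gamma> 1 = \<delta> 0" using path[OF p dT] by blast
    \<comment> \<open>The path \<open>\<delta>\<close> is preceded by one from \<open>p0\<close>, so
      that a single section gives both end values, at the times \<open>1 / 2\<close> and 1.\<close>
    let ?g = "\<lambda>t. if t \<le> 1 / 2 then \<gamma> (2 * t) else \<delta> (2 * t - 1)"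
    have pg: "pathin (subtopology X T) ?g" by (rule pathin_join[OF g(1) d g(3)])
    obtain C where C: "lcs X B {0..1} ?g C" "C 0 = a"
      using path_section_exists[OF tr pg] a g(2) by auto
    have e1: "C 1 = \<sigma> (\<delta> 1)" using s[OF pg _ C] g(2) by simp
    have "lcs X B {0..1} (\<lambda>t. ?g (t / 2)) (\<lambda>t. C (t / 2))"
      by (rule lcs_compose[OF C(1)]) (auto intro!: continuous_intros)
    then have 1: "lcs X B {0..1} \<gamma> (\<lambda>t. C (t / 2))"
      by (rule lcs_cong) auto
    have e2: "C (1 / 2) = \<sigma> (\<delta> 0)" using s[OF g(1,2) 1] C(2) g(3) by simp
    have "lcs X B {0..1} (\<lambda>t. ?g ((1 + t) / 2)) (\<lambda>t. C ((1 + t) / 2))"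
      by (rule lcs_compose[OF C(1)]) (auto intro!: continuous_intros)
    then have "lcs X B {0..1} \<delta> (\<lambda>t. C ((1 + t) / 2))"
      by (rule lcs_cong) (use g(3) in \<open>auto simp: field_simps\<close>)
    then show "transport X B \<delta> (\<sigma> (\<delta> 0)) (\<sigma> (\<delta> 1))"
      unfolding transport_iff using e1 e2 by (intro exI[of _ "\<lambda>t. C ((1 + t) / 2)"]) simp
  qed
  moreover have "\<sigma> p0 = a"
  proof -
    have "pathin (subtopology X T) (\<lambda>_. p0)" using p tr by (auto simp: pathin_def locally_trivial_def)
    moreover from this obtain c where c: "lcs X B {0..1::real} (\<lambda>_. p0) c" "c 0 = a"
      using path_section_exists[OF tr, of "\<lambda>_. p0"] a by blast
    ultimately have "c 1 = \<sigma> p0" using s[of "\<lambda>_. p0" c] by simp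
    moreover have "c 1 = c 0"
      by (rule trivial_monodromy[OF tr sc _ _ c(1)]) (use \<open>pathin (subtopology X T) (\<lambda>_. p0)\<close> in auto)
    ultimately show ?thesis using c(2) by simp
  qed
  ultimately show ?thesis by blast
qed

lemma lim_pi0_stratum_unique:
  assumes tr: "locally_trivial X B T" and pc: "path_connectedin X T"
    and s: "\<sigma> \<in> lim_pi0_stratum X B T" "\<sigma>' \<in> lim_pi0_stratum X B T" and p: "p \<in> T" "\<sigma> p = \<sigma>' p"
  shows "\<sigma> = \<sigma>'"
proof (rule PiE_ext)
  show "\<sigma> \<in> (\<Pi>\<^sub>E p\<in>T. lim_pi0 X B p)" "\<sigma>' \<in> (\<Pi>\<^sub>E p\<in>T. lim_pi0 X B p)"
    by (rule lim_pi0_stratum_PiE[OF s(1)], rule lim_pi0_stratum_PiE[OF s(2)])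
  fix q assume q: "q \<in> T"
  have "path_connected_space (subtopology X T)" "T \<subseteq> topspace X"
    using pc by (auto simp: path_connectedin_def)
  then have "\<exists>\<gamma>. pathin (subtopology X T) \<gamma> \<and> \<gamma> 0 = p \<and> \<gamma> 1 = q"
    using p q by (simp add: path_connected_space_def Int_absorb1)
  then obtain \<gamma> where g: "pathin (subtopology X T) \<gamma>" "\<gamma> 0 = p" "\<gamma> 1 = q" by blast
  obtain c where c: "c 0 = \<sigma> p" "c 1 = \<sigma> q" "lcs X B {0..1} \<gamma> c"
    using lim_pi0_stratum_transport[OF s(1) g(1)] g unfolding transport_iff by auto
  obtain c' where c': "c' 0 = \<sigma>' p" "c' 1 = \<sigma>' q" "lcs X B {0..1} \<gamma> c'"
    using lim_pi0_stratum_transport[OF s(2) g(1)] g unfolding transport_iff by auto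
  have "c 1 = c' 1"
    by (rule lcs_unique[OF tr _ _ c(3) c'(3), of 0]) (use pathin_T[OF g(1)] c c' p(2) in auto)
  then show "\<sigma> q = \<sigma>' q" using c c' by simp
qed

text \<open>Along a path inside \<open>V \<inter> T\<close> the value on the fixed \<open>V\<close>
  is locally constant in time. This is what makes \<open>q p' V\<close> depend only on the component
  of \<open>p'\<close>.\<close>

lemma lim_pi0_stratum_const:
  assumes s: "\<sigma> \<in> lim_pi0_stratum X B T" and V: "openin X V"
    and xy: "path_component_of (subtopology X (V \<inter> T)) x y"
  shows "\<sigma> x V = \<sigma> y V"
proof -
  obtain g where g: "pathin (subtopology X (V \<inter> T)) g" "g 0 = x" "g 1 = y"
    using xy by (auto simp: path_component_of_def)
  have gVT: "g t \<in> V" "g t \<in> T" if "t \<in> {0..1}" for t using pathin_T[OF g(1) that] by auto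
  have "pathin (subtopology X T) g"
    using g(1) by (auto simp: pathin_def continuous_map_in_subtopology)
  from lim_pi0_stratum_transport[OF s this]
  obtain c where c: "c 0 = \<sigma> x" "c 1 = \<sigma> y" "lcs X B {0..1} g c"
    unfolding transport_iff g(2,3) by blast
  have "c 0 V = c 1 V"
  proof (rule connected_local_const[of "{0..1::real}"])
    show "\<forall>a\<in>{0..1}. \<forall>\<^sub>F b in at a within {0..1}. c a V = c b V"
    proof
      fix a :: real assume a: "a \<in> {0..1}"
      have "V \<in> nbhds_of X (g a)" using gVT[OF a] V by (simp add: nbhds_of_iff)
      from lcs_local[OF c(3) a this] show "\<forall>\<^sub>F b in at a within {0..1}. c a V = c b V"
        unfolding eventually_at_topological by (metis IntI)
    qed
  qed auto
  then show ?thesis using c by simp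
qed

section \<open>The endpoint modification\<close>

lemma connected_local_const_abstract:
  assumes T: "connectedin X T" and f: "\<And>p. p \<in> T \<Longrightarrow> \<exists>U\<in>nbhds_of X p. \<forall>p'\<in>U \<inter> T. f p' = f p"
    and pq: "p \<in> T" "q \<in> T"
  shows "f p = f q"
proof -
  have TX: "T \<subseteq> topspace X" and con: "connected_space (subtopology X T)"
    using T by (auto simp: connectedin_def)
  have op: "openin (subtopology X T) {x \<in> T. P (f x)}" for P
  proof (subst openin_subopen, intro ballI)
    fix x assume x: "x \<in> {x \<in> T. P (f x)}"
    then obtain U where U: "U \<in> nbhds_of X x" "\<forall>p'\<in>U \<inter> T. f p' = f x" using f by blast
    have "openin (subtopology X T) (T \<inter> U)"
      using U(1) by (auto simp: nbhds_of_iff openin_subtopology_Int2)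
    moreover have "x \<in> T \<inter> U" using x U(1) by (auto simp: nbhds_of_iff)
    moreover have "T \<inter> U \<subseteq> {x \<in> T. P (f x)}" using U(2) x by auto
    ultimately show "\<exists>V. openin (subtopology X T) V \<and> x \<in> V \<and> V \<subseteq> {x \<in> T. P (f x)}" by blast
  qed
  have "{x \<in> T. f x = f p} = topspace (subtopology X T)"
  proof -
    have "closedin (subtopology X T) {x \<in> T. f x = f p}"
    proof -
      have "topspace (subtopology X T) - {x \<in> T. f x = f p} = {x \<in> T. f x \<noteq> f p}" using TX by auto
      then show ?thesis using op[of "\<lambda>y. y \<noteq> f p"] TX by (auto simp: closedin_def)
    qed
    then have "{x \<in> T. f x = f p} = {} \<or> {x \<in> T. f x = f p} = topspace (subtopology X T)"
      using con op[of "\<lambda>y. y = f p"] connected_space_clopen_in by blast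
    then show ?thesis using pq by blast
  qed
  moreover have "q \<in> topspace (subtopology X T)" using pq TX by auto
  ultimately have "q \<in> {x \<in> T. f x = f p}" by (simp only:)
  then show ?thesis by simp
qed

lemma path_comps_closed:
  assumes "C \<in> path_components_of Y" "x \<in> C" "path_component_of Y x y"
  shows "y \<in> C"
  using assms path_component_of_trans unfolding path_components_of_def by fastforce

text \<open>The generating sets form a basis: a value on \<open>V1 \<inter> V2\<close> determines
  the values on \<open>V1\<close> and \<open>V2\<close> by \<open>lim_pi0_agree_mono\<close>. So one
  neighbourhood \<open>V\<close> per point tests openness.\<close>

lemma endpoint_modification_openin:
  "openin (endpoint_modification X S) W \<longleftrightarrow>
     W \<subseteq> {(p, e). p \<in> topspace X \<and> e \<in> lim_pi0 X S p} \<and>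
     (\<forall>p e. (p, e) \<in> W \<longrightarrow> (\<exists>V\<in>nbhds_of X p. \<forall>p'\<in>V. \<forall>e'\<in>lim_pi0 X S p'. e' V = e V \<longrightarrow> (p', e') \<in> W))"
  (is "?L W \<longleftrightarrow> ?R W")
proof
  let ?G = "{{(p, e). p \<in> U \<and> e \<in> lim_pi0 X S p \<and> e U = C} | U C.
          openin X U \<and> C \<in> path_components_of (subtopology X (U \<inter> S))}"
  assume "?L W"
  then have "generate_topology_on ?G W"
    by (simp add: endpoint_modification_def openin_topology_generated_by_iff)
  then show "?R W"
  proof (induction rule: generate_topology_on.induct)
    case Empty
    then show ?case by simp
  next
    case (Int a b)
    have "\<exists>V\<in>nbhds_of X p. \<forall>p'\<in>V. \<forall>e'\<in>lim_pi0 X S p'. e' V = e V \<longrightarrow> (p', e') \<in> a \<inter> b"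
      if pe: "(p, e) \<in> a \<inter> b" for p e
    proof -
      have ab: "(p, e) \<in> a" "(p, e) \<in> b" using pe by simp_all
      from Int.IH(1)[THEN conjunct2, rule_format, OF ab(1)] obtain V1 where V1: "V1 \<in> nbhds_of X p"
        "\<forall>p'\<in>V1. \<forall>e'\<in>lim_pi0 X S p'. e' V1 = e V1 \<longrightarrow> (p', e') \<in> a" by (elim bexE)
      from Int.IH(2)[THEN conjunct2, rule_format, OF ab(2)] obtain V2 where V2: "V2 \<in> nbhds_of X p"
        "\<forall>p'\<in>V2. \<forall>e'\<in>lim_pi0 X S p'. e' V2 = e V2 \<longrightarrow> (p', e') \<in> b" by (elim bexE)
      note V = V1(1) V2(1) V1(2) V2(2)
      have V12: "V1 \<inter> V2 \<in> nbhds_of X p" using V(1,2) by (auto simp: nbhds_of_iff)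
      have e: "e \<in> lim_pi0 X S p" using subsetD[OF Int.IH(1)[THEN conjunct1] ab(1)] by simp
      have "(p', e') \<in> a \<inter> b" if p': "p' \<in> V1 \<inter> V2" and e': "e' \<in> lim_pi0 X S p'" and eq: "e' (V1 \<inter> V2) = e (V1 \<inter> V2)" for p' e'
      proof -
        have n: "V1 \<inter> V2 \<in> nbhds_of X p'" "V1 \<in> nbhds_of X p'" "V2 \<in> nbhds_of X p'"
          using V(1,2) V12 p' by (auto simp: nbhds_of_iff)
        have "e' V1 = e V1" by (rule lim_pi0_agree_mono[OF e' e n(1) V12 n(2) V(1) Int_lower1 eq])
        moreover have "e' V2 = e V2" by (rule lim_pi0_agree_mono[OF e' e n(1) V12 n(3) V(2) Int_lower2 eq])
        moreover have "p' \<in> V1" "p' \<in> V2" using p' by simp_all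
        ultimately show ?thesis using V(3)[rule_format, OF _ e'] V(4)[rule_format, OF _ e'] by simp
      qed
      then show ?thesis by (intro bexI[OF _ V12] ballI impI)
    qed
    moreover have "a \<inter> b \<subseteq> {(p, e). p \<in> topspace X \<and> e \<in> lim_pi0 X S p}"
      by (rule subset_trans[OF Int_lower1 Int.IH(1)[THEN conjunct1]])
    ultimately show ?case by (intro conjI allI impI)
  next
    case (UN K)
    show ?case
    proof (intro conjI allI impI)
      show "\<Union>K \<subseteq> {(p, e). p \<in> topspace X \<and> e \<in> lim_pi0 X S p}"
        by (rule Union_least) (rule UN.IH[THEN conjunct1])
      fix p e assume "(p, e) \<in> \<Union>K"
      then obtain k where k: "k \<in> K" "(p, e) \<in> k" by blast
      from UN.IH[OF k(1), THEN conjunct2, rule_format, OF k(2)] obtain V where "V\<in>nbhds_of X p"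
        "\<forall>p'\<in>V. \<forall>e'\<in>lim_pi0 X S p'. e' V = e V \<longrightarrow> (p', e') \<in> k" by (elim bexE)
      then show "\<exists>V\<in>nbhds_of X p. \<forall>p'\<in>V. \<forall>e'\<in>lim_pi0 X S p'. e' V = e V \<longrightarrow> (p', e') \<in> \<Union>K"
        using k(1) by blast
    qed
  next
    case (Basis s)
    then obtain U C where U: "openin X U" "s = {(p, e). p \<in> U \<and> e \<in> lim_pi0 X S p \<and> e U = C}" by blast
    have "s \<subseteq> {(p, e). p \<in> topspace X \<and> e \<in> lim_pi0 X S p}"
      using U openin_subset by blast
    moreover have "\<exists>V\<in>nbhds_of X p. \<forall>p'\<in>V. \<forall>e'\<in>lim_pi0 X S p'. e' V = e V \<longrightarrow> (p', e') \<in> s"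
      if "(p, e) \<in> s" for p e
      by (rule bexI[of _ U]) (use that U in \<open>auto simp: nbhds_of_iff\<close>)
    ultimately show ?case by (intro conjI allI impI)
  qed
next
  assume R: "?R W"
  show "?L W"
  proof (subst openin_subopen, intro ballI)
    fix z assume z: "z \<in> W"
    obtain p e where pe: "z = (p, e)" by (cases z)
    have peW: "(p, e) \<in> W" using z pe by simp
    have e: "e \<in> lim_pi0 X S p" using subsetD[OF R[THEN conjunct1] peW] by simp
    from R[THEN conjunct2, rule_format, OF peW] obtain V where V: "V \<in> nbhds_of X p"
      "\<forall>p'\<in>V. \<forall>e'\<in>lim_pi0 X S p'. e' V = e V \<longrightarrow> (p', e') \<in> W" by (elim bexE)
    let ?b = "{(p', e'). p' \<in> V \<and> e' \<in> lim_pi0 X S p' \<and> e' V = e V}"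
    have "openin (endpoint_modification X S) ?b"
      unfolding endpoint_modification_def
      by (rule topology_generated_by_Basis) (use V(1) lim_pi0_comp[OF e V(1)] in \<open>auto simp: nbhds_of_iff\<close>)
    moreover have "z \<in> ?b" using pe e V(1) by (simp add: nbhds_of_iff)
    moreover have "?b \<subseteq> W" using V(2) by blast
    ultimately show "\<exists>T. openin (endpoint_modification X S) T \<and> z \<in> T \<and> T \<subseteq> W" by blast
  qed
qed

lemma topspace_endpoint_modification:
  "topspace (endpoint_modification X S) = {(p, e). p \<in> topspace X \<and> e \<in> lim_pi0 X S p}"
proof
  show "topspace (endpoint_modification X S) \<subseteq> {(p, e). p \<in> topspace X \<and> e \<in> lim_pi0 X S p}"
    using openin_topspace[of "endpoint_modification X S"] unfolding endpoint_modification_openin by blast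
  have "openin (endpoint_modification X S) {(p, e). p \<in> topspace X \<and> e \<in> lim_pi0 X S p}"
    unfolding endpoint_modification_openin
  proof (intro conjI allI impI)
    fix p e assume "(p, e) \<in> {(p, e). p \<in> topspace X \<and> e \<in> lim_pi0 X S p}"
    then have "topspace X \<in> nbhds_of X p" by (simp add: nbhds_of_iff)
    then show "\<exists>V\<in>nbhds_of X p. \<forall>p'\<in>V. \<forall>e'\<in>lim_pi0 X S p'. e' V = e V \<longrightarrow>
        (p', e') \<in> {(p, e). p \<in> topspace X \<and> e \<in> lim_pi0 X S p}" by blast
  qed simp
  then show "{(p, e). p \<in> topspace X \<and> e \<in> lim_pi0 X S p} \<subseteq> topspace (endpoint_modification X S)"
    by (rule openin_subset)
qed

text \<open>The orthant at \<open>p\<close> that is adjacent to the end \<open>e\<close> and corresponds to \<open>q\<close>.\<close>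

definition push :: "'a topology \<Rightarrow> ('a \<Rightarrow> 'a set \<Rightarrow> 'a set) \<Rightarrow> 'a \<Rightarrow> ('a set \<Rightarrow> 'a set) \<Rightarrow> 'a set \<Rightarrow> 'a set" where
  "push X q p e = (\<lambda>V\<in>nbhds_of X p. \<Union>p'\<in>e V. q p' V)"

text \<open>The union in \<open>push\<close> is taken over equal sets: \<open>e V\<close> is path
  connected inside \<open>V \<inter> S\<close>, and \<open>q\<close> has a constant value on
  \<open>V\<close> along it.\<close>

lemma push_eq:
  assumes e: "e \<in> lim_pi0 X S p" and q: "q \<in> lim_pi0_stratum X B S" and V: "V \<in> nbhds_of X p" and p': "p' \<in> e V"
  shows "push X q p e V = q p' V"
proof -
  have C: "e V \<in> path_components_of (subtopology X (V \<inter> S))" by (rule lim_pi0_comp[OF e V])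
  have "q z V = q p' V" if "z \<in> e V" for z
  proof -
    have "path_component_of (subtopology X (V \<inter> S)) z p'"
      using C that p' path_connectedin_path_components_of[OF C] by (meson path_component_of)
    then show ?thesis using lim_pi0_stratum_const[OF q] V by (simp add: nbhds_of_iff)
  qed
  then have "(\<Union>z\<in>e V. q z V) = q p' V" using p' by blast
  then show ?thesis using V by (simp add: push_def)
qed

lemma push_lim:
  assumes e: "e \<in> lim_pi0 X S p" and q: "q \<in> lim_pi0_stratum X B S"
  shows "push X q p e \<in> lim_pi0 X B p"
  unfolding lim_pi0_def
proof (intro CollectI conjI ballI impI)
  have comp: "push X q p e V \<in> path_components_of (subtopology X (V \<inter> B))" if V: "V \<in> nbhds_of X p" for V
  proof -
    obtain p' where p': "p' \<in> e V" using lim_pi0_nonempty[OF e V] by blast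
    then have "p' \<in> S" "p' \<in> V" using lim_pi0_subset[OF e V] by blast+
    then have "V \<in> nbhds_of X p'" using V by (simp add: nbhds_of_iff)
    then show ?thesis
      unfolding push_eq[OF e q V p'] by (rule lim_pi0_comp[OF lim_pi0_stratum_at[OF q \<open>p' \<in> S\<close>]])
  qed
  show "push X q p e \<in> (\<Pi>\<^sub>E U\<in>nbhds_of X p. path_components_of (subtopology X (U \<inter> B)))"
  proof (rule PiE_I)
    show "push X q p e V = undefined" if "V \<notin> nbhds_of X p" for V using that by (simp add: push_def)
  qed (rule comp)
  fix U V assume U: "U \<in> nbhds_of X p" and V: "V \<in> nbhds_of X p" and UV: "U \<subseteq> V"
  obtain p' where p': "p' \<in> e U" using lim_pi0_nonempty[OF e U] by blast
  then have p'V: "p' \<in> e V" using lim_pi0_mono[OF e U V UV] by blast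
  have "p' \<in> S" "p' \<in> U" using lim_pi0_subset[OF e U] p' by blast+
  then have "U \<in> nbhds_of X p'" "V \<in> nbhds_of X p'" using U V UV by (auto simp: nbhds_of_iff)
  then show "push X q p e U \<subseteq> push X q p e V"
    unfolding push_eq[OF e q U p'] push_eq[OF e q V p'V]
    by (rule lim_pi0_mono[OF lim_pi0_stratum_at[OF q \<open>p' \<in> S\<close>] _ _ UV])
qed

definition int_end :: "'a topology \<Rightarrow> 'a set \<Rightarrow> 'a \<Rightarrow> 'a set \<Rightarrow> 'a set" where
  "int_end X S p = (\<lambda>U\<in>nbhds_of X p. path_component_of_set (subtopology X (U \<inter> S)) p)"

lemma interior_point_eq: "interior_point X S p = (p, int_end X S p)"
  by (simp add: interior_point_def int_end_def)

lemma int_end_mem: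
  assumes "p \<in> S" "p \<in> topspace X" "U \<in> nbhds_of X p"
  shows "p \<in> int_end X S p U"
  using assms by (simp add: int_end_def path_component_of_refl nbhds_of_iff)

lemma int_end_lim:
  assumes "p \<in> S" "p \<in> topspace X"
  shows "int_end X S p \<in> lim_pi0 X S p"
  unfolding lim_pi0_def
proof (intro CollectI conjI ballI impI)
  show "int_end X S p \<in> (\<Pi>\<^sub>E U\<in>nbhds_of X p. path_components_of (subtopology X (U \<inter> S)))"
    using assms by (auto simp: int_end_def path_component_in_path_components_of nbhds_of_iff)
  fix U V assume "U \<in> nbhds_of X p" "V \<in> nbhds_of X p" "U \<subseteq> V"
  moreover from this have "U \<inter> S \<subseteq> V \<inter> S" by blast
  ultimately show "int_end X S p U \<subseteq> int_end X S p V"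
    using path_component_of_mono by (fastforce simp: int_end_def)
qed

lemma push_int_end:
  assumes "p \<in> S" "p \<in> topspace X" and q: "q \<in> lim_pi0_stratum X B S"
  shows "push X q p (int_end X S p) = q p"
proof (rule lim_pi0_ext)
  show "push X q p (int_end X S p) \<in> lim_pi0 X B p" by (rule push_lim[OF int_end_lim[OF assms(1,2)] q])
  show "q p \<in> lim_pi0 X B p" by (rule lim_pi0_stratum_at[OF q assms(1)])
  show "push X q p (int_end X S p) U = q p U" if "U \<in> nbhds_of X p" for U
    by (rule push_eq[OF int_end_lim[OF assms(1,2)] q that int_end_mem[OF assms(1,2) that]])
qed

context nc_pair
begin

section \<open>Contraction of cubes\<close>

abbreviation scl :: "'a set \<Rightarrow> ('a \<Rightarrow> nat \<Rightarrow> real) \<Rightarrow> 'a \<Rightarrow> real \<Rightarrow> 'a \<Rightarrow> 'a" where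
  "scl U \<phi> p' t x \<equiv> pt U \<phi> (\<lambda>i. (1 - t) * \<phi> p' i + t * \<phi> x i)"

abbreviation coord_box :: "'a set \<Rightarrow> ('a \<Rightarrow> nat \<Rightarrow> real) \<Rightarrow> 'a \<Rightarrow> real \<Rightarrow> 'a set" where
  "coord_box U \<phi> p' d \<equiv> {x \<in> U. \<forall>i<n. \<bar>\<phi> x i - \<phi> p' i\<bar> < d}"

lemma scl_props:
  assumes q: "nc_cube p k U \<phi> \<epsilon> J" and "p' \<in> U" "x \<in> U" "0 \<le> t" "t \<le> 1"
  shows "scl U \<phi> p' t x \<in> U" "\<phi> (scl U \<phi> p' t x) = (\<lambda>i. (1 - t) * \<phi> p' i + t * \<phi> x i)"
  using pt_cube[OF q segment_in_cube[OF q assms(2-5)]] by auto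

lemma scl_continuous:
  assumes q: "nc_cube p k U \<phi> \<epsilon> J" and p': "p' \<in> U" and t: "0 \<le> t" "t \<le> 1"
  shows "continuous_map (subtopology X U) (subtopology X U) (scl U \<phi> p' t)"
proof -
  note q' = nc_cube_D[OF q]
  have c\<phi>: "continuous_map (subtopology X U) (Euclidean_space n) \<phi>"
    using homeomorphic_imp_continuous_map[OF smooth_charts_D(3)[OF M q'(1)]] by (simp add: continuous_map_in_subtopology)
  have "continuous_map (subtopology X U) euclideanreal (\<lambda>x. \<phi> x i)" for i
    using continuous_map_compose[OF c\<phi> continuous_map_Euclidean_coord[of n i]] by (simp add: o_def)
  then have "continuous_map (subtopology X U) (Euclidean_space n) (\<lambda>x i. (1 - t) * \<phi> p' i + t * \<phi> x i)"
    using q'(14)[OF p'] q'(14)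
    by (intro continuous_map_into_Euclidean continuous_map_add continuous_map_real_mult)
      (auto simp: topspace_Euclidean_space)
  then have "continuous_map (subtopology X U) (subtopology (Euclidean_space n) (cube n \<epsilon>)) (\<lambda>x i. (1 - t) * \<phi> p' i + t * \<phi> x i)"
    using segment_in_cube[OF q p' _ t] by (auto simp: continuous_map_in_subtopology)
  from continuous_map_compose[OF this continuous_map_pt[OF q]] show ?thesis by (simp add: o_def)
qed

text \<open>Contractions towards \<open>p'\<close> preserve \<open>C\<close> and every box around
  \<open>p'\<close>, and the factor \<open>t0\<close> brings the whole cube into the given box. Two
  points of \<open>C\<close> in the box are joined in three pieces: shrink the first, follow the
  shrunken image of a path in \<open>C\<close>, and undo the shrinking at the second.\<close>

lemma contraction:
  assumes q: "nc_cube p k U \<phi> \<epsilon> J" and p': "p' \<in> U"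
    and contr: "\<And>x t. x \<in> U \<Longrightarrow> x \<in> B \<Longrightarrow> 0 < t \<Longrightarrow> t \<le> 1 \<Longrightarrow> scl U \<phi> p' t x \<in> B"
    and C: "C \<in> path_components_of (subtopology X (U \<inter> B))" and d: "d > 0"
  shows "path_connectedin X (C \<inter> coord_box U \<phi> p' d)" "C \<inter> coord_box U \<phi> p' d \<noteq> {}"
proof -
  note q' = nc_cube_D[OF q]
  have CU: "C \<subseteq> U" "C \<subseteq> B" "C \<subseteq> topspace X" using path_components_of_subset[OF C] by auto
  let ?N = "coord_box U \<phi> p' d"
  \<comment> \<open>The segment from \<open>x\<close> to its contraction consists of contractions of
    \<open>x\<close>, with factors \<open>1 - s + s * t\<close>.\<close>
  have two: "pt U \<phi> (\<lambda>i. (1 - s) * \<phi> x i + s * \<phi> (scl U \<phi> p' t x) i) = scl U \<phi> p' (1 - s + s * t) x"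
    if "x \<in> U" "0 \<le> t" "t \<le> 1" for x s t
    unfolding scl_props(2)[OF q p' that] by (rule arg_cong[where f = "pt U \<phi>"]) (simp add: fun_eq_iff algebra_simps)
  have u: "0 < 1 - s + s * t" "1 - s + s * t \<le> 1" if "0 < t" "t \<le> 1" "0 \<le> s" "s \<le> 1" for s t :: real
  proof -
    show "1 - s + s * t \<le> 1" using that mult_left_le[of t s] by simp
    show "0 < 1 - s + s * t"
    proof (cases "s = 0")
      case False
      then have "0 < s * t" using that by simp
      then show ?thesis using that by linarith
    qed simp
  qed
  have inC: "scl U \<phi> p' t x \<in> C" if x: "x \<in> C" and t: "0 < t" "t \<le> 1" for x t
  proof -
    have xU: "x \<in> U" "x \<in> B" using x CU by blast+
    have xsU: "scl U \<phi> p' t x \<in> U" by (rule scl_props(1)[OF q p' xU(1)]) (use t in auto)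
    have "path_component_of (subtopology X (U \<inter> B)) x (scl U \<phi> p' t x)"
    proof (rule segment_path[OF q xU(1) xsU])
      fix s :: real assume s: "0 \<le> s" "s \<le> 1"
      have "scl U \<phi> p' (1 - s + s * t) x \<in> U"
        by (rule scl_props(1)[OF q p' xU(1)]) (use u[OF t s] in auto)
      moreover have "scl U \<phi> p' (1 - s + s * t) x \<in> B"
        by (rule contr[OF xU u[OF t s]])
      ultimately show "pt U \<phi> (\<lambda>i. (1 - s) * \<phi> x i + s * \<phi> (scl U \<phi> p' t x) i) \<in> U \<inter> B"
        using two[OF xU(1), of t s] t by simp
    qed
    then show ?thesis by (rule path_comps_closed[OF C x])
  qed
  have dst: "\<bar>\<phi> (scl U \<phi> p' t x) i - \<phi> p' i\<bar> = t * \<bar>\<phi> x i - \<phi> p' i\<bar>" if "x \<in> U" "0 \<le> t" "t \<le> 1" for x t i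
  proof -
    have "\<phi> (scl U \<phi> p' t x) i - \<phi> p' i = t * (\<phi> x i - \<phi> p' i)"
      unfolding scl_props(2)[OF q p' that] by (simp add: algebra_simps)
    then show ?thesis using that by (simp add: abs_mult)
  qed
  have inN: "scl U \<phi> p' t x \<in> ?N" if x: "x \<in> ?N" and t: "0 < t" "t \<le> 1" for x t
  proof -
    have xU: "x \<in> U" using x by blast
    have "\<bar>\<phi> (scl U \<phi> p' t x) i - \<phi> p' i\<bar> < d" if "i < n" for i
    proof -
      have "t * \<bar>\<phi> x i - \<phi> p' i\<bar> \<le> \<bar>\<phi> x i - \<phi> p' i\<bar>" using t by (simp add: mult_left_le_one_le)
      also have "\<dots> < d" using x that by blast
      finally show ?thesis using dst[OF xU, of t i] t by simp
    qed
    then show ?thesis using scl_props(1)[OF q p' xU, of t] t by simp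
  qed
  \<comment> \<open>Coordinates of two points of the cube differ by less than
    \<open>2 * \<epsilon>\<close>.\<close>
  define t0 where "t0 = min 1 (d / (2 * \<epsilon>))"
  have t0: "0 < t0" "t0 \<le> 1" using d q'(4) by (auto simp: t0_def)
  have t0N: "scl U \<phi> p' t0 x \<in> ?N" if xU: "x \<in> U" for x
  proof -
    have "\<bar>\<phi> (scl U \<phi> p' t0 x) i - \<phi> p' i\<bar> < d" if i: "i < n" for i
    proof -
      have "\<bar>\<phi> x i - \<phi> p' i\<bar> < 2 * \<epsilon>" using q'(15)[OF xU i] q'(15)[OF p' i] by linarith
      then have "t0 * \<bar>\<phi> x i - \<phi> p' i\<bar> < t0 * (2 * \<epsilon>)" using t0(1) by simp
      also have "\<dots> \<le> d / (2 * \<epsilon>) * (2 * \<epsilon>)" using q'(4) by (intro mult_right_mono) (auto simp: t0_def)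
      also have "\<dots> = d" using q'(4) by simp
      finally show ?thesis using dst[OF xU, of t0 i] t0 by simp
    qed
    then show ?thesis using scl_props(1)[OF q p' xU, of t0] t0 by simp
  qed
  show "C \<inter> ?N \<noteq> {}"
  proof -
    obtain x where x: "x \<in> C" using nonempty_path_components_of[OF C] by blast
    then show ?thesis using inC[OF x t0] t0N CU by blast
  qed
  have step: "path_component_of (subtopology X (C \<inter> ?N)) x (scl U \<phi> p' t0 x)" if x: "x \<in> C \<inter> ?N" for x
  proof -
    have xU: "x \<in> U" using x by blast
    show ?thesis
    proof (rule segment_path[OF q xU])
      show "scl U \<phi> p' t0 x \<in> U" using t0N[OF xU] by blast
      fix s :: real assume s: "0 \<le> s" "s \<le> 1"
      have "scl U \<phi> p' (1 - s + s * t0) x \<in> C \<inter> ?N"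
        using inC[OF _ u[OF t0 s]] inN[OF _ u[OF t0 s]] x by blast
      then show "pt U \<phi> (\<lambda>i. (1 - s) * \<phi> x i + s * \<phi> (scl U \<phi> p' t0 x) i) \<in> C \<inter> ?N"
        using two[OF xU, of t0 s] t0 by simp
    qed
  qed
  have "path_component_of (subtopology X (C \<inter> ?N)) x y" if x: "x \<in> C \<inter> ?N" and y: "y \<in> C \<inter> ?N" for x y
  proof -
    obtain g where g: "pathin (subtopology X C) g" "g 0 = x" "g 1 = y"
    proof -
      have "path_connectedin X C"
        using path_connectedin_path_components_of[OF C] by (simp add: path_connectedin_subtopology)
      then have "path_connected_space (subtopology X C)" by (simp add: path_connectedin_def)
      then have "\<exists>g. pathin (subtopology X C) g \<and> g 0 = x \<and> g 1 = y"
        using x y CU(3) unfolding path_connected_space_def by (simp add: Int_absorb1)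
      then show ?thesis using that by blast
    qed
    have gC: "g t \<in> C" if "t \<in> {0..1}" for t by (rule pathin_T[OF g(1) that])
    have "continuous_map (top_of_set {0..1}) (subtopology X U) g"
      using g(1) CU(1) gC by (auto simp: pathin_def continuous_map_in_subtopology)
    from continuous_map_compose[OF this scl_continuous[OF q p', of t0]] t0
    have "continuous_map (top_of_set {0..1}) X (\<lambda>t. scl U \<phi> p' t0 (g t))"
      by (simp add: o_def continuous_map_in_subtopology)
    then have "pathin (subtopology X (C \<inter> ?N)) (\<lambda>t. scl U \<phi> p' t0 (g t))"
      unfolding pathin_def continuous_map_in_subtopology
    proof (intro conjI image_subsetI)
      show "(\<lambda>t. scl U \<phi> p' t0 (g t)) \<in> topspace (top_of_set {0..1}) \<rightarrow> C \<inter> ?N"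
      proof
        fix t :: real assume "t \<in> topspace (top_of_set {0..1})"
        then have "g t \<in> C" using gC by simp
        then show "scl U \<phi> p' t0 (g t) \<in> C \<inter> ?N" using inC[OF _ t0] t0N CU(1) by blast
      qed
    qed
    then have "path_component_of (subtopology X (C \<inter> ?N)) (scl U \<phi> p' t0 x) (scl U \<phi> p' t0 y)"
      unfolding path_component_of_def using g(2,3) by (intro exI[of _ "\<lambda>t. scl U \<phi> p' t0 (g t)"]) simp
    then show ?thesis
      using path_component_of_trans[OF step[OF x]] path_component_of_trans[OF _ path_component_of_sym[OF step[OF y]]]
      by blast
  qed
  then have "path_connected_space (subtopology X (C \<inter> ?N))"
    unfolding path_connected_space_iff_path_component by simp
  then show "path_connectedin X (C \<inter> ?N)"
    using CU(3) unfolding path_connectedin_def by blast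
qed

lemma box_nbhd:
  assumes q: "nc_cube p k U \<phi> \<epsilon> J" and p': "p' \<in> U" and V: "V \<in> nbhds_of X p'"
  shows "\<exists>d>0. coord_box U \<phi> p' d \<in> nbhds_of X p' \<and> coord_box U \<phi> p' d \<subseteq> V"
proof -
  note q' = nc_cube_D[OF q]
  obtain d where d: "d > 0" "coord_box U \<phi> p' d \<subseteq> V"
    using chart_box_basis[OF q'(1) _ _ p', of V] V by (auto simp: nbhds_of_iff)
  have "openin X (coord_box U \<phi> p' d)" by (rule chart_box_open[OF q'(1)])
  then show ?thesis using d p' by (intro exI[of _ d]) (simp add: nbhds_of_iff)
qed

text \<open>As the crossing coordinates of \<open>p'\<close> vanish, contraction towards
  \<open>p'\<close> multiplies these coordinates by a positive factor and thus preserves each face.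
  The same assumption puts \<open>p'\<close> in the closure of every face, which is what
  surjectivity expresses.\<close>

lemma eval_bij:
  assumes q: "nc_cube p k U \<phi> \<epsilon> J" and B: "saturated k U \<phi> B" and p': "p' \<in> U" "\<And>i. i < k \<Longrightarrow> \<phi> p' i = 0"
  shows "bij_betw (\<lambda>c. c U) (lim_pi0 X B p') (path_components_of (subtopology X (U \<inter> B)))"
proof -
  note q' = nc_cube_D[OF q]
  have contr: "scl U \<phi> p' t x \<in> B" if "x \<in> U" "x \<in> B" "0 < t" "t \<le> 1" for x t
  proof -
    have t: "0 \<le> t" using that by simp
    have "same_signs k \<phi> x (scl U \<phi> p' t x)"
      unfolding same_signs_def scl_props(2)[OF q p'(1) that(1) t that(4)] using p'(2) that(3) by (simp add: sgn_mult)
    then show ?thesis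
      using B that scl_props(1)[OF q p'(1) that(1) t that(4)] unfolding saturated_def by blast
  qed
  have U: "U \<in> nbhds_of X p'" using q'(10) p' by (simp add: nbhds_of_iff)
  have basis: "\<exists>d>0. coord_box U \<phi> p' d \<in> nbhds_of X p' \<and> coord_box U \<phi> p' d \<subseteq> V" if "V \<in> nbhds_of X p'" for V
    by (rule box_nbhd[OF q p'(1) that])
  have inj: "inj_on (\<lambda>c. c U) (lim_pi0 X B p')"
  proof (rule lim_pi0_eval_inj[OF U])
    fix V assume "V \<in> nbhds_of X p'"
    then obtain d where d: "d > 0" "coord_box U \<phi> p' d \<in> nbhds_of X p'" "coord_box U \<phi> p' d \<subseteq> V" using basis by blast
    have "\<forall>C\<in>path_components_of (subtopology X (U \<inter> B)). path_connectedin X (C \<inter> coord_box U \<phi> p' d)"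
      using contraction(1)[OF q p'(1) contr _ d(1)] by blast
    then show "\<exists>N\<in>nbhds_of X p'. N \<subseteq> V \<and> N \<subseteq> U \<and>
        (\<forall>C\<in>path_components_of (subtopology X (U \<inter> B)). path_connectedin X (C \<inter> N))"
      using d by (intro bexI[of _ "coord_box U \<phi> p' d"]) auto
  qed
  have surj: "\<exists>c\<in>lim_pi0 X B p'. c U = C" if C: "C \<in> path_components_of (subtopology X (U \<inter> B))" for C
  proof (rule lim_pi0_eval_surj[OF U _ _ C])
    fix V assume "V \<in> nbhds_of X p'"
    then obtain d where d: "d > 0" "coord_box U \<phi> p' d \<in> nbhds_of X p'" "coord_box U \<phi> p' d \<subseteq> V" using basis by blast
    have "path_connectedin X (C \<inter> coord_box U \<phi> p' d)"
      by (rule contraction(1)[OF q p'(1) contr C d(1)])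
    then show "\<exists>N\<in>nbhds_of X p'. N \<subseteq> V \<and> N \<subseteq> U \<and> path_connectedin X (C \<inter> N)"
      using d by (intro bexI[of _ "coord_box U \<phi> p' d"]) auto
  next
    fix N assume "N \<in> nbhds_of X p'"
    then obtain d where d: "d > 0" "coord_box U \<phi> p' d \<subseteq> N" using basis by blast
    have "C \<inter> coord_box U \<phi> p' d \<noteq> {}" by (rule contraction(2)[OF q p'(1) contr C d(1)])
    then show "C \<inter> N \<noteq> {}" using d by blast
  qed
  have "(\<lambda>c. c U) ` lim_pi0 X B p' = path_components_of (subtopology X (U \<inter> B))"
  proof
    show "(\<lambda>c. c U) ` lim_pi0 X B p' \<subseteq> path_components_of (subtopology X (U \<inter> B))"
      using lim_pi0_comp[OF _ U] by blast
    show "path_components_of (subtopology X (U \<inter> B)) \<subseteq> (\<lambda>c. c U) ` lim_pi0 X B p'"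
      using surj by blast
  qed
  with inj show ?thesis by (simp add: bij_betw_def)
qed

section \<open>Strata, their closures and the orthant map\<close>

definition face_union :: "'a set \<Rightarrow> bool" where
  "face_union B \<longleftrightarrow> (\<forall>p k U \<phi> \<epsilon> J. nc_cube p k U \<phi> \<epsilon> J \<longrightarrow> saturated k U \<phi> B)"

lemma face_union_stratum: "S \<in> strata n X A D' \<Longrightarrow> face_union S"
  unfolding face_union_def using strata_saturated by blast

lemma face_union_compl: "face_union (topspace X - D)"
  unfolding face_union_def using compl_saturated by blast

text \<open>One cube trivialises over all of \<open>U \<inter> T\<close>, because all crossing
  coordinates vanish there.\<close>

lemma strata_locally_trivial:
  assumes T: "T \<in> strata n X A D'" and B: "face_union B"
  shows "locally_trivial X B T"
  unfolding locally_trivial_def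
proof (intro conjI ballI)
  show "T \<subseteq> topspace X" using strata_facts[OF T] by blast
  fix p V assume p: "p \<in> T" and V: "V \<in> nbhds_of X p"
  then have pV: "p \<in> topspace X" "openin X V" "p \<in> V" using strata_facts[OF T] by (auto simp: nbhds_of_iff)
  obtain k U \<phi> \<epsilon> J where q: "nc_cube p k U \<phi> \<epsilon> J" "U \<subseteq> V"
    using nc_cube_exists[OF pV] by blast
  have "saturated k U \<phi> B" using B q(1) unfolding face_union_def by blast
  then have "bij_betw (\<lambda>c. c U) (lim_pi0 X B p') (path_components_of (subtopology X (U \<inter> B)))" if "p' \<in> U \<inter> T" for p'
    by (rule eval_bij[OF q(1)]) (use stratum_cube[OF q(1) T p] that in blast)+
  then show "\<exists>U\<in>nbhds_of X p. U \<subseteq> V \<and> (\<forall>p'\<in>U \<inter> T.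
      bij_betw (\<lambda>c. c U) (lim_pi0 X B p') (path_components_of (subtopology X (U \<inter> B))))"
    using q(2) nc_cube_D(2,10)[OF q(1)] by (intro bexI[of _ U]) (auto simp: nbhds_of_iff)
qed

lemma stratum_cube_path:
  assumes q: "nc_cube p k U \<phi> \<epsilon> J" and T: "T \<in> strata n X A D'" "p \<in> T" and xy: "x \<in> U" "x \<in> T" "y \<in> U" "y \<in> T"
  shows "path_component_of (subtopology X (U \<inter> T)) x y"
proof (rule saturated_segment[OF q strata_saturated[OF q T(1)] xy(1,3) _ xy(2)])
  have "\<phi> x i = 0" "\<phi> y i = 0" if "i < k" for i
    using stratum_cube[OF q T] xy that by blast+
  then show "same_signs k \<phi> x y" by (simp add: same_signs_def)
qed

lemma strata_path_connected:
  assumes T: "T \<in> strata n X A D'"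
  shows "path_connectedin X T"
proof -
  note TF = strata_facts[OF T]
  have "path_component_of (subtopology X T) p p' = path_component_of (subtopology X T) p p" if p: "p \<in> T" "p' \<in> T" for p p'
  proof (rule connected_local_const_abstract[OF TF(3) _ p(2,1)])
    fix x assume x: "x \<in> T"
    then obtain k U \<phi> \<epsilon> J where q: "nc_cube x k U \<phi> \<epsilon> J"
      using nc_cube_exists[of x "topspace X"] TF(1) by blast
    note q' = nc_cube_D[OF q]
    have "path_component_of (subtopology X T) x x'" if "x' \<in> U" "x' \<in> T" for x'
      by (rule path_component_of_mono[OF stratum_cube_path[OF q T x q'(2) x that] Int_lower2])
    then have "\<forall>x'\<in>U \<inter> T. path_component_of (subtopology X T) p x' = path_component_of (subtopology X T) p x"
      using path_component_of_trans path_component_of_sym by (metis IntD1 IntD2)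
    then show "\<exists>U\<in>nbhds_of X x. \<forall>p'\<in>U \<inter> T. path_component_of (subtopology X T) p p' = path_component_of (subtopology X T) p x"
      using q'(2,10) by (intro bexI[of _ U]) (auto simp: nbhds_of_iff)
  qed
  moreover have "path_component_of (subtopology X T) p p" if "p \<in> T" for p
    using that TF(1) by (auto simp: path_component_of_refl)
  ultimately have "path_connected_space (subtopology X T)"
    unfolding path_connected_space_iff_path_component by simp
  then show ?thesis using TF(1) by (simp add: path_connectedin_def)
qed

text \<open>If \<open>S\<close> meets the cube, surjectivity of evaluation produces a germ of
  \<open>S\<close> at \<open>p'\<close>, and such a germ has points of \<open>S\<close> in every
  neighbourhood of \<open>p'\<close>.\<close>

lemma closure_cube:
  assumes q: "nc_cube p k U \<phi> \<epsilon> J" and S: "face_union S" and p': "p' \<in> U" "\<And>i. i < k \<Longrightarrow> \<phi> p' i = 0"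
    and ne: "S \<inter> U \<noteq> {}"
  shows "p' \<in> X closure_of S"
proof -
  note q' = nc_cube_D[OF q]
  have U: "U \<in> nbhds_of X p'" using p'(1) q'(10) by (simp add: nbhds_of_iff)
  have "saturated k U \<phi> S" using S q unfolding face_union_def by blast
  note bij = eval_bij[OF q this p']
  obtain x where x: "x \<in> S" "x \<in> U" using ne by blast
  then have "path_component_of_set (subtopology X (U \<inter> S)) x \<in> path_components_of (subtopology X (U \<inter> S))"
    using q'(11) by (auto simp: path_component_in_path_components_of)
  then obtain c where c: "c \<in> lim_pi0 X S p'" using bij by (auto simp: bij_betw_def)
  have "\<exists>y. y \<in> S \<and> y \<in> V" if "p' \<in> V" "openin X V" for V
  proof -
    have V: "V \<in> nbhds_of X p'" using that by (simp add: nbhds_of_iff)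
    show ?thesis using lim_pi0_nonempty[OF c V] lim_pi0_subset[OF c V] by blast
  qed
  then show ?thesis using q'(11) p'(1) by (auto simp: in_closure_of)
qed

text \<open>For points of \<open>T\<close> in a cube, lying in the closure of \<open>S\<close> means
  that \<open>S\<close> meets the cube. So it is a locally constant property on the connected set
  \<open>T\<close>.\<close>

lemma frontier:
  assumes T: "T \<in> strata n X A D'" and S: "face_union S" and p: "p \<in> T" "p \<in> X closure_of S"
  shows "T \<subseteq> X closure_of S"
proof
  fix p' assume p': "p' \<in> T"
  have "(p' \<in> X closure_of S) = (p \<in> X closure_of S)"
  proof (rule connected_local_const_abstract[OF strata_facts(3)[OF T] _ p' p(1)])
    fix x assume x: "x \<in> T"
    then obtain k U \<phi> \<epsilon> J where q: "nc_cube x k U \<phi> \<epsilon> J"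
      using nc_cube_exists[of x "topspace X"] strata_facts(1)[OF T] by blast
    note q' = nc_cube_D[OF q]
    have "x' \<in> X closure_of S \<longleftrightarrow> S \<inter> U \<noteq> {}" if x': "x' \<in> U" "x' \<in> T" for x'
    proof
      show "S \<inter> U \<noteq> {}" if "x' \<in> X closure_of S" using that x'(1) q'(10) by (auto simp: in_closure_of)
      show "x' \<in> X closure_of S" if "S \<inter> U \<noteq> {}"
        by (rule closure_cube[OF q S x'(1) _ that]) (use stratum_cube[OF q T x] x' in blast)
    qed
    then have "\<forall>x'\<in>U \<inter> T. (x' \<in> X closure_of S) = (x \<in> X closure_of S)" using q'(2) x by simp
    then show "\<exists>U\<in>nbhds_of X x. \<forall>x'\<in>U \<inter> T. (x' \<in> X closure_of S) = (x \<in> X closure_of S)"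
      using q'(2,10) by (intro bexI[of _ U]) (auto simp: nbhds_of_iff)
  qed
  then show "p' \<in> X closure_of S" using p(2) by simp
qed

lemma strata_D:
  assumes S: "S \<in> strata n X A D'" and p: "p \<in> S" "p \<in> D"
  shows "S \<subseteq> D"
proof
  fix p' assume p': "p' \<in> S"
  have "(p' \<in> D) = (p \<in> D)"
  proof (rule connected_local_const_abstract[OF strata_facts(3)[OF S] _ p' p(1)])
    fix x assume x: "x \<in> S"
    then obtain k U \<phi> \<epsilon> J where q: "nc_cube x k U \<phi> \<epsilon> J"
      using nc_cube_exists[of x "topspace X"] strata_facts(1)[OF S] by blast
    note q' = nc_cube_D[OF q]
    have "x' \<in> D \<longleftrightarrow> J \<noteq> {}" if x': "x' \<in> U" "x' \<in> S" for x'
    proof -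
      have "\<forall>i\<in>J. \<phi> x' i = 0" using stratum_cube[OF q S x] x' q'(8) by blast
      then show ?thesis using q'(9)[OF x'(1)] by blast
    qed
    then have "\<forall>x'\<in>U \<inter> S. (x' \<in> D) = (x \<in> D)" using q'(2) x by simp
    then show "\<exists>U\<in>nbhds_of X x. \<forall>x'\<in>U \<inter> S. (x' \<in> D) = (x \<in> D)"
      using q'(2,10) by (intro bexI[of _ U]) (auto simp: nbhds_of_iff)
  qed
  then show "p' \<in> D" using p(2) by simp
qed

text \<open>In a cube centred at \<open>p\<close> the stratum is a coordinate slice, hence has one
  path component, and evaluation on the cube is injective.\<close>

lemma int_end_unique:
  assumes S: "S \<in> strata n X A D'" and p: "p \<in> S" and e: "e \<in> lim_pi0 X S p"
  shows "e = int_end X S p"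
proof -
  have pt: "p \<in> topspace X" using strata_facts(1)[OF S] p by blast
  obtain k U \<phi> \<epsilon> J where q: "nc_cube p k U \<phi> \<epsilon> J"
    using nc_cube_exists[of p "topspace X"] pt by blast
  note q' = nc_cube_D[OF q]
  have U: "U \<in> nbhds_of X p" using q'(2,10) by (simp add: nbhds_of_iff)
  note i = int_end_lim[OF p pt]
  have "bij_betw (\<lambda>c. c U) (lim_pi0 X S p) (path_components_of (subtopology X (U \<inter> S)))"
    by (rule eval_bij[OF q strata_saturated[OF q S] q'(2)]) (simp add: q'(3))
  then have inj: "inj_on (\<lambda>c. c U) (lim_pi0 X S p)" by (simp add: bij_betw_def)
  obtain x where x: "x \<in> e U" using lim_pi0_nonempty[OF e U] by blast
  then have xU: "x \<in> U" "x \<in> S" using lim_pi0_subset[OF e U] by blast+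
  have "x \<in> int_end X S p U"
    using stratum_cube_path[OF q S p q'(2) p xU] U by (simp add: int_end_def)
  then have "e U = int_end X S p U" by (rule lim_pi0_agree[OF e i U U x])
  then show ?thesis using inj_onD[OF inj _ e i] by blast
qed

text \<open>A point off \<open>D'\<close> has a cube contained in its own stratum, and
  \<open>S\<close> would meet that cube. The lemma guarantees small charts at all points of
  \<open>T\<close>, on which \<open>orthant_map\<close> relies.\<close>

lemma pos_codim:
  assumes S: "S \<in> strata n X A D'" and T: "T \<in> strata n X A D'" and TS: "T \<noteq> S" "T \<subseteq> X closure_of S" and p: "p \<in> T"
  shows "p \<in> D'"
proof (rule ccontr)
  assume nD: "p \<notin> D'"
  have pt: "p \<in> topspace X" using strata_facts(1)[OF T] p by blast
  obtain k U \<phi> \<epsilon> J where q: "nc_cube p k U \<phi> \<epsilon> J"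
    using nc_cube_exists[of p "topspace X"] pt by blast
  note q' = nc_cube_D[OF q]
  have "k = 0" using q'(7)[OF q'(2)] nD q'(3) by (metis gr0I)
  then have "U \<subseteq> T" using stratum_cube[OF q T p] by blast
  moreover have "p \<in> X closure_of S" using TS(2) p by blast
  then have "S \<inter> U \<noteq> {}" using q'(2,10) by (auto simp: in_closure_of)
  ultimately show False using strata_disjoint[OF S T] TS(1) by blast
qed

lemma nc_cube_nbhd:
  assumes "p \<in> topspace X" "V \<in> nbhds_of X p"
  shows "\<exists>k U \<phi> \<epsilon> J. nc_cube p k U \<phi> \<epsilon> J \<and> U \<subseteq> V \<and> (p \<in> D' \<longrightarrow> 1 \<le> k)"
proof -
  have "openin X V" "p \<in> V" using assms(2) by (simp_all add: nbhds_of_iff)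
  from nc_cube_exists[OF assms(1) this] show ?thesis .
qed

text \<open>On \<open>V\<close> the pushed germ depends on the end only through its component at
  \<open>V\<close>, and this component is constant along \<open>T\<close> inside a cube contained in
  \<open>V\<close>.\<close>

lemma push_stratum:
  assumes T: "T \<in> strata n X A D'" and e: "e \<in> lim_pi0_stratum X S T" and q: "q \<in> lim_pi0_stratum X B S"
  shows "(\<lambda>p\<in>T. push X q p (e p)) \<in> lim_pi0_stratum X B T"
  unfolding lim_pi0_stratum_def
proof (intro CollectI conjI allI impI)
  note TF = strata_facts[OF T]
  have pl: "push X q p (e p) \<in> lim_pi0 X B p" if "p \<in> T" for p
    by (rule push_lim[OF lim_pi0_stratum_at[OF e that] q])
  then show "(\<lambda>p\<in>T. push X q p (e p)) \<in> (\<Pi>\<^sub>E p\<in>T. lim_pi0 X B p)" by auto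
  fix \<gamma> assume g: "pathin (subtopology X T) \<gamma>"
  have gT: "\<gamma> t \<in> T" if "t \<in> {0..1}" for t by (rule pathin_T[OF g that])
  have "lcs X B {0..1} \<gamma> (\<lambda>t. push X q (\<gamma> t) (e (\<gamma> t)))"
    unfolding lcs_def
  proof (intro conjI ballI)
    fix t :: real assume t: "t \<in> {0..1}"
    show "push X q (\<gamma> t) (e (\<gamma> t)) \<in> lim_pi0 X B (\<gamma> t)" by (rule pl[OF gT[OF t]])
    fix V assume V: "V \<in> nbhds_of X (\<gamma> t)"
    obtain k U \<phi> \<epsilon> J where c: "nc_cube (\<gamma> t) k U \<phi> \<epsilon> J" "U \<subseteq> V"
      using nc_cube_nbhd[OF subsetD[OF TF(1) gT[OF t]] V] by blast
    note c' = nc_cube_D[OF c(1)]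
    have "continuous_map (top_of_set {0..1}) X \<gamma>"
      using g by (simp add: pathin_def continuous_map_in_subtopology)
    from openin_continuous_map_preimage[OF this c'(10)]
    obtain S' where S': "open S'" "{s \<in> {0..1}. \<gamma> s \<in> U} = {0..1} \<inter> S'" by (auto simp: openin_open)
    have "\<gamma> s \<in> V \<and> push X q (\<gamma> s) (e (\<gamma> s)) V = push X q (\<gamma> t) (e (\<gamma> t)) V" if s: "s \<in> S' \<inter> {0..1}" for s
    proof -
      have sU: "\<gamma> s \<in> U" "s \<in> {0..1}" using S'(2) s by blast+
      have Vs: "V \<in> nbhds_of X (\<gamma> s)" using V sU(1) c(2) by (auto simp: nbhds_of_iff)
      have "path_component_of (subtopology X (U \<inter> T)) (\<gamma> s) (\<gamma> t)"
        by (rule stratum_cube_path[OF c(1) T gT[OF t] sU(1) gT[OF sU(2)] c'(2) gT[OF t]])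
      then have "path_component_of (subtopology X (V \<inter> T)) (\<gamma> s) (\<gamma> t)"
        by (rule path_component_of_mono) (use c(2) in blast)
      then have eq: "e (\<gamma> s) V = e (\<gamma> t) V"
        using lim_pi0_stratum_const[OF e] V by (simp add: nbhds_of_iff)
      have es: "e (\<gamma> s) \<in> lim_pi0 X S (\<gamma> s)" "e (\<gamma> t) \<in> lim_pi0 X S (\<gamma> t)"
        using lim_pi0_stratum_at[OF e] gT[OF sU(2)] gT[OF t] by blast+
      obtain p' where p': "p' \<in> e (\<gamma> s) V" using lim_pi0_nonempty[OF es(1) Vs] by blast
      have "push X q (\<gamma> s) (e (\<gamma> s)) V = q p' V" by (rule push_eq[OF es(1) q Vs p'])
      moreover have "push X q (\<gamma> t) (e (\<gamma> t)) V = q p' V"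
        by (rule push_eq[OF es(2) q V]) (use p' eq in simp)
      ultimately show ?thesis using Vs by (simp add: nbhds_of_iff)
    qed
    moreover have "t \<in> S'" using S'(2) t c'(2) by blast
    ultimately show "\<exists>S. open S \<and> t \<in> S \<and>
        (\<forall>y'\<in>S \<inter> {0..1}. \<gamma> y' \<in> V \<and> push X q (\<gamma> y') (e (\<gamma> y')) V = push X q (\<gamma> t) (e (\<gamma> t)) V)"
      using S'(1) by blast
  qed
  then show "transport X B \<gamma> ((\<lambda>p\<in>T. push X q p (e p)) (\<gamma> 0)) ((\<lambda>p\<in>T. push X q p (e p)) (\<gamma> 1))"
    unfolding transport_iff using gT[of 0] gT[of 1]
    by (intro exI[of _ "\<lambda>t. push X q (\<gamma> t) (e (\<gamma> t))"]) simp
qed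

text \<open>Existence for the definite description is \<open>push_eq\<close>. Uniqueness holds
  because small charts at the points of \<open>T\<close> are arbitrarily small, and the value on a
  small chart determines the value on every larger neighbourhood.\<close>

lemma orthant_map_eq:
  assumes S: "S \<in> strata n X A D'" and T: "T \<in> strata n X A D'" and TS: "T \<noteq> S" "T \<subseteq> X closure_of S"
    and e: "e \<in> lim_pi0_stratum X S T" and q: "q \<in> orthants X D S"
  shows "orthant_map n X A D D' T e q = (\<lambda>p\<in>T. push X q p (e p))"
  unfolding orthant_map_def
proof (rule the_equality)
  have small: "U \<in> nbhds_of X p" if "small_nc_chart n X A D D' p U \<phi>" for p U \<phi>
    using that smooth_charts_D(1)[OF M, of U \<phi>] unfolding small_nc_chart_def nc_chart_def by (auto simp: nbhds_of_iff)
  show "(\<lambda>p\<in>T. push X q p (e p)) \<in> orthants X D T \<and>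
    (\<forall>p\<in>T. \<forall>U \<phi>. small_nc_chart n X A D D' p U \<phi> \<longrightarrow> (\<forall>p'\<in>e p U. (\<lambda>p\<in>T. push X q p (e p)) p U = q p' U))"
    using push_stratum[OF T e q] push_eq[OF lim_pi0_stratum_at[OF e] q small] by simp
  fix \<tau> assume \<tau>: "\<tau> \<in> orthants X D T \<and>
    (\<forall>p\<in>T. \<forall>U \<phi>. small_nc_chart n X A D D' p U \<phi> \<longrightarrow> (\<forall>p'\<in>e p U. \<tau> p U = q p' U))"
  show "\<tau> = (\<lambda>p\<in>T. push X q p (e p))"
  proof (rule PiE_ext)
    show "\<tau> \<in> (\<Pi>\<^sub>E p\<in>T. lim_pi0 X (topspace X - D) p)" using \<tau> lim_pi0_stratum_PiE by blast
    show "(\<lambda>p\<in>T. push X q p (e p)) \<in> (\<Pi>\<^sub>E p\<in>T. lim_pi0 X (topspace X - D) p)"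
      by (rule lim_pi0_stratum_PiE[OF push_stratum[OF T e q]])
    fix p assume p: "p \<in> T"
    have ep: "e p \<in> lim_pi0 X S p" by (rule lim_pi0_stratum_at[OF e p])
    have tp: "\<tau> p \<in> lim_pi0 X (topspace X - D) p" by (rule lim_pi0_stratum_at[OF \<tau>[THEN conjunct1] p])
    have pp: "push X q p (e p) \<in> lim_pi0 X (topspace X - D) p" by (rule push_lim[OF ep q])
    have "\<tau> p = push X q p (e p)"
    proof (rule lim_pi0_ext[OF tp pp])
      fix V assume V: "V \<in> nbhds_of X p"
      have "p \<in> D'" by (rule pos_codim[OF S T TS p])
      then obtain k U \<phi> \<epsilon> J where c: "nc_cube p k U \<phi> \<epsilon> J" "U \<subseteq> V" "1 \<le> k"
        using nc_cube_nbhd[OF subsetD[OF strata_facts(1)[OF T] p] V] by blast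
      have sm: "small_nc_chart n X A D D' p U \<phi>" by (rule nc_cube_small[OF c(1,3)])
      note U = small[OF sm]
      obtain p' where p': "p' \<in> e p U" using lim_pi0_nonempty[OF ep U] by blast
      have "\<tau> p U = q p' U" using \<tau>[THEN conjunct2, rule_format, OF p sm p'] .
      moreover have "push X q p (e p) U = q p' U" by (rule push_eq[OF ep q U p'])
      ultimately have "\<tau> p U = push X q p (e p) U" by simp
      then show "\<tau> p V = push X q p (e p) V"
        by (rule lim_pi0_agree_mono[OF tp pp U U V V c(2)])
    qed
    then show "\<tau> p = (\<lambda>p\<in>T. push X q p (e p)) p" using p by simp
  qed
qed

section \<open>Orthants of a cube\<close>

lemma compl_component_signs:
  assumes q: "nc_cube p k U \<phi> \<epsilon> J" and C: "C \<in> path_components_of (subtopology X (U \<inter> (topspace X - D)))"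
    and xy: "x \<in> C" "y \<in> C" and i: "i \<in> J"
  shows "sgn (\<phi> x i) = sgn (\<phi> y i)"
proof -
  note q' = nc_cube_D[OF q]
  have CU: "C \<subseteq> U" "C \<inter> D = {}" using path_components_of_subset[OF C] by auto
  have cn: "connectedin (subtopology X U) C"
    using path_connectedin_imp_connectedin[OF path_connectedin_path_components_of[OF C]] CU
    by (auto simp: connectedin_subtopology)
  have c\<phi>: "continuous_map (subtopology X U) (Euclidean_space n) \<phi>"
    using homeomorphic_imp_continuous_map[OF smooth_charts_D(3)[OF M q'(1)]] by (simp add: continuous_map_in_subtopology)
  have "continuous_map (subtopology X U) euclideanreal (\<lambda>x. \<phi> x i)"
    using continuous_map_compose[OF c\<phi> continuous_map_Euclidean_coord[of n i]] by (simp add: o_def)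
  from connectedin_continuous_map_image[OF this cn]
  have con: "connected ((\<lambda>x. \<phi> x i) ` C)" by simp
  have nz: "0 \<notin> (\<lambda>x. \<phi> x i) ` C"
  proof
    assume "0 \<in> (\<lambda>x. \<phi> x i) ` C"
    then obtain z where z: "z \<in> C" "\<phi> z i = 0" by auto
    then have "z \<in> D" using q'(9)[of z] CU(1) i by blast
    then show False using CU(2) z(1) by blast
  qed
  have mem: "\<phi> x i \<in> (\<lambda>x. \<phi> x i) ` C" "\<phi> y i \<in> (\<lambda>x. \<phi> x i) ` C" using xy by blast+
  have "\<not> (\<phi> x i \<le> 0 \<and> 0 \<le> \<phi> y i)" using connectedD_interval[OF con mem] nz by blast
  moreover have "\<not> (\<phi> y i \<le> 0 \<and> 0 \<le> \<phi> x i)" using connectedD_interval[OF con mem(2,1)] nz by blast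
  ultimately show ?thesis by (auto simp: sgn_if)
qed

lemma compl_component_segment:
  assumes q: "nc_cube p k U \<phi> \<epsilon> J" and xy: "x \<in> U" "y \<in> U" and x: "x \<notin> D"
    and s: "\<And>i. i \<in> J \<Longrightarrow> sgn (\<phi> x i) = sgn (\<phi> y i)" and t: "0 \<le> t" "t \<le> 1"
  shows "pt U \<phi> (\<lambda>i. (1 - t) * \<phi> x i + t * \<phi> y i) \<in> U \<inter> (topspace X - D)"
proof -
  note q' = nc_cube_D[OF q]
  let ?z = "pt U \<phi> (\<lambda>i. (1 - t) * \<phi> x i + t * \<phi> y i)"
  note z = pt_cube[OF q segment_in_cube[OF q xy t]]
  have "\<phi> ?z i \<noteq> 0" if i: "i \<in> J" for i
  proof -
    have "\<phi> x i \<noteq> 0" using x q'(9)[OF xy(1)] i by blast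
    then have "sgn (\<phi> ?z i) \<noteq> 0" unfolding z(2) using sgn_convex[OF s[OF i] t] by (simp add: sgn_0_0)
    then show ?thesis by auto
  qed
  then have "?z \<notin> D" using q'(9)[OF z(1)] by blast
  then show ?thesis using z(1) q'(11) by blast
qed

text \<open>Off \<open>D\<close> the coordinates in \<open>J\<close> do not vanish, so their signs
  are constant on a component; equal signs are joined by a segment off \<open>D\<close>.\<close>

lemma compl_component_iff:
  assumes q: "nc_cube p k U \<phi> \<epsilon> J" and C: "C \<in> path_components_of (subtopology X (U \<inter> (topspace X - D)))"
    and x: "x \<in> C" and y: "y \<in> U"
  shows "y \<in> C \<longleftrightarrow> (\<forall>i\<in>J. sgn (\<phi> x i) = sgn (\<phi> y i))"
proof
  show "\<forall>i\<in>J. sgn (\<phi> x i) = sgn (\<phi> y i)" if "y \<in> C"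
    using compl_component_signs[OF q C x that] by blast
  assume s: "\<forall>i\<in>J. sgn (\<phi> x i) = sgn (\<phi> y i)"
  have xU: "x \<in> U" "x \<notin> D" using path_components_of_subset[OF C] x by auto
  have "path_component_of (subtopology X (U \<inter> (topspace X - D))) x y"
    by (rule segment_path[OF q xU(1) y]) (rule compl_component_segment[OF q xU(1) y xU(2)], use s in auto)
  then show "y \<in> C" by (rule path_comps_closed[OF C x])
qed

text \<open>In coordinates an orthant meets any box in a convex set.\<close>

lemma compl_component_box:
  assumes q: "nc_cube p k U \<phi> \<epsilon> J" and C: "C \<in> path_components_of (subtopology X (U \<inter> (topspace X - D)))"
  shows "path_connectedin X (C \<inter> coord_box U \<phi> p' d)"
proof -
  let ?N = "coord_box U \<phi> p' d"
  have CU: "C \<subseteq> U" "C \<inter> D = {}" "C \<subseteq> topspace X" using path_components_of_subset[OF C] by auto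
  have "path_component_of (subtopology X (C \<inter> ?N)) x y" if x: "x \<in> C \<inter> ?N" and y: "y \<in> C \<inter> ?N" for x y
  proof -
    have xU: "x \<in> U" "y \<in> U" "x \<in> C" "y \<in> C" using x y by blast+
    have s: "sgn (\<phi> x i) = sgn (\<phi> y i)" if "i \<in> J" for i
      by (rule compl_component_signs[OF q C xU(3,4) that])
    show ?thesis
    proof (rule segment_path[OF q xU(1,2)])
      fix t :: real assume t: "0 \<le> t" "t \<le> 1"
      let ?z = "pt U \<phi> (\<lambda>i. (1 - t) * \<phi> x i + t * \<phi> y i)"
      note z = pt_cube[OF q segment_in_cube[OF q xU(1,2) t]]
      have "sgn (\<phi> x i) = sgn (\<phi> ?z i)" if "i \<in> J" for i
        unfolding z(2) using sgn_convex[OF s[OF that] t] by simp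
      then have "?z \<in> C" using compl_component_iff[OF q C xU(3) z(1)] by blast
      moreover have "\<bar>\<phi> ?z i - \<phi> p' i\<bar> < d" if "i < n" for i
      proof -
        have "\<phi> ?z i - \<phi> p' i = (1 - t) * (\<phi> x i - \<phi> p' i) + t * (\<phi> y i - \<phi> p' i)"
          unfolding z(2) by (simp add: algebra_simps)
        moreover have "\<bar>(1 - t) * (\<phi> x i - \<phi> p' i) + t * (\<phi> y i - \<phi> p' i)\<bar> < d"
          by (rule abs_convex_less) (use x y that t in auto)
        ultimately show ?thesis by simp
      qed
      ultimately show "?z \<in> C \<inter> ?N" using z(1) by blast
    qed
  qed
  then have "path_connected_space (subtopology X (C \<inter> ?N))"
    unfolding path_connected_space_iff_path_component by simp
  then show ?thesis using CU(3) unfolding path_connectedin_def by blast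
qed

text \<open>\<open>eval_bij\<close> reaches only points with vanishing crossing coordinates. For
  orthants, convexity gives injectivity at every point of the cube; the image then consists of the
  orthants adjacent to \<open>p'\<close>.\<close>

lemma compl_eval_inj:
  assumes q: "nc_cube p k U \<phi> \<epsilon> J" and p': "p' \<in> U"
  shows "inj_on (\<lambda>c. c U) (lim_pi0 X (topspace X - D) p')"
proof (rule lim_pi0_eval_inj)
  show "U \<in> nbhds_of X p'" using nc_cube_D(10)[OF q] p' by (simp add: nbhds_of_iff)
  fix V assume "V \<in> nbhds_of X p'"
  then obtain d where d: "d > 0" "coord_box U \<phi> p' d \<in> nbhds_of X p'" "coord_box U \<phi> p' d \<subseteq> V"
    using box_nbhd[OF q p'] by blast
  then show "\<exists>N\<in>nbhds_of X p'. N \<subseteq> V \<and> N \<subseteq> U \<and>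
      (\<forall>C\<in>path_components_of (subtopology X (U \<inter> (topspace X - D))). path_connectedin X (C \<inter> N))"
    using compl_component_box[OF q] by (intro bexI[of _ "coord_box U \<phi> p' d"]) auto
qed

text \<open>A face lies in one component of one stratum, so a component is determined by the sign
  vector of any of its points, and there are at most \<open>3 ^ k\<close> sign vectors.\<close>

lemma finite_cube_components:
  assumes q: "nc_cube p k U \<phi> \<epsilon> J"
  shows "finite {C. \<exists>S\<in>strata n X A D'. C \<in> path_components_of (subtopology X (U \<inter> S))}" (is "finite ?K")
proof -
  note q' = nc_cube_D[OF q]
  let ?s = "\<lambda>x. \<lambda>i\<in>{..<k}. sgn (\<phi> x i)"
  define f where "f = (\<lambda>v. SOME C. C \<in> ?K \<and> (\<exists>x\<in>C. ?s x = v))"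
  have "?K \<subseteq> f ` ({..<k} \<rightarrow>\<^sub>E {-1, 0, 1})"
  proof
    fix C assume CK: "C \<in> ?K"
    then obtain S where S: "S \<in> strata n X A D'" "C \<in> path_components_of (subtopology X (U \<inter> S))" by blast
    obtain x where x: "x \<in> C" using nonempty_path_components_of[OF S(2)] by blast
    have xU: "x \<in> U" "x \<in> S" using path_components_of_subset[OF S(2)] x by auto
    define C' where "C' = f (?s x)"
    have "C' \<in> ?K \<and> (\<exists>y\<in>C'. ?s y = ?s x)"
      unfolding C'_def f_def by (rule someI[of _ C]) (use CK x in blast)
    then obtain S' y where S': "S' \<in> strata n X A D'" "C' \<in> path_components_of (subtopology X (U \<inter> S'))"
      and y: "y \<in> C'" "?s y = ?s x" by blast
    have yU: "y \<in> U" "y \<in> S'" using path_components_of_subset[OF S'(2)] y(1) by auto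
    have "same_signs k \<phi> x y"
      unfolding same_signs_def
    proof (intro allI impI)
      fix i assume "i < k"
      then show "sgn (\<phi> x i) = sgn (\<phi> y i)" using fun_cong[OF y(2), of i] by simp
    qed
    then have pc: "path_component_of (subtopology X (U \<inter> S)) x y"
      by (rule saturated_segment[OF q strata_saturated[OF q S(1)] xU(1) yU(1) _ xU(2)])
    then have "y \<in> C" by (rule path_comps_closed[OF S(2) x])
    then have "y \<in> S" using path_components_of_subset[OF S(2)] by auto
    then have "S = S'" using strata_disjoint[OF S(1) S'(1)] yU(2) by blast
    then have "C = C'" using path_comps_eq[OF S(2) _ \<open>y \<in> C\<close> y(1)] S'(2) by simp
    moreover have "?s x \<in> {..<k} \<rightarrow>\<^sub>E {-1, 0, 1}" by (auto simp: sgn_if)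
    ultimately show "C \<in> f ` ({..<k} \<rightarrow>\<^sub>E {-1, 0, 1})" unfolding C'_def by blast
  qed
  moreover have "finite ({..<k} \<rightarrow>\<^sub>E {-1, 0, 1 :: real})" by (intro finite_PiE) auto
  ultimately show ?thesis by (rule finite_surj[rotated])
qed

end

section \<open>The real-oriented blow-up\<close>

lemma topspace_cut_line: "topspace cut_line = {(b, r). if b then 0 \<le> r else r \<le> 0}"
  by (auto simp: cut_line_def topspace_sum_topology split: if_splits)

lemma topspace_cut_model:
  "topspace (cut_model n k) = (\<Pi>\<^sub>E i\<in>{..<k}. topspace cut_line) \<times> topspace (Euclidean_space (n - k))"
  by (simp add: cut_model_def topspace_product_topology)

lemma cut_line_nbhd:
  assumes "openin cut_line W" "w \<in> W"
  shows "\<exists>d>0. \<forall>v\<in>topspace cut_line. fst v = fst w \<and> \<bar>snd v - snd w\<bar> < d \<longrightarrow> v \<in> W"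
proof -
  let ?b = "fst w"
  let ?T = "if ?b then {0..} else {..0::real}"
  have "openin (top_of_set ?T) {r. (?b, r) \<in> W}"
    using assms(1) unfolding cut_line_def openin_sum_topology by blast
  then obtain O' where O': "open O'" "{r. (?b, r) \<in> W} = ?T \<inter> O'" by (auto simp: openin_open)
  have "snd w \<in> O'" using O'(2) assms(2) by (metis IntD2 mem_Collect_eq prod.collapse)
  then obtain d where d: "d > 0" "\<forall>r. \<bar>r - snd w\<bar> < d \<longrightarrow> r \<in> O'"
    using O'(1) by (auto simp: open_dist dist_real_def)
  have "v \<in> W" if v: "v \<in> topspace cut_line" "fst v = ?b" "\<bar>snd v - snd w\<bar> < d" for v
  proof -
    have "snd v \<in> ?T" using v(1,2) by (cases v) (auto simp: topspace_cut_line split: if_splits)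
    moreover have "snd v \<in> O'" using d(2) v(3) by blast
    ultimately have "(?b, snd v) \<in> W" using O'(2) by blast
    then show ?thesis using v(2) by (cases v) simp
  qed
  then show ?thesis using d(1) by blast
qed

lemma cut_line_tag_open: "openin cut_line {w \<in> topspace cut_line. fst w = b}"
proof -
  have eq: "{w \<in> topspace cut_line. fst w = b} = Sigma UNIV (\<lambda>b'. if b' = b then (if b then {0..} else {..0}) else {})"
    by (auto simp: topspace_cut_line split: if_splits)
  show ?thesis
    unfolding eq unfolding cut_line_def openin_sum_topology by (auto split: if_splits)
qed

text \<open>For \<open>i < k\<close> this is the half-line on which coordinate \<open>i\<close>
  lies; off the hyperplane it is the sign.\<close>

definition cut_tags :: "((nat \<Rightarrow> bool \<times> real) \<times> (nat \<Rightarrow> real)) \<Rightarrow> nat \<Rightarrow> bool" where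
  "cut_tags z i = fst (fst z i)"

lemma cut_tags_open:
  "openin (cut_model n k) {z \<in> topspace (cut_model n k). \<forall>i<k. cut_tags z i = t i}"
proof -
  have "openin (cut_model n k) {z \<in> topspace (cut_model n k). \<forall>i<m. cut_tags z i = t i}" if "m \<le> k" for m
    using that
  proof (induction m)
    case 0
    then show ?case by simp
  next
    case (Suc m)
    then have mk: "m \<in> {..<k}" by simp
    have "continuous_map (cut_model n k) (product_topology (\<lambda>_. cut_line) {..<k}) fst"
      unfolding cut_model_def by (rule continuous_map_fst)
    from continuous_map_compose[OF this continuous_map_product_projection[OF mk]]
    have "continuous_map (cut_model n k) cut_line (\<lambda>z. fst z m)" by (simp add: o_def)
    from openin_continuous_map_preimage[OF this cut_line_tag_open[of "t m"]]
    have "openin (cut_model n k) {z \<in> topspace (cut_model n k). fst z m \<in> {w \<in> topspace cut_line. fst w = t m}}" .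
    from openin_Int[OF Suc.IH this] Suc.prems
    have "openin (cut_model n k) ({z \<in> topspace (cut_model n k). \<forall>i<m. cut_tags z i = t i} \<inter>
       {z \<in> topspace (cut_model n k). fst z m \<in> {w \<in> topspace cut_line. fst w = t m}})" by simp
    moreover have "{z \<in> topspace (cut_model n k). \<forall>i<m. cut_tags z i = t i} \<inter>
       {z \<in> topspace (cut_model n k). fst z m \<in> {w \<in> topspace cut_line. fst w = t m}} =
       {z \<in> topspace (cut_model n k). \<forall>i<Suc m. cut_tags z i = t i}"
      using mk by (auto simp: topspace_cut_model cut_tags_def less_Suc_eq)
    ultimately show ?case by simp
  qed
  then show ?thesis by blast
qed

lemma cut_model_nbhd:
  assumes k: "k \<le> n" and "openin (cut_model n k) W" "w \<in> W"
  shows "\<exists>d>0. \<forall>z\<in>topspace (cut_model n k). (\<forall>i<k. cut_tags z i = cut_tags w i) \<and>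
      (\<forall>i<n. \<bar>cut_map k z i - cut_map k w i\<bar> < d) \<longrightarrow> z \<in> W"
proof -
  obtain a b where w: "w = (a, b)" by (cases w)
  have "openin (prod_topology (product_topology (\<lambda>_. cut_line) {..<k}) (Euclidean_space (n - k))) W"
    using assms(2) by (simp add: cut_model_def)
  then have "\<exists>U V. openin (product_topology (\<lambda>_. cut_line) {..<k}) U \<and> openin (Euclidean_space (n - k)) V \<and>
      a \<in> U \<and> b \<in> V \<and> U \<times> V \<subseteq> W"
    using assms(3) w unfolding openin_prod_topology_alt by blast
  then obtain U V where U: "openin (product_topology (\<lambda>_. cut_line) {..<k}) U" "a \<in> U"
    and V: "openin (Euclidean_space (n - k)) V" "b \<in> V" and UV: "U \<times> V \<subseteq> W" by blast
  have "\<exists>P. finite {i \<in> {..<k}. P i \<noteq> topspace cut_line} \<and> (\<forall>i\<in>{..<k}. openin cut_line (P i)) \<and>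
      a \<in> Pi\<^sub>E {..<k} P \<and> Pi\<^sub>E {..<k} P \<subseteq> U"
    using U unfolding openin_product_topology_alt by blast
  then obtain P where P: "\<forall>i\<in>{..<k}. openin cut_line (P i)" "a \<in> Pi\<^sub>E {..<k} P" "Pi\<^sub>E {..<k} P \<subseteq> U" by blast
  have "\<exists>d>0. \<forall>v\<in>topspace cut_line. fst v = fst (a i) \<and> \<bar>snd v - snd (a i)\<bar> < d \<longrightarrow> v \<in> P i" if "i < k" for i
  proof (rule cut_line_nbhd)
    show "openin cut_line (P i)" using P(1) that by simp
    show "a i \<in> P i" using PiE_mem[OF P(2)] that by simp
  qed
  then obtain e where e: "\<And>i. i < k \<Longrightarrow> e i > 0"
    "\<And>i v. i < k \<Longrightarrow> v \<in> topspace cut_line \<Longrightarrow> fst v = fst (a i) \<Longrightarrow> \<bar>snd v - snd (a i)\<bar> < e i \<Longrightarrow> v \<in> P i"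
    by metis
  obtain d0 where d0: "d0 > 0" "\<forall>x\<in>topspace (Euclidean_space (n - k)). (\<forall>i<n - k. \<bar>x i - b i\<bar> < d0) \<longrightarrow> x \<in> V"
    using Euclidean_box_nbhd_ex[OF V] by blast
  define d where "d = Min (insert d0 (e ` {..<k}))"
  have d: "d > 0" "d \<le> d0" "\<And>i. i < k \<Longrightarrow> d \<le> e i"
    using d0(1) e(1) by (auto simp: d_def)
  have "z \<in> W" if z: "z \<in> topspace (cut_model n k)" and tg: "\<forall>i<k. cut_tags z i = cut_tags w i"
    and cl: "\<forall>i<n. \<bar>cut_map k z i - cut_map k w i\<bar> < d" for z
  proof -
    obtain x y where xy: "z = (x, y)" by (cases z)
    have x: "x \<in> (\<Pi>\<^sub>E i\<in>{..<k}. topspace cut_line)" and y: "y \<in> topspace (Euclidean_space (n - k))"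
      using z xy by (auto simp: topspace_cut_model)
    have "x \<in> Pi\<^sub>E {..<k} P"
    proof (rule PiE_I)
      fix i assume i: "i \<in> {..<k}"
      have "\<bar>cut_map k z i - cut_map k w i\<bar> < e i"
        using cl[rule_format, of i] i k d(3)[of i] by simp
      then show "x i \<in> P i"
        using e(2)[of i "x i"] i PiE_mem[OF x i] tg by (simp add: cut_tags_def cut_map_def xy w)
    next
      show "x i = undefined" if "i \<notin> {..<k}" for i using PiE_arb[OF x that] .
    qed
    moreover have "y \<in> V"
    proof (rule d0(2)[rule_format, OF y])
      fix i assume "i < n - k"
      \<comment> \<open>The last \<open>n - k\<close> coordinates of the model are numbered from 0
        and reappear in \<open>cut_map\<close> shifted by \<open>k\<close>.\<close>
      then have "\<bar>cut_map k z (i + k) - cut_map k w (i + k)\<bar> < d" using cl by simp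
      then show "\<bar>y i - b i\<bar> < d0" using d(2) by (simp add: cut_map_def xy w)
    qed
    ultimately show "z \<in> W" using UV P(3) xy by blast
  qed
  then show ?thesis using d(1) by blast
qed

locale nc_blowup = nc_pair +
  fixes Xt :: "'b topology" and \<alpha> :: "'b \<Rightarrow> 'a"
  assumes bl: "real_blowup n X A D Xt \<alpha>"
begin

text \<open>Cubes for \<open>D\<close> alone: there all the coordinates that define \<open>D\<close> come first, as in the model of the blow-up.\<close>

sublocale DD: nc_pair n X A D D
  using M ncD by unfold_locales auto

lemma alpha_continuous: "continuous_map Xt X \<alpha>"
  using bl by (simp add: real_blowup_def)

lemma alpha_top: "x \<in> topspace Xt \<Longrightarrow> \<alpha> x \<in> topspace X"
  using continuous_map_image_subset_topspace[OF alpha_continuous] by blast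

lemma alpha_preimage_open: "openin X U \<Longrightarrow> openin Xt {x \<in> topspace Xt. \<alpha> x \<in> U}"
  by (rule openin_continuous_map_preimage[OF alpha_continuous])

abbreviation "B \<equiv> topspace X - D"

lemma B_open: "openin X B"
  using ncD by (auto simp: nc_divisor_def)

lemma DD_cube_J:
  assumes "DD.nc_cube p k U \<phi> \<epsilon> J"
  shows "J = {..<k}"
proof
  show "J \<subseteq> {..<k}" by (rule DD.nc_cube_D(8)[OF assms])
  note q' = DD.nc_cube_D[OF assms]
  show "{..<k} \<subseteq> J"
  proof
    fix l assume l: "l \<in> {..<k}"
    \<comment> \<open>A generic point of the hyperplane \<open>l\<close>: it lies on
      \<open>D\<close>, and no index of \<open>J\<close> other than \<open>l\<close> can account for
      that.\<close>
    define y where "y = (\<lambda>j. if j < n \<and> j \<noteq> l then \<epsilon> / 2 else 0)"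
    have y: "y \<in> cube n \<epsilon>" using q'(4) by (auto simp: cube_def y_def topspace_Euclidean_space)
    note z = DD.pt_cube[OF assms y]
    have "\<phi> (DD.pt U \<phi> y) l = 0" unfolding z(2) by (simp add: y_def)
    then have "DD.pt U \<phi> y \<in> D" using q'(7)[OF z(1)] l by blast
    then obtain i where i: "i \<in> J" "y i = 0" using q'(9)[OF z(1)] unfolding z(2) by blast
    have "i < n" using i(1) q'(6,8) by auto
    then have "i = l" using i(2) q'(4) by (auto simp: y_def split: if_splits)
    then show "l \<in> J" using i(1) by simp
  qed
qed

lemma DD_cube_k0:
  assumes "DD.nc_cube p k U \<phi> \<epsilon> J" "p \<notin> D"
  shows "k = 0"
  using DD.nc_cube_D(2,3,7)[OF assms(1)] assms(2) by (metis gr0I)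

text \<open>\<open>g\<close> identifies the part of the blow-up over \<open>U\<close> with an open subset of the model over \<open>\<phi> ` U\<close>.\<close>

definition cut_coords :: "nat \<Rightarrow> 'a set \<Rightarrow> ('a \<Rightarrow> nat \<Rightarrow> real) \<Rightarrow> ('b \<Rightarrow> (nat \<Rightarrow> bool \<times> real) \<times> (nat \<Rightarrow> real)) \<Rightarrow> bool" where
  "cut_coords k U \<phi> g \<longleftrightarrow>
    (\<forall>x. x \<in> topspace Xt \<longrightarrow> \<alpha> x \<in> U \<longrightarrow> g x \<in> topspace (cut_model n k) \<and> cut_map k (g x) = \<phi> (\<alpha> x)) \<and>
    (\<forall>W. openin (cut_model n k) W \<longrightarrow> openin Xt {x \<in> topspace Xt. \<alpha> x \<in> U \<and> g x \<in> W}) \<and>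
    (\<forall>Q. openin Xt Q \<longrightarrow> (\<exists>W. openin (cut_model n k) W \<and> (\<forall>x\<in>topspace Xt. \<alpha> x \<in> U \<longrightarrow> (x \<in> Q \<longleftrightarrow> g x \<in> W)))) \<and>
    (\<forall>w. w \<in> topspace (cut_model n k) \<longrightarrow> cut_map k w \<in> \<phi> ` U \<longrightarrow> (\<exists>x\<in>topspace Xt. \<alpha> x \<in> U \<and> g x = w)) \<and>
    (\<forall>x y. x \<in> topspace Xt \<longrightarrow> \<alpha> x \<in> U \<longrightarrow> y \<in> topspace Xt \<longrightarrow> \<alpha> y \<in> U \<longrightarrow> g x = g y \<longrightarrow> x = y)"

lemma cut_coordsD:
  assumes "cut_coords k U \<phi> g"
  shows "\<And>x. x \<in> topspace Xt \<Longrightarrow> \<alpha> x \<in> U \<Longrightarrow> g x \<in> topspace (cut_model n k) \<and> cut_map k (g x) = \<phi> (\<alpha> x)"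
    "\<And>W. openin (cut_model n k) W \<Longrightarrow> openin Xt {x \<in> topspace Xt. \<alpha> x \<in> U \<and> g x \<in> W}"
    "\<And>Q. openin Xt Q \<Longrightarrow> \<exists>W. openin (cut_model n k) W \<and> (\<forall>x\<in>topspace Xt. \<alpha> x \<in> U \<longrightarrow> (x \<in> Q \<longleftrightarrow> g x \<in> W))"
    "\<And>w. w \<in> topspace (cut_model n k) \<Longrightarrow> cut_map k w \<in> \<phi> ` U \<Longrightarrow> \<exists>x\<in>topspace Xt. \<alpha> x \<in> U \<and> g x = w"
    "\<And>x y. x \<in> topspace Xt \<Longrightarrow> \<alpha> x \<in> U \<Longrightarrow> y \<in> topspace Xt \<Longrightarrow> \<alpha> y \<in> U \<Longrightarrow> g x = g y \<Longrightarrow> x = y"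
  using assms[unfolded cut_coords_def, THEN conjunct1]
    assms[unfolded cut_coords_def, THEN conjunct2, THEN conjunct1]
    assms[unfolded cut_coords_def, THEN conjunct2, THEN conjunct2, THEN conjunct1]
    assms[unfolded cut_coords_def, THEN conjunct2, THEN conjunct2, THEN conjunct2, THEN conjunct1]
    assms[unfolded cut_coords_def, THEN conjunct2, THEN conjunct2, THEN conjunct2, THEN conjunct2]
  by (simp_all only:)

section \<open>Points of the blow-up and orthants\<close>

lemma cut_chart:
  assumes q: "DD.nc_cube p k U \<phi> \<epsilon> J" and p: "p \<in> D"
  shows "\<exists>g. cut_coords k U \<phi> g"
proof -
  note q' = DD.nc_cube_D[OF q]
  have k: "1 \<le> k" using p q'(7)[OF q'(2)] by auto
  have "D \<inter> U = {x \<in> U. (\<Prod>i<k. \<phi> x i) = 0}" using q'(7) by auto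
  then have "nc_chart n X A D k p U \<phi>" using q' k by (simp add: nc_chart_def)
  moreover have "\<forall>k p U \<phi>. p \<in> D \<and> nc_chart n X A D k p U \<phi> \<longrightarrow>
        (\<exists>g. homeomorphic_map
               (subtopology Xt {x \<in> topspace Xt. \<alpha> x \<in> U})
               (subtopology (cut_model n k) {y \<in> topspace (cut_model n k). cut_map k y \<in> \<phi> ` U}) g \<and>
             (\<forall>x\<in>topspace Xt. \<alpha> x \<in> U \<longrightarrow> cut_map k (g x) = \<phi> (\<alpha> x)))"
    using bl unfolding real_blowup_def by (elim conjE)
  ultimately obtain g where g: "homeomorphic_map
               (subtopology Xt {x \<in> topspace Xt. \<alpha> x \<in> U})
               (subtopology (cut_model n k) {y \<in> topspace (cut_model n k). cut_map k y \<in> \<phi> ` U}) g"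
    and cg: "\<forall>x\<in>topspace Xt. \<alpha> x \<in> U \<longrightarrow> cut_map k (g x) = \<phi> (\<alpha> x)"
    using p by blast
  let ?P = "{x \<in> topspace Xt. \<alpha> x \<in> U}" and ?R = "{y \<in> topspace (cut_model n k). cut_map k y \<in> \<phi> ` U}"
  have tP: "topspace (subtopology Xt ?P) = ?P" and tR: "topspace (subtopology (cut_model n k) ?R) = ?R" by auto
  have img: "g ` ?P = ?R" using homeomorphic_imp_surjective_map[OF g] unfolding tP tR .
  have inj: "inj_on g ?P" using homeomorphic_imp_injective_map[OF g] unfolding tP .
  have Po: "openin Xt ?P" by (rule alpha_preimage_open[OF q'(10)])
  have "cut_coords k U \<phi> g"
    unfolding cut_coords_def
  proof (intro conjI allI impI)
    fix x assume "x \<in> topspace Xt" "\<alpha> x \<in> U"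
    then show "g x \<in> topspace (cut_model n k)" "cut_map k (g x) = \<phi> (\<alpha> x)" using img cg by blast+
  next
    fix W assume W: "openin (cut_model n k) W"
    have "continuous_map (subtopology Xt ?P) (cut_model n k) g"
      using homeomorphic_imp_continuous_map[OF g] by (simp add: continuous_map_in_subtopology)
    from openin_continuous_map_preimage[OF this W]
    have "openin (subtopology Xt ?P) {x \<in> ?P. g x \<in> W}" unfolding tP .
    then have "openin Xt {x \<in> ?P. g x \<in> W}" using Po openin_trans_full by blast
    moreover have "{x \<in> ?P. g x \<in> W} = {x \<in> topspace Xt. \<alpha> x \<in> U \<and> g x \<in> W}" by blast
    ultimately show "openin Xt {x \<in> topspace Xt. \<alpha> x \<in> U \<and> g x \<in> W}" by simp
  next
    fix Q assume Q: "openin Xt Q"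
    have "openin (subtopology Xt ?P) (Q \<inter> ?P)" using Q by (simp add: openin_subtopology_Int)
    then have "openin (subtopology (cut_model n k) ?R) (g ` (Q \<inter> ?P))"
      using homeomorphic_imp_open_map[OF g] unfolding open_map_def by blast
    then obtain W where W: "openin (cut_model n k) W" "g ` (Q \<inter> ?P) = W \<inter> ?R"
      unfolding openin_subtopology by blast
    have "x \<in> Q \<longleftrightarrow> g x \<in> W" if x: "x \<in> ?P" for x
    proof
      show "g x \<in> W" if "x \<in> Q" using W(2) that x by blast
      assume "g x \<in> W"
      moreover have "g x \<in> ?R" using img x by blast
      ultimately obtain y where y: "y \<in> Q \<inter> ?P" "g x = g y" using W(2) by blast
      then have "x = y" using inj_onD[OF inj y(2) x] by blast
      then show "x \<in> Q" using y by blast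
    qed
    then show "\<exists>W. openin (cut_model n k) W \<and> (\<forall>x\<in>topspace Xt. \<alpha> x \<in> U \<longrightarrow> (x \<in> Q \<longleftrightarrow> g x \<in> W))"
      using W(1) by blast
  next
    fix w assume "w \<in> topspace (cut_model n k)" "cut_map k w \<in> \<phi> ` U"
    then have "w \<in> g ` ?P" unfolding img by blast
    then show "\<exists>x\<in>topspace Xt. \<alpha> x \<in> U \<and> g x = w" by blast
  next
    fix x y assume "x \<in> topspace Xt" "\<alpha> x \<in> U" "y \<in> topspace Xt" "\<alpha> y \<in> U" "g x = g y"
    then show "x = y" using inj_onD[OF inj, of x y] by blast
  qed
  then show ?thesis by blast
qed

lemma cut_sign:
  assumes w: "w \<in> topspace (cut_model n k)" and i: "i < k" and nz: "cut_map k w i \<noteq> 0"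
  shows "sgn (cut_map k w i) = (if cut_tags w i then 1 else - 1)"
proof -
  have "fst w \<in> (\<Pi>\<^sub>E i\<in>{..<k}. topspace cut_line)"
    using w unfolding topspace_cut_model by (rule mem_Times_iff[THEN iffD1, THEN conjunct1])
  then have mem: "fst w i \<in> topspace cut_line" by (rule PiE_mem) (use i in simp)
  obtain t r where tr: "fst w i = (t, r)" by (rule prod.exhaust)
  have r: "cut_map k w i = r" "cut_tags w i = t"
    using i tr by (simp_all add: cut_map_def cut_tags_def split_def)
  have "if t then 0 \<le> r else r \<le> 0" using mem unfolding tr topspace_cut_line by simp
  then show ?thesis using nz unfolding r by (cases t) simp_all
qed

lemma alpha_off_D:
  assumes "p \<in> topspace X" "p \<notin> D"
  shows "\<exists>x\<in>topspace Xt. \<alpha> x = p"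
    and "\<And>x y. x \<in> topspace Xt \<Longrightarrow> y \<in> topspace Xt \<Longrightarrow> \<alpha> x = p \<Longrightarrow> \<alpha> y = p \<Longrightarrow> x = y"
    and "\<And>Q. openin Xt Q \<Longrightarrow> openin X {\<alpha> x | x. x \<in> Q \<and> \<alpha> x \<notin> D}"
proof -
  let ?P = "{x \<in> topspace Xt. \<alpha> x \<notin> D}"
  have g: "homeomorphic_map (subtopology Xt ?P) (subtopology X B) \<alpha>"
    using bl unfolding real_blowup_def by (elim conjE)
  have tP: "topspace (subtopology Xt ?P) = ?P" and tR: "topspace (subtopology X B) = B" by auto
  have img: "\<alpha> ` ?P = B" using homeomorphic_imp_surjective_map[OF g] unfolding tP tR .
  have inj: "inj_on \<alpha> ?P" using homeomorphic_imp_injective_map[OF g] unfolding tP .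
  show "\<exists>x\<in>topspace Xt. \<alpha> x = p" using img assms by (metis (no_types, lifting) DiffI imageE mem_Collect_eq)
  show "x = y" if "x \<in> topspace Xt" "y \<in> topspace Xt" "\<alpha> x = p" "\<alpha> y = p" for x y
    using inj_onD[OF inj, of x y] that assms by simp
  fix Q assume Q: "openin Xt Q"
  have "openin (subtopology Xt ?P) (Q \<inter> ?P)" using Q by (simp add: openin_subtopology_Int)
  then have "openin (subtopology X B) (\<alpha> ` (Q \<inter> ?P))"
    using homeomorphic_imp_open_map[OF g] unfolding open_map_def by blast
  then have "openin X (\<alpha> ` (Q \<inter> ?P))" using B_open openin_trans_full by blast
  moreover have "\<alpha> ` (Q \<inter> ?P) = {\<alpha> x | x. x \<in> Q \<and> \<alpha> x \<notin> D}" using openin_subset[OF Q] by blast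
  ultimately show "openin X {\<alpha> x | x. x \<in> Q \<and> \<alpha> x \<notin> D}" by simp
qed

text \<open>Over \<open>D\<close> the blow-up looks like a closed orthant near \<open>x\<close>, and
  the part off \<open>D\<close> is an open orthant cut by a box, which is convex and nonempty. So
  each point of the blow-up has arbitrarily small neighbourhoods that see a single component of the
  complement of \<open>D\<close>.\<close>

lemma small_nbhd:
  assumes Q: "openin Xt Q" "x \<in> Q"
  shows "\<exists>N. openin Xt N \<and> x \<in> N \<and> N \<subseteq> Q \<and> path_connectedin X (\<alpha> ` N - D) \<and> \<alpha> ` N - D \<noteq> {}"
proof -
  have xt: "x \<in> topspace Xt" using openin_subset[OF Q(1)] Q(2) by blast
  let ?p = "\<alpha> x"
  have pt: "?p \<in> topspace X" by (rule alpha_top[OF xt])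
  show ?thesis
  proof (cases "?p \<in> D")
    case False
    let ?V = "{\<alpha> x | x. x \<in> Q \<and> \<alpha> x \<notin> D}"
    have V: "openin X ?V" by (rule alpha_off_D(3)[OF pt False Q(1)])
    have pV: "?p \<in> ?V" using Q(2) False by blast
    obtain k U \<phi> \<epsilon> J where q: "DD.nc_cube ?p k U \<phi> \<epsilon> J" "U \<subseteq> ?V"
      using DD.nc_cube_exists[OF pt V pV] by blast
    note q' = DD.nc_cube_D[OF q(1)]
    have UD: "U \<inter> D = {}" using q(2) by blast
    let ?N = "{y \<in> topspace Xt. \<alpha> y \<in> U}"
    have "?N \<subseteq> Q"
    proof
      fix y assume y: "y \<in> ?N"
      then obtain z where z: "z \<in> Q" "\<alpha> y = \<alpha> z" "\<alpha> z \<notin> D" using q(2) by blast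
      have "z \<in> topspace Xt" using openin_subset[OF Q(1)] z(1) by blast
      then have "y = z"
        using alpha_off_D(2)[OF alpha_top z(3), of y z] y z(2) by simp
      then show "y \<in> Q" using z(1) by simp
    qed
    moreover have "\<alpha> ` ?N - D = U"
    proof
      show "\<alpha> ` ?N - D \<subseteq> U" by blast
      show "U \<subseteq> \<alpha> ` ?N - D"
      proof
        fix u assume u: "u \<in> U"
        then have "u \<in> topspace X" "u \<notin> D" using q'(11) UD by blast+
        then obtain y where "y \<in> topspace Xt" "\<alpha> y = u" using alpha_off_D(1) by blast
        then show "u \<in> \<alpha> ` ?N - D" using u \<open>u \<notin> D\<close> by blast
      qed
    qed
    moreover have "path_connectedin X U"
    proof -
      have "path_component_of (subtopology X U) a b" if "a \<in> U" "b \<in> U" for a b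
        by (rule DD.segment_path[OF q(1) that]) (rule DD.pt_cube(1)[OF q(1) DD.segment_in_cube[OF q(1) that]])
      then have "path_connected_space (subtopology X U)"
        unfolding path_connected_space_iff_path_component by simp
      then show ?thesis using q'(11) unfolding path_connectedin_def by blast
    qed
    moreover have "openin Xt ?N" by (rule alpha_preimage_open[OF q'(10)])
    moreover have "x \<in> ?N" using xt q'(2) by simp
    moreover have "U \<noteq> {}" using q'(2) by blast
    ultimately show ?thesis by (intro exI[of _ ?N]) simp
  next
    case True
    obtain k U \<phi> \<epsilon> J where q: "DD.nc_cube ?p k U \<phi> \<epsilon> J"
      using DD.nc_cube_exists[OF pt openin_topspace pt] by blast
    note q' = DD.nc_cube_D[OF q]
    obtain g where cg: "cut_coords k U \<phi> g" using cut_chart[OF q True] by blast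
    note g = cut_coordsD(1)[OF cg] and gc = cut_coordsD(2)[OF cg] and go = cut_coordsD(3)[OF cg]
      and gs = cut_coordsD(4)[OF cg] and gi = cut_coordsD(5)[OF cg]
    obtain W where W: "openin (cut_model n k) W" "\<And>y. y \<in> topspace Xt \<Longrightarrow> \<alpha> y \<in> U \<Longrightarrow> y \<in> Q \<longleftrightarrow> g y \<in> W"
      using go[OF Q(1)] by blast
    have gx: "g x \<in> W" using W(2)[OF xt q'(2)] Q(2) by blast
    have gx0: "cut_map k (g x) = (\<lambda>_. 0)" using g[OF xt q'(2)] q'(3) by simp
    obtain d where d: "d > 0" "\<forall>z\<in>topspace (cut_model n k). (\<forall>i<k. cut_tags z i = cut_tags (g x) i) \<and>
      (\<forall>i<n. \<bar>cut_map k z i - cut_map k (g x) i\<bar> < d) \<longrightarrow> z \<in> W"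
      using cut_model_nbhd[OF q'(6) W(1) gx] by blast
    let ?T = "{z \<in> topspace (cut_model n k). \<forall>i<k. cut_tags z i = cut_tags (g x) i}"
    let ?Bx = "DD.coord_box U \<phi> ?p d"
    have Bo: "openin X ?Bx" by (rule DD.chart_box_open[OF q'(1)])
    \<comment> \<open>Fixing the tags selects one orthant, and the box makes it small.\<close>
    let ?N = "{y \<in> topspace Xt. \<alpha> y \<in> U \<and> g y \<in> ?T} \<inter> {y \<in> topspace Xt. \<alpha> y \<in> ?Bx}"
    have No: "openin Xt ?N" by (intro openin_Int gc cut_tags_open alpha_preimage_open Bo)
    have xN: "x \<in> ?N" using xt q'(2) g[OF xt q'(2)] d(1) by simp
    have NQ: "?N \<subseteq> Q"
    proof
      fix y assume y: "y \<in> ?N"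
      then have y1: "y \<in> topspace Xt" "\<alpha> y \<in> U" "g y \<in> ?T" by blast+
      have "\<bar>cut_map k (g y) i - cut_map k (g x) i\<bar> < d" if "i < n" for i
        using y that g[OF y1(1,2)] g[OF xt q'(2)] by simp
      then have "g y \<in> W" using d(2) y1(3) by blast
      then show "y \<in> Q" using W(2)[OF y1(1,2)] by blast
    qed
    define s where "s = (\<lambda>i. if cut_tags (g x) i then 1 else - 1 :: real)"
    have img: "\<alpha> ` ?N - D = {z \<in> ?Bx. \<forall>i<k. sgn (\<phi> z i) = s i}"
    proof
      show "\<alpha> ` ?N - D \<subseteq> {z \<in> ?Bx. \<forall>i<k. sgn (\<phi> z i) = s i}"
      proof
        fix z assume "z \<in> \<alpha> ` ?N - D"
        then obtain y where y: "y \<in> ?N" "z = \<alpha> y" "z \<notin> D" by blast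
        have y1: "y \<in> topspace Xt" "\<alpha> y \<in> U" "g y \<in> ?T" using y(1) by blast+
        have "sgn (\<phi> z i) = s i" if i: "i < k" for i
        proof -
          have nz: "cut_map k (g y) i \<noteq> 0" using q'(7)[OF y1(2)] y(2,3) i g[OF y1(1,2)] by auto
          have "cut_tags (g y) i = cut_tags (g x) i" using y1(3) i by blast
          then show ?thesis
            using cut_sign[of "g y" k i] g[OF y1(1,2)] i nz y(2) by (simp add: s_def)
        qed
        then show "z \<in> {z \<in> ?Bx. \<forall>i<k. sgn (\<phi> z i) = s i}" using y by blast
      qed
      show "{z \<in> ?Bx. \<forall>i<k. sgn (\<phi> z i) = s i} \<subseteq> \<alpha> ` ?N - D"
      proof
        fix z assume z: "z \<in> {z \<in> ?Bx. \<forall>i<k. sgn (\<phi> z i) = s i}"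
        then have zU: "z \<in> U" by blast
        \<comment> \<open>The lift of \<open>z\<close> with the tags of \<open>x\<close>; it is a
          point of the model because \<open>z\<close> has the signs \<open>s\<close>.\<close>
        let ?w = "(\<lambda>i\<in>{..<k}. (cut_tags (g x) i, \<phi> z i), \<lambda>i. \<phi> z (i + k))"
        have sg: "if cut_tags (g x) i then 0 \<le> \<phi> z i else \<phi> z i \<le> 0" if "i < k" for i
          using z that by (auto simp: s_def sgn_if split: if_splits)
        have w: "?w \<in> topspace (cut_model n k)"
          using sg q'(14)[OF zU] by (auto simp: topspace_cut_model topspace_cut_line topspace_Euclidean_space)
        have cw: "cut_map k ?w = \<phi> z" by (auto simp: cut_map_def fun_eq_iff)
        obtain y where y: "y \<in> topspace Xt" "\<alpha> y \<in> U" "g y = ?w" using gs[OF w] cw zU by auto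
        have "\<phi> (\<alpha> y) = \<phi> z" using g[OF y(1,2)] y(3) cw by simp
        then have az: "\<alpha> y = z" using inj_onD[OF q'(12) _ y(2) zU] by blast
        have "z \<notin> D"
        proof
          assume "z \<in> D"
          then obtain i where "i < k" "\<phi> z i = 0" using q'(7)[OF zU] by blast
          then show False using z by (auto simp: s_def split: if_splits)
        qed
        moreover have "cut_tags (g y) i = cut_tags (g x) i" if "i < k" for i
          using that y(3) by (simp add: cut_tags_def)
        then have "y \<in> ?N" using y w z az by auto
        ultimately show "z \<in> \<alpha> ` ?N - D" using az by blast
      qed
    qed
    have "path_component_of (subtopology X (\<alpha> ` ?N - D)) a b" if a: "a \<in> \<alpha> ` ?N - D" and b: "b \<in> \<alpha> ` ?N - D" for a b
    proof -
      have aU: "a \<in> U" "b \<in> U" using a b by blast+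
      show ?thesis
      proof (rule DD.segment_path[OF q aU])
        fix t :: real assume t: "0 \<le> t" "t \<le> 1"
        let ?z = "DD.pt U \<phi> (\<lambda>i. (1 - t) * \<phi> a i + t * \<phi> b i)"
        note z = DD.pt_cube[OF q DD.segment_in_cube[OF q aU t]]
        have "\<bar>\<phi> ?z i - \<phi> ?p i\<bar> < d" if "i < n" for i
          unfolding z(2) q'(3) using a b that t unfolding img q'(3) by (auto intro: abs_convex_less)
        moreover have "sgn (\<phi> ?z i) = s i" if "i < k" for i
        proof -
          have "sgn (\<phi> a i) = s i" "sgn (\<phi> b i) = s i" using a b that unfolding img by blast+
          then show ?thesis unfolding z(2) using sgn_convex[of "\<phi> a i" "\<phi> b i" t] t by simp
        qed
        ultimately show "?z \<in> \<alpha> ` ?N - D" unfolding img using z(1) by blast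
      qed
    qed
    then have "path_connected_space (subtopology X (\<alpha> ` ?N - D))"
      unfolding path_connected_space_iff_path_component by simp
    moreover have "\<alpha> ` ?N - D \<subseteq> topspace X" using alpha_top by blast
    ultimately have pc: "path_connectedin X (\<alpha> ` ?N - D)" unfolding path_connectedin_def by blast
    have "\<alpha> ` ?N - D \<noteq> {}"
    proof -
      \<comment> \<open>Small enough for the box and for the cube; the point with coordinates
        \<open>e * s i\<close> lies in the orthant.\<close>
      define e where "e = min d \<epsilon> / 2"
      have e: "e > 0" "e < d" "e < \<epsilon>" using d(1) q'(4) by (auto simp: e_def min_def)
      let ?y = "\<lambda>i. if i < n then e * s i else 0"
      have y: "?y \<in> cube n \<epsilon>" using e by (auto simp: cube_def topspace_Euclidean_space s_def)
      note z = DD.pt_cube[OF q y]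
      have "DD.pt U \<phi> ?y \<in> {z \<in> ?Bx. \<forall>i<k. sgn (\<phi> z i) = s i}"
        using z(1) e q'(6) unfolding mem_Collect_eq z(2) q'(3) by (auto simp: s_def sgn_mult)
      then show ?thesis unfolding img by blast
    qed
    then show ?thesis using No xN NQ pc by blast
  qed
qed

text \<open>The orthant at \<open>\<alpha> x\<close> given by the point \<open>x\<close> of the blow-up.\<close>

definition orth :: "'b \<Rightarrow> 'a set \<Rightarrow> 'a set" where
  "orth x = (\<lambda>V\<in>nbhds_of X (\<alpha> x). THE C. C \<in> path_components_of (subtopology X (V \<inter> B)) \<and>
      x \<in> Xt closure_of {y \<in> topspace Xt. \<alpha> y \<in> C})"

text \<open>\<open>C\<close> is the component that contains the image off \<open>D\<close> of a
  neighbourhood from \<open>small_nbhd\<close>. Any component whose preimage accumulates at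
  \<open>x\<close> meets this image and therefore equals \<open>C\<close>.\<close>

lemma orth_ex1:
  assumes x: "x \<in> topspace Xt" and V: "V \<in> nbhds_of X (\<alpha> x)"
  shows "\<exists>N C. openin Xt N \<and> x \<in> N \<and> \<alpha> ` N \<subseteq> V \<and> C \<in> path_components_of (subtopology X (V \<inter> B)) \<and>
     \<alpha> ` N - D \<subseteq> C \<and> \<alpha> ` N - D \<noteq> {} \<and>
     (\<forall>C'\<in>path_components_of (subtopology X (V \<inter> B)). x \<in> Xt closure_of {y \<in> topspace Xt. \<alpha> y \<in> C'} \<longleftrightarrow> C' = C)"
proof -
  have Vo: "openin X V" "\<alpha> x \<in> V" using V by (simp_all add: nbhds_of_iff)
  have "openin Xt {y \<in> topspace Xt. \<alpha> y \<in> V}" "x \<in> {y \<in> topspace Xt. \<alpha> y \<in> V}"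
    using alpha_preimage_open[OF Vo(1)] x Vo(2) by simp_all
  from small_nbhd[OF this] obtain N where N: "openin Xt N" "x \<in> N" "N \<subseteq> {y \<in> topspace Xt. \<alpha> y \<in> V}"
    "path_connectedin X (\<alpha> ` N - D)" "\<alpha> ` N - D \<noteq> {}" by blast
  have NV: "\<alpha> ` N - D \<subseteq> V \<inter> B" using N(3) alpha_top by blast
  have "path_connectedin (subtopology X (V \<inter> B)) (\<alpha> ` N - D)"
    using N(4) NV by (simp add: path_connectedin_subtopology)
  moreover have "topspace (subtopology X (V \<inter> B)) \<noteq> {}" using NV N(5) openin_subset[OF Vo(1)] by auto
  ultimately obtain C where C: "C \<in> path_components_of (subtopology X (V \<inter> B))" "\<alpha> ` N - D \<subseteq> C"
    by (rule exists_path_component_of_superset)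
  have "x \<in> Xt closure_of {y \<in> topspace Xt. \<alpha> y \<in> C'} \<longleftrightarrow> C' = C" if C': "C' \<in> path_components_of (subtopology X (V \<inter> B))" for C'
  proof
    assume "x \<in> Xt closure_of {y \<in> topspace Xt. \<alpha> y \<in> C'}"
    then obtain y where y: "y \<in> N" "\<alpha> y \<in> C'" using N(1,2) by (auto simp: in_closure_of)
    have "C' \<subseteq> B" using path_components_of_subset[OF C'] by auto
    then have "\<alpha> y \<in> C" using C(2) y by blast
    then show "C' = C" using path_comps_eq[OF C' C(1) y(2)] by blast
  next
    assume eq: "C' = C"
    have "\<exists>y. y \<in> {y \<in> topspace Xt. \<alpha> y \<in> C} \<and> y \<in> Q" if Q: "x \<in> Q" "openin Xt Q" for Q
    proof -
      have "openin Xt (N \<inter> Q)" "x \<in> N \<inter> Q" using N(1,2) Q by auto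
      from small_nbhd[OF this] obtain N' where N': "N' \<subseteq> N \<inter> Q" "\<alpha> ` N' - D \<noteq> {}" by blast
      then obtain y where y: "y \<in> N'" "\<alpha> y \<notin> D" by blast
      then have "\<alpha> y \<in> C" using N'(1) C(2) by blast
      moreover have "y \<in> topspace Xt" using y(1) N'(1) openin_subset[OF N(1)] by blast
      ultimately show ?thesis using y(1) N'(1) by blast
    qed
    then show "x \<in> Xt closure_of {y \<in> topspace Xt. \<alpha> y \<in> C'}" using x eq by (simp add: in_closure_of)
  qed
  then show ?thesis using N(1,2,3,5) C by (intro exI[of _ N] exI[of _ C]) blast
qed

lemma orth_props:
  assumes x: "x \<in> topspace Xt" and V: "V \<in> nbhds_of X (\<alpha> x)"
  shows "orth x V \<in> path_components_of (subtopology X (V \<inter> B))"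
    and "\<And>C. C \<in> path_components_of (subtopology X (V \<inter> B)) \<Longrightarrow>
       x \<in> Xt closure_of {y \<in> topspace Xt. \<alpha> y \<in> C} \<longleftrightarrow> C = orth x V"
    and "\<exists>N. openin Xt N \<and> x \<in> N \<and> \<alpha> ` N \<subseteq> V \<and> \<alpha> ` N - D \<subseteq> orth x V \<and> \<alpha> ` N - D \<noteq> {}"
proof -
  obtain N C where NC: "openin Xt N" "x \<in> N" "\<alpha> ` N \<subseteq> V" "C \<in> path_components_of (subtopology X (V \<inter> B))"
     "\<alpha> ` N - D \<subseteq> C" "\<alpha> ` N - D \<noteq> {}"
     and cl: "\<forall>C'\<in>path_components_of (subtopology X (V \<inter> B)). x \<in> Xt closure_of {y \<in> topspace Xt. \<alpha> y \<in> C'} \<longleftrightarrow> C' = C"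
    using orth_ex1[OF assms] by (elim exE conjE)
  have "(THE C. C \<in> path_components_of (subtopology X (V \<inter> B)) \<and> x \<in> Xt closure_of {y \<in> topspace Xt. \<alpha> y \<in> C}) = C"
    by (rule the_equality) (use NC(4) cl in auto)
  then have eq: "orth x V = C" using V by (simp add: orth_def)
  show "orth x V \<in> path_components_of (subtopology X (V \<inter> B))" using NC(4) eq by simp
  show "x \<in> Xt closure_of {y \<in> topspace Xt. \<alpha> y \<in> C'} \<longleftrightarrow> C' = orth x V"
    if "C' \<in> path_components_of (subtopology X (V \<inter> B))" for C' using cl that eq by simp
  show "\<exists>N. openin Xt N \<and> x \<in> N \<and> \<alpha> ` N \<subseteq> V \<and> \<alpha> ` N - D \<subseteq> orth x V \<and> \<alpha> ` N - D \<noteq> {}"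
    using NC eq by blast
qed

lemma orth_lim:
  assumes x: "x \<in> topspace Xt"
  shows "orth x \<in> lim_pi0 X B (\<alpha> x)"
  unfolding lim_pi0_def
proof (intro CollectI conjI ballI impI)
  show "orth x \<in> (\<Pi>\<^sub>E U\<in>nbhds_of X (\<alpha> x). path_components_of (subtopology X (U \<inter> B)))"
  proof (rule PiE_I)
    show "orth x V = undefined" if "V \<notin> nbhds_of X (\<alpha> x)" for V using that by (simp add: orth_def)
  qed (rule orth_props(1)[OF x])
  fix U V assume U: "U \<in> nbhds_of X (\<alpha> x)" and V: "V \<in> nbhds_of X (\<alpha> x)" and UV: "U \<subseteq> V"
  have "path_connectedin X (orth x U)" "orth x U \<subseteq> U \<inter> B"
    using path_connectedin_path_components_of[OF orth_props(1)[OF x U]] path_components_of_subset[OF orth_props(1)[OF x U]]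
    by (auto simp: path_connectedin_subtopology)
  then have pc: "path_connectedin (subtopology X (V \<inter> B)) (orth x U)"
    using UV by (auto simp: path_connectedin_subtopology)
  have ne: "topspace (subtopology X (V \<inter> B)) \<noteq> {}"
    using nonempty_path_components_of[OF orth_props(1)[OF x U]] path_connectedin_subset_topspace[OF pc] by blast
  obtain C where C: "C \<in> path_components_of (subtopology X (V \<inter> B))" "orth x U \<subseteq> C"
    by (rule exists_path_component_of_superset[OF pc ne])
  have "x \<in> Xt closure_of {y \<in> topspace Xt. \<alpha> y \<in> orth x U}"
    using orth_props(2)[OF x U orth_props(1)[OF x U]] by simp
  then have "x \<in> Xt closure_of {y \<in> topspace Xt. \<alpha> y \<in> C}"
    using closure_of_mono[of "{y \<in> topspace Xt. \<alpha> y \<in> orth x U}" "{y \<in> topspace Xt. \<alpha> y \<in> C}" Xt] C(2) by blast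
  then have "C = orth x V" using orth_props(2)[OF x V C(1)] by simp
  then show "orth x U \<subseteq> orth x V" using C(2) by simp
qed

text \<open>Translates the canonical identification of the statement, given by closures, into
  \<open>orth\<close>.\<close>

lemma orthant_point_iff:
  assumes c: "c \<in> lim_pi0 X B p"
  shows "orthant_point X Xt \<alpha> p c x \<longleftrightarrow> x \<in> topspace Xt \<and> \<alpha> x = p \<and> orth x = c"
proof
  assume o: "orthant_point X Xt \<alpha> p c x"
  then have x: "x \<in> topspace Xt" "\<alpha> x = p" by (simp_all add: orthant_point_def)
  have "orth x = c"
  proof (rule lim_pi0_ext)
    show "orth x \<in> lim_pi0 X B p" using orth_lim[OF x(1)] x(2) by simp
    show "c \<in> lim_pi0 X B p" by (rule c)
    fix U assume U: "U \<in> nbhds_of X p"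
    then have "x \<in> Xt closure_of {y \<in> topspace Xt. \<alpha> y \<in> c U}" using o by (simp add: orthant_point_def)
    then show "orth x U = c U" using orth_props(2)[OF x(1), of U "c U"] U x(2) lim_pi0_comp[OF c U] by simp
  qed
  then show "x \<in> topspace Xt \<and> \<alpha> x = p \<and> orth x = c" using x by simp
next
  assume x: "x \<in> topspace Xt \<and> \<alpha> x = p \<and> orth x = c"
  have "x \<in> Xt closure_of {y \<in> topspace Xt. \<alpha> y \<in> c U}" if U: "U \<in> nbhds_of X p" for U
    using orth_props(2)[of x U "c U"] x U lim_pi0_comp[OF c U] by simp
  then show "orthant_point X Xt \<alpha> p c x" using x by (simp add: orthant_point_def)
qed

text \<open>Tags are locally constant and every neighbourhood of \<open>x\<close> has points off
  \<open>D\<close>, where the tag is the sign. Such a point with image in \<open>orth x U\<close>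
  fixes the sign on the whole component.\<close>

lemma orth_tags:
  assumes q: "DD.nc_cube p k U \<phi> \<epsilon> J"
    and g: "\<And>x. x \<in> topspace Xt \<Longrightarrow> \<alpha> x \<in> U \<Longrightarrow> g x \<in> topspace (cut_model n k) \<and> cut_map k (g x) = \<phi> (\<alpha> x)"
    and gc: "\<And>W. openin (cut_model n k) W \<Longrightarrow> openin Xt {x \<in> topspace Xt. \<alpha> x \<in> U \<and> g x \<in> W}"
    and x: "x \<in> topspace Xt" "\<alpha> x \<in> U" and z: "z \<in> orth x U" and i: "i < k"
  shows "sgn (\<phi> z i) = (if cut_tags (g x) i then 1 else - 1)"
proof -
  note q' = DD.nc_cube_D[OF q]
  have U: "U \<in> nbhds_of X (\<alpha> x)" using q'(10) x(2) by (simp add: nbhds_of_iff)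
  obtain N where N: "openin Xt N" "x \<in> N" "\<alpha> ` N \<subseteq> U" "\<alpha> ` N - D \<subseteq> orth x U"
    using orth_props(3)[OF x(1) U] by blast
  let ?Q = "N \<inter> {y \<in> topspace Xt. \<alpha> y \<in> U \<and> g y \<in> {z \<in> topspace (cut_model n k). \<forall>i<k. cut_tags z i = cut_tags (g x) i}}"
  have Qo: "openin Xt ?Q" by (rule openin_Int[OF N(1) gc[OF cut_tags_open]])
  have gx: "g x \<in> topspace (cut_model n k)" by (rule conjunct1[OF g[OF x]])
  have xQ: "x \<in> ?Q" by (rule IntI[OF N(2)]) (simp add: x gx)
  from small_nbhd[OF Qo xQ] obtain N' where N': "N' \<subseteq> ?Q" "\<alpha> ` N' - D \<noteq> {}" by blast
  then obtain y where y: "y \<in> N'" "\<alpha> y \<notin> D" by blast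
  then have yQ: "y \<in> ?Q" using N'(1) by blast
  then have y1: "y \<in> topspace Xt" "\<alpha> y \<in> U" "cut_tags (g y) i = cut_tags (g x) i" using i by blast+
  have "\<alpha> y \<in> orth x U" using N(4) yQ y(2) by blast
  have nz: "cut_map k (g y) i \<noteq> 0" using q'(7)[OF y1(2)] y(2) i g[OF y1(1,2)] by auto
  have "sgn (\<phi> (\<alpha> y) i) = (if cut_tags (g x) i then 1 else - 1)"
    using cut_sign[of "g y" k i] g[OF y1(1,2)] i nz y1(3) by simp
  moreover have "i \<in> J" using i DD_cube_J[OF q] by simp
  then have "sgn (\<phi> z i) = sgn (\<phi> (\<alpha> y) i)"
    by (rule DD.compl_component_signs[OF q orth_props(1)[OF x(1) U] z \<open>\<alpha> y \<in> orth x U\<close>])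
  ultimately show ?thesis by simp
qed

text \<open>Over \<open>D\<close> a point of the model is determined by its tags and its image under
  \<open>cut_map\<close>, which are read off from \<open>orth x\<close> and
  \<open>\<alpha> x\<close>.\<close>

lemma orth_inj:
  assumes x: "x \<in> topspace Xt" "x' \<in> topspace Xt" "\<alpha> x = \<alpha> x'" "orth x = orth x'"
  shows "x = x'"
proof (cases "\<alpha> x \<in> D")
  case False
  then show ?thesis using alpha_off_D(2)[OF alpha_top[OF x(1)] False x(1,2) refl] x(3) by simp
next
  case True
  have pt: "\<alpha> x \<in> topspace X" by (rule alpha_top[OF x(1)])
  obtain k U \<phi> \<epsilon> J where q: "DD.nc_cube (\<alpha> x) k U \<phi> \<epsilon> J"
    using DD.nc_cube_exists[OF pt openin_topspace pt] by blast
  note q' = DD.nc_cube_D[OF q]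
  obtain g where cg: "cut_coords k U \<phi> g" using cut_chart[OF q True] by blast
  note g = cut_coordsD(1)[OF cg] and gc = cut_coordsD(2)[OF cg] and go = cut_coordsD(3)[OF cg]
    and gs = cut_coordsD(4)[OF cg] and gi = cut_coordsD(5)[OF cg]
  have xU: "\<alpha> x \<in> U" "\<alpha> x' \<in> U" using q'(2) x(3) by simp_all
  have U: "U \<in> nbhds_of X (\<alpha> x)" using q'(2,10) by (simp add: nbhds_of_iff)
  obtain z where z: "z \<in> orth x U" using nonempty_path_components_of[OF orth_props(1)[OF x(1) U]] by blast
  have z': "z \<in> orth x' U" using z x(4) by simp
  have tags: "cut_tags (g x) i = cut_tags (g x') i" if "i < k" for i
    using orth_tags[OF q g gc x(1) xU(1) z that] orth_tags[OF q g gc x(2) xU(2) z' that] by (auto split: if_splits)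
  obtain a b a' b' where ab: "g x = (a, b)" "g x' = (a', b')" by (metis surj_pair)
  have eq: "cut_map k (a, b) = cut_map k (a', b')" using g[OF x(1) xU(1)] g[OF x(2) xU(2)] x(3) ab by simp
  have tp: "(a, b) \<in> topspace (cut_model n k)" "(a', b') \<in> topspace (cut_model n k)"
    using g[OF x(1) xU(1)] g[OF x(2) xU(2)] ab by simp_all
  then have a: "a \<in> (\<Pi>\<^sub>E i\<in>{..<k}. topspace cut_line)" "a' \<in> (\<Pi>\<^sub>E i\<in>{..<k}. topspace cut_line)"
    by (simp_all add: topspace_cut_model)
  have "a = a'"
  proof (rule PiE_ext[OF a])
    fix i assume "i \<in> {..<k}"
    then have "fst (a i) = fst (a' i)" "snd (a i) = snd (a' i)"
      using tags[of i] fun_cong[OF eq, of i] by (simp_all add: ab cut_tags_def cut_map_def)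
    then show "a i = a' i" by (rule prod_eqI)
  qed
  moreover have "b i = b' i" for i using fun_cong[OF eq, of "i + k"] by (simp add: cut_map_def)
  then have "b = b'" by (rule ext)
  ultimately show ?thesis using gi[OF x(1) xU(1) x(2) xU(2)] ab by simp
qed

lemma orth_surj:
  assumes p: "p \<in> topspace X" and c: "c \<in> lim_pi0 X B p"
  shows "\<exists>x\<in>topspace Xt. \<alpha> x = p \<and> orth x = c"
proof -
  obtain k U \<phi> \<epsilon> J where q: "DD.nc_cube p k U \<phi> \<epsilon> J"
    using DD.nc_cube_exists[OF p openin_topspace p] by blast
  note q' = DD.nc_cube_D[OF q]
  have U: "U \<in> nbhds_of X p" using q'(2,10) by (simp add: nbhds_of_iff)
  have "\<exists>x\<in>topspace Xt. \<alpha> x = p \<and> (\<forall>z\<in>orth x U. \<forall>y\<in>c U. \<forall>i\<in>J. sgn (\<phi> y i) = sgn (\<phi> z i))"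
  proof (cases "p \<in> D")
    case False
    then have "J = {}" using DD_cube_k0[OF q] DD_cube_J[OF q] by simp
    then show ?thesis using alpha_off_D(1)[OF p False] by simp
  next
    case True
    obtain g where cg: "cut_coords k U \<phi> g" using cut_chart[OF q True] by blast
    note g = cut_coordsD(1)[OF cg] and gc = cut_coordsD(2)[OF cg] and go = cut_coordsD(3)[OF cg]
      and gs = cut_coordsD(4)[OF cg] and gi = cut_coordsD(5)[OF cg]
    obtain y0 where y0: "y0 \<in> c U" using lim_pi0_nonempty[OF c U] by blast
    then have y0U: "y0 \<in> U" "y0 \<notin> D" using lim_pi0_subset[OF c U] by blast+
    \<comment> \<open>The lift of the centre \<open>p\<close> prescribed by \<open>c\<close>: all
      values are 0, and the tag of coordinate \<open>i\<close> is its sign on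
      \<open>c U\<close>.\<close>
    let ?w = "(\<lambda>i\<in>{..<k}. (\<phi> y0 i > 0, 0 :: real), \<lambda>i. 0 :: real)"
    have w: "?w \<in> topspace (cut_model n k)"
      by (auto simp: topspace_cut_model topspace_cut_line topspace_Euclidean_space)
    have cw: "cut_map k ?w = \<phi> p" by (auto simp: cut_map_def fun_eq_iff q'(3))
    obtain x where x: "x \<in> topspace Xt" "\<alpha> x \<in> U" "g x = ?w" using gs[OF w] cw q'(2) by auto
    have "\<phi> (\<alpha> x) = \<phi> p" using g[OF x(1,2)] x(3) cw by simp
    then have ap: "\<alpha> x = p" using inj_onD[OF q'(12) _ x(2) q'(2)] by blast
    have "sgn (\<phi> y i) = sgn (\<phi> z i)" if z: "z \<in> orth x U" and y: "y \<in> c U" and i: "i \<in> J" for z y i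
    proof -
      have ik: "i < k" using i DD_cube_J[OF q] by simp
      have "\<phi> y0 i \<noteq> 0" using q'(7)[OF y0U(1)] y0U(2) ik by blast
      then have "sgn (\<phi> y0 i) = sgn (\<phi> z i)"
        using orth_tags[OF q g gc x(1,2) z ik] x(3) ik by (auto simp: cut_tags_def sgn_if)
      moreover have "sgn (\<phi> y i) = sgn (\<phi> y0 i)"
        by (rule DD.compl_component_signs[OF q lim_pi0_comp[OF c U] y y0 i])
      ultimately show ?thesis by simp
    qed
    then show ?thesis using x(1) ap by blast
  qed
  then obtain x where x: "x \<in> topspace Xt" "\<alpha> x = p" "\<forall>z\<in>orth x U. \<forall>y\<in>c U. \<forall>i\<in>J. sgn (\<phi> y i) = sgn (\<phi> z i)"
    by blast
  have ox: "orth x \<in> lim_pi0 X B p" using orth_lim[OF x(1)] x(2) by simp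
  obtain z where z: "z \<in> orth x U" using lim_pi0_nonempty[OF ox U] by blast
  obtain y where y: "y \<in> c U" using lim_pi0_nonempty[OF c U] by blast
  have "z \<in> U" using lim_pi0_subset[OF ox U] z by blast
  then have "z \<in> c U" using DD.compl_component_iff[OF q lim_pi0_comp[OF c U] y] x(3) z y by blast
  then have "orth x U = c U" by (rule lim_pi0_agree[OF ox c U U z])
  then have "orth x = c" using inj_onD[OF DD.compl_eval_inj[OF q q'(2)] _ ox c] by blast
  then show ?thesis using x(1,2) by blast
qed

text \<open>The counterpart of \<open>endpoint_modification_openin\<close>, with orthants for ends.
  In the model, closeness means equal tags and close images, and equal tags mean equal orthants of
  the cube.\<close>

lemma openin_blowup:
  "openin Xt Q \<longleftrightarrow> Q \<subseteq> topspace Xt \<and> (\<forall>x\<in>Q. \<exists>V\<in>nbhds_of X (\<alpha> x). \<forall>x'\<in>topspace Xt.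
      \<alpha> x' \<in> V \<and> orth x' V = orth x V \<longrightarrow> x' \<in> Q)"
proof
  assume Q: "openin Xt Q"
  have "\<exists>V\<in>nbhds_of X (\<alpha> x). \<forall>x'\<in>topspace Xt. \<alpha> x' \<in> V \<and> orth x' V = orth x V \<longrightarrow> x' \<in> Q" if xQ: "x \<in> Q" for x
  proof -
    have xt: "x \<in> topspace Xt" using openin_subset[OF Q] xQ by blast
    have pt: "\<alpha> x \<in> topspace X" by (rule alpha_top[OF xt])
    show ?thesis
    proof (cases "\<alpha> x \<in> D")
      case False
      let ?V = "{\<alpha> x | x. x \<in> Q \<and> \<alpha> x \<notin> D}"
      have V: "openin X ?V" by (rule alpha_off_D(3)[OF pt False Q])
      have "x' \<in> Q" if x': "x' \<in> topspace Xt" "\<alpha> x' \<in> ?V" for x'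
      proof -
        obtain z where z: "z \<in> Q" "\<alpha> x' = \<alpha> z" "\<alpha> z \<notin> D" using x'(2) by blast
        have "z \<in> topspace Xt" using openin_subset[OF Q] z(1) by blast
        then have "x' = z" using alpha_off_D(2)[OF alpha_top z(3), of x' z] x'(1) z(2) by simp
        then show ?thesis using z(1) by simp
      qed
      moreover have "?V \<in> nbhds_of X (\<alpha> x)" using V xQ False unfolding nbhds_of_iff by blast
      ultimately show ?thesis by blast
    next
      case True
      obtain k U \<phi> \<epsilon> J where q: "DD.nc_cube (\<alpha> x) k U \<phi> \<epsilon> J"
        using DD.nc_cube_exists[OF pt openin_topspace pt] by blast
      note q' = DD.nc_cube_D[OF q]
      obtain g where cg: "cut_coords k U \<phi> g" using cut_chart[OF q True] by blast
      note g = cut_coordsD(1)[OF cg] and gc = cut_coordsD(2)[OF cg] and go = cut_coordsD(3)[OF cg]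
        and gs = cut_coordsD(4)[OF cg] and gi = cut_coordsD(5)[OF cg]
      obtain W where W: "openin (cut_model n k) W" "\<And>y. y \<in> topspace Xt \<Longrightarrow> \<alpha> y \<in> U \<Longrightarrow> y \<in> Q \<longleftrightarrow> g y \<in> W"
        using go[OF Q] by blast
      have gx: "g x \<in> W" using W(2)[OF xt q'(2)] xQ by blast
      obtain d where d: "d > 0" "\<forall>z\<in>topspace (cut_model n k). (\<forall>i<k. cut_tags z i = cut_tags (g x) i) \<and>
        (\<forall>i<n. \<bar>cut_map k z i - cut_map k (g x) i\<bar> < d) \<longrightarrow> z \<in> W"
        using cut_model_nbhd[OF q'(6) W(1) gx] by blast
      let ?V = "DD.coord_box U \<phi> (\<alpha> x) d"
      have V: "?V \<in> nbhds_of X (\<alpha> x)"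
        using DD.chart_box_open[OF q'(1)] q'(2) d(1) by (simp add: nbhds_of_iff)
      have U: "U \<in> nbhds_of X (\<alpha> x)" using q'(2,10) by (simp add: nbhds_of_iff)
      have "x' \<in> Q" if x': "x' \<in> topspace Xt" "\<alpha> x' \<in> ?V" "orth x' ?V = orth x ?V" for x'
      proof -
        have x'U: "\<alpha> x' \<in> U" using x'(2) by blast
        have U': "U \<in> nbhds_of X (\<alpha> x')" "?V \<in> nbhds_of X (\<alpha> x')"
          using x'U U x'(2) V unfolding nbhds_of_iff by blast+
        have eq: "orth x' U = orth x U"
          by (rule lim_pi0_agree_mono[OF orth_lim[OF x'(1)] orth_lim[OF xt] U'(2) V U'(1) U _ x'(3)]) blast
        obtain z where z: "z \<in> orth x U" using lim_pi0_nonempty[OF orth_lim[OF xt] U] by blast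
        have z': "z \<in> orth x' U" using z eq by simp
        have "cut_tags (g x') i = cut_tags (g x) i" if "i < k" for i
          using orth_tags[OF q g gc xt q'(2) z that] orth_tags[OF q g gc x'(1) x'U z' that] by (auto split: if_splits)
        moreover have "\<bar>cut_map k (g x') i - cut_map k (g x) i\<bar> < d" if "i < n" for i
          using x'(2) that g[OF x'(1) x'U] g[OF xt q'(2)] by simp
        ultimately have "g x' \<in> W" using d(2) g[OF x'(1) x'U] by blast
        then show "x' \<in> Q" using W(2)[OF x'(1) x'U] by blast
      qed
      then show ?thesis using V by blast
    qed
  qed
  then show "Q \<subseteq> topspace Xt \<and> (\<forall>x\<in>Q. \<exists>V\<in>nbhds_of X (\<alpha> x). \<forall>x'\<in>topspace Xt.
      \<alpha> x' \<in> V \<and> orth x' V = orth x V \<longrightarrow> x' \<in> Q)" using openin_subset[OF Q] by blast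
next
  assume R: "Q \<subseteq> topspace Xt \<and> (\<forall>x\<in>Q. \<exists>V\<in>nbhds_of X (\<alpha> x). \<forall>x'\<in>topspace Xt.
      \<alpha> x' \<in> V \<and> orth x' V = orth x V \<longrightarrow> x' \<in> Q)"
  show "openin Xt Q"
  proof (subst openin_subopen, intro ballI)
    fix x assume x: "x \<in> Q"
    then have xt: "x \<in> topspace Xt" using R by blast
    obtain V where V: "V \<in> nbhds_of X (\<alpha> x)"
      "\<And>x'. x' \<in> topspace Xt \<Longrightarrow> \<alpha> x' \<in> V \<Longrightarrow> orth x' V = orth x V \<Longrightarrow> x' \<in> Q" using R x by blast
    obtain N where N: "openin Xt N" "x \<in> N" "\<alpha> ` N \<subseteq> V" "\<alpha> ` N - D \<subseteq> orth x V"
      using orth_props(3)[OF xt V(1)] by blast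
    \<comment> \<open>Arbitrarily close to a point \<open>x'\<close> of \<open>N\<close> there is a
      point off \<open>D\<close>. Its image lies in the components at \<open>V\<close> of both
      \<open>x\<close> and \<open>x'\<close>, which therefore coincide.\<close>
    have "N \<subseteq> Q"
    proof
      fix x' assume x': "x' \<in> N"
      then have x't: "x' \<in> topspace Xt" using openin_subset[OF N(1)] by blast
      have V': "V \<in> nbhds_of X (\<alpha> x')" using V(1) N(3) x' unfolding nbhds_of_iff by blast
      obtain N1 where N1: "openin Xt N1" "x' \<in> N1" "\<alpha> ` N1 - D \<subseteq> orth x' V"
        using orth_props(3)[OF x't V'] by blast
      have "openin Xt (N \<inter> N1)" "x' \<in> N \<inter> N1" using N(1) N1(1,2) x' by auto
      from small_nbhd[OF this] obtain N2 where N2: "N2 \<subseteq> N \<inter> N1" "\<alpha> ` N2 - D \<noteq> {}" by blast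
      then obtain y where y: "y \<in> \<alpha> ` N2 - D" by blast
      have "y \<in> orth x' V" "y \<in> orth x V" using y N2(1) N1(3) N(4) by blast+
      then have "orth x' V = orth x V"
        by (rule lim_pi0_agree[OF orth_lim[OF x't] orth_lim[OF xt] V' V(1)])
      then show "x' \<in> Q" using V(2)[OF x't] N(3) x' by blast
    qed
    then show "\<exists>T. openin Xt T \<and> x \<in> T \<and> T \<subseteq> Q" using N(1,2) by blast
  qed
qed

end

section \<open>The quotient map onto the blow-up\<close>

lemma openin_prod_discrete:
  "openin (prod_topology T (discrete_topology K)) V \<longleftrightarrow>
     V \<subseteq> topspace T \<times> K \<and> (\<forall>q\<in>K. openin T {a. (a, q) \<in> V})"
proof
  assume V: "openin (prod_topology T (discrete_topology K)) V"
  then have sub: "V \<subseteq> topspace T \<times> K" using openin_subset by fastforce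
  have "openin T {a. (a, q) \<in> V}" if q: "q \<in> K" for q
  proof -
    have "continuous_map T (prod_topology T (discrete_topology K)) (\<lambda>a. (a, q))"
      using q by (simp add: continuous_map_pairwise o_def)
    from openin_continuous_map_preimage[OF this V]
    have "openin T {a \<in> topspace T. (a, q) \<in> V}" .
    moreover have "{a \<in> topspace T. (a, q) \<in> V} = {a. (a, q) \<in> V}" using sub by blast
    ultimately show ?thesis by simp
  qed
  then show "V \<subseteq> topspace T \<times> K \<and> (\<forall>q\<in>K. openin T {a. (a, q) \<in> V})" using sub by blast
next
  assume R: "V \<subseteq> topspace T \<times> K \<and> (\<forall>q\<in>K. openin T {a. (a, q) \<in> V})"
  have "V = (\<Union>q\<in>K. {a. (a, q) \<in> V} \<times> {q})" using R by blast
  moreover have "openin (prod_topology T (discrete_topology K)) (\<Union>q\<in>K. {a. (a, q) \<in> V} \<times> {q})"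
  proof (intro openin_Union ballI)
    fix P assume "P \<in> (\<lambda>q. {a. (a, q) \<in> V} \<times> {q}) ` K"
    then obtain q where q: "q \<in> K" "P = {a. (a, q) \<in> V} \<times> {q}" by blast
    then show "openin (prod_topology T (discrete_topology K)) P"
      using R by (simp add: openin_prod_Times_iff)
  qed
  ultimately show "openin (prod_topology T (discrete_topology K)) V" by simp
qed

lemma topspace_pieces:
  "(S, (p, e), q) \<in> topspace (pieces X SS QQ) \<longleftrightarrow>
     S \<in> SS \<and> p \<in> topspace X \<and> e \<in> lim_pi0 X S p \<and> q \<in> QQ S"
  by (simp add: pieces_def topspace_sum_topology topspace_endpoint_modification)

lemma openin_pieces:
  "openin (pieces X SS QQ) W \<longleftrightarrow> W \<subseteq> topspace (pieces X SS QQ) \<and>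
     (\<forall>S\<in>SS. \<forall>q\<in>QQ S. openin (endpoint_modification X S) {a. (S, a, q) \<in> W})"
proof -
  have "openin (pieces X SS QQ) W \<longleftrightarrow> W \<subseteq> topspace (pieces X SS QQ) \<and>
      (\<forall>S\<in>SS. openin (prod_topology (endpoint_modification X S) (discrete_topology (QQ S))) {z. (S, z) \<in> W})"
    unfolding pieces_def openin_sum_topology topspace_sum_topology by blast
  also have "\<dots> \<longleftrightarrow> W \<subseteq> topspace (pieces X SS QQ) \<and>
     (\<forall>S\<in>SS. \<forall>q\<in>QQ S. openin (endpoint_modification X S) {a. (S, a, q) \<in> W})"
  proof (intro conj_cong refl ball_cong)
    fix S assume W: "W \<subseteq> topspace (pieces X SS QQ)" and S: "S \<in> SS"
    have "{z. (S, z) \<in> W} \<subseteq> topspace (endpoint_modification X S) \<times> QQ S"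
      using W by (auto simp: pieces_def topspace_sum_topology)
    then show "openin (prod_topology (endpoint_modification X S) (discrete_topology (QQ S))) {z. (S, z) \<in> W} \<longleftrightarrow>
       (\<forall>q\<in>QQ S. openin (endpoint_modification X S) {a. (S, a, q) \<in> W})"
      unfolding openin_prod_discrete by simp
  qed
  finally show ?thesis .
qed

lemma connected_components_partition:
  assumes cov: "\<Union>P = topspace Z" and P: "\<And>C. C \<in> P \<Longrightarrow> openin Z C" "\<And>C. C \<in> P \<Longrightarrow> connectedin Z C"
    "\<And>C. C \<in> P \<Longrightarrow> C \<noteq> {}" and dj: "\<And>C C' x. C \<in> P \<Longrightarrow> C' \<in> P \<Longrightarrow> x \<in> C \<Longrightarrow> x \<in> C' \<Longrightarrow> C = C'"
  shows "connected_components_of Z = P"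
proof -
  have cc: "connected_component_of_set Z x = C" if C: "C \<in> P" "x \<in> C" for C x
  proof
    show "C \<subseteq> connected_component_of_set Z x"
      by (rule connected_component_of_maximal[OF P(2)[OF C(1)] C(2)])
    have "topspace Z - C = \<Union>(P - {C})" using cov dj[OF C(1)] C(1) by blast
    moreover have "openin Z (\<Union>(P - {C}))" using P(1) by blast
    ultimately have "closedin Z C" using openin_subset[OF P(1)[OF C(1)]] by (simp add: closedin_def)
    then have "connected_component_of_set Z x \<subseteq> C \<or> disjnt (connected_component_of_set Z x) C"
      using connectedin_clopen_cases[OF connectedin_connected_component_of _ P(1)[OF C(1)]] by blast
    moreover have "x \<in> connected_component_of_set Z x"
      using C openin_subset[OF P(1)[OF C(1)]] by (auto simp: connected_component_of_refl)
    ultimately show "connected_component_of_set Z x \<subseteq> C" using C(2) unfolding disjnt_def by blast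
  qed
  show ?thesis
  proof
    show "connected_components_of Z \<subseteq> P"
    proof
      fix K assume "K \<in> connected_components_of Z"
      then obtain x where x: "x \<in> topspace Z" "K = connected_component_of_set Z x"
        by (auto simp: connected_components_of_def)
      then obtain C where "C \<in> P" "x \<in> C" using cov by blast
      then show "K \<in> P" using cc x(2) by simp
    qed
    show "P \<subseteq> connected_components_of Z"
    proof
      fix C assume C: "C \<in> P"
      obtain x where x: "x \<in> C" using P(3)[OF C] by blast
      have "x \<in> topspace Z" using openin_subset[OF P(1)[OF C]] x by blast
      then have "connected_component_of_set Z x \<in> connected_components_of Z"
        by (simp add: connected_component_in_connected_components_of)
      then show "C \<in> connected_components_of Z" using cc[OF C x] by simp
    qed
  qed
qed

text \<open>Both parts of the theorem are instances: all strata and all orthants, and the strata of the special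
  fibre with their positive orthants.\<close>

locale nc_gluing = nc_blowup +
  fixes SS :: "'a set set" and QQ :: "'a set \<Rightarrow> ('a \<Rightarrow> 'a set \<Rightarrow> 'a set) set" and Y :: "'b set"
  assumes sc: "\<And>S. S \<in> strata n X A D' \<Longrightarrow> simply_connected_space (subtopology X S)"
    and SS: "\<And>S. S \<in> SS \<Longrightarrow> S \<in> strata n X A D'"
    and QQ: "\<And>S q. S \<in> SS \<Longrightarrow> q \<in> QQ S \<Longrightarrow> q \<in> lim_pi0_stratum X (topspace X - D) S"
    and SS_closed: "\<And>S T. S \<in> SS \<Longrightarrow> T \<in> strata n X A D' \<Longrightarrow> T \<subseteq> X closure_of S \<Longrightarrow> T \<in> SS"
    and QQ_closed: "\<And>S T e q. S \<in> SS \<Longrightarrow> T \<in> strata n X A D' \<Longrightarrow> T \<noteq> S \<Longrightarrow> T \<subseteq> X closure_of S \<Longrightarrow>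
        e \<in> lim_pi0_stratum X S T \<Longrightarrow> q \<in> QQ S \<Longrightarrow> (\<lambda>p\<in>T. push X q p (e p)) \<in> QQ T"
    and Y: "Y = {x \<in> topspace Xt. \<exists>S\<in>SS. \<alpha> x \<in> S \<and> (\<exists>q\<in>QQ S. q (\<alpha> x) = orth x)}"
begin

section \<open>The fibres of the gluing map\<close>

lemma stratum_top: "S \<in> SS \<Longrightarrow> p \<in> S \<Longrightarrow> p \<in> topspace X"
  using strata_facts(1)[OF SS] by blast

definition pnt :: "'a \<Rightarrow> ('a set \<Rightarrow> 'a set) \<Rightarrow> 'b" where
  "pnt p c = (SOME x. x \<in> topspace Xt \<and> \<alpha> x = p \<and> orth x = c)"

lemma pnt_props:
  assumes "p \<in> topspace X" "c \<in> lim_pi0 X B p"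
  shows "pnt p c \<in> topspace Xt" "\<alpha> (pnt p c) = p" "orth (pnt p c) = c"
proof -
  have "\<exists>x. x \<in> topspace Xt \<and> \<alpha> x = p \<and> orth x = c" using orth_surj[OF assms] by blast
  from someI_ex[OF this] show "pnt p c \<in> topspace Xt" "\<alpha> (pnt p c) = p" "orth (pnt p c) = c"
    unfolding pnt_def by blast+
qed

lemma pnt_eq:
  assumes "x \<in> topspace Xt"
  shows "pnt (\<alpha> x) (orth x) = x"
proof -
  note p = pnt_props[OF alpha_top[OF assms] orth_lim[OF assms]]
  show ?thesis by (rule orth_inj[OF p(1) assms p(2,3)])
qed

text \<open>The point of the blow-up over \<open>p\<close> with orthant \<open>\<mu>(e, q)\<close>; the fibres are the classes of the gluing relation.\<close>

definition F :: "'a piece_point \<Rightarrow> 'b" where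
  "F = (\<lambda>(S, (p, e), q). pnt p (push X q p e))"

abbreviation "Z \<equiv> pieces X SS QQ"
abbreviation "gl \<equiv> gluing_map n X A D D' SS QQ"

lemma F_props:
  assumes "(S, (p, e), q) \<in> topspace Z"
  shows "F (S, (p, e), q) \<in> topspace Xt" "\<alpha> (F (S, (p, e), q)) = p" "orth (F (S, (p, e), q)) = push X q p e"
proof -
  have z: "S \<in> SS" "p \<in> topspace X" "e \<in> lim_pi0 X S p" "q \<in> QQ S" using assms unfolding topspace_pieces by blast+
  from pnt_props[OF z(2) push_lim[OF z(3) QQ[OF z(1,4)]]]
  show "F (S, (p, e), q) \<in> topspace Xt" "\<alpha> (F (S, (p, e), q)) = p" "orth (F (S, (p, e), q)) = push X q p e"
    by (simp_all add: F_def)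
qed

text \<open>The gluing relation is indexed by ends over the whole of \<open>T\<close>, whereas a
  boundary point carries an end at \<open>p\<close> only. Simple connectedness of \<open>T\<close>
  supplies the section.\<close>

lemma end_extends:
  assumes S: "S \<in> strata n X A D'" and T: "T \<in> strata n X A D'" and p: "p \<in> T" and e: "e \<in> lim_pi0 X S p"
  shows "\<exists>e'\<in>lim_pi0_stratum X S T. e' p = e"
  by (rule lim_pi0_stratum_exists[OF strata_locally_trivial[OF T face_union_stratum[OF S]] sc[OF T]
        strata_path_connected[OF T] p e])

lemma orthant_unique:
  assumes T: "T \<in> strata n X A D'" and "\<sigma> \<in> lim_pi0_stratum X B T" "\<sigma>' \<in> lim_pi0_stratum X B T" "p \<in> T" "\<sigma> p = \<sigma>' p"
  shows "\<sigma> = \<sigma>'"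
  by (rule lim_pi0_stratum_unique[OF strata_locally_trivial[OF T face_union_compl] strata_path_connected[OF T] assms(2-5)])

lemma end_closure:
  assumes "e \<in> lim_pi0 X S p" "p \<in> topspace X"
  shows "p \<in> X closure_of S"
proof -
  have "\<exists>y. y \<in> S \<and> y \<in> V" if "p \<in> V" "openin X V" for V
  proof -
    have V: "V \<in> nbhds_of X p" using that by (simp add: nbhds_of_iff)
    show ?thesis using lim_pi0_nonempty[OF assms(1) V] lim_pi0_subset[OF assms(1) V] by blast
  qed
  then show ?thesis using assms(2) by (auto simp: in_closure_of)
qed

text \<open>For \<open>T \<noteq> S\<close> one gluing step leads to the interior point over
  \<open>p\<close> of the stratum through \<open>p\<close>. For \<open>T = S\<close> the point is
  already of this form, because \<open>S\<close> has a single end at \<open>p\<close>.\<close>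

lemma normal_form:
  assumes z: "(S, (p, e), q) \<in> topspace Z" and T: "T \<in> strata n X A D'" "p \<in> T"
  shows "T \<in> SS \<and> (\<exists>\<tau>\<in>QQ T. \<tau> p = push X q p e \<and>
     ((S, (p, e), q) = (T, interior_point X T p, \<tau>) \<or> gl (S, (p, e), q) (T, interior_point X T p, \<tau>)))"
proof -
  have z': "S \<in> SS" "p \<in> topspace X" "e \<in> lim_pi0 X S p" "q \<in> QQ S" using z unfolding topspace_pieces by blast+
  note S = SS[OF z'(1)]
  have TS: "T \<subseteq> X closure_of S"
    by (rule frontier[OF T(1) face_union_stratum[OF S] T(2) end_closure[OF z'(3,2)]])
  have TSS: "T \<in> SS" by (rule SS_closed[OF z'(1) T(1) TS])
  show ?thesis
  proof (cases "T = S")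
    case True
    have "e = int_end X S p" by (rule int_end_unique[OF S _ z'(3)]) (use T(2) True in simp)
    moreover have "push X q p (int_end X S p) = q p"
      by (rule push_int_end[OF _ z'(2) QQ[OF z'(1,4)]]) (use T(2) True in simp)
    ultimately show ?thesis
      using TSS z'(4) True by (intro conjI bexI[of _ q]) (simp_all add: interior_point_eq)
  next
    case False
    obtain e' where e': "e' \<in> lim_pi0_stratum X S T" "e' p = e" using end_extends[OF S T z'(3)] by blast
    let ?\<tau> = "\<lambda>p\<in>T. push X q p (e' p)"
    have \<tau>: "?\<tau> \<in> QQ T" by (rule QQ_closed[OF z'(1) T(1) False TS e'(1) z'(4)])
    have "orthant_map n X A D D' T e' q = ?\<tau>"
      by (rule orthant_map_eq[OF S T(1) False TS e'(1) QQ[OF z'(1,4)]])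
    then have "gl (S, (p, e), q) (T, interior_point X T p, ?\<tau>)"
      unfolding gluing_map_def
      by (intro bexI[OF _ z'(1)] bexI[OF _ TSS] bexI[OF _ T(2)] bexI[OF _ e'(1)] bexI[OF _ z'(4)])
        (use False TS e'(2) in simp)
    moreover have "?\<tau> p = push X q p e" using T(2) e'(2) by simp
    ultimately show ?thesis using TSS \<tau> by blast
  qed
qed

lemma gl_F:
  assumes "gl z z'"
  shows "z \<in> topspace Z" "z' \<in> topspace Z" "F z = F z'"
proof -
  obtain S T p e q where *: "S \<in> SS" "T \<in> SS" "p \<in> T" "e \<in> lim_pi0_stratum X S T" "q \<in> QQ S" "T \<noteq> S" "T \<subseteq> X closure_of S"
    "z = (S, (p, e p), q)" "z' = (T, interior_point X T p, orthant_map n X A D D' T e q)"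
    using assms unfolding gluing_map_def by (elim bexE conjE) (rule that)
  note pt = stratum_top[OF *(2,3)]
  let ?\<tau> = "\<lambda>p\<in>T. push X q p (e p)"
  have om: "orthant_map n X A D D' T e q = ?\<tau>"
    by (rule orthant_map_eq[OF SS[OF *(1)] SS[OF *(2)] *(6,7,4) QQ[OF *(1,5)]])
  have \<tau>: "?\<tau> \<in> QQ T" by (rule QQ_closed[OF *(1) SS[OF *(2)] *(6,7,4,5)])
  show "z \<in> topspace Z"
    using *(1,5,8) pt lim_pi0_stratum_at[OF *(4,3)] by (simp add: topspace_pieces)
  show "z' \<in> topspace Z"
    using *(2,9) pt int_end_lim[OF *(3) pt] \<tau> by (simp add: om interior_point_eq topspace_pieces)
  have "push X ?\<tau> p (int_end X T p) = ?\<tau> p"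
    by (rule push_int_end[OF *(3) pt QQ[OF *(2) \<tau>]])
  then show "F z = F z'" using *(3,8,9) by (simp add: F_def om interior_point_eq)
qed

lemma equiv_F:
  assumes "equivclp gl z z'"
  shows "F z = F z'"
  using assms
proof (induction rule: equivclp_induct)
  case (step y z')
  then show ?case using gl_F(3) by metis
qed simp

text \<open>Equal images mean the same \<open>p\<close> and the same orthant at \<open>p\<close>; by
  \<open>orthant_unique\<close> the normal forms are then equal.\<close>

lemma F_equiv:
  assumes z: "z \<in> topspace Z" "z' \<in> topspace Z" and eq: "F z = F z'"
  shows "equivclp gl z z'"
proof -
  obtain S p e q where ze: "z = (S, (p, e), q)" by (metis surj_pair)
  obtain S' p' e' q' where ze': "z' = (S', (p', e'), q')" by (metis surj_pair)
  have zt: "(S, (p, e), q) \<in> topspace Z" "(S', (p', e'), q') \<in> topspace Z" using z ze ze' by simp_all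
  have pp: "p' = p" using F_props(2)[OF zt(1)] F_props(2)[OF zt(2)] eq ze ze' by simp
  have "p \<in> topspace X" using zt(1) unfolding topspace_pieces by blast
  then obtain T where T: "T \<in> strata n X A D'" "p \<in> T" using strata_cover by blast
  have T': "p' \<in> T" using T(2) pp by simp
  obtain \<tau> where \<tau>: "\<tau> \<in> QQ T" "\<tau> p = push X q p e"
    "(S, (p, e), q) = (T, interior_point X T p, \<tau>) \<or> gl (S, (p, e), q) (T, interior_point X T p, \<tau>)"
    and TSS: "T \<in> SS"
    using normal_form[OF zt(1) T] by blast
  obtain \<tau>' where \<tau>': "\<tau>' \<in> QQ T" "\<tau>' p' = push X q' p' e'"
    "(S', (p', e'), q') = (T, interior_point X T p', \<tau>') \<or> gl (S', (p', e'), q') (T, interior_point X T p', \<tau>')"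
    using normal_form[OF zt(2) T(1) T'] by blast
  have "\<tau> p = \<tau>' p"
    using F_props(3)[OF zt(1)] F_props(3)[OF zt(2)] eq ze ze' \<tau>(2) \<tau>'(2) pp by simp
  then have tt: "\<tau> = \<tau>'" by (rule orthant_unique[OF T(1) QQ[OF TSS \<tau>(1)] QQ[OF TSS \<tau>'(1)] T(2)])
  have 1: "equivclp gl z (T, interior_point X T p, \<tau>)"
    using \<tau>(3) ze by (auto intro: r_into_equivclp)
  have 2: "equivclp gl z' (T, interior_point X T p, \<tau>)"
    using \<tau>'(3) ze' pp tt by (auto intro: r_into_equivclp)
  show ?thesis using equivclp_trans[OF 1 equivclp_sym[OF 2]] .
qed

section \<open>The quotient topology\<close>

lemma orth_basic_open:
  assumes V: "openin X V"
  shows "openin Xt {x \<in> topspace Xt. \<alpha> x \<in> V \<and> orth x V = C}"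
  unfolding openin_blowup
proof (intro conjI ballI)
  fix x assume x: "x \<in> {x \<in> topspace Xt. \<alpha> x \<in> V \<and> orth x V = C}"
  then have "V \<in> nbhds_of X (\<alpha> x)" using V by (simp add: nbhds_of_iff)
  then show "\<exists>V'\<in>nbhds_of X (\<alpha> x). \<forall>x'\<in>topspace Xt. \<alpha> x' \<in> V' \<and> orth x' V' = orth x V' \<longrightarrow>
      x' \<in> {x \<in> topspace Xt. \<alpha> x \<in> V \<and> orth x V = C}"
    using x by (intro bexI[of _ V]) auto
qed blast

lemma F_image: "F ` topspace Z = Y"
proof
  show "F ` topspace Z \<subseteq> Y"
  proof (rule image_subsetI)
    fix z assume z: "z \<in> topspace Z"
    obtain S p e q where ze: "z = (S, (p, e), q)" by (metis surj_pair)
    have zt: "(S, (p, e), q) \<in> topspace Z" using z ze by simp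
    have "p \<in> topspace X" using zt unfolding topspace_pieces by blast
    then obtain T where T: "T \<in> strata n X A D'" "p \<in> T" using strata_cover by blast
    obtain \<tau> where \<tau>: "T \<in> SS" "\<tau> \<in> QQ T" "\<tau> p = push X q p e"
      using normal_form[OF zt T] by blast
    show "F z \<in> Y" unfolding Y ze mem_Collect_eq F_props(2,3)[OF zt]
      using F_props(1)[OF zt] \<tau> T(2) by blast
  qed
  show "Y \<subseteq> F ` topspace Z"
  proof
    fix x assume "x \<in> Y"
    then obtain S q where x: "x \<in> topspace Xt" "S \<in> SS" "\<alpha> x \<in> S" "q \<in> QQ S" "q (\<alpha> x) = orth x" unfolding Y by blast
    let ?z = "(S, (\<alpha> x, int_end X S (\<alpha> x)), q)"
    have "?z \<in> topspace Z"
      using x alpha_top[OF x(1)] int_end_lim[OF x(3)] by (simp add: topspace_pieces)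
    moreover have "F ?z = x"
      using push_int_end[OF x(3) alpha_top[OF x(1)] QQ[OF x(2,4)]] x(5) pnt_eq[OF x(1)] by (simp add: F_def)
    ultimately show "x \<in> F ` topspace Z" by (metis imageI)
  qed
qed

lemma F_interior:
  assumes "S \<in> SS" "q \<in> QQ S" "p \<in> S"
  shows "(S, interior_point X S p, q) \<in> topspace Z" "F (S, interior_point X S p, q) = pnt p (q p)"
proof -
  note pt = stratum_top[OF assms(1,3)]
  show "(S, interior_point X S p, q) \<in> topspace Z"
    using assms pt int_end_lim[OF assms(3) pt] by (simp add: interior_point_eq topspace_pieces)
  show "F (S, interior_point X S p, q) = pnt p (q p)"
    using push_int_end[OF assms(3) pt QQ[OF assms(1,2)]] by (simp add: F_def interior_point_eq)
qed

text \<open>A neighbourhood \<open>V\<close> that tests openness in the blow-up also tests it in the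
  endpoint modification, since \<open>push\<close> at \<open>V\<close> depends on \<open>e\<close>
  only through \<open>e V\<close>.\<close>

lemma F_open_preimage:
  assumes Q: "openin Xt Q"
  shows "openin Z {z \<in> topspace Z. F z \<in> Q}"
  unfolding openin_pieces
proof (intro conjI ballI)
  fix S q assume S: "S \<in> SS" and q: "q \<in> QQ S"
  show "openin (endpoint_modification X S) {a. (S, a, q) \<in> {z \<in> topspace Z. F z \<in> Q}}"
    unfolding endpoint_modification_openin
  proof (intro conjI allI impI)
    show "{a. (S, a, q) \<in> {z \<in> topspace Z. F z \<in> Q}} \<subseteq> {(p, e). p \<in> topspace X \<and> e \<in> lim_pi0 X S p}"
      by (auto simp: topspace_pieces)
    fix p e assume "(p, e) \<in> {a. (S, a, q) \<in> {z \<in> topspace Z. F z \<in> Q}}"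
    then have z: "(S, (p, e), q) \<in> topspace Z" and FQ: "F (S, (p, e), q) \<in> Q" by simp_all
    have pe: "p \<in> topspace X" "e \<in> lim_pi0 X S p" using z unfolding topspace_pieces by blast+
    obtain V where V: "V \<in> nbhds_of X p"
      "\<forall>x'\<in>topspace Xt. \<alpha> x' \<in> V \<and> orth x' V = push X q p e V \<longrightarrow> x' \<in> Q"
      using Q FQ F_props(2,3)[OF z] unfolding openin_blowup by metis
    have "(p', e') \<in> {a. (S, a, q) \<in> {z \<in> topspace Z. F z \<in> Q}}"
      if p': "p' \<in> V" and e': "e' \<in> lim_pi0 X S p'" and eq: "e' V = e V" for p' e'
    proof -
      have V': "V \<in> nbhds_of X p'" using V(1) p' by (simp add: nbhds_of_iff)
      then have "p' \<in> topspace X" using openin_subset by (auto simp: nbhds_of_iff)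
      then have z': "(S, (p', e'), q) \<in> topspace Z" using S q e' by (simp add: topspace_pieces)
      obtain y where y: "y \<in> e' V" using lim_pi0_nonempty[OF e' V'] by blast
      have "push X q p' e' V = q y V" by (rule push_eq[OF e' QQ[OF S q] V' y])
      moreover have "push X q p e V = q y V" by (rule push_eq[OF pe(2) QQ[OF S q] V(1)]) (use y eq in simp)
      ultimately have "orth (F (S, (p', e'), q)) V = push X q p e V" using F_props(3)[OF z'] by simp
      then have "F (S, (p', e'), q) \<in> Q" using V(2) F_props(1,2)[OF z'] p' by simp
      then show ?thesis using z' by simp
    qed
    then show "\<exists>V\<in>nbhds_of X p. \<forall>p'\<in>V. \<forall>e'\<in>lim_pi0 X S p'. e' V = e V \<longrightarrow>
        (p', e') \<in> {a. (S, a, q) \<in> {z \<in> topspace Z. F z \<in> Q}}"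
      by (intro bexI[OF _ V(1)] ballI impI)
  qed
qed blast

text \<open>A component of \<open>S\<close> in the cube might split inside the box. Contraction
  towards \<open>p\<close> shows that it does not, so its points in the box belong to the end
  there.\<close>

lemma end_in_box:
  assumes q: "nc_cube p k U \<phi> \<epsilon> J" and S: "S \<in> strata n X A D'" and e: "e \<in> lim_pi0 X S p" and d: "d > 0"
    and y: "y \<in> e U" "y \<in> coord_box U \<phi> p d"
  shows "y \<in> e (coord_box U \<phi> p d)"
proof -
  note q' = nc_cube_D[OF q]
  let ?N = "coord_box U \<phi> p d"
  have U: "U \<in> nbhds_of X p" using q'(2,10) by (simp add: nbhds_of_iff)
  have N: "?N \<in> nbhds_of X p" using chart_box_open[OF q'(1)] q'(2) d by (simp add: nbhds_of_iff)
  have contr: "scl U \<phi> p t x \<in> S" if "x \<in> U" "x \<in> S" "0 < t" "t \<le> 1" for x t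
  proof -
    have t: "0 \<le> t" using that by simp
    note s = scl_props[OF q q'(2) that(1) t that(4)]
    have "same_signs k \<phi> x (scl U \<phi> p t x)"
      unfolding same_signs_def s(2) using that(3) by (simp add: q'(3) sgn_mult)
    then show ?thesis using strata_saturated[OF q S] that(1,2) s(1) unfolding saturated_def by blast
  qed
  have pc: "path_connectedin X (e U \<inter> ?N)"
    by (rule contraction(1)[OF q q'(2) contr lim_pi0_comp[OF e U] d])
  have "path_connectedin (subtopology X (?N \<inter> S)) (e U \<inter> ?N)"
    using pc lim_pi0_subset[OF e U] by (auto simp: path_connectedin_subtopology)
  moreover have "\<not> disjnt (e ?N) (e U \<inter> ?N)"
  proof -
    obtain w where w: "w \<in> e ?N" using lim_pi0_nonempty[OF e N] by blast
    have "w \<in> e U" using lim_pi0_mono[OF e N U] w by blast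
    moreover have "w \<in> ?N" using lim_pi0_subset[OF e N] w by blast
    ultimately show ?thesis using w unfolding disjnt_def by blast
  qed
  ultimately have "e U \<inter> ?N \<subseteq> e ?N"
    using path_components_of_maximal[OF lim_pi0_comp[OF e N]] by blast
  then show ?thesis using y by blast
qed

text \<open>Openness of the preimage gives a neighbourhood for each point over \<open>x\<close>.
  Such a point is determined by the face \<open>e U\<close>, so one box serves all of them. A nearby
  point of \<open>Y\<close> lies on a face whose end at the centre, with the same orthant section,
  is one of the points over \<open>x\<close>.\<close>

lemma F_preimage_open:
  assumes W: "W \<subseteq> Y" and FW: "openin Z {z \<in> topspace Z. F z \<in> W}"
  shows "openin (subtopology Xt Y) W"
proof -
  have "\<exists>Q. openin Xt Q \<and> x \<in> Q \<and> Q \<inter> Y \<subseteq> W" if xW: "x \<in> W" for x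
  proof -
    have xt: "x \<in> topspace Xt" using xW W unfolding Y by blast
    let ?p = "\<alpha> x"
    have pt: "?p \<in> topspace X" by (rule alpha_top[OF xt])
    obtain k U \<phi> \<epsilon> J where q: "nc_cube ?p k U \<phi> \<epsilon> J"
      using nc_cube_exists[OF pt openin_topspace pt] by blast
    note q' = nc_cube_D[OF q]
    have U: "U \<in> nbhds_of X ?p" using q'(2,10) by (simp add: nbhds_of_iff)
    let ?K = "{C. \<exists>S\<in>strata n X A D'. C \<in> path_components_of (subtopology X (U \<inter> S))}"
    let ?P = "\<lambda>C S s e. S \<in> SS \<and> s \<in> QQ S \<and> e \<in> lim_pi0 X S ?p \<and> e U = C \<and> push X s ?p e = orth x"
    have "\<exists>V\<in>nbhds_of X ?p. \<forall>S s e. ?P C S s e \<longrightarrow>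
       (\<forall>p'\<in>V. \<forall>e'\<in>lim_pi0 X S p'. e' V = e V \<longrightarrow> F (S, (p', e'), s) \<in> W)" for C
    proof (cases "\<exists>S s e. ?P C S s e")
      case False
      then show ?thesis using pt by (intro bexI[of _ "topspace X"]) (auto simp: nbhds_of_iff)
    next
      case True
      then obtain S s e where P: "S \<in> SS" "s \<in> QQ S" "e \<in> lim_pi0 X S ?p" "e U = C" "push X s ?p e = orth x" by blast
      \<comment> \<open>The face \<open>C\<close> fixes the stratum, the end by injectivity of
        evaluation, and, at a point \<open>y\<close> of \<open>C\<close>, the orthant, as the one
        with value \<open>orth x U\<close> on \<open>U\<close>.\<close>
      have uniq: "S' = S \<and> s' = s \<and> e' = e" if P': "S' \<in> SS" "s' \<in> QQ S'" "e' \<in> lim_pi0 X S' ?p" "e' U = C" "push X s' ?p e' = orth x" for S' s' e'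
      proof -
        obtain y where y: "y \<in> C" using lim_pi0_nonempty[OF P(3) U] P(4) by blast
        have ye: "y \<in> e U" "y \<in> e' U" using y P(4) P'(4) by simp_all
        have yS: "y \<in> S" "y \<in> U" "y \<in> S'" using lim_pi0_subset[OF P(3) U] lim_pi0_subset[OF P'(3) U] ye by blast+
        have SS': "S' = S" by (rule strata_disjoint[OF SS[OF P'(1)] SS[OF P(1)] yS(3,1)])
        have "bij_betw (\<lambda>c. c U) (lim_pi0 X S ?p) (path_components_of (subtopology X (U \<inter> S)))"
          by (rule eval_bij[OF q strata_saturated[OF q SS[OF P(1)]] q'(2)]) (simp add: q'(3))
        then have inj: "inj_on (\<lambda>c. c U) (lim_pi0 X S ?p)" by (simp add: bij_betw_def)
        have ee: "e' = e" by (rule inj_onD[OF inj _ _ P(3)]) (use P(4) P'(3,4) SS' in simp_all)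
        have "s y U = orth x U" using push_eq[OF P(3) QQ[OF P(1,2)] U ye(1)] P(5) by simp
        moreover have "s' y U = orth x U" using push_eq[OF P'(3) QQ[OF P'(1,2)] U ye(2)] P'(5) by simp
        moreover have sl: "s \<in> lim_pi0_stratum X B S" "s' \<in> lim_pi0_stratum X B S"
          using QQ[OF P(1,2)] QQ[OF P'(1,2)] SS' by simp_all
        ultimately have "s' y = s y"
          using inj_onD[OF compl_eval_inj[OF q yS(2)] _ lim_pi0_stratum_at[OF sl(2) yS(1)] lim_pi0_stratum_at[OF sl(1) yS(1)]] by simp
        then have "s' = s" by (rule orthant_unique[OF SS[OF P(1)] sl(2,1) yS(1)])
        then show ?thesis using SS' ee by blast
      qed
      have z: "(S, (?p, e), s) \<in> topspace Z" using P(1-3) pt by (simp add: topspace_pieces)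
      have "F (S, (?p, e), s) = x"
        using P(5) pnt_eq[OF xt] by (simp add: F_def)
      then have mem: "(?p, e) \<in> {a. (S, a, s) \<in> {z \<in> topspace Z. F z \<in> W}}" using z xW by simp
      have "openin (endpoint_modification X S) {a. (S, a, s) \<in> {z \<in> topspace Z. F z \<in> W}}"
        using FW P(1,2) unfolding openin_pieces by blast
      then have "\<exists>V\<in>nbhds_of X ?p. \<forall>p'\<in>V. \<forall>e'\<in>lim_pi0 X S p'. e' V = e V \<longrightarrow>
          (p', e') \<in> {a. (S, a, s) \<in> {z \<in> topspace Z. F z \<in> W}}"
        unfolding endpoint_modification_openin using mem by (elim conjE allE impE)
      then obtain V where V: "V \<in> nbhds_of X ?p" "\<forall>p'\<in>V. \<forall>e'\<in>lim_pi0 X S p'. e' V = e V \<longrightarrow>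
          (p', e') \<in> {a. (S, a, s) \<in> {z \<in> topspace Z. F z \<in> W}}" by (elim bexE)
      show ?thesis
      proof (rule bexI[OF _ V(1)], intro allI impI ballI)
        fix S' s' e' p' e''
        assume P': "?P C S' s' e'" and p': "p' \<in> V" and e'': "e'' \<in> lim_pi0 X S' p'" "e'' V = e' V"
        have "S' = S \<and> s' = s \<and> e' = e" by (rule uniq) (use P' in blast)+
        then show "F (S', (p', e''), s') \<in> W" using V(2)[rule_format, OF p', of e''] e'' by simp
      qed
    qed
    then obtain V where V: "\<And>C. V C \<in> nbhds_of X ?p"
      "\<And>C S s e p' e'. ?P C S s e \<Longrightarrow> p' \<in> V C \<Longrightarrow> e' \<in> lim_pi0 X S p' \<Longrightarrow> e' (V C) = e (V C) \<Longrightarrow> F (S, (p', e'), s) \<in> W"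
      by metis
    have "openin X (U \<inter> (\<Inter>C\<in>?K. V C))"
    proof (cases "?K = {}")
      case True
      then show ?thesis using q'(10) by simp
    next
      case False
      have "openin X (\<Inter>C\<in>?K. V C)"
        by (rule openin_INT2[OF finite_cube_components[OF q] False]) (use V(1) in \<open>simp add: nbhds_of_iff\<close>)
      then show ?thesis using q'(10) by blast
    qed
    then have "U \<inter> (\<Inter>C\<in>?K. V C) \<in> nbhds_of X ?p"
      using q'(2) V(1) unfolding nbhds_of_iff by blast
    then obtain d where d: "d > 0" "coord_box U \<phi> ?p d \<in> nbhds_of X ?p" "coord_box U \<phi> ?p d \<subseteq> U \<inter> (\<Inter>C\<in>?K. V C)"
      using box_nbhd[OF q q'(2)] by blast
    let ?N = "coord_box U \<phi> ?p d"
    let ?Q = "{x' \<in> topspace Xt. \<alpha> x' \<in> ?N \<and> orth x' ?N = orth x ?N}"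
    have "openin Xt ?Q" by (rule orth_basic_open) (use d(2) in \<open>simp add: nbhds_of_iff\<close>)
    moreover have "x \<in> ?Q" using xt d(2) unfolding nbhds_of_iff by blast
    moreover have "?Q \<inter> Y \<subseteq> W"
    proof
      fix x' assume x': "x' \<in> ?Q \<inter> Y"
      then have x't: "x' \<in> topspace Xt" "\<alpha> x' \<in> ?N" "orth x' ?N = orth x ?N" by blast+
      obtain S s where S: "S \<in> SS" "\<alpha> x' \<in> S" "s \<in> QQ S" "s (\<alpha> x') = orth x'" using x' unfolding Y by blast
      let ?p' = "\<alpha> x'"
      have p't: "?p' \<in> topspace X" by (rule alpha_top[OF x't(1)])
      have p'U: "?p' \<in> U" using x't(2) by blast
      \<comment> \<open>The face through the image of \<open>x'\<close>. It is adjacent to the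
        centre of the cube, so it comes from an end \<open>e\<close> there, and pushing
        \<open>s\<close> along \<open>e\<close> gives \<open>orth x\<close>.\<close>
      let ?C = "path_component_of_set (subtopology X (U \<inter> S)) ?p'"
      have C: "?C \<in> path_components_of (subtopology X (U \<inter> S))"
        using p'U S(2) p't by (simp add: path_component_in_path_components_of)
      have p'C: "?p' \<in> ?C" using p'U S(2) p't by (simp add: path_component_of_refl)
      have "bij_betw (\<lambda>c. c U) (lim_pi0 X S ?p) (path_components_of (subtopology X (U \<inter> S)))"
        by (rule eval_bij[OF q strata_saturated[OF q SS[OF S(1)]] q'(2)]) (simp add: q'(3))
      then have "?C \<in> (\<lambda>c. c U) ` lim_pi0 X S ?p" using C by (simp add: bij_betw_def)
      then obtain e where e: "e \<in> lim_pi0 X S ?p" "e U = ?C" by (metis (no_types, lifting) imageE)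
      have p'e: "?p' \<in> e U" using p'C e(2) by simp
      have nb: "?N \<in> nbhds_of X ?p'" "U \<in> nbhds_of X ?p'"
        using d(2) x't(2) U p'U unfolding nbhds_of_iff by blast+
      have "orth x' U = orth x U"
        by (rule lim_pi0_agree_mono[OF orth_lim[OF x't(1)] orth_lim[OF xt] nb(1) d(2) nb(2) U _ x't(3)]) blast
      then have "push X s ?p e U = orth x U" using push_eq[OF e(1) QQ[OF S(1,3)] U p'e] S(4) by simp
      then have pu: "push X s ?p e = orth x"
        using inj_onD[OF compl_eval_inj[OF q q'(2)] _ push_lim[OF e(1) QQ[OF S(1,3)]] orth_lim[OF xt]] by blast
      have CK: "?C \<in> ?K" using C SS[OF S(1)] by blast
      have NV: "?N \<subseteq> V ?C" using d(3) CK by blast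
      \<comment> \<open>The neighbourhood \<open>V ?C\<close> refers to ends at the centre. To use
        it at \<open>?p'\<close>, the interior end of \<open>?p'\<close> must agree there with
        \<open>e\<close>, which holds once \<open>?p'\<close> belongs to \<open>e\<close> on the
        box.\<close>
      have p'N: "?p' \<in> e ?N" by (rule end_in_box[OF q SS[OF S(1)] e(1) d(1) p'e x't(2)])
      then have p'V: "?p' \<in> e (V ?C)" using lim_pi0_mono[OF e(1) d(2) V(1) NV] by blast
      have nV: "V ?C \<in> nbhds_of X ?p'" using V(1)[of ?C] NV x't(2) unfolding nbhds_of_iff by blast
      note i = int_end_lim[OF S(2) p't]
      have "int_end X S ?p' (V ?C) = e (V ?C)"
        by (rule lim_pi0_agree[OF i e(1) nV V(1) int_end_mem[OF S(2) p't nV] p'V])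
      then have "F (S, (?p', int_end X S ?p'), s) \<in> W"
        using V(2)[of S s e ?C ?p' "int_end X S ?p'"] S(1,3) e pu NV x't(2) i by blast
      moreover have "F (S, (?p', int_end X S ?p'), s) = x'"
        using F_interior(2)[OF S(1,3,2)] S(4) pnt_eq[OF x't(1)] by (simp add: interior_point_eq)
      ultimately show "x' \<in> W" by simp
    qed
    ultimately show ?thesis by blast
  qed
  note ex = this
  show ?thesis
  proof (subst openin_subopen, intro ballI)
    fix x assume x: "x \<in> W"
    obtain Q where Q: "openin Xt Q" "x \<in> Q" "Q \<inter> Y \<subseteq> W" using ex[OF x] by blast
    then have "openin (subtopology Xt Y) (Q \<inter> Y)" by (simp add: openin_subtopology_Int)
    moreover have "x \<in> Q \<inter> Y" using Q(2) W x by blast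
    ultimately show "\<exists>T. openin (subtopology Xt Y) T \<and> x \<in> T \<and> T \<subseteq> W" using Q(3) by blast
  qed
qed

lemma F_quotient: "quotient_map Z (subtopology Xt Y) F"
  unfolding quotient_map_def
proof (intro conjI allI impI)
  have YX: "Y \<subseteq> topspace Xt" unfolding Y by blast
  show "F ` topspace Z = topspace (subtopology Xt Y)" using F_image YX by auto
  fix W assume "W \<subseteq> topspace (subtopology Xt Y)"
  then have W: "W \<subseteq> Y" by auto
  show "openin Z {z \<in> topspace Z. F z \<in> W} \<longleftrightarrow> openin (subtopology Xt Y) W"
  proof
    assume "openin (subtopology Xt Y) W"
    then obtain Q where Q: "openin Xt Q" "W = Q \<inter> Y" by (auto simp: openin_subtopology)
    have "{z \<in> topspace Z. F z \<in> W} = {z \<in> topspace Z. F z \<in> Q}" using Q(2) F_image by blast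
    then show "openin Z {z \<in> topspace Z. F z \<in> W}" using F_open_preimage[OF Q(1)] by simp
  qed (rule F_preimage_open[OF W])
qed

lemma glue_class_refl: "z \<in> topspace Z \<Longrightarrow> z \<in> glue_class Z gl z"
  by (simp add: glue_class_def)

lemma glue_homeomorphism:
  obtains h where "homeomorphic_map (glue Z gl) (subtopology Xt Y) h"
    "\<And>z. z \<in> topspace Z \<Longrightarrow> h (glue_class Z gl z) = F z"
proof -
  \<comment> \<open>Defined through chosen representatives; \<open>equiv_F\<close> shows that the
    value is independent of the choice.\<close>
  define h where "h = (\<lambda>w. F (SOME z. z \<in> topspace Z \<and> glue_class Z gl z = w))"
  have h: "h (glue_class Z gl z) = F z" if z: "z \<in> topspace Z" for z
  proof -
    define z0 where "z0 = (SOME z'. z' \<in> topspace Z \<and> glue_class Z gl z' = glue_class Z gl z)"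
    have z0: "z0 \<in> topspace Z \<and> glue_class Z gl z0 = glue_class Z gl z"
      unfolding z0_def by (rule someI[of _ z]) (use z in simp)
    have "z0 \<in> glue_class Z gl z"
      using glue_class_refl[OF z0[THEN conjunct1]] unfolding z0[THEN conjunct2] .
    then have "equivclp gl z z0" by (simp add: glue_class_def)
    then have "F z = F z0" by (rule equiv_F)
    then show ?thesis by (simp add: h_def z0_def)
  qed
  have qm: "quotient_map Z (glue Z gl) (glue_class Z gl)" by (rule quotient_map_glue)
  have comp: "quotient_map Z (subtopology Xt Y) (h \<circ> glue_class Z gl)"
    using F_quotient h by (rule_tac quotient_map_eq[of _ _ F]) auto
  have cont: "continuous_map (glue Z gl) (subtopology Xt Y) h"
    by (rule continuous_compose_quotient_map[OF qm quotient_imp_continuous_map[OF comp]])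
  have "quotient_map (glue Z gl) (subtopology Xt Y) h"
    by (rule quotient_map_from_composition[OF quotient_imp_continuous_map[OF qm] cont comp])
  moreover have "inj_on h (topspace (glue Z gl))"
  proof (rule inj_onI)
    fix w w' assume w: "w \<in> topspace (glue Z gl)" "w' \<in> topspace (glue Z gl)" "h w = h w'"
    have top: "topspace (glue Z gl) = glue_class Z gl ` topspace Z"
      using quotient_imp_surjective_map[OF qm] by simp
    obtain z z' where z: "z \<in> topspace Z" "w = glue_class Z gl z" "z' \<in> topspace Z" "w' = glue_class Z gl z'"
      using w(1,2) unfolding top by blast
    have "F z = F z'" using w(3) h z by simp
    then have eq: "equivclp gl z z'" by (rule F_equiv[OF z(1,3)])
    have "equivclp gl z y \<longleftrightarrow> equivclp gl z' y" for y
      using eq equivclp_trans equivclp_sym by metis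
    then show "w = w'" unfolding z(2,4) glue_class_def by blast
  qed
  ultimately have "homeomorphic_map (glue Z gl) (subtopology Xt Y) h"
    by (simp add: homeomorphic_map_def)
  then show ?thesis using that h by blast
qed

section \<open>The strata of the glued space\<close>

definition L :: "'a set \<Rightarrow> ('a \<Rightarrow> 'a set \<Rightarrow> 'a set) \<Rightarrow> 'b set" where
  "L S q = {x \<in> topspace Xt. \<alpha> x \<in> S \<and> orth x = q (\<alpha> x)}"

lemma L_image:
  assumes "S \<in> SS" "q \<in> QQ S"
  shows "(\<lambda>p. pnt p (q p)) ` S = L S q"
proof
  show "(\<lambda>p. pnt p (q p)) ` S \<subseteq> L S q"
  proof (rule image_subsetI)
    fix p assume p: "p \<in> S"
    note pn = pnt_props[OF stratum_top[OF assms(1) p] lim_pi0_stratum_at[OF QQ[OF assms] p]]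
    show "pnt p (q p) \<in> L S q" unfolding L_def using pn p by simp
  qed
  show "L S q \<subseteq> (\<lambda>p. pnt p (q p)) ` S"
  proof
    fix x assume "x \<in> L S q"
    then have x: "x \<in> topspace Xt" "\<alpha> x \<in> S" "orth x = q (\<alpha> x)" unfolding L_def by blast+
    then have "x = pnt (\<alpha> x) (q (\<alpha> x))" using pnt_eq[OF x(1)] by simp
    then show "x \<in> (\<lambda>p. pnt p (q p)) ` S" using x(2) by blast
  qed
qed

lemma L_subset_Y: "S \<in> SS \<Longrightarrow> q \<in> QQ S \<Longrightarrow> L S q \<subseteq> Y"
  unfolding Y L_def by (rule subsetI) (drule CollectD, rule CollectI, metis)

text \<open>The section that sends \<open>p\<close> to \<open>pnt p (q p)\<close> is continuous on
  the connected set \<open>S\<close>: inside a cube contained in \<open>V\<close> the value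
  \<open>q p V\<close> does not vary along \<open>S\<close>.\<close>

lemma L_connected:
  assumes S: "S \<in> SS" and q: "q \<in> QQ S"
  shows "connectedin Xt (L S q)"
proof -
  let ?s = "\<lambda>p. pnt p (q p)"
  note ql = QQ[OF S q]
  note pn = pnt_props[OF stratum_top[OF S] lim_pi0_stratum_at[OF ql]]
  have "continuous_map (subtopology X S) Xt ?s"
    unfolding continuous_map_def
  proof (intro conjI allI impI)
    show "?s \<in> topspace (subtopology X S) \<rightarrow> topspace Xt" using pn(1) by auto
    fix Q assume Q: "openin Xt Q"
    have tS: "topspace (subtopology X S) = S" using stratum_top[OF S] by auto
    show "openin (subtopology X S) {p \<in> topspace (subtopology X S). ?s p \<in> Q}"
      unfolding tS
    proof (subst openin_subopen, intro ballI)
      fix p assume "p \<in> {p \<in> S. ?s p \<in> Q}"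
      then have p: "p \<in> S" "?s p \<in> Q" by simp_all
      note pp = pn[OF p(1) p(1)]
      obtain V where V: "V \<in> nbhds_of X p" "\<forall>x'\<in>topspace Xt. \<alpha> x' \<in> V \<and> orth x' V = q p V \<longrightarrow> x' \<in> Q"
        using Q p(2) pp(2,3) unfolding openin_blowup by metis
      obtain k U \<phi> \<epsilon> J where c: "nc_cube p k U \<phi> \<epsilon> J" "U \<subseteq> V"
        using nc_cube_nbhd[OF stratum_top[OF S p(1)] V(1)] by blast
      note c' = nc_cube_D[OF c(1)]
      have "?s p' \<in> Q" if p': "p' \<in> U" "p' \<in> S" for p'
      proof -
        note pp' = pn[OF p'(2) p'(2)]
        have "path_component_of (subtopology X (U \<inter> S)) p' p"
          by (rule stratum_cube_path[OF c(1) SS[OF S] p(1) p' c'(2) p(1)])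
        then have "path_component_of (subtopology X (V \<inter> S)) p' p"
          by (rule path_component_of_mono) (use c(2) in blast)
        then have "q p' V = q p V" using lim_pi0_stratum_const[OF ql] V(1) by (simp add: nbhds_of_iff)
        then show ?thesis using V(2) pp' p'(1) c(2) by auto
      qed
      then have "S \<inter> U \<subseteq> {p \<in> S. ?s p \<in> Q}" by blast
      moreover have "openin (subtopology X S) (S \<inter> U)" using c'(10) by (simp add: openin_subtopology_Int2)
      moreover have "p \<in> S \<inter> U" using p(1) c'(2) by simp
      ultimately show "\<exists>T. openin (subtopology X S) T \<and> p \<in> T \<and> T \<subseteq> {p \<in> S. ?s p \<in> Q}" by blast
    qed
  qed
  moreover have "connectedin (subtopology X S) S"
    using strata_facts(3)[OF SS[OF S]] by (simp add: connectedin_subtopology)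
  ultimately have "connectedin Xt (?s ` S)" by (rule connectedin_continuous_map_image)
  then show ?thesis using L_image[OF S q] by simp
qed

abbreviation "over S \<equiv> {x \<in> topspace Xt \<inter> Y. \<alpha> x \<in> S}"

lemma L_components:
  assumes S: "S \<in> SS"
  shows "connected_components_of (subtopology Xt (over S)) = L S ` QQ S"
proof (rule connected_components_partition)
  have top: "topspace (subtopology Xt (over S)) = over S" by auto
  have Lo: "L S q \<subseteq> over S" if "q \<in> QQ S" for q
    using L_subset_Y[OF S that] unfolding L_def by blast
  show "\<Union>(L S ` QQ S) = topspace (subtopology Xt (over S))"
    unfolding top
  proof
    show "\<Union>(L S ` QQ S) \<subseteq> over S" using Lo by blast
    show "over S \<subseteq> \<Union>(L S ` QQ S)"
    proof
      fix x assume x: "x \<in> over S"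
      then obtain S' q where S': "S' \<in> SS" "\<alpha> x \<in> S'" "q \<in> QQ S'" "q (\<alpha> x) = orth x" unfolding Y by blast
      have "S' = S" by (rule strata_disjoint[OF SS[OF S'(1)] SS[OF S] S'(2)]) (use x in blast)
      then have "x \<in> L S q" "q \<in> QQ S" using x S' unfolding L_def by simp_all
      then show "x \<in> \<Union>(L S ` QQ S)" by blast
    qed
  qed
  fix C assume "C \<in> L S ` QQ S"
  then obtain q where q: "q \<in> QQ S" "C = L S q" by blast
  show "C \<noteq> {}"
    using L_image[OF S q(1)] strata_facts(2)[OF SS[OF S]] q(2) by blast
  show "connectedin (subtopology Xt (over S)) C"
    using L_connected[OF S q(1)] Lo[OF q(1)] q(2) by (simp add: connectedin_subtopology)
  show "openin (subtopology Xt (over S)) C"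
  proof (subst openin_subopen, intro ballI)
    fix x assume "x \<in> C"
    then have x: "x \<in> topspace Xt" "\<alpha> x \<in> S" "orth x = q (\<alpha> x)" unfolding q(2) L_def by blast+
    obtain k U \<phi> \<epsilon> J where c: "nc_cube (\<alpha> x) k U \<phi> \<epsilon> J"
      using nc_cube_exists[OF alpha_top[OF x(1)] openin_topspace alpha_top[OF x(1)]] by blast
    note c' = nc_cube_D[OF c]
    \<comment> \<open>On \<open>S \<inter> U\<close> the section \<open>q\<close> has one value on
      \<open>U\<close>, and this value determines the orthant at each point; so \<open>?Q\<close>
      meets no other stratum over \<open>S\<close>.\<close>
    let ?Q = "{x' \<in> topspace Xt. \<alpha> x' \<in> U \<and> orth x' U = orth x U}"
    have "openin Xt ?Q" by (rule orth_basic_open[OF c'(10)])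
    then have "openin (subtopology Xt (over S)) (over S \<inter> ?Q)" by (simp add: openin_subtopology_Int2)
    moreover have "x \<in> over S \<inter> ?Q" using Lo[OF q(1)] \<open>x \<in> C\<close> q(2) c'(2) x(1) by blast
    moreover have "over S \<inter> ?Q \<subseteq> C"
    proof
      fix x' assume x': "x' \<in> over S \<inter> ?Q"
      then have x1: "x' \<in> topspace Xt" "\<alpha> x' \<in> S" "\<alpha> x' \<in> U" "orth x' U = orth x U" by blast+
      have "q (\<alpha> x') U = q (\<alpha> x) U"
        using lim_pi0_stratum_const[OF QQ[OF S q(1)] c'(10)] stratum_cube_path[OF c SS[OF S] x(2) x1(3,2) c'(2) x(2)] by blast
      then have "q (\<alpha> x') U = orth x' U" using x(3) x1(4) by simp
      then have "q (\<alpha> x') = orth x'"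
        using inj_onD[OF compl_eval_inj[OF c x1(3)] _ lim_pi0_stratum_at[OF QQ[OF S q(1)] x1(2)] orth_lim[OF x1(1)]] by blast
      then show "x' \<in> C" using x1 unfolding q(2) L_def by simp
    qed
    ultimately show "\<exists>T. openin (subtopology Xt (over S)) T \<and> x \<in> T \<and> T \<subseteq> C" by blast
  qed
  fix C' x assume "C' \<in> L S ` QQ S" and xC: "x \<in> C" "x \<in> C'"
  then obtain q' where q': "q' \<in> QQ S" "C' = L S q'" by blast
  have x: "\<alpha> x \<in> S" "q (\<alpha> x) = q' (\<alpha> x)" using xC unfolding q(2) q'(2) L_def by simp_all
  have "q = q'" by (rule orthant_unique[OF SS[OF S] QQ[OF S q(1)] QQ[OF S q'(1)] x])
  then show "C = C'" using q(2) q'(2) by simp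
qed

end

section \<open>Whitney stratification\<close>

lemma limitin_Euclidean_coord:
  assumes "limitin (Euclidean_space n) x z sequentially"
  shows "(\<lambda>j. x j i) \<longlonglongrightarrow> z i"
  using continuous_map_limit[OF continuous_map_Euclidean_coord[of n i] assms]
  by (simp add: o_def)

text \<open>Condition (b) for unions of faces: near \<open>z\<close> the points of \<open>N\<close> lie on the face through \<open>z\<close>, so that
  the secants are tangent to the faces of \<open>M\<close>.\<close>

lemma whitney_faces:
  assumes k: "k \<le> n" and \<epsilon>: "\<epsilon> > 0" and M: "M \<subseteq> cube n \<epsilon>"
    and sat: "\<And>x y. x \<in> M \<Longrightarrow> y \<in> cube n \<epsilon> \<Longrightarrow> (\<And>i. i < k \<Longrightarrow> sgn (x i) = sgn (y i)) \<Longrightarrow> y \<in> M"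
    and N: "\<And>x. x \<in> N \<Longrightarrow> card {i. i < k \<and> x i = 0} = c"
  shows "whitney_b n M N"
  unfolding whitney_b_def
proof (intro ballI allI impI)
  fix z x y v \<tau>
  assume z: "z \<in> N" and *: "(\<forall>j. x j \<in> M \<and> y j \<in> N \<and> x j \<noteq> y j) \<and>
        limitin (Euclidean_space n) x z sequentially \<and>
        limitin (Euclidean_space n) y z sequentially \<and>
        limitin (Euclidean_space n)
          (\<lambda>j i. (x j i - y j i) / sqrt (\<Sum>l<n. (x j l - y j l)\<^sup>2)) v sequentially \<and>
        set_limit n (\<lambda>j. tangent_space n M (x j)) \<tau>"
  have xM: "\<And>j. x j \<in> M" and yN: "\<And>j. y j \<in> N" and lx: "limitin (Euclidean_space n) x z sequentially"
    and ly: "limitin (Euclidean_space n) y z sequentially"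
    and lv: "limitin (Euclidean_space n) (\<lambda>j i. (x j i - y j i) / sqrt (\<Sum>l<n. (x j l - y j l)\<^sup>2)) v sequentially"
    and st: "set_limit n (\<lambda>j. tangent_space n M (x j)) \<tau>"
    using * by blast+
  let ?Z = "\<lambda>a::nat \<Rightarrow> real. {i. i < k \<and> a i = 0}"
  have nz: "\<forall>\<^sub>F j in sequentially. a j i \<noteq> 0" if "limitin (Euclidean_space n) a z sequentially" "z i \<noteq> 0" for a i
    using tendsto_imp_eventually_ne[OF limitin_Euclidean_coord[OF that(1)] that(2)] .
  have nzz: "\<forall>\<^sub>F j in sequentially. x j i \<noteq> 0 \<and> y j i \<noteq> 0" if "z i \<noteq> 0" for i
    by (rule eventually_conj[OF nz[OF lx that] nz[OF ly that]])
  have "\<forall>\<^sub>F j in sequentially. \<forall>i\<in>{i. i < k \<and> z i \<noteq> 0}. x j i \<noteq> 0 \<and> y j i \<noteq> 0"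
    by (rule eventually_ball_finite) (simp_all add: nzz)
  then obtain j0 where j0: "\<And>j i. j \<ge> j0 \<Longrightarrow> i < k \<Longrightarrow> z i \<noteq> 0 \<Longrightarrow> x j i \<noteq> 0 \<and> y j i \<noteq> 0"
    unfolding eventually_sequentially by blast
  have Zx: "?Z (x j) \<subseteq> ?Z z" if "j \<ge> j0" for j using j0[OF that] by blast
  \<comment> \<open>Points of \<open>N\<close> near \<open>z\<close> have no zeros that
    \<open>z\<close> lacks, and they have equally many.\<close>
  have Zy: "?Z (y j) = ?Z z" if "j \<ge> j0" for j
  proof (rule card_subset_eq)
    show "?Z (y j) \<subseteq> ?Z z" using j0[OF that] by blast
    show "card (?Z (y j)) = card (?Z z)" using N[OF z] N[OF yN] by simp
  qed simp
  \<comment> \<open>Only finitely many zero sets occur, so one of them occurs along a subsequence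
    \<open>r\<close>; \<open>set_limit\<close> speaks about subsequences as well.\<close>
  have "finite ((\<lambda>j. ?Z (x j)) ` {j0..})"
    by (rule finite_subset[of _ "Pow {..<k}"]) auto
  then obtain i0 where i0: "i0 \<in> {j0..}" "infinite {j \<in> {j0..}. ?Z (x j) = ?Z (x i0)}"
    using pigeonhole_infinite[of "{j0..}" "\<lambda>j. ?Z (x j)"] infinite_Ici by blast
  then obtain r where r: "strict_mono (r :: nat \<Rightarrow> nat)" and rJ: "\<And>j. r j \<ge> j0 \<and> ?Z (x (r j)) = ?Z (x i0)"
    using strict_mono_enumerate[OF i0(2)] enumerate_in_set[OF i0(2)] by blast
  have vE: "v \<in> topspace (Euclidean_space n)" using limitin_topspace[OF lv] .
  \<comment> \<open>A coordinate vanishing along this subsequence of \<open>x\<close> vanishes at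
    \<open>z\<close>, hence also along \<open>y\<close>. So the secants have no component in its
    direction.\<close>
  have v0: "v i = 0" if i: "i < k" "x i0 i = 0" for i
  proof -
    let ?s = "\<lambda>j. (x j i - y j i) / sqrt (\<Sum>l<n. (x j l - y j l)\<^sup>2)"
    have "?s \<longlonglongrightarrow> v i" using limitin_Euclidean_coord[OF lv, of i] .
    then have l: "(?s \<circ> r) \<longlonglongrightarrow> v i" using r by (rule LIMSEQ_subseq_LIMSEQ)
    have "?s (r j) = 0" for j
    proof -
      have rj: "r j \<ge> j0" "?Z (x (r j)) = ?Z (x i0)" using rJ[of j] by blast+
      have "i \<in> ?Z (x (r j))" unfolding rj(2) using i by simp
      then have "i \<in> ?Z z" and x0: "x (r j) i = 0" using Zx[OF rj(1)] by blast+
      then have "i \<in> ?Z (y (r j))" using Zy[OF rj(1)] by simp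
      then show ?thesis using x0 by simp
    qed
    then have "(?s \<circ> r) = (\<lambda>_. 0)" unfolding o_def by (rule ext)
    with l have "(\<lambda>_::nat. 0) \<longlonglongrightarrow> v i" by (rule subst[rotated, where P = "\<lambda>f. f \<longlonglongrightarrow> v i"])
    from LIMSEQ_unique[OF this tendsto_const] show ?thesis .
  qed
  have tan: "v \<in> tangent_space n M (x (r j))" for j
  proof -
    let ?x = "x (r j)"
    have Zr: "?Z ?x = ?Z (x i0)" using rJ[of j] by blast
    have xc: "?x \<in> cube n \<epsilon>" using xM M by blast
    \<comment> \<open>The straight line in direction \<open>v\<close>. Coordinates that vanish at
      \<open>?x\<close> stay zero by \<open>v0\<close>, the others keep their signs for small
      \<open>t\<close>; so the line stays in the saturated set \<open>M\<close>.\<close>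
    define \<gamma> where "\<gamma> = (\<lambda>t i. ?x i + t * v i :: real)"
    have lim: "((\<lambda>t. \<gamma> t i) \<longlongrightarrow> ?x i) (at 0)" for i
      unfolding \<gamma>_def by (auto intro!: tendsto_eq_intros)
    have "\<forall>\<^sub>F t in at 0. \<bar>\<gamma> t i\<bar> < \<epsilon>" if "i < n" for i
    proof -
      have "((\<lambda>t. \<bar>\<gamma> t i\<bar>) \<longlongrightarrow> \<bar>?x i\<bar>) (at 0)" by (intro tendsto_intros lim)
      then show ?thesis using xc that by (auto simp: cube_def intro: order_tendstoD(2))
    qed
    then have e1: "\<forall>\<^sub>F t in at 0. \<forall>i\<in>{..<n}. \<bar>\<gamma> t i\<bar> < \<epsilon>"
      by (intro eventually_ball_finite) auto
    have "\<forall>\<^sub>F t in at 0. sgn (?x i) = sgn (\<gamma> t i)" if i: "i < k" for i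
    proof -
      consider "?x i = 0" | "?x i > 0" | "?x i < 0" by linarith
      then show ?thesis
      proof cases
        case 1
        then have "i \<in> ?Z (x i0)" unfolding Zr[symmetric] using i by simp
        then have "v i = 0" using v0 by blast
        then show ?thesis by (simp add: \<gamma>_def)
      next
        case 2
        have "\<forall>\<^sub>F t in at 0. \<gamma> t i > 0" by (rule order_tendstoD(1)[OF lim 2])
        then show ?thesis by eventually_elim (use 2 in simp)
      next
        case 3
        have "\<forall>\<^sub>F t in at 0. \<gamma> t i < 0" by (rule order_tendstoD(2)[OF lim 3])
        then show ?thesis by eventually_elim (use 3 in simp)
      qed
    qed
    then have e2: "\<forall>\<^sub>F t in at 0. \<forall>i\<in>{..<k}. sgn (?x i) = sgn (\<gamma> t i)"
      by (intro eventually_ball_finite) auto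
    have gE: "\<gamma> t \<in> topspace (Euclidean_space n)" for t
      using xc vE by (simp add: \<gamma>_def cube_def topspace_Euclidean_space)
    have "\<forall>\<^sub>F t in at 0. \<gamma> t \<in> M"
      using eventually_conj[OF e1 e2]
    proof eventually_elim
      case (elim t)
      show ?case by (rule sat[OF xM]) (use elim gE in \<open>auto simp: cube_def\<close>)
    qed
    moreover have "\<gamma> 0 = ?x" by (simp add: \<gamma>_def)
    moreover have "((\<lambda>t. \<gamma> t i) has_real_derivative v i) (at 0)" for i
      unfolding \<gamma>_def by (auto intro!: derivative_eq_intros)
    ultimately show ?thesis
      unfolding tangent_space_def using vE by (intro CollectI conjI exI[of _ \<gamma>]) auto
  qed
  \<comment> \<open>As \<open>v\<close> lies in all tangent spaces of the subsequence, the constant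
    sequence shows that it lies in \<open>\<tau>\<close>.\<close>
  have "\<forall>r w v. strict_mono (r :: nat \<Rightarrow> nat) \<and> (\<forall>j. w j \<in> tangent_space n M (x (r j))) \<and>
        limitin (Euclidean_space n) w v sequentially \<longrightarrow> v \<in> \<tau>"
    using st unfolding set_limit_def by (rule conjunct2)
  then show "v \<in> \<tau>"
    by (rule allE[of _ r], elim allE[of _ "\<lambda>_. v"] allE[of _ v]) (simp add: r tan vE)
qed

lemma closure_of_meets:
  "x \<in> X closure_of S \<Longrightarrow> openin X Q \<Longrightarrow> x \<in> Q \<Longrightarrow> \<exists>y. y \<in> S \<and> y \<in> Q"
  unfolding in_closure_of by blast

section \<open>Strata of the blow-up over a cube\<close>

context nc_gluing
begin

lemma L_eq:
  assumes "S \<in> SS" "q \<in> QQ S" "S' \<in> SS" "q' \<in> QQ S'" "x \<in> L S q" "x \<in> L S' q'"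
  shows "S = S' \<and> q = q'"
proof -
  have x: "\<alpha> x \<in> S" "\<alpha> x \<in> S'" "q (\<alpha> x) = q' (\<alpha> x)" using assms(5,6) unfolding L_def by simp_all
  have S: "S = S'" by (rule strata_disjoint[OF SS[OF assms(1)] SS[OF assms(3)] x(1,2)])
  have ql: "q' \<in> lim_pi0_stratum X B S" using QQ[OF assms(3,4)] S by simp
  have "q = q'" by (rule orthant_unique[OF SS[OF assms(1)] QQ[OF assms(1,2)] ql x(1,3)])
  then show ?thesis using S by blast
qed

text \<open>A point of \<open>L T \<tau>\<close> in the closure yields an end of \<open>S\<close> at
  its image along which \<open>q\<close> is pushed to \<open>\<tau>\<close>. Extended over
  \<open>T\<close>, the end gives a pushed section that agrees with \<open>\<tau>\<close> at one
  point, hence everywhere. So every point of \<open>L T \<tau>\<close> is adjacent to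
  \<open>L S q\<close>.\<close>

lemma L_frontier:
  assumes S: "S \<in> SS" "q \<in> QQ S" and T: "T \<in> SS" "\<tau> \<in> QQ T"
    and x: "x \<in> L T \<tau>" "x \<in> Xt closure_of L S q"
  shows "L T \<tau> \<subseteq> Xt closure_of L S q"
proof -
  have x1: "x \<in> topspace Xt" "\<alpha> x \<in> T" "orth x = \<tau> (\<alpha> x)" using x(1) unfolding L_def by blast+
  let ?p = "\<alpha> x"
  have pt: "?p \<in> topspace X" by (rule alpha_top[OF x1(1)])
  obtain k U \<phi> \<epsilon> J where c: "nc_cube ?p k U \<phi> \<epsilon> J"
    using nc_cube_exists[OF pt openin_topspace pt] by blast
  note c' = nc_cube_D[OF c]
  have U: "U \<in> nbhds_of X ?p" using c'(2,10) by (simp add: nbhds_of_iff)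
  have op: "openin Xt {x' \<in> topspace Xt. \<alpha> x' \<in> U \<and> orth x' U = orth x U}" by (rule orth_basic_open[OF c'(10)])
  have mem: "x \<in> {x' \<in> topspace Xt. \<alpha> x' \<in> U \<and> orth x' U = orth x U}" using x1(1) c'(2) by blast
  from closure_of_meets[OF x(2) op mem]
  obtain x' where x': "x' \<in> L S q" "\<alpha> x' \<in> U" "orth x' U = orth x U" by blast
  then have x'1: "x' \<in> topspace Xt" "\<alpha> x' \<in> S" "orth x' = q (\<alpha> x')" unfolding L_def by blast+
  let ?C = "path_component_of_set (subtopology X (U \<inter> S)) (\<alpha> x')"
  have C: "?C \<in> path_components_of (subtopology X (U \<inter> S))"
    using x'(2) x'1(2) alpha_top[OF x'1(1)] by (simp add: path_component_in_path_components_of)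
  have pC: "\<alpha> x' \<in> ?C" using x'(2) x'1(2) alpha_top[OF x'1(1)] by (simp add: path_component_of_refl)
  have "bij_betw (\<lambda>c. c U) (lim_pi0 X S ?p) (path_components_of (subtopology X (U \<inter> S)))"
    by (rule eval_bij[OF c strata_saturated[OF c SS[OF S(1)]] c'(2)]) (simp add: c'(3))
  then have "?C \<in> (\<lambda>c. c U) ` lim_pi0 X S ?p" using C by (simp add: bij_betw_def)
  then obtain e where e: "e \<in> lim_pi0 X S ?p" "e U = ?C" by (metis (no_types, lifting) imageE)
  have pe: "\<alpha> x' \<in> e U" using pC e(2) by simp
  have "push X q ?p e U = orth x U" using push_eq[OF e(1) QQ[OF S] U pe] x'(3) x'1(3) by simp
  then have pu: "push X q ?p e = orth x"
    using inj_onD[OF compl_eval_inj[OF c c'(2)] _ push_lim[OF e(1) QQ[OF S]] orth_lim[OF x1(1)]] by blast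
  obtain e' where e': "e' \<in> lim_pi0_stratum X S T" "e' ?p = e"
    using end_extends[OF SS[OF S(1)] SS[OF T(1)] x1(2) e(1)] by blast
  have eq: "(\<lambda>p\<in>T. push X q p (e' p)) = \<tau>"
    by (rule orthant_unique[OF SS[OF T(1)] push_stratum[OF SS[OF T(1)] e'(1) QQ[OF S]] QQ[OF T] x1(2)])
      (use x1(2,3) e'(2) pu in simp)
  show ?thesis
  proof
    fix y assume "y \<in> L T \<tau>"
    then have y: "y \<in> topspace Xt" "\<alpha> y \<in> T" "orth y = \<tau> (\<alpha> y)" unfolding L_def by blast+
    have oy: "orth y = push X q (\<alpha> y) (e' (\<alpha> y))" using y(2,3) unfolding eq[symmetric] by simp
    have ey: "e' (\<alpha> y) \<in> lim_pi0 X S (\<alpha> y)" by (rule lim_pi0_stratum_at[OF e'(1) y(2)])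
    have "\<exists>w. w \<in> L S q \<and> w \<in> Q" if Q: "y \<in> Q" "openin Xt Q" for Q
    proof -
      have "\<exists>V\<in>nbhds_of X (\<alpha> y). \<forall>x'\<in>topspace Xt. \<alpha> x' \<in> V \<and> orth x' V = orth y V \<longrightarrow> x' \<in> Q"
        using Q unfolding openin_blowup by blast
      then obtain V where V: "V \<in> nbhds_of X (\<alpha> y)"
        "\<forall>x'\<in>topspace Xt. \<alpha> x' \<in> V \<and> orth x' V = orth y V \<longrightarrow> x' \<in> Q" by (elim bexE)
      obtain p' where p': "p' \<in> e' (\<alpha> y) V" using lim_pi0_nonempty[OF ey V(1)] by blast
      have p'S: "p' \<in> S" "p' \<in> V" using lim_pi0_subset[OF ey V(1)] p' by blast+
      note pn = pnt_props[OF stratum_top[OF S(1) p'S(1)] lim_pi0_stratum_at[OF QQ[OF S] p'S(1)]]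
      have "orth (pnt p' (q p')) V = orth y V"
        using push_eq[OF ey QQ[OF S] V(1) p'] pn(3) oy by simp
      then have "pnt p' (q p') \<in> Q" using V(2) pn(1,2) p'S(2) by simp
      moreover have "pnt p' (q p') \<in> L S q" unfolding L_def using pn p'S(1) by simp
      ultimately show ?thesis by blast
    qed
    then show "y \<in> Xt closure_of L S q" using y(1) by (simp add: in_closure_of)
  qed
qed

text \<open>For an orthant \<open>C\<close> of the cube: the part of \<open>S\<close> in the cube
  that is adjacent to \<open>C\<close> by way of \<open>q\<close>.\<close>

definition face :: "'a set \<Rightarrow> 'a set \<Rightarrow> 'a set \<Rightarrow> ('a \<Rightarrow> 'a set \<Rightarrow> 'a set) \<Rightarrow> 'a set" where
  "face U C S q = {z \<in> U. z \<in> S \<and> q z U = C}"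

text \<open>The lift of the closed orthant belonging to \<open>C\<close>. Over a cube the sheets are
  open, and on each of them \<open>\<alpha>\<close> is an embedding.\<close>

definition sheet :: "'a set \<Rightarrow> 'a set \<Rightarrow> 'b set" where
  "sheet U C = {x \<in> topspace Xt. \<alpha> x \<in> U \<and> orth x U = C}"

lemma sheet_inj:
  assumes q: "nc_cube p k U \<phi> \<epsilon> J" and x: "x \<in> sheet U C" "x' \<in> sheet U C" "\<alpha> x = \<alpha> x'"
  shows "x = x'"
proof -
  have x1: "x \<in> topspace Xt" "\<alpha> x \<in> U" "orth x U = C" "x' \<in> topspace Xt" "orth x' U = C"
    using x(1,2) unfolding sheet_def by blast+
  have o: "orth x' \<in> lim_pi0 X B (\<alpha> x)" using orth_lim[OF x1(4)] x(3) by simp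
  have "orth x = orth x'"
    using inj_onD[OF compl_eval_inj[OF q x1(2)] _ orth_lim[OF x1(1)] o] x1(3,5) by simp
  then show ?thesis by (rule orth_inj[OF x1(1,4) x(3)])
qed

lemma face_image:
  assumes S: "S \<in> SS" "q \<in> QQ S"
  shows "\<alpha> ` (L S q \<inter> sheet U C) = face U C S q"
proof
  show "\<alpha> ` (L S q \<inter> sheet U C) \<subseteq> face U C S q"
    unfolding L_def sheet_def face_def by auto
  show "face U C S q \<subseteq> \<alpha> ` (L S q \<inter> sheet U C)"
  proof
    fix z assume "z \<in> face U C S q"
    then have z: "z \<in> U" "z \<in> S" "q z U = C" unfolding face_def by blast+
    note pn = pnt_props[OF stratum_top[OF S(1) z(2)] lim_pi0_stratum_at[OF QQ[OF S] z(2)]]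
    have "pnt z (q z) \<in> L S q \<inter> sheet U C" unfolding L_def sheet_def using pn z by simp
    then show "z \<in> \<alpha> ` (L S q \<inter> sheet U C)" using pn(2) by (metis imageI)
  qed
qed

lemma face_saturated:
  assumes q: "nc_cube p k U \<phi> \<epsilon> J" and S: "S \<in> SS" "s \<in> QQ S" and x: "x \<in> face U C S s"
    and y: "y \<in> U" "same_signs k \<phi> x y"
  shows "y \<in> face U C S s"
proof -
  have x1: "x \<in> U" "x \<in> S" "s x U = C" using x unfolding face_def by blast+
  note sat = strata_saturated[OF q SS[OF S(1)]]
  have "y \<in> S" using sat x1 y unfolding saturated_def by blast
  moreover have "s x U = s y U"
    by (rule lim_pi0_stratum_const[OF QQ[OF S] nc_cube_D(10)[OF q] saturated_segment[OF q sat x1(1) y x1(2)]])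
  ultimately show ?thesis using x1(3) y(1) unfolding face_def by simp
qed

lemma face_codim:
  assumes q: "nc_cube p k U \<phi> \<epsilon> J" and S: "S \<in> SS"
  shows "\<exists>j\<le>n. \<forall>C s. \<forall>x\<in>face U C S s. card {i. i < k \<and> \<phi> x i = 0} = j"
proof -
  obtain j where j: "j \<le> n" "S \<subseteq> codim_locus n X A D' j" using SS[OF S] by (elim strata_codim)
  have "card {i. i < k \<and> \<phi> x i = 0} = j" if "x \<in> face U C S s" for x C s
  proof -
    have "x \<in> U" "x \<in> S" using that unfolding face_def by blast+
    then show ?thesis using codim_iff[OF q] j(2) by blast
  qed
  then show ?thesis using j(1) by blast
qed

lemma face_submanifold:
  assumes q: "nc_cube p k U \<phi> \<epsilon> J" and S: "S \<in> SS" "s \<in> QQ S"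
  shows "\<exists>m. smooth_submanifold n X A m (face U C S s)"
proof -
  note q' = nc_cube_D[OF q]
  obtain j where j: "j \<le> n" "\<forall>C s. \<forall>x\<in>face U C S s. card {i. i < k \<and> \<phi> x i = 0} = j"
    using face_codim[OF q S(1)] by blast
  let ?M = "face U C S s"
  have MU: "?M \<subseteq> U" unfolding face_def by blast
  have "smooth_submanifold n X A (n - j) ?M"
    unfolding smooth_submanifold_def
  proof (intro conjI ballI)
    show "n - j \<le> n" by simp
    show "?M \<subseteq> topspace X" using MU q'(11) by blast
    fix x assume x: "x \<in> ?M"
    have xU: "x \<in> U" using x MU by blast
    let ?Z = "{i. i < k \<and> \<phi> x i = 0}"
    have card: "card ?Z = j" using j(2) x by blast
    obtain d where d: "d > 0" "\<And>i. i < k \<Longrightarrow> i \<notin> ?Z \<Longrightarrow> d \<le> \<bar>\<phi> x i\<bar>"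
    proof
      let ?S = "insert 1 ((\<lambda>i. \<bar>\<phi> x i\<bar>) ` {i. i < k \<and> \<phi> x i \<noteq> 0})"
      show "Min ?S > 0" by (subst Min_gr_iff) auto
      show "Min ?S \<le> \<bar>\<phi> x i\<bar>" if "i < k" "i \<notin> ?Z" for i
        by (rule Min_le) (use that in auto)
    qed
    let ?U' = "coord_box U \<phi> x d"
    have ch: "(?U', \<phi>) \<in> smooth_charts n X A"
      by (rule chart_restrict[OF q'(1) chart_box_open[OF q'(1)]]) blast
    have near: "sgn (\<phi> y i) = sgn (\<phi> x i)" if y: "y \<in> ?U'" and i: "i < k" "i \<notin> ?Z" for y i
    proof -
      have "i < n" using i(1) q'(6) by simp
      then have "\<bar>\<phi> y i - \<phi> x i\<bar> < d" using y by blast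
      then have "\<bar>\<phi> y i - \<phi> x i\<bar> < \<bar>\<phi> x i\<bar>" using d(2)[OF i] by linarith
      then show ?thesis by (auto simp: sgn_if abs_if split: if_splits)
    qed
    \<comment> \<open>Coordinates nonzero at \<open>x\<close> keep their signs in the box. A point
      of the face has as many zeros as \<open>x\<close>, hence the same ones; conversely the same
      zeros give the same sign vector, and the face is saturated.\<close>
    have "?M \<inter> ?U' = {y \<in> ?U'. \<forall>i\<in>?Z. \<phi> y i = 0}"
    proof
      show "?M \<inter> ?U' \<subseteq> {y \<in> ?U'. \<forall>i\<in>?Z. \<phi> y i = 0}"
      proof
        fix y assume y: "y \<in> ?M \<inter> ?U'"
        have "{i. i < k \<and> \<phi> y i = 0} \<subseteq> ?Z"
        proof
          fix i assume "i \<in> {i. i < k \<and> \<phi> y i = 0}"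
          then have i: "i < k" "\<phi> y i = 0" by simp_all
          show "i \<in> ?Z"
          proof (rule ccontr)
            assume nZ: "i \<notin> ?Z"
            have "sgn (\<phi> y i) = sgn (\<phi> x i)" by (rule near[OF _ i(1) nZ]) (use y in blast)
            then have "\<phi> x i = 0" using i(2) by (simp add: sgn_0_0)
            then show False using nZ i(1) by simp
          qed
        qed
        moreover have "card {i. i < k \<and> \<phi> y i = 0} = card ?Z" using card j(2) y by blast
        ultimately have "{i. i < k \<and> \<phi> y i = 0} = ?Z" by (intro card_subset_eq) simp_all
        then have "\<forall>i\<in>?Z. \<phi> y i = 0" by blast
        then show "y \<in> {y \<in> ?U'. \<forall>i\<in>?Z. \<phi> y i = 0}" using y by blast
      qed
      show "{y \<in> ?U'. \<forall>i\<in>?Z. \<phi> y i = 0} \<subseteq> ?M \<inter> ?U'"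
      proof
        fix y assume "y \<in> {y \<in> ?U'. \<forall>i\<in>?Z. \<phi> y i = 0}"
        then have y: "y \<in> ?U'" "\<forall>i\<in>?Z. \<phi> y i = 0" by blast+
        have "same_signs k \<phi> x y"
          unfolding same_signs_def
        proof (intro allI impI)
          fix i assume i: "i < k"
          show "sgn (\<phi> x i) = sgn (\<phi> y i)"
          proof (cases "i \<in> ?Z")
            case True
            then show ?thesis using y(2) by simp
          next
            case False
            then show ?thesis using near[OF y(1) i] by simp
          qed
        qed
        then have "y \<in> ?M" using face_saturated[OF q S x] y(1) by blast
        then show "y \<in> ?M \<inter> ?U'" using y(1) by blast
      qed
    qed
    moreover have "?Z \<subseteq> {..<n}" using q'(6) by auto
    moreover have "card ?Z = n - (n - j)" using card j(1) by simp
    moreover have "x \<in> ?U'" using xU d(1) by simp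
    ultimately show "\<exists>(U, \<phi>)\<in>smooth_charts n X A. \<exists>J\<subseteq>{..<n}. card J = n - (n - j) \<and> x \<in> U \<and>
        ?M \<inter> U = {y \<in> U. \<forall>i\<in>J. \<phi> y i = 0}"
      by (intro bexI[OF _ ch]) (unfold prod.case, intro exI[of _ ?Z] conjI)
  qed
  then show ?thesis by blast
qed

lemma face_whitney:
  assumes q: "nc_cube p k U \<phi> \<epsilon> J" and S: "S \<in> SS" "s \<in> QQ S" and T: "T \<in> SS" "t \<in> QQ T"
  shows "whitney_b n (\<phi> ` face U C S s) (\<phi> ` face U C T t)"
proof -
  note q' = nc_cube_D[OF q]
  obtain j where j: "\<forall>C s. \<forall>x\<in>face U C T s. card {i. i < k \<and> \<phi> x i = 0} = j"
    using face_codim[OF q T(1)] by blast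
  show ?thesis
  proof (rule whitney_faces[OF q'(6,4)])
    have "face U C S s \<subseteq> U" unfolding face_def by blast
    then show "\<phi> ` face U C S s \<subseteq> cube n \<epsilon>" using q'(5) by blast
    fix x y assume x: "x \<in> \<phi> ` face U C S s" and y: "y \<in> cube n \<epsilon>" and s: "\<And>i. i < k \<Longrightarrow> sgn (x i) = sgn (y i)"
    obtain a where a: "a \<in> face U C S s" "x = \<phi> a" using x by blast
    note b = pt_cube[OF q y]
    have "same_signs k \<phi> a (pt U \<phi> y)" using s unfolding same_signs_def b(2) a(2) by blast
    then have "pt U \<phi> y \<in> face U C S s" by (rule face_saturated[OF q S a(1) b(1)])
    then show "y \<in> \<phi> ` face U C S s" using b(2) by (metis imageI)
  next
    fix x assume "x \<in> \<phi> ` face U C T t"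
    then show "card {i. i < k \<and> x i = 0} = j" using j by blast
  qed
qed

text \<open>The point is openness. On a sheet the orthant at a smaller box \<open>?N\<close> is
  determined by \<open>C\<close>, because \<open>C \<inter> ?N\<close> is path connected; so
  neighbourhoods in the sheet are described by the position in \<open>X\<close> alone.\<close>

lemma sheet_embedding:
  assumes q: "nc_cube p k U \<phi> \<epsilon> J" and W: "W \<subseteq> sheet U C"
  shows "embedding_map (subtopology Xt W) X \<alpha>"
proof -
  note q' = nc_cube_D[OF q]
  have Wt: "W \<subseteq> topspace Xt" using W unfolding sheet_def by blast
  then have tW: "topspace (subtopology Xt W) = W" by auto
  have aX: "\<alpha> ` W \<subseteq> topspace X" using Wt alpha_top by blast
  have "homeomorphic_map (subtopology Xt W) (subtopology X (\<alpha> ` W)) \<alpha>"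
  proof (rule bijective_open_imp_homeomorphic_map)
    show "continuous_map (subtopology Xt W) (subtopology X (\<alpha> ` W)) \<alpha>"
      using continuous_map_from_subtopology[OF alpha_continuous] tW by (auto simp: continuous_map_in_subtopology)
    show "\<alpha> ` topspace (subtopology Xt W) = topspace (subtopology X (\<alpha> ` W))"
      unfolding tW using aX by auto
    show "inj_on \<alpha> (topspace (subtopology Xt W))"
      unfolding tW using sheet_inj[OF q] W by (intro inj_onI) blast
    show "open_map (subtopology Xt W) (subtopology X (\<alpha> ` W)) \<alpha>"
      unfolding open_map_def
    proof (intro allI impI)
      fix R assume "openin (subtopology Xt W) R"
      then obtain Q where Q: "openin Xt Q" "R = Q \<inter> W" by (auto simp: openin_subtopology)
      show "openin (subtopology X (\<alpha> ` W)) (\<alpha> ` R)"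
      proof (subst openin_subopen, intro ballI)
        fix z assume "z \<in> \<alpha> ` R"
        then obtain x where x: "x \<in> Q" "x \<in> W" "z = \<alpha> x" unfolding Q(2) by blast
        have xs: "x \<in> topspace Xt" "\<alpha> x \<in> U" "orth x U = C" using W x(2) unfolding sheet_def by blast+
        have "\<exists>V\<in>nbhds_of X (\<alpha> x). \<forall>x'\<in>topspace Xt. \<alpha> x' \<in> V \<and> orth x' V = orth x V \<longrightarrow> x' \<in> Q"
          using Q(1) x(1) unfolding openin_blowup by blast
        then obtain V where V: "V \<in> nbhds_of X (\<alpha> x)"
          "\<forall>x'\<in>topspace Xt. \<alpha> x' \<in> V \<and> orth x' V = orth x V \<longrightarrow> x' \<in> Q" by (elim bexE)
        have U: "U \<in> nbhds_of X (\<alpha> x)" using q'(10) xs(2) by (simp add: nbhds_of_iff)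
        obtain d where d: "d > 0" "coord_box U \<phi> (\<alpha> x) d \<in> nbhds_of X (\<alpha> x)" "coord_box U \<phi> (\<alpha> x) d \<subseteq> V"
          using box_nbhd[OF q xs(2) V(1)] by blast
        let ?N = "coord_box U \<phi> (\<alpha> x) d"
        have C: "C \<in> path_components_of (subtopology X (U \<inter> B))" using orth_props(1)[OF xs(1) U] xs(3) by simp
        have CB: "C \<subseteq> B" using path_components_of_subset[OF C] by auto
        have pc: "path_connectedin (subtopology X (?N \<inter> B)) (C \<inter> ?N)"
          using compl_component_box[OF q C] CB by (auto simp: path_connectedin_subtopology)
        have sub: "C \<inter> ?N \<subseteq> orth x' ?N" if x': "x' \<in> topspace Xt" "\<alpha> x' \<in> ?N" "orth x' U = C" for x'
        proof -
          have n: "?N \<in> nbhds_of X (\<alpha> x')" "U \<in> nbhds_of X (\<alpha> x')"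
            using d(2) U x'(2) unfolding nbhds_of_iff by blast+
          obtain w where w: "w \<in> orth x' ?N" using lim_pi0_nonempty[OF orth_lim[OF x'(1)] n(1)] by blast
          have "orth x' ?N \<subseteq> orth x' U" by (rule lim_pi0_mono[OF orth_lim[OF x'(1)] n]) blast
          then have "w \<in> C" using w x'(3) by blast
          moreover have "w \<in> ?N" using lim_pi0_subset[OF orth_lim[OF x'(1)] n(1)] w by blast
          ultimately have "\<not> disjnt (orth x' ?N) (C \<inter> ?N)" using w unfolding disjnt_def by blast
          then show ?thesis using path_components_of_maximal[OF lim_pi0_comp[OF orth_lim[OF x'(1)] n(1)] pc] by blast
        qed
        have "\<alpha> ` W \<inter> ?N \<subseteq> \<alpha> ` R"
        proof
          fix u assume "u \<in> \<alpha> ` W \<inter> ?N"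
          then obtain x' where x': "x' \<in> W" "u = \<alpha> x'" "\<alpha> x' \<in> ?N" by blast
          have x's: "x' \<in> topspace Xt" "orth x' U = C" using W x'(1) unfolding sheet_def by blast+
          have n: "?N \<in> nbhds_of X (\<alpha> x')" "V \<in> nbhds_of X (\<alpha> x')"
            using d(2,3) V(1) x'(3) unfolding nbhds_of_iff by blast+
          have ax: "\<alpha> x \<in> ?N" using d(2) unfolding nbhds_of_iff by (rule conjunct2)
          obtain w where "w \<in> orth x ?N" using lim_pi0_nonempty[OF orth_lim[OF xs(1)] d(2)] by blast
          moreover have "orth x ?N \<subseteq> C \<inter> ?N"
            using lim_pi0_mono[OF orth_lim[OF xs(1)] d(2) U] lim_pi0_subset[OF orth_lim[OF xs(1)] d(2)] xs(3) by blast
          ultimately have w: "w \<in> orth x ?N" "w \<in> orth x' ?N" using sub[OF x's(1) x'(3) x's(2)] by blast+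
          have "orth x' ?N = orth x ?N"
            by (rule lim_pi0_agree[OF orth_lim[OF x's(1)] orth_lim[OF xs(1)] n(1) d(2) w(2,1)])
          then have "orth x' V = orth x V"
            by (rule lim_pi0_agree_mono[OF orth_lim[OF x's(1)] orth_lim[OF xs(1)] n(1) d(2) n(2) V(1) d(3)])
          then have "x' \<in> Q" using V(2) x's(1) x'(3) d(3) by blast
          then show "u \<in> \<alpha> ` R" using x'(1,2) unfolding Q(2) by blast
        qed
        moreover have "openin (subtopology X (\<alpha> ` W)) (\<alpha> ` W \<inter> ?N)"
          using d(2) by (simp add: nbhds_of_iff openin_subtopology_Int2)
        moreover have "z \<in> \<alpha> ` W \<inter> ?N" using x(2,3) d(2) unfolding nbhds_of_iff by blast
        ultimately show "\<exists>T. openin (subtopology X (\<alpha> ` W)) T \<and> z \<in> T \<and> T \<subseteq> \<alpha> ` R" by blast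
      qed
    qed
  qed
  then show ?thesis unfolding embedding_map_def tW .
qed

definition "LL \<equiv> \<Union>S\<in>SS. L S ` QQ S"

lemma LL_E:
  assumes "P \<in> LL"
  obtains S q where "S \<in> SS" "q \<in> QQ S" "P = L S q"
  using assms unfolding LL_def by blast

text \<open>On a sheet the sign vector of the image determines the stratum: the set
  \<open>face U C S q\<close> is saturated, and \<open>\<alpha>\<close> is injective on the
  sheet.\<close>

lemma sheet_finite:
  assumes c: "nc_cube p k U \<phi> \<epsilon> J"
  shows "finite {P \<in> LL. P \<inter> (Y \<inter> sheet U C) \<noteq> {}}" (is "finite ?K")
proof -
  let ?s = "\<lambda>x. \<lambda>i\<in>{..<k}. sgn (\<phi> x i)"
  let ?W = "sheet U C"
  define f where "f = (\<lambda>v. SOME P. P \<in> LL \<and> (\<exists>x\<in>P \<inter> ?W. ?s (\<alpha> x) = v))"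
  have "?K \<subseteq> f ` ({..<k} \<rightarrow>\<^sub>E {-1, 0, 1})"
  proof
    fix P assume "P \<in> ?K"
    then have P: "P \<in> LL" "P \<inter> ?W \<noteq> {}" by blast+
    obtain S q where S: "S \<in> SS" "q \<in> QQ S" "P = L S q" by (rule LL_E[OF P(1)])
    obtain x where x: "x \<in> P \<inter> ?W" using P(2) by blast
    define P' where "P' = f (?s (\<alpha> x))"
    have "P' \<in> LL \<and> (\<exists>y\<in>P' \<inter> ?W. ?s (\<alpha> y) = ?s (\<alpha> x))"
      unfolding P'_def f_def by (rule someI[of _ P]) (use P(1) x in blast)
    then obtain y where y: "P' \<in> LL" "y \<in> P'" "y \<in> ?W" "?s (\<alpha> y) = ?s (\<alpha> x)" by blast
    obtain S' q' where S': "S' \<in> SS" "q' \<in> QQ S'" "P' = L S' q'" by (rule LL_E[OF y(1)])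
    have "same_signs k \<phi> (\<alpha> x) (\<alpha> y)"
      unfolding same_signs_def
    proof (intro allI impI)
      fix i assume "i < k"
      then show "sgn (\<phi> (\<alpha> x) i) = sgn (\<phi> (\<alpha> y) i)" using fun_cong[OF y(4), of i] by simp
    qed
    moreover have "\<alpha> x \<in> face U C S q" using x unfolding face_image[OF S(1,2), symmetric] S(3) by blast
    moreover have "\<alpha> y \<in> U" using y(3) unfolding sheet_def by blast
    ultimately have "\<alpha> y \<in> face U C S q" using face_saturated[OF c S(1,2)] by blast
    then obtain x'' where x'': "x'' \<in> L S q" "x'' \<in> ?W" "\<alpha> y = \<alpha> x''"
      unfolding face_image[OF S(1,2), symmetric] by blast
    have "y = x''" by (rule sheet_inj[OF c y(3) x''(2,3)])
    then have "S = S' \<and> q = q'" using L_eq[OF S(1,2) S'(1,2) x''(1)] y(2) S'(3) by simp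
    then have "P = P'" using S(3) S'(3) by simp
    moreover have "?s (\<alpha> x) \<in> {..<k} \<rightarrow>\<^sub>E {-1, 0, 1}" by (auto simp: sgn_if)
    ultimately show "P \<in> f ` ({..<k} \<rightarrow>\<^sub>E {-1, 0, 1})" unfolding P'_def by blast
  qed
  moreover have "finite ({..<k} \<rightarrow>\<^sub>E {-1, 0, 1 :: real})" by (intro finite_PiE) auto
  ultimately show ?thesis by (rule finite_surj[rotated])
qed

lemma whitney: "whitney_stratified n X A (subtopology Xt Y) \<alpha> LL"
  unfolding whitney_stratified_def
proof (intro conjI ballI impI)
  have YX: "Y \<subseteq> topspace Xt" unfolding Y by blast
  then have tY: "topspace (subtopology Xt Y) = Y" by auto
  have LY: "P \<subseteq> Y" if "P \<in> LL" for P
    by (rule LL_E[OF that]) (use L_subset_Y in blast)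
  show "continuous_map (subtopology Xt Y) X \<alpha>"
    by (rule continuous_map_from_subtopology[OF alpha_continuous])
  show "\<Union>LL = topspace (subtopology Xt Y)"
    unfolding tY
  proof
    show "\<Union>LL \<subseteq> Y" using LY by blast
    show "Y \<subseteq> \<Union>LL"
    proof
      fix x assume "x \<in> Y"
      then obtain S q where "x \<in> topspace Xt" "S \<in> SS" "\<alpha> x \<in> S" "q \<in> QQ S" "q (\<alpha> x) = orth x" unfolding Y by blast
      then have "x \<in> L S q" "L S q \<in> LL" unfolding L_def LL_def by auto
      then show "x \<in> \<Union>LL" by blast
    qed
  qed
  show "{} \<notin> LL"
  proof
    assume "{} \<in> LL"
    then obtain S q where S: "S \<in> SS" "q \<in> QQ S" "{} = L S q" by (rule LL_E)
    then show False using L_image[OF S(1,2)] strata_facts(2)[OF SS[OF S(1)]] by blast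
  qed
  show "pairwise disjnt LL"
  proof (rule pairwiseI)
    fix P P' assume P: "P \<in> LL" "P' \<in> LL" "P \<noteq> P'"
    obtain S q where S: "S \<in> SS" "q \<in> QQ S" "P = L S q" by (rule LL_E[OF P(1)])
    obtain S' q' where S': "S' \<in> SS" "q' \<in> QQ S'" "P' = L S' q'" by (rule LL_E[OF P(2)])
    show "disjnt P P'"
      using L_eq[OF S(1,2) S'(1,2)] P(3) S(3) S'(3) unfolding disjnt_def by blast
  qed
  fix P P' assume P: "P \<in> LL" and P': "P' \<in> LL" and ne: "P' \<inter> subtopology Xt Y closure_of P \<noteq> {}"
  obtain S q where S: "S \<in> SS" "q \<in> QQ S" "P = L S q" by (rule LL_E[OF P])
  obtain T t where T: "T \<in> SS" "t \<in> QQ T" "P' = L T t" by (rule LL_E[OF P'])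
  have cl: "subtopology Xt Y closure_of P = Y \<inter> Xt closure_of P"
    using LY[OF P] by (simp add: closure_of_subtopology Int_absorb1)
  obtain x where x: "x \<in> P'" "x \<in> Xt closure_of P" using ne unfolding cl by blast
  have "P' \<subseteq> Xt closure_of P"
    using L_frontier[OF S(1,2) T(1,2) x[unfolded S(3) T(3)]] unfolding S(3) T(3) .
  then show "P' \<subseteq> subtopology Xt Y closure_of P" using LY[OF P'] unfolding cl by blast
next
  have YX: "Y \<subseteq> topspace Xt" unfolding Y by blast
  then have tY: "topspace (subtopology Xt Y) = Y" by auto
  have LY: "P \<subseteq> Y" if "P \<in> LL" for P
    by (rule LL_E[OF that]) (use L_subset_Y in blast)
  fix y assume "y \<in> topspace (subtopology Xt Y)"
  then have y: "y \<in> Y" "y \<in> topspace Xt" using YX tY by auto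
  obtain k U \<phi> \<epsilon> J where c: "nc_cube (\<alpha> y) k U \<phi> \<epsilon> J"
    using nc_cube_exists[OF alpha_top[OF y(2)] openin_topspace alpha_top[OF y(2)]] by blast
  note c' = nc_cube_D[OF c]
  let ?C = "orth y U"
  let ?W = "Y \<inter> sheet U ?C"
  have ch: "(U, \<phi>) \<in> smooth_charts n X A" by (rule c'(1))
  have so: "openin Xt (sheet U ?C)" unfolding sheet_def by (rule orth_basic_open[OF c'(10)])
  have 1: "openin (subtopology Xt Y) ?W" using so by (simp add: openin_subtopology_Int2)
  have 2: "y \<in> ?W" using y c'(2) unfolding sheet_def by blast
  have 3: "\<alpha> ` ?W \<subseteq> U" unfolding sheet_def by blast
  have "embedding_map (subtopology Xt ?W) X \<alpha>" by (rule sheet_embedding[OF c]) blast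
  then have 4: "embedding_map (subtopology (subtopology Xt Y) ?W) X \<alpha>"
    by (simp add: subtopology_subtopology)
  have img: "\<alpha> ` (L S q \<inter> ?W) = face U ?C S q" if "S \<in> SS" "q \<in> QQ S" for S q
  proof -
    have "L S q \<inter> ?W = L S q \<inter> sheet U ?C" using L_subset_Y[OF that] by blast
    then show ?thesis using face_image[OF that] by simp
  qed
  have 5: "finite {S \<in> LL. S \<inter> ?W \<noteq> {}}" by (rule sheet_finite[OF c])
  have 6: "\<forall>P\<in>LL. \<exists>m. smooth_submanifold n X A m (\<alpha> ` (P \<inter> ?W))"
  proof
    fix P assume "P \<in> LL"
    then obtain S q where S: "S \<in> SS" "q \<in> QQ S" "P = L S q" by (rule LL_E)
    show "\<exists>m. smooth_submanifold n X A m (\<alpha> ` (P \<inter> ?W))"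
      unfolding S(3) img[OF S(1,2)] by (rule face_submanifold[OF c S(1,2)])
  qed
  have 7: "\<forall>P\<in>LL. \<forall>P'\<in>LL. P \<noteq> P' \<longrightarrow> whitney_b n (\<phi> ` \<alpha> ` (P \<inter> ?W)) (\<phi> ` \<alpha> ` (P' \<inter> ?W))"
  proof (intro ballI impI)
    fix P P' assume P: "P \<in> LL" "P' \<in> LL"
    obtain S q where S: "S \<in> SS" "q \<in> QQ S" "P = L S q" by (rule LL_E[OF P(1)])
    obtain T t where T: "T \<in> SS" "t \<in> QQ T" "P' = L T t" by (rule LL_E[OF P(2)])
    show "whitney_b n (\<phi> ` \<alpha> ` (P \<inter> ?W)) (\<phi> ` \<alpha> ` (P' \<inter> ?W))"
      unfolding S(3) T(3) img[OF S(1,2)] img[OF T(1,2)] by (rule face_whitney[OF c S(1,2) T(1,2)])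
  qed
  show "\<exists>W. \<exists>(U, \<phi>)\<in>smooth_charts n X A.
        openin (subtopology Xt Y) W \<and> y \<in> W \<and> \<alpha> ` W \<subseteq> U \<and> embedding_map (subtopology (subtopology Xt Y) W) X \<alpha> \<and>
        finite {S\<in>LL. S \<inter> W \<noteq> {}} \<and>
        (\<forall>S\<in>LL. \<exists>m. smooth_submanifold n X A m (\<alpha> ` (S \<inter> W))) \<and>
        (\<forall>S\<in>LL. \<forall>T\<in>LL. S \<noteq> T \<longrightarrow> whitney_b n (\<phi> ` \<alpha> ` (S \<inter> W)) (\<phi> ` \<alpha> ` (T \<inter> W)))"
    by (rule exI[of _ ?W], rule bexI[OF _ ch], unfold prod.case, intro conjI 1 2 3 4 5 6 7)
qed

lemma obtained: "obtained_from_gluing n X A D D' Xt \<alpha> Y SS QQ"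
proof -
  have LLeq: "(\<Union>S\<in>SS. connected_components_of (subtopology Xt (over S))) = LL"
    unfolding LL_def using L_components by simp
  obtain h where h: "homeomorphic_map (glue Z gl) (subtopology Xt Y) h"
    "\<And>z. z \<in> topspace Z \<Longrightarrow> h (glue_class Z gl z) = F z"
    by (rule glue_homeomorphism) (rule that)
  have h1: "\<alpha> (h (glue_class Z gl (S, (p, e), q))) = p" if "(S, (p, e), q) \<in> topspace Z" for S p e q
    using h(2)[OF that] F_props(2)[OF that] by simp
  have h2: "orthant_point X Xt \<alpha> p (q p) (h (glue_class Z gl (S, interior_point X S p, q)))"
    if S: "S \<in> SS" "q \<in> QQ S" "p \<in> S" for S q p
  proof -
    note ql = lim_pi0_stratum_at[OF QQ[OF S(1,2)] S(3)]
    show ?thesis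
      unfolding h(2)[OF F_interior(1)[OF S]] F_interior(2)[OF S] orthant_point_iff[OF ql]
      using pnt_props[OF stratum_top[OF S(1,3)] ql] by blast
  qed
  have h3: "h ` glued_stratum X Z gl S q = L S q" if S: "S \<in> SS" "q \<in> QQ S" for S q
  proof -
    have "h ` glued_stratum X Z gl S q = (\<lambda>p. h (glue_class Z gl (S, interior_point X S p, q))) ` S"
      unfolding glued_stratum_def image_image ..
    also have "\<dots> = (\<lambda>p. pnt p (q p)) ` S"
      by (rule image_cong[OF refl]) (simp add: h(2)[OF F_interior(1)[OF S]] F_interior(2)[OF S])
    finally show ?thesis using L_image[OF S] by simp
  qed
  have h4: "{h ` glued_stratum X Z gl S q | S q. S \<in> SS \<and> q \<in> QQ S} = LL"
  proof
    show "{h ` glued_stratum X Z gl S q | S q. S \<in> SS \<and> q \<in> QQ S} \<subseteq> LL"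
      unfolding LL_def using h3 by blast
    show "LL \<subseteq> {h ` glued_stratum X Z gl S q | S q. S \<in> SS \<and> q \<in> QQ S}"
      unfolding LL_def using h3 by blast
  qed
  show ?thesis
    unfolding obtained_from_gluing_def Let_def LLeq
    by (intro conjI whitney exI[of _ h] h(1) h4 allI impI ballI h1 h2)
qed

end

section \<open>Positive orthants\<close>

context nc_pair
begin

lemma smooth_function_continuous:
  assumes "smooth_function n A f"
  shows "continuous_map X euclideanreal f"
  unfolding continuous_map_def
proof (intro conjI allI impI)
  fix W :: "real set" assume W: "openin euclideanreal W"
  show "openin X {x \<in> topspace X. f x \<in> W}"
  proof (subst openin_subopen, intro ballI)
    fix x assume "x \<in> {x \<in> topspace X. f x \<in> W}"
    then have x: "x \<in> topspace X" "f x \<in> W" by simp_all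
    obtain U \<phi> where U: "(U, \<phi>) \<in> A" "x \<in> U"
      using M x(1) unfolding smooth_manifold_def by blast
    have c: "(U, \<phi>) \<in> smooth_charts n X A" using atlas_subset_smooth_charts[OF M] U(1) by blast
    note c' = smooth_charts_D[OF M c]
    have "smooth_real_on n (\<phi> ` U) (f \<circ> inv_into U \<phi>)"
      using assms U(1) unfolding smooth_function_def by blast
    from smooth_real_on_imp_C1_on[OF this]
    have "continuous_map (subtopology (Euclidean_space n) (\<phi> ` U)) euclideanreal (f \<circ> inv_into U \<phi>)"
      unfolding C1_on_def by (rule conjunct1)
    from continuous_map_compose[OF homeomorphic_imp_continuous_map[OF c'(3)] this]
    have "continuous_map (subtopology X U) euclideanreal (\<lambda>y. f (inv_into U \<phi> (\<phi> y)))" by (simp add: o_def)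
    then have "continuous_map (subtopology X U) euclideanreal f"
      by (rule continuous_map_eq) (use c'(5) in simp)
    from openin_continuous_map_preimage[OF this W]
    have "openin (subtopology X U) {y \<in> topspace (subtopology X U). f y \<in> W}" .
    then have "openin X {y \<in> topspace (subtopology X U). f y \<in> W}" using c'(1) openin_trans_full by blast
    moreover have "x \<in> {y \<in> topspace (subtopology X U). f y \<in> W}" using x U(2) by simp
    moreover have "{y \<in> topspace (subtopology X U). f y \<in> W} \<subseteq> {x \<in> topspace X. f x \<in> W}" by auto
    ultimately show "\<exists>T. openin X T \<and> x \<in> T \<and> T \<subseteq> {x \<in> topspace X. f x \<in> W}" by blast
  qed
qed simp

lemma stratum_orthant_extends:
  assumes T: "T \<in> strata n X A D'" and sc: "simply_connected_space (subtopology X T)"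
    and p: "p \<in> T" and c: "c \<in> lim_pi0 X (topspace X - D) p"
  shows "\<exists>\<tau>\<in>orthants X D T. \<tau> p = c"
  by (rule lim_pi0_stratum_exists[OF strata_locally_trivial[OF T face_union_compl] sc strata_path_connected[OF T] p c])

end

text \<open>\<open>\<pi>\<close> has constant sign along paths outside its zero set; so the components of \<open>V \<inter> {\<pi> > 0}\<close> are those
  components of \<open>V \<inter> {\<pi> \<noteq> 0}\<close> on which \<open>\<pi>\<close> is positive.\<close>

lemma path_component_of_positive:
  assumes c: "continuous_map X euclideanreal \<pi>" and nz: "\<forall>x\<in>B. \<pi> x \<noteq> 0"
    and pos: "\<forall>x\<in>topspace X. x \<in> P \<longleftrightarrow> 0 < \<pi> x"
    and xy: "path_component_of (subtopology X (V \<inter> B)) x y" "x \<in> P"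
  shows "path_component_of (subtopology X (V \<inter> P)) x y"
proof -
  obtain g where g: "pathin (subtopology X (V \<inter> B)) g" "g 0 = x" "g 1 = y"
    using xy(1) unfolding path_component_of_def by blast
  have gX: "continuous_map (top_of_set {0..1}) X g"
    using g(1) by (simp add: pathin_def continuous_map_in_subtopology)
  have gt: "g t \<in> topspace X" "g t \<in> V" "g t \<in> B" if "t \<in> {0..1}" for t
    using continuous_map_image_subset_topspace[OF gX] pathin_T[OF g(1) that] that by auto
  have "continuous_map (top_of_set {0..1}) euclideanreal (\<lambda>t. \<pi> (g t))"
    using continuous_map_compose[OF gX c] by (simp add: o_def)
  then have "continuous_on {0..1} (\<lambda>t. \<pi> (g t))" by simp
  then have con: "connected ((\<lambda>t. \<pi> (g t)) ` {0..1})" by (rule connected_continuous_image) simp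
  have x0: "0 < \<pi> x" using bspec[OF pos, of x] gt(1)[of 0] g(2) xy(2) by simp
  have "0 < \<pi> (g t)" if t: "t \<in> {0..1}" for t
  proof (rule ccontr)
    assume "\<not> 0 < \<pi> (g t)"
    moreover have "\<pi> (g t) \<in> (\<lambda>t. \<pi> (g t)) ` {0..1}" using t by blast
    moreover have "\<pi> x \<in> (\<lambda>t. \<pi> (g t)) ` {0..1}" by (rule image_eqI[of _ _ 0]) (simp_all add: g(2))
    ultimately have "0 \<in> (\<lambda>t. \<pi> (g t)) ` {0..1}"
      using connectedD_interval[OF con, of "\<pi> (g t)" "\<pi> x" 0] x0 by simp
    then obtain s where "s \<in> {0..1}" "\<pi> (g s) = 0" by auto
    then show False using bspec[OF nz gt(3)] by blast
  qed
  then have "g t \<in> V \<inter> P" if "t \<in> {0..1}" for t using gt[OF that] pos that by blast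
  then have "pathin (subtopology X (V \<inter> P)) g"
    using gX by (simp add: pathin_def continuous_map_in_subtopology image_subset_iff_funcset[symmetric] image_subset_iff)
  then show ?thesis unfolding path_component_of_def using g(2,3) by blast
qed

lemma path_components_of_positive:
  assumes c: "continuous_map X euclideanreal \<pi>" and nz: "\<forall>x\<in>B. \<pi> x \<noteq> 0"
    and pos: "\<forall>x\<in>topspace X. x \<in> P \<longleftrightarrow> 0 < \<pi> x" and PB: "P \<subseteq> B"
  shows "C \<in> path_components_of (subtopology X (V \<inter> P)) \<longleftrightarrow>
      C \<in> path_components_of (subtopology X (V \<inter> B)) \<and> C \<inter> P \<noteq> {}"
proof -
  have eq: "path_component_of_set (subtopology X (V \<inter> P)) x = path_component_of_set (subtopology X (V \<inter> B)) x"
    if x: "x \<in> P" for x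
  proof
    have "V \<inter> P \<subseteq> V \<inter> B" using PB by blast
    then show "path_component_of_set (subtopology X (V \<inter> P)) x \<subseteq> path_component_of_set (subtopology X (V \<inter> B)) x"
      using path_component_of_mono by fastforce
    show "path_component_of_set (subtopology X (V \<inter> B)) x \<subseteq> path_component_of_set (subtopology X (V \<inter> P)) x"
      using path_component_of_positive[OF c nz pos _ x] by blast
  qed
  show ?thesis
  proof
    assume C: "C \<in> path_components_of (subtopology X (V \<inter> P))"
    then obtain x where x: "x \<in> topspace (subtopology X (V \<inter> P))" "C = path_component_of_set (subtopology X (V \<inter> P)) x"
      unfolding path_components_of_def by blast
    have xP: "x \<in> P" "x \<in> topspace (subtopology X (V \<inter> B))" using x(1) PB by auto
    have "C = path_component_of_set (subtopology X (V \<inter> B)) x" using x(2) eq[OF xP(1)] by simp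
    then have "C \<in> path_components_of (subtopology X (V \<inter> B))"
      using xP(2) by (simp add: path_component_in_path_components_of)
    moreover have "x \<in> C" using x by (simp add: path_component_of_refl)
    ultimately show "C \<in> path_components_of (subtopology X (V \<inter> B)) \<and> C \<inter> P \<noteq> {}" using xP(1) by blast
  next
    assume C: "C \<in> path_components_of (subtopology X (V \<inter> B)) \<and> C \<inter> P \<noteq> {}"
    then obtain x where x: "x \<in> C" "x \<in> P" by blast
    have xt: "x \<in> topspace (subtopology X (V \<inter> B))" using path_components_of_subset[OF C[THEN conjunct1]] x(1) by blast
    have "path_component_of_set (subtopology X (V \<inter> B)) x \<in> path_components_of (subtopology X (V \<inter> B))"
      using xt by (simp add: path_component_in_path_components_of)
    moreover have "x \<in> path_component_of_set (subtopology X (V \<inter> B)) x" using xt by (simp add: path_component_of_refl)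
    ultimately have "C = path_component_of_set (subtopology X (V \<inter> B)) x"
      using path_comps_eq[OF C[THEN conjunct1] _ x(1)] by blast
    then have "C = path_component_of_set (subtopology X (V \<inter> P)) x" using eq[OF x(2)] by simp
    moreover have "x \<in> topspace (subtopology X (V \<inter> P))" using xt x(2) by simp
    ultimately show "C \<in> path_components_of (subtopology X (V \<inter> P))"
      by (simp add: path_component_in_path_components_of)
  qed
qed

text \<open>Positivity of a germ can be read off on the largest neighbourhood: all
  \<open>a U\<close> lie in \<open>a (topspace X)\<close>, on which \<open>\<pi>\<close> has
  constant sign.\<close>

lemma lim_pi0_positive:
  assumes c: "continuous_map X euclideanreal \<pi>" and nz: "\<forall>x\<in>B. \<pi> x \<noteq> 0"
    and pos: "\<forall>x\<in>topspace X. x \<in> P \<longleftrightarrow> 0 < \<pi> x" and PB: "P \<subseteq> B" and p: "p \<in> topspace X"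
  shows "a \<in> lim_pi0 X P p \<longleftrightarrow> a \<in> lim_pi0 X B p \<and> a (topspace X) \<subseteq> P"
proof -
  note pcp = path_components_of_positive[OF c nz pos PB]
  have top: "topspace X \<in> nbhds_of X p" using p by (simp add: nbhds_of_iff)
  show ?thesis
  proof
    assume a: "a \<in> lim_pi0 X P p"
    have "a \<in> lim_pi0 X B p"
      unfolding lim_pi0_def
    proof (intro CollectI conjI ballI impI)
      show "a \<in> (\<Pi>\<^sub>E U\<in>nbhds_of X p. path_components_of (subtopology X (U \<inter> B)))"
      proof (rule PiE_I)
        show "a U \<in> path_components_of (subtopology X (U \<inter> B))" if "U \<in> nbhds_of X p" for U
          by (rule conjunct1[OF iffD1[OF pcp lim_pi0_comp[OF a that]]])
        show "a U = undefined" if "U \<notin> nbhds_of X p" for U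
          using PiE_arb[OF lim_pi0_PiE[OF a] that] .
      qed
    qed (rule lim_pi0_mono[OF a])
    then show "a \<in> lim_pi0 X B p \<and> a (topspace X) \<subseteq> P" using lim_pi0_subset[OF a top] by blast
  next
    assume "a \<in> lim_pi0 X B p \<and> a (topspace X) \<subseteq> P"
    then have a: "a \<in> lim_pi0 X B p" and aP: "a (topspace X) \<subseteq> P" by blast+
    show "a \<in> lim_pi0 X P p"
      unfolding lim_pi0_def
    proof (intro CollectI conjI ballI impI)
      show "a \<in> (\<Pi>\<^sub>E U\<in>nbhds_of X p. path_components_of (subtopology X (U \<inter> P)))"
      proof (rule PiE_I)
        fix U assume U: "U \<in> nbhds_of X p"
        have "U \<subseteq> topspace X" using U by (auto simp: nbhds_of_iff dest: openin_subset)
        then have "a U \<subseteq> P" using lim_pi0_mono[OF a U top] aP by blast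
        then have "a U \<inter> P \<noteq> {}" using lim_pi0_nonempty[OF a U] by blast
        then show "a U \<in> path_components_of (subtopology X (U \<inter> P))"
          by (intro iffD2[OF pcp] conjI lim_pi0_comp[OF a U])
      next
        show "a U = undefined" if "U \<notin> nbhds_of X p" for U
          using PiE_arb[OF lim_pi0_PiE[OF a] that] .
      qed
    qed (rule lim_pi0_mono[OF a])
  qed
qed

lemma lcs_const_top:
  assumes c: "lcs X B {0..1::real} \<gamma> c" and \<gamma>: "\<And>t. t \<in> {0..1} \<Longrightarrow> \<gamma> t \<in> topspace X" and t: "t \<in> {0..1}"
  shows "c t (topspace X) = c 0 (topspace X)"
proof (rule connected_local_const[of "{0..1::real}"])
  show "\<forall>a\<in>{0..1}. \<forall>\<^sub>F b in at a within {0..1}. c a (topspace X) = c b (topspace X)"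
  proof
    fix a :: real assume a: "a \<in> {0..1}"
    have "topspace X \<in> nbhds_of X (\<gamma> a)" using \<gamma>[OF a] by (simp add: nbhds_of_iff)
    from lcs_local[OF c a this] show "\<forall>\<^sub>F b in at a within {0..1}. c a (topspace X) = c b (topspace X)"
      unfolding eventually_at_topological by (metis IntI)
  qed
qed (use t in auto)

text \<open>The value on the whole space does not change along a path, so transport preserves
  positivity, and a locally constant family that starts at a positive germ is the same for
  \<open>P\<close> and for \<open>B\<close>.\<close>

lemma lim_pi0_stratum_positive:
  assumes c: "continuous_map X euclideanreal \<pi>" and nz: "\<forall>x\<in>B. \<pi> x \<noteq> 0"
    and pos: "\<forall>x\<in>topspace X. x \<in> P \<longleftrightarrow> 0 < \<pi> x" and PB: "P \<subseteq> B" and T: "T \<subseteq> topspace X"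
  shows "\<sigma> \<in> lim_pi0_stratum X P T \<longleftrightarrow> \<sigma> \<in> lim_pi0_stratum X B T \<and> (\<forall>p\<in>T. \<sigma> p (topspace X) \<subseteq> P)"
proof -
  note lp = lim_pi0_positive[OF c nz pos PB]
  have tr: "transport X P \<gamma> a b \<longleftrightarrow> transport X B \<gamma> a b"
    if g: "pathin (subtopology X T) \<gamma>" and a: "a (topspace X) \<subseteq> P" for \<gamma> a b
  proof -
    have gT: "\<gamma> t \<in> topspace X" if "t \<in> {0..1}" for t using pathin_T[OF g that] T by blast
    show ?thesis
    proof
      assume "transport X P \<gamma> a b"
      then obtain c where c: "c 0 = a" "c 1 = b" "lcs X P {0..1} \<gamma> c" unfolding transport_iff by blast
      have "c y \<in> lim_pi0 X B (\<gamma> y)" if "y \<in> {0..1}" for y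
        by (rule conjunct1[OF iffD1[OF lp[OF gT[OF that]] lcs_lim[OF c(3) that]]])
      then have "lcs X B {0..1} \<gamma> c" unfolding lcs_def using lcs_local[OF c(3)] by blast
      then show "transport X B \<gamma> a b" unfolding transport_iff using c(1,2) by blast
    next
      assume "transport X B \<gamma> a b"
      then obtain c where c: "c 0 = a" "c 1 = b" "lcs X B {0..1} \<gamma> c" unfolding transport_iff by blast
      have "c y \<in> lim_pi0 X P (\<gamma> y)" if "y \<in> {0..1}" for y
        by (rule iffD2[OF lp[OF gT[OF that]]]) (use lcs_lim[OF c(3) that] lcs_const_top[OF c(3) gT that] c(1) a in simp)
      then have "lcs X P {0..1} \<gamma> c" unfolding lcs_def using lcs_local[OF c(3)] by blast
      then show "transport X P \<gamma> a b" unfolding transport_iff using c(1,2) by blast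
    qed
  qed
  show ?thesis
  proof
    assume s: "\<sigma> \<in> lim_pi0_stratum X P T"
    have sp: "\<sigma> p \<in> lim_pi0 X B p" "\<sigma> p (topspace X) \<subseteq> P" if "p \<in> T" for p
      using iffD1[OF lp[OF subsetD[OF T that]] lim_pi0_stratum_at[OF s that]] by blast+
    have "\<sigma> \<in> lim_pi0_stratum X B T"
      unfolding lim_pi0_stratum_def
    proof (intro CollectI conjI allI impI)
      show "\<sigma> \<in> (\<Pi>\<^sub>E p\<in>T. lim_pi0 X B p)"
      proof (rule PiE_I)
        show "\<sigma> p = undefined" if "p \<notin> T" for p using PiE_arb[OF lim_pi0_stratum_PiE[OF s] that] .
      qed (rule sp(1))
      fix \<gamma> assume g: "pathin (subtopology X T) \<gamma>"
      have g0: "\<gamma> 0 \<in> T" using pathin_T[OF g, of 0] by simp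
      then show "transport X B \<gamma> (\<sigma> (\<gamma> 0)) (\<sigma> (\<gamma> 1))"
        using tr[of \<gamma> "\<sigma> (\<gamma> 0)", OF g sp(2)[OF g0]] lim_pi0_stratum_transport[OF s g] by blast
    qed
    then show "\<sigma> \<in> lim_pi0_stratum X B T \<and> (\<forall>p\<in>T. \<sigma> p (topspace X) \<subseteq> P)" using sp(2) by blast
  next
    assume "\<sigma> \<in> lim_pi0_stratum X B T \<and> (\<forall>p\<in>T. \<sigma> p (topspace X) \<subseteq> P)"
    then have s: "\<sigma> \<in> lim_pi0_stratum X B T" and sP: "\<And>p. p \<in> T \<Longrightarrow> \<sigma> p (topspace X) \<subseteq> P" by blast+
    show "\<sigma> \<in> lim_pi0_stratum X P T"
      unfolding lim_pi0_stratum_def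
    proof (intro CollectI conjI allI impI)
      show "\<sigma> \<in> (\<Pi>\<^sub>E p\<in>T. lim_pi0 X P p)"
      proof (rule PiE_I)
        show "\<sigma> p \<in> lim_pi0 X P p" if "p \<in> T" for p
          by (intro iffD2[OF lp[OF subsetD[OF T that]]] conjI lim_pi0_stratum_at[OF s that] sP[OF that])
        show "\<sigma> p = undefined" if "p \<notin> T" for p using PiE_arb[OF lim_pi0_stratum_PiE[OF s] that] .
      qed
      fix \<gamma> assume g: "pathin (subtopology X T) \<gamma>"
      have g0: "\<gamma> 0 \<in> T" using pathin_T[OF g, of 0] by simp
      then show "transport X P \<gamma> (\<sigma> (\<gamma> 0)) (\<sigma> (\<gamma> 1))"
        using tr[of \<gamma> "\<sigma> (\<gamma> 0)", OF g sP[OF g0]] lim_pi0_stratum_transport[OF s g] by blast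
    qed
  qed
qed

section \<open>The two instances of the gluing\<close>

context nc_blowup
begin

text \<open>All points of the blow-up are reached, since the orthant of a point extends to a section
  over the stratum through its image.\<close>

lemma nc_gluing_all:
  assumes sc: "\<forall>S\<in>strata n X A D'. simply_connected_space (subtopology X S)"
  shows "nc_gluing n X A D D' Xt \<alpha> (strata n X A D') (orthants X D) (topspace Xt)"
proof unfold_locales
  show "topspace Xt = {x \<in> topspace Xt. \<exists>S\<in>strata n X A D'. \<alpha> x \<in> S \<and> (\<exists>q\<in>orthants X D S. q (\<alpha> x) = orth x)}"
  proof
    show "topspace Xt \<subseteq> {x \<in> topspace Xt. \<exists>S\<in>strata n X A D'. \<alpha> x \<in> S \<and> (\<exists>q\<in>orthants X D S. q (\<alpha> x) = orth x)}"
    proof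
      fix x assume x: "x \<in> topspace Xt"
      obtain S where S: "S \<in> strata n X A D'" "\<alpha> x \<in> S" using strata_cover[OF alpha_top[OF x]] by blast
      have "\<exists>q\<in>orthants X D S. q (\<alpha> x) = orth x"
        by (rule stratum_orthant_extends[OF S(1) _ S(2) orth_lim[OF x]]) (use sc S(1) in blast)
      then show "x \<in> {x \<in> topspace Xt. \<exists>S\<in>strata n X A D'. \<alpha> x \<in> S \<and> (\<exists>q\<in>orthants X D S. q (\<alpha> x) = orth x)}"
        using x S by blast
    qed
  qed blast
  show "(\<lambda>p\<in>T. push X q p (e p)) \<in> orthants X D T"
    if "T \<in> strata n X A D'" "e \<in> lim_pi0_stratum X S T" "q \<in> orthants X D S" for S T e q
    by (rule push_stratum[OF that])
qed (use sc in blast)+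

context
  fixes \<pi> :: "'a \<Rightarrow> real" and \<pi>t :: "'b \<Rightarrow> bool \<times> real"
  assumes ss: "semistable_degeneration n X A \<pi>" and Dpi: "D = special_fibre X \<pi>"
    and lift: "lifted_degeneration Xt \<alpha> \<pi> \<pi>t"
    and sc: "\<forall>S\<in>strata n X A D'. simply_connected_space (subtopology X S)"
begin

abbreviation "P \<equiv> {p \<in> topspace X. \<pi> p \<in> {0<..<1}}"

lemma pi_continuous: "continuous_map X euclideanreal \<pi>"
  using ss smooth_function_continuous by (simp add: semistable_degeneration_def)

lemma P_iff: "\<forall>x\<in>topspace X. x \<in> P \<longleftrightarrow> 0 < \<pi> x"
  using ss unfolding semistable_degeneration_def by force

lemma B_nonzero: "\<forall>x\<in>B. \<pi> x \<noteq> 0"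
  using Dpi by (auto simp: special_fibre_def)

lemma P_subset_B: "P \<subseteq> B"
  using Dpi by (auto simp: special_fibre_def)

lemma pos_orthants_iff:
  assumes "T \<in> strata n X A D'"
  shows "\<sigma> \<in> pos_orthants X \<pi> T \<longleftrightarrow> \<sigma> \<in> orthants X D T \<and> (\<forall>p\<in>T. \<sigma> p (topspace X) \<subseteq> P)"
  by (rule lim_pi0_stratum_positive[OF pi_continuous B_nonzero P_iff P_subset_B strata_facts(1)[OF assms]])

text \<open>On the whole space the pushed orthant has the value of \<open>q\<close> at some point of
  \<open>S\<close>, which is positive.\<close>

lemma pos_push:
  assumes S: "S \<in> strata n X A D'" and T: "T \<in> strata n X A D'" and e: "e \<in> lim_pi0_stratum X S T" and q: "q \<in> pos_orthants X \<pi> S"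
  shows "(\<lambda>p\<in>T. push X q p (e p)) \<in> pos_orthants X \<pi> T"
proof -
  have q': "q \<in> orthants X D S" "\<And>p. p \<in> S \<Longrightarrow> q p (topspace X) \<subseteq> P"
    using q unfolding pos_orthants_iff[OF S] by blast+
  have "(\<lambda>p\<in>T. push X q p (e p)) p (topspace X) \<subseteq> P" if p: "p \<in> T" for p
  proof -
    have top: "topspace X \<in> nbhds_of X p" using strata_facts(1)[OF T] p by (auto simp: nbhds_of_iff)
    have ep: "e p \<in> lim_pi0 X S p" by (rule lim_pi0_stratum_at[OF e p])
    obtain p' where p': "p' \<in> e p (topspace X)" using lim_pi0_nonempty[OF ep top] by blast
    have "p' \<in> S" using lim_pi0_subset[OF ep top] p' by blast
    then show ?thesis using push_eq[OF ep q'(1) top p'] q'(2) p by simp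
  qed
  then show ?thesis unfolding pos_orthants_iff[OF T] using push_stratum[OF T e q'(1)] by blast
qed

text \<open>Near \<open>x\<close> the tag of the lifted map is constant, and there is a point
  \<open>y\<close> off \<open>D\<close> with image in the component of \<open>orth x\<close>. At
  \<open>y\<close> the tag is the sign of \<open>\<pi>\<close>, and this sign is constant on the
  component.\<close>

lemma pit_iff:
  assumes x: "x \<in> topspace Xt" "\<alpha> x \<in> D"
  shows "\<pi>t x = (True, 0) \<longleftrightarrow> orth x (topspace X) \<subseteq> P"
proof -
  have top: "topspace X \<in> nbhds_of X (\<alpha> x)" using alpha_top[OF x(1)] by (simp add: nbhds_of_iff)
  have ct: "continuous_map Xt cut_interval \<pi>t" and sn: "\<And>y. y \<in> topspace Xt \<Longrightarrow> snd (\<pi>t y) = \<pi> (\<alpha> y)"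
    using lift by (simp_all add: lifted_degeneration_def)
  have s0: "snd (\<pi>t x) = 0" using sn[OF x(1)] x(2) Dpi by (simp add: special_fibre_def)
  let ?b = "fst (\<pi>t x)"
  have tci: "topspace cut_interval = {(b, r). if b then 0 \<le> r \<and> r < 1 else - 1 < r \<and> r \<le> 0}"
    by (auto simp: cut_interval_def topspace_sum_topology split: if_splits)
  have "openin cut_interval {w \<in> topspace cut_interval. fst w = ?b}"
  proof -
    have eq: "{w \<in> topspace cut_interval. fst w = ?b} =
        Sigma UNIV (\<lambda>b'. if b' = ?b then (if ?b then {0..<1} else {-1<..0}) else {})"
      unfolding tci by (auto split: if_splits)
    show ?thesis
      unfolding eq unfolding cut_interval_def openin_sum_topology by (auto split: if_splits)
  qed
  from openin_continuous_map_preimage[OF ct this]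
  have Qo: "openin Xt {y \<in> topspace Xt. \<pi>t y \<in> {w \<in> topspace cut_interval. fst w = ?b}}" .
  have pt: "\<pi>t y \<in> topspace cut_interval" if "y \<in> topspace Xt" for y
    using continuous_map_image_subset_topspace[OF ct] that by blast
  obtain N where N: "openin Xt N" "x \<in> N" "\<alpha> ` N - D \<subseteq> orth x (topspace X)"
    using orth_props(3)[OF x(1) top] by blast
  have xm: "x \<in> N \<inter> {y \<in> topspace Xt. \<pi>t y \<in> {w \<in> topspace cut_interval. fst w = ?b}}"
    using N(2) x(1) pt[OF x(1)] by simp
  from small_nbhd[OF openin_Int[OF N(1) Qo] xm] obtain N' where
    N': "N' \<subseteq> N \<inter> {y \<in> topspace Xt. \<pi>t y \<in> {w \<in> topspace cut_interval. fst w = ?b}}" "\<alpha> ` N' - D \<noteq> {}" by blast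
  then obtain y where y: "y \<in> N'" "\<alpha> y \<notin> D" by blast
  have y1: "y \<in> N" "y \<in> topspace Xt" "fst (\<pi>t y) = ?b" using y(1) N'(1) by blast+
  have yo: "\<alpha> y \<in> orth x (topspace X)" using N(3) y1(1) y(2) by blast
  have nz: "\<pi> (\<alpha> y) \<noteq> 0" using B_nonzero alpha_top[OF y1(2)] y(2) by blast
  have "(fst (\<pi>t y), snd (\<pi>t y)) \<in> topspace cut_interval" using pt[OF y1(2)] by simp
  then have "if ?b then 0 \<le> \<pi> (\<alpha> y) else \<pi> (\<alpha> y) \<le> 0"
    unfolding tci using y1(3) sn[OF y1(2)] by (simp split: if_splits)
  then have bP: "?b \<longleftrightarrow> \<alpha> y \<in> P" unfolding bspec[OF P_iff alpha_top[OF y1(2)]] using nz by (simp split: if_splits)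
  have C: "orth x (topspace X) \<in> path_components_of (subtopology X (topspace X \<inter> B))"
    by (rule orth_props(1)[OF x(1) top])
  have "orth x (topspace X) \<subseteq> P" if "\<alpha> y \<in> P"
  proof -
    have "orth x (topspace X) \<in> path_components_of (subtopology X (topspace X \<inter> P))"
      using path_components_of_positive[OF pi_continuous B_nonzero P_iff P_subset_B, of "orth x (topspace X)" "topspace X"]
        C yo that by blast
    then show ?thesis using path_components_of_subset by fastforce
  qed
  then have "?b \<longleftrightarrow> orth x (topspace X) \<subseteq> P" using bP yo by blast
  moreover have "\<pi>t x = (True, 0) \<longleftrightarrow> ?b" using s0 by (cases "\<pi>t x") auto
  ultimately show ?thesis by blast
qed

text \<open>The family of strata is closed under passing to the frontier because \<open>D\<close> is
  closed, and by \<open>strata_D\<close> every stratum that meets the special fibre lies in it.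
  Positivity of the tag becomes positivity of the orthant by \<open>pit_iff\<close>.\<close>

lemma nc_gluing_positive:
  "nc_gluing n X A D D' Xt \<alpha> {S \<in> strata n X A D'. S \<subseteq> special_fibre X \<pi>} (pos_orthants X \<pi>) (positive_special_fibre Xt \<pi>t)"
proof unfold_locales
  show "T \<in> {S \<in> strata n X A D'. S \<subseteq> special_fibre X \<pi>}"
    if "S \<in> {S \<in> strata n X A D'. S \<subseteq> special_fibre X \<pi>}" "T \<in> strata n X A D'" "T \<subseteq> X closure_of S" for S T
  proof -
    have "closedin X D" using ncD by (simp add: nc_divisor_def)
    then have "X closure_of S \<subseteq> D" using closure_of_minimal[of S D X] that(1) Dpi by blast
    then show ?thesis using that(2,3) Dpi by blast
  qed
  show "q \<in> orthants X D S" if "S \<in> {S \<in> strata n X A D'. S \<subseteq> special_fibre X \<pi>}" "q \<in> pos_orthants X \<pi> S" for S q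
    using that pos_orthants_iff[of S q] by blast
  show "(\<lambda>p\<in>T. push X q p (e p)) \<in> pos_orthants X \<pi> T"
    if "S \<in> {S \<in> strata n X A D'. S \<subseteq> special_fibre X \<pi>}" "T \<in> strata n X A D'"
      "e \<in> lim_pi0_stratum X S T" "q \<in> pos_orthants X \<pi> S" for S T e q
    by (rule pos_push[OF _ that(2-4)]) (use that(1) in blast)
  let ?R = "{x \<in> topspace Xt. \<exists>S\<in>{S \<in> strata n X A D'. S \<subseteq> special_fibre X \<pi>}. \<alpha> x \<in> S \<and>
      (\<exists>q\<in>pos_orthants X \<pi> S. q (\<alpha> x) = orth x)}"
  have sn: "snd (\<pi>t y) = \<pi> (\<alpha> y)" if "y \<in> topspace Xt" for y
    using lift that by (simp add: lifted_degeneration_def)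
  show "positive_special_fibre Xt \<pi>t = ?R"
  proof
    show "positive_special_fibre Xt \<pi>t \<subseteq> ?R"
    proof
      fix x assume "x \<in> positive_special_fibre Xt \<pi>t"
      then have x: "x \<in> topspace Xt" "\<pi>t x = (True, 0)" unfolding positive_special_fibre_def by blast+
      have ax: "\<alpha> x \<in> D" using sn[OF x(1)] x(2) alpha_top[OF x(1)] Dpi by (simp add: special_fibre_def)
      have oP: "orth x (topspace X) \<subseteq> P" using pit_iff[OF x(1) ax] x(2) by blast
      obtain S where S: "S \<in> strata n X A D'" "\<alpha> x \<in> S" using strata_cover[OF alpha_top[OF x(1)]] by blast
      have SD: "S \<subseteq> special_fibre X \<pi>" using strata_D[OF S ax] Dpi by simp
      have "\<exists>q\<in>orthants X D S. q (\<alpha> x) = orth x"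
        by (rule stratum_orthant_extends[OF S(1) _ S(2) orth_lim[OF x(1)]]) (use sc S(1) in blast)
      then obtain q where q: "q \<in> orthants X D S" "q (\<alpha> x) = orth x" by blast
      \<comment> \<open>Positivity is known at \<open>\<alpha> x\<close> only; on the path connected
        \<open>S\<close> the value on the whole space is constant.\<close>
      have "q p (topspace X) \<subseteq> P" if p: "p \<in> S" for p
      proof -
        have SX: "topspace X \<inter> S = S" using strata_facts(1)[OF S(1)] by blast
        have "path_connected_space (subtopology X S)" using strata_path_connected[OF S(1)] by (simp add: path_connectedin_def)
        then have "path_component_of (subtopology X (topspace X \<inter> S)) p (\<alpha> x)"
          unfolding SX using path_connected_space_imp_path_component_of p S(2) strata_facts(1)[OF S(1)]
          by (metis topspace_subtopology_subset)
        then have "q p (topspace X) = q (\<alpha> x) (topspace X)" by (rule lim_pi0_stratum_const[OF q(1) openin_topspace])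
        then show ?thesis using q(2) oP by simp
      qed
      then have "q \<in> pos_orthants X \<pi> S" using q(1) pos_orthants_iff[OF S(1)] by blast
      then show "x \<in> ?R" using x(1) S SD q(2) by blast
    qed
    show "?R \<subseteq> positive_special_fibre Xt \<pi>t"
    proof
      fix x assume "x \<in> ?R"
      then obtain S q where x: "x \<in> topspace Xt" "S \<in> strata n X A D'" "S \<subseteq> special_fibre X \<pi>" "\<alpha> x \<in> S"
        "q \<in> pos_orthants X \<pi> S" "q (\<alpha> x) = orth x" by blast
      have ax: "\<alpha> x \<in> D" using x(3,4) Dpi by blast
      have "q (\<alpha> x) (topspace X) \<subseteq> P" using x(4,5) pos_orthants_iff[OF x(2)] by blast
      then have "\<pi>t x = (True, 0)" using pit_iff[OF x(1) ax] x(6) by simp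
      then show "x \<in> positive_special_fibre Xt \<pi>t" using x(1) unfolding positive_special_fibre_def by blast
    qed
  qed
qed (use sc in blast)+

lemma orthant_map_positive:
  assumes S: "S \<in> strata n X A D'" and T: "T \<in> strata n X A D'" "T \<noteq> S" "T \<subseteq> X closure_of S"
    and e: "e \<in> lim_pi0_stratum X S T" and q: "q \<in> pos_orthants X \<pi> S"
  shows "orthant_map n X A D D' T e q \<in> pos_orthants X \<pi> T"
proof -
  have "q \<in> orthants X D S" using q pos_orthants_iff[OF S] by blast
  from orthant_map_eq[OF S T e this] show ?thesis using pos_push[OF S T(1) e q] by simp
qed

end

end

theorem theorem8p1:
  fixes n :: nat
    and X :: "'a topology" and A :: "'a chart set"
    and D D' :: "'a set"
    and Xt :: "'b topology" and \<alpha> :: "'b \<Rightarrow> 'a"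
  assumes "smooth_manifold n X A"
    and "nc_divisor n X A D"
    and "nc_divisor n X A D'" and "D \<subseteq> D'"
    and "\<forall>S\<in>strata n X A D'. simply_connected_space (subtopology X S)"
    and "real_blowup n X A D Xt \<alpha>"
  shows "obtained_from_gluing n X A D D' Xt \<alpha> (topspace Xt) (strata n X A D') (orthants X D) \<and>
    (\<forall>\<pi> \<pi>t. semistable_degeneration n X A \<pi> \<and> D = special_fibre X \<pi> \<and>
        lifted_degeneration Xt \<alpha> \<pi> \<pi>t \<longrightarrow>
      obtained_from_gluing n X A D D' Xt \<alpha> (positive_special_fibre Xt \<pi>t)
        {S \<in> strata n X A D'. S \<subseteq> special_fibre X \<pi>} (pos_orthants X \<pi>) \<and>
      (\<forall>S\<in>strata n X A D'. \<forall>T\<in>strata n X A D'.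
         S \<subseteq> special_fibre X \<pi> \<and> T \<noteq> S \<and> T \<subseteq> X closure_of S \<longrightarrow>
         (\<forall>e\<in>ends X T S. \<forall>q\<in>pos_orthants X \<pi> S.
            orthant_map n X A D D' T e q \<in> pos_orthants X \<pi> T)))"
proof -
  interpret nc_blowup n X A D D' Xt \<alpha>
    using assms(1-4,6) by unfold_locales
  show ?thesis
  proof (intro conjI allI impI)
    show "obtained_from_gluing n X A D D' Xt \<alpha> (topspace Xt) (strata n X A D') (orthants X D)"
      by (rule nc_gluing.obtained[OF nc_gluing_all[OF assms(5)]])
    fix \<pi> \<pi>t
    assume "semistable_degeneration n X A \<pi> \<and> D = special_fibre X \<pi> \<and> lifted_degeneration Xt \<alpha> \<pi> \<pi>t"
    then have h: "semistable_degeneration n X A \<pi>" "D = special_fibre X \<pi>" "lifted_degeneration Xt \<alpha> \<pi> \<pi>t"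
      by blast+
    show "obtained_from_gluing n X A D D' Xt \<alpha> (positive_special_fibre Xt \<pi>t)
        {S \<in> strata n X A D'. S \<subseteq> special_fibre X \<pi>} (pos_orthants X \<pi>)"
      by (rule nc_gluing.obtained[OF nc_gluing_positive[OF h assms(5)]])
    show "\<forall>S\<in>strata n X A D'. \<forall>T\<in>strata n X A D'.
         S \<subseteq> special_fibre X \<pi> \<and> T \<noteq> S \<and> T \<subseteq> X closure_of S \<longrightarrow>
         (\<forall>e\<in>ends X T S. \<forall>q\<in>pos_orthants X \<pi> S.
            orthant_map n X A D D' T e q \<in> pos_orthants X \<pi> T)"
      using orthant_map_positive[OF h assms(5)] by blast
  qed
qed

end
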